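(* Let $V=(M_\psi\otimes K^* )\mathscr V(M_\psi\otimes K)$ with $\nu_0>3$, $0\le\mathscr V\in\mathcal B(\ell^2(\mathbb Z_h,\mathcal G))$ and $K\in\mathfrak S_2(\mathcal G)$. Then for all non-degenerate thresholds $\mu_s$ and $\frac4{h^2}+\mu_s$ in $\mathscr E_Q$, $s\in I_Q$, $$\mp\xi(\lambda;H^\pm,H_Q)\sim-\frac1\pi\mathrm{Tr}\arctan(\Omega_s(\lambda))$$ as $\lambda\searrow\mu_s$ and as $\lambda\nearrow\frac4{h^2}+\mu_s$.
   Context: Let $h>0$, $\mathbb Z_h=\{hn:n\in\mathbb Z\}$, and let $\mathcal G$ be a separable complex Hilbert space. $\ell^2(\mathbb Z_h)=\ell^2(\mathbb Z_h,\mathbb C)$ has scalar product $\langle\varphi,\phi\rangle=\sum_{n\in\mathbb Z}\overline{\varphi(hn)}\phi(hn)$, and $\ell^2(\mathbb Z_h,\mathcal G)$ is identified with $\ell^2(\mathbb Z_h)\otimes\mathcal G$. On $\ell^2(\mathbb Z_h)$, $(-\Delta_h\phi)(hn)=h^{-2}\big(2\phi(hn)-\phi(h(n+1))-\phi(h(n-1))\big)$, whose spectrum is $[0,4/h^2]$. $Q$ is a self-adjoint operator on $\mathcal G$ such that either $Q=0$, or $Q\ne0$ and $\mathcal G=\bigoplus_{s=1}^d\mathrm{Ker}(Q-\mu_s)$ with $d<+\infty$ and $\mu_1,\dots,\mu_d$ the distinct (real) eigenvalues of $Q$. If $Q=0$ put $I_Q=\{0\}$, $\mu_0=0$, $\pi_0=I_{\mathcal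 G}$; if $Q\neq0$ put $I_Q=\{1,\dots,d\}$ and let $\pi_s$ be the orthogonal projection onto $\mathrm{Ker}(Q-\mu_s)$. $H_Q=-\Delta_h\otimes I_{\mathcal G}+I_{\ell^2(\mathbb Z_h)}\otimes Q$; the threshold set is $\mathscr E_Q=\{\mu_s,\mu_s+4/h^2\}_{s\in I_Q}$. If $Q\ne0$, $\mu_s$ (resp. $\frac4{h^2}+\mu_s$) is non-degenerate if $\mu_s\ne\frac4{h^2}+\mu_{s'}$ (resp. $\frac4{h^2}+\mu_s\neq\mu_{s'}$) for all $s'\ne s$; if $Q=0$ both thresholds $0,4/h^2$ count as non-degenerate. $\mathfrak S_p$ denotes the Schatten class. $\langle n\rangle=(1+n^2)^{1/2}$, $\psi(hn)=\langle n\rangle^{-\nu_0/2}$, $M_\psi$ is multiplication by $\psi$ on $\ell^2(\mathbb Z_h)$. $H^\pm=H_Q\pm V$. Spectral shift function: put $\mathscr M=\mathscr V^{1/2}(M_\psi\otimes K)\in\mathfrak S_2$ (so $V=\mathscr M^*\mathscr M$) and $T(z)=\mathscr M(H_Q-z)^{-1}\mathscr M^*$. For each $\lambda\in\mathbb R\setminus\mathscr E_Q$ the limit $T(\lambda+i0)=\lim_{\varepsilon\searrow0}T(\lambda+i\varepsilon)$ exists in $\mathfrak S_2$; $A(\lambda+i0)$ and $B(\lambda+i0)$ are its real and imaginary (self-adjoint) parts, $0\le B(\lambda+i0)\in\mathfrak S_1$. For compact self-adjoint $S$ and $r>0$, $\mathscr N_\pm(r,S)=\mathrm{Rank}\,\mathbf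 1_{(r,\infty)}(\pm S)$. The SSF is identified with its representative $\xi(\lambda;H^\pm,H_Q)=\pm\frac1\pi\int_{\mathbb R}\mathscr N_\mp(1,A(\lambda+i0)+tB(\lambda+i0))\frac{dt}{1+t^2}$, $\lambda\in\mathbb R\setminus\mathscr E_Q$. Effective operator: $\mathbf V=(I_{\ell^2(\mathbb Z_h)}\otimes K^* )\mathscr V(I_{\ell^2(\mathbb Z_h)}\otimes K)$; $g_s(\lambda)=\arcsin\big(\frac h2\sqrt{\lambda-\mu_s}\big)$ for $\lambda\in(\mu_s,\frac4{h^2}+\mu_s)$; $Y_s(\lambda):\ell^2(\mathbb Z_h)\to\mathbb C^2$, $$Y_s(\lambda)\phi=\Big(\sum_{n}\langle n\rangle^{-\nu_0/2}\cos(2ng_s(\lambda))\phi(hn),\ \sum_{n}\langle n\rangle^{-\nu_0/2}\sin(2ng_s(\lambda))\phi(hn)\Big);$$ $$\Omega_s(\lambda)=\frac{1}{\sqrt{\lambda-\mu_s}\sqrt{4/h^2+\mu_s-\lambda}}\,(Y_s(\lambda)\otimes\pi_s)\mathbf V(Y_s(\lambda)^*\otimes\pi_s)\quad\text{on }\mathbb C^2\otimes\mathcal G,$$ a positive trace class operator. Notation $\sim$: for real functionals $F_1(V,\lambda),F_2(V,\lambda)$, $F_1(V,\lambda)\sim F_2(V,\lambda)$ as $\lambda\to\lambda_0$ means that for every $\varepsilon\in(0,1)$, $$F_2((1-\varepsilon)^{-1}V,\lambda)+\mathcal O_\varepsilon(1)\le F_1(V,\lambda)\le F_2((1+\varepsilon)^{-1}V,\lambda)+\mathcal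 O_\varepsilon(1),\quad\lambda\to\lambda_0,$$ where $F(cV,\lambda)$ is $F$ with $\mathscr V$ replaced by $c\mathscr V$ ($\nu_0$, $K$ fixed). *)

theory Defs
  imports "HOL-Analysis.Analysis" "HOL-Library.Landau_Symbols"
begin

section \<open>Complex Hilbert spaces\<close>

class complex_inner = real_inner +
  fixes scaleC :: "complex \<Rightarrow> 'a \<Rightarrow> 'a" (infixr "*\<^sub>C" 75)
    and cinner :: "'a \<Rightarrow> 'a \<Rightarrow> complex"
  assumes scaleC_add_right: "c *\<^sub>C (x + y) = c *\<^sub>C x + c *\<^sub>C y"
    and scaleC_add_left: "(c + c') *\<^sub>C x = c *\<^sub>C x + c' *\<^sub>C x"
    and scaleC_scaleC: "c *\<^sub>C c' *\<^sub>C x = (c * c') *\<^sub>C x"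
    and scaleR_scaleC: "r *\<^sub>R x = of_real r *\<^sub>C x"
    and cinner_commute: "cinner x y = cnj (cinner y x)"
    and cinner_add_right: "cinner x (y + z) = cinner x y + cinner x z"
    and cinner_scaleC_right: "cinner x (c *\<^sub>C y) = c * cinner x y"
    and inner_cinner: "inner x y = Re (cinner x y)"

class chilbert_space = complex_inner + complete_space

lemma scaleC_one [simp]: "1 *\<^sub>C (x :: 'a::complex_inner) = x"
  using scaleR_scaleC[of 1 x] by simp

lemma vector_space_scaleC: "vector_space ((*\<^sub>C) :: complex \<Rightarrow> 'a::complex_inner \<Rightarrow> 'a)"
  by standard (simp_all add: scaleC_add_right scaleC_add_left scaleC_scaleC)

lemma cinner_self: "cinner (x :: 'a::complex_inner) x = of_real ((norm x)\<^sup>2)"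
proof -
  have "Im (cinner x x) = 0"
    using cinner_commute[of x x] by (metis cnj.sel(2) equal_neg_zero)
  then show ?thesis
    using inner_cinner[of x x] by (simp add: complex_eq_iff power2_norm_eq_inner)
qed

lemma cinner_add_left: "cinner (x + y :: 'a::complex_inner) z = cinner x z + cinner y z"
  using cinner_commute[of "x + y" z] cinner_commute[of x z] cinner_commute[of y z]
  by (simp add: cinner_add_right)

lemma cinner_scaleC_left: "cinner (c *\<^sub>C x) (y :: 'a::complex_inner) = cnj c * cinner x y"
  using cinner_commute[of "c *\<^sub>C x" y] cinner_commute[of x y]
  by (simp add: cinner_scaleC_right)

lemma norm_scaleC: "norm (c *\<^sub>C x :: 'a::complex_inner) = norm c * norm x"
proof -
  have "of_real ((norm (c *\<^sub>C x))\<^sup>2) = c * (cnj c * of_real ((norm x)\<^sup>2))"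
    using cinner_self[of "c *\<^sub>C x"] cinner_self[of x]
    by (simp add: cinner_scaleC_right cinner_scaleC_left)
  also have "\<dots> = complex_of_real ((norm c * norm x)\<^sup>2)"
    by (simp only: power_mult_distrib of_real_mult complex_norm_square mult.assoc)
  finally have "(norm (c *\<^sub>C x))\<^sup>2 = (norm c * norm x)\<^sup>2"
    using of_real_eq_iff by blast
  then show ?thesis
    by (simp add: power2_eq_iff_nonneg)
qed

lemma norm_cinner_le: "norm (cinner (x :: 'a::complex_inner) y) \<le> norm x * norm y"
proof (cases "cinner x y = 0")
  case False
  define c where "c = cnj (sgn (cinner x y))"
  have nc: "norm c = 1"
    using False by (simp add: c_def norm_sgn)
  have "cinner x (c *\<^sub>C y) = of_real (norm (cinner x y))"
    using False
    by (simp add: cinner_scaleC_right c_def sgn_eq complex_norm_square[symmetric] power2_eq_square mult.commute)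
  then have "norm (cinner x y) = inner x (c *\<^sub>C y)"
    by (simp add: inner_cinner)
  also have "\<dots> \<le> norm x * norm (c *\<^sub>C y)"
    by (rule norm_cauchy_schwarz)
  finally show ?thesis
    by (simp add: norm_scaleC nc)
qed simp

instantiation complex :: chilbert_space
begin

definition scaleC_complex :: "complex \<Rightarrow> complex \<Rightarrow> complex" where "scaleC_complex c z = c * z"
definition cinner_complex :: "complex \<Rightarrow> complex \<Rightarrow> complex" where "cinner_complex w z = cnj w * z"

instance
  by standard
    (simp_all add: scaleC_complex_def cinner_complex_def distrib_left distrib_right mult.assoc
      mult.left_commute scaleR_conv_of_real inner_complex_def)

end

instantiation prod :: (complex_inner, complex_inner) complex_inner
begin

definition scaleC_prod :: "complex \<Rightarrow> 'a \<times> 'b \<Rightarrow> 'a \<times> 'b"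
  where "scaleC_prod c p = (c *\<^sub>C fst p, c *\<^sub>C snd p)"
definition cinner_prod :: "'a \<times> 'b \<Rightarrow> 'a \<times> 'b \<Rightarrow> complex"
  where "cinner_prod p q = cinner (fst p) (fst q) + cinner (snd p) (snd q)"

instance
proof
  fix x y z :: "'a \<times> 'b" and a b :: complex and r :: real
  show "a *\<^sub>C (x + y) = a *\<^sub>C x + a *\<^sub>C y"
    by (simp add: scaleC_prod_def scaleC_add_right)
  show "(a + b) *\<^sub>C x = a *\<^sub>C x + b *\<^sub>C x"
    by (simp add: scaleC_prod_def scaleC_add_left)
  show "a *\<^sub>C b *\<^sub>C x = (a * b) *\<^sub>C x"
    by (simp add: scaleC_prod_def scaleC_scaleC)
  show "r *\<^sub>R x = of_real r *\<^sub>C x"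
    by (simp add: scaleC_prod_def scaleR_prod_def scaleR_scaleC)
  show "cinner x y = cnj (cinner y x)"
    by (simp add: cinner_prod_def cinner_commute[symmetric])
  show "cinner x (y + z) = cinner x y + cinner x z"
    by (simp add: cinner_prod_def cinner_add_right)
  show "cinner x (a *\<^sub>C y) = a * cinner x y"
    by (simp add: cinner_prod_def scaleC_prod_def cinner_scaleC_right distrib_left)
  show "inner x y = Re (cinner x y)"
    by (simp add: cinner_prod_def inner_prod_def inner_cinner)
qed

end

instance prod :: (chilbert_space, chilbert_space) chilbert_space ..


section \<open>The space \<open>\<ell>\<^sup>2(\<int>\<^sub>h, \<G>)\<close>\<close>

text \<open>A function on \<open>\<int>\<^sub>h = {h n. n \<in> \<int>}\<close> is represented by the function \<open>n \<mapsto> \<phi> (h n)\<close> on the integers.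
  The scalar product does not involve \<open>h\<close>.\<close>

typedef (overloaded) 'a l2 = "{\<phi> :: int \<Rightarrow> 'a::complex_inner. (\<lambda>n. (norm (\<phi> n))\<^sup>2) summable_on UNIV}"
  morphisms l2_fun Abs_l2
  by (rule exI[of _ "\<lambda>_. 0"]) simp

setup_lifting type_definition_l2

lemma l2_add:
  fixes f g :: "int \<Rightarrow> 'a::complex_inner"
  assumes "(\<lambda>n. (norm (f n))\<^sup>2) summable_on UNIV" "(\<lambda>n. (norm (g n))\<^sup>2) summable_on UNIV"
  shows "(\<lambda>n. (norm (f n + g n))\<^sup>2) summable_on UNIV"
proof (rule summable_on_comparison_test)
  show "(\<lambda>n. 2 * (norm (f n))\<^sup>2 + 2 * (norm (g n))\<^sup>2) summable_on UNIV"
    using assms by (intro summable_on_add summable_on_cmult_right)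
  fix n
  have "(norm (f n + g n))\<^sup>2 \<le> (norm (f n) + norm (g n))\<^sup>2"
    by (simp add: norm_triangle_ineq power_mono)
  also have "\<dots> \<le> 2 * (norm (f n))\<^sup>2 + 2 * (norm (g n))\<^sup>2"
    using sum_squares_ge_zero zero_le_power2[of "norm (f n) - norm (g n)"]
    by (simp add: power2_eq_square algebra_simps)
  finally show "(norm (f n + g n))\<^sup>2 \<le> 2 * (norm (f n))\<^sup>2 + 2 * (norm (g n))\<^sup>2" .
qed auto

lemma l2_scaleC:
  fixes f :: "int \<Rightarrow> 'a::complex_inner"
  assumes "(\<lambda>n. (norm (f n))\<^sup>2) summable_on UNIV"
  shows "(\<lambda>n. (norm (c *\<^sub>C f n))\<^sup>2) summable_on UNIV"
  using assms by (simp add: norm_scaleC power_mult_distrib summable_on_cmult_right)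

lemma l2_cinner:
  fixes f g :: "int \<Rightarrow> 'a::complex_inner"
  assumes "(\<lambda>n. (norm (f n))\<^sup>2) summable_on UNIV" "(\<lambda>n. (norm (g n))\<^sup>2) summable_on UNIV"
  shows "(\<lambda>n. cinner (f n) (g n)) summable_on UNIV"
proof (rule abs_summable_summable, rule summable_on_comparison_test)
  show "(\<lambda>n. (norm (f n))\<^sup>2 + (norm (g n))\<^sup>2) summable_on UNIV"
    using assms by (rule summable_on_add)
  fix n
  have "norm (cinner (f n) (g n)) \<le> norm (f n) * norm (g n)"
    by (rule norm_cinner_le)
  also have "\<dots> \<le> (norm (f n))\<^sup>2 + (norm (g n))\<^sup>2"
    using sum_squares_bound[of "norm (f n)" "norm (g n)"] mult_nonneg_nonneg[OF norm_ge_zero norm_ge_zero, of "f n" "g n"]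
    by linarith
  finally show "norm (cinner (f n) (g n)) \<le> (norm (f n))\<^sup>2 + (norm (g n))\<^sup>2" .
qed auto

instantiation l2 :: (complex_inner) complex_inner
begin

lift_definition zero_l2 :: "'a l2" is "\<lambda>_. 0" by simp
lift_definition plus_l2 :: "'a l2 \<Rightarrow> 'a l2 \<Rightarrow> 'a l2" is "\<lambda>f g n. f n + g n" by (rule l2_add)
lift_definition scaleC_l2 :: "complex \<Rightarrow> 'a l2 \<Rightarrow> 'a l2" is "\<lambda>c f n. c *\<^sub>C f n" by (rule l2_scaleC)
lift_definition uminus_l2 :: "'a l2 \<Rightarrow> 'a l2" is "\<lambda>f n. - f n" by simp
definition minus_l2 :: "'a l2 \<Rightarrow> 'a l2 \<Rightarrow> 'a l2" where "minus_l2 f g = f + - g"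
definition scaleR_l2 :: "real \<Rightarrow> 'a l2 \<Rightarrow> 'a l2" where "scaleR_l2 r f = of_real r *\<^sub>C f"
definition cinner_l2 :: "'a l2 \<Rightarrow> 'a l2 \<Rightarrow> complex"
  where "cinner_l2 f g = (\<Sum>\<^sub>\<infinity>n. cinner (l2_fun f n) (l2_fun g n))"
definition inner_l2 :: "'a l2 \<Rightarrow> 'a l2 \<Rightarrow> real" where "inner_l2 f g = Re (cinner f g)"
definition norm_l2 :: "'a l2 \<Rightarrow> real" where "norm_l2 f = sqrt (inner f f)"
definition sgn_l2 :: "'a l2 \<Rightarrow> 'a l2" where "sgn_l2 f = inverse (norm f) *\<^sub>R f"
definition dist_l2 :: "'a l2 \<Rightarrow> 'a l2 \<Rightarrow> real" where "dist_l2 f g = norm (f - g)"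
definition uniformity_l2 :: "('a l2 \<times> 'a l2) filter"
  where "uniformity_l2 = (INF e\<in>{0<..}. principal {(f, g). dist f g < e})"
definition open_l2 :: "'a l2 set \<Rightarrow> bool"
  where "open_l2 U = (\<forall>x\<in>U. eventually (\<lambda>(x', y). x' = x \<longrightarrow> y \<in> U) uniformity)"

lemma l2_fun_summable: "(\<lambda>n. (norm (l2_fun f n))\<^sup>2) summable_on UNIV"
  using l2_fun[of f] by simp

lemma inner_l2_self: "inner f f = (\<Sum>\<^sub>\<infinity>n. (norm (l2_fun f n))\<^sup>2)"
proof -
  have "cinner f f = (\<Sum>\<^sub>\<infinity>n. complex_of_real ((norm (l2_fun f n))\<^sup>2))"
    unfolding cinner_l2_def by (simp add: cinner_self)
  also have "\<dots> = of_real (\<Sum>\<^sub>\<infinity>n. (norm (l2_fun f n))\<^sup>2)"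
    by (intro infsumI has_sum_bounded_linear[OF bounded_linear_of_real] has_sum_infsum l2_fun_summable)
  finally show ?thesis
    by (simp add: inner_l2_def)
qed

lemma cinner_l2_summable: "(\<lambda>n. cinner (l2_fun f n) (l2_fun g n)) summable_on UNIV"
  by (intro l2_cinner l2_fun_summable)

instance
proof
  fix f g k :: "'a l2" and a b :: complex and r q :: real
  show "f + g + k = f + (g + k)" by transfer (simp add: add.assoc)
  show "f + g = g + f" by transfer (simp add: add.commute)
  show "0 + f = f" by transfer simp
  show "- f + f = 0" by transfer simp
  show "f - g = f + - g" by (rule minus_l2_def)
  show sar: "a *\<^sub>C (f + g) = a *\<^sub>C f + a *\<^sub>C g" for a :: complex and f g :: "'a l2"
    by transfer (simp add: scaleC_add_right)
  show sal: "(a + b) *\<^sub>C f = a *\<^sub>C f + b *\<^sub>C f" for a b :: complex and f :: "'a l2"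
    by transfer (simp add: scaleC_add_left)
  show ss: "a *\<^sub>C b *\<^sub>C f = (a * b) *\<^sub>C f" for a b :: complex and f :: "'a l2"
    by transfer (simp add: scaleC_scaleC)
  show "r *\<^sub>R f = of_real r *\<^sub>C f" by (rule scaleR_l2_def)
  show "r *\<^sub>R (f + g) = r *\<^sub>R f + r *\<^sub>R g" by (simp add: scaleR_l2_def sar)
  show "(r + q) *\<^sub>R f = r *\<^sub>R f + q *\<^sub>R f" by (simp add: scaleR_l2_def sal)
  show "r *\<^sub>R q *\<^sub>R f = (r * q) *\<^sub>R f" by (simp add: scaleR_l2_def ss)
  show "1 *\<^sub>R f = f" unfolding scaleR_l2_def by transfer simp
  show cc: "cinner f g = cnj (cinner g f)" for f g :: "'a l2"
    unfolding cinner_l2_def infsum_cnj[symmetric] by (intro infsum_cong cinner_commute)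
  show ca: "cinner f (g + k) = cinner f g + cinner f k" for f g k :: "'a l2"
    unfolding cinner_l2_def
    by (simp add: plus_l2.rep_eq cinner_add_right infsum_add cinner_l2_summable)
  show cs: "cinner f (a *\<^sub>C g) = a * cinner f g" for f g :: "'a l2" and a
    unfolding cinner_l2_def
    by (simp add: scaleC_l2.rep_eq cinner_scaleC_right infsum_cmult_right cinner_l2_summable)
  show "inner f g = Re (cinner f g)" by (rule inner_l2_def)
  show ic: "inner f g = inner g f" for f g :: "'a l2"
    unfolding inner_l2_def by (subst cc) simp
  show "inner (f + g) k = inner f k + inner g k"
    using ic[of "f + g" k] ic[of f k] ic[of g k] by (simp add: inner_l2_def ca)
  show "inner (r *\<^sub>R f) g = r * inner f g"
    using ic[of "r *\<^sub>R f" g] ic[of f g] by (simp add: inner_l2_def scaleR_l2_def cs)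
  show "0 \<le> inner f f"
    unfolding inner_l2_self by (rule infsum_nonneg) simp
  show "(inner f f = 0) = (f = 0)"
  proof
    assume "inner f f = 0"
    then have "(norm (l2_fun f n))\<^sup>2 = 0" for n
      using nonneg_infsum_le_0D[of "\<lambda>n. (norm (l2_fun f n))\<^sup>2" UNIV] l2_fun_summable[of f]
      unfolding inner_l2_self by auto
    then show "f = 0" by transfer (simp add: fun_eq_iff)
  next
    assume "f = 0"
    then show "inner f f = 0" unfolding inner_l2_self by (simp add: zero_l2.rep_eq)
  qed
  show "norm f = sqrt (inner f f)" by (rule norm_l2_def)
  show "sgn f = inverse (norm f) *\<^sub>R f" by (rule sgn_l2_def)
  show "dist f g = norm (f - g)" by (rule dist_l2_def)
  show "uniformity = (INF e\<in>{0<..}. principal {(f :: 'a l2, g). dist f g < e})"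
    by (rule uniformity_l2_def)
  show "open U = (\<forall>x\<in>U. \<forall>\<^sub>F (x', y) in uniformity. x' = x \<longrightarrow> y \<in> U)" for U :: "'a l2 set"
    by (rule open_l2_def)
qed

end

lemma l2_fun_add [simp]: "l2_fun (f + g) n = l2_fun f n + l2_fun g n"
  by (simp add: plus_l2.rep_eq)

lemma l2_fun_scaleC [simp]: "l2_fun (c *\<^sub>C f) n = c *\<^sub>C l2_fun f n"
  by (simp add: scaleC_l2.rep_eq)

lemma l2_fun_diff [simp]: "l2_fun (f - g) n = l2_fun f n - l2_fun g n"
  unfolding minus_l2_def by (simp add: uminus_l2.rep_eq del: add_uminus_conv_diff)

lemma norm_l2_eq: "(norm f)\<^sup>2 = (\<Sum>\<^sub>\<infinity>n. (norm (l2_fun f n))\<^sup>2)"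
  by (simp add: power2_norm_eq_inner inner_l2_self)

lemma sum_le_norm_l2:
  assumes "finite F"
  shows "(\<Sum>n\<in>F. (norm (l2_fun f n))\<^sup>2) \<le> (norm f)\<^sup>2"
  unfolding norm_l2_eq using assms by (intro finite_sum_le_infsum l2_fun_summable) auto

instance l2 :: (chilbert_space) chilbert_space
proof
  fix X :: "nat \<Rightarrow> 'a l2"
  assume X: "Cauchy X"
  have coord: "norm (l2_fun f n) \<le> norm f" for f :: "'a l2" and n
    using sum_le_norm_l2[of "{n}" f] by (simp add: power2_le_iff_abs_le)
  have "Cauchy (\<lambda>i. l2_fun (X i) n)" for n
  proof (rule CauchyI)
    fix e :: real assume "e > 0"
    then obtain M where "\<forall>i\<ge>M. \<forall>j\<ge>M. norm (X i - X j) < e"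
      using CauchyD[OF X] by blast
    then show "\<exists>M. \<forall>i\<ge>M. \<forall>j\<ge>M. norm (l2_fun (X i) n - l2_fun (X j) n) < e"
      using coord[of "X _ - X _" n] by (metis l2_fun_diff order_le_less_trans)
  qed
  then have "\<forall>n. \<exists>l. (\<lambda>i. l2_fun (X i) n) \<longlonglongrightarrow> l"
    by (simp add: Cauchy_convergent_iff convergent_def)
  then obtain L where L: "\<And>n. (\<lambda>i. l2_fun (X i) n) \<longlonglongrightarrow> L n"
    by metis
  have bound: "(\<Sum>n\<in>F. (norm (l2_fun (X i) n - L n))\<^sup>2) \<le> e\<^sup>2"
    if "finite F" and M: "\<forall>i\<ge>M. \<forall>j\<ge>M. norm (X i - X j) < e" and "i \<ge> M" for F e M i
  proof (rule tendsto_upperbound)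
    show "(\<lambda>j. \<Sum>n\<in>F. (norm (l2_fun (X i) n - l2_fun (X j) n))\<^sup>2)
        \<longlonglongrightarrow> (\<Sum>n\<in>F. (norm (l2_fun (X i) n - L n))\<^sup>2)"
      by (intro tendsto_intros L)
    show "\<forall>\<^sub>F j in sequentially. (\<Sum>n\<in>F. (norm (l2_fun (X i) n - l2_fun (X j) n))\<^sup>2) \<le> e\<^sup>2"
      using eventually_ge_at_top[of M]
    proof eventually_elim
      case (elim j)
      have "(\<Sum>n\<in>F. (norm (l2_fun (X i) n - l2_fun (X j) n))\<^sup>2) \<le> (norm (X i - X j))\<^sup>2"
        using sum_le_norm_l2[OF \<open>finite F\<close>, of "X i - X j"] by simp
      also have "\<dots> \<le> e\<^sup>2"
        using M \<open>i \<ge> M\<close> elim by (intro power_mono) (auto intro: less_imp_le)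
      finally show ?case .
    qed
  qed simp
  have summ: "(\<lambda>n. (norm (l2_fun (X i) n - L n))\<^sup>2) summable_on UNIV"
    and le: "(\<Sum>\<^sub>\<infinity>n. (norm (l2_fun (X i) n - L n))\<^sup>2) \<le> e\<^sup>2"
    if M: "\<forall>i\<ge>M. \<forall>j\<ge>M. norm (X i - X j) < e" and "i \<ge> M" for e M i
  proof -
    show s: "(\<lambda>n. (norm (l2_fun (X i) n - L n))\<^sup>2) summable_on UNIV"
      using bound[OF _ that]
      by (intro nonneg_bdd_above_summable_on bdd_aboveI[of _ "e\<^sup>2"]) auto
    show "(\<Sum>\<^sub>\<infinity>n. (norm (l2_fun (X i) n - L n))\<^sup>2) \<le> e\<^sup>2"
      using bound[OF _ that] by (intro infsum_le_finite_sums s) auto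
  qed
  obtain M1 where M1: "\<forall>i\<ge>M1. \<forall>j\<ge>M1. norm (X i - X j) < 1"
    using CauchyD[OF X, of 1] by auto
  have "(\<lambda>n. (norm (L n))\<^sup>2) summable_on UNIV"
    using l2_add[OF l2_fun_summable[of "X M1"] l2_scaleC[OF summ[OF M1 order_refl], of "-1"]]
    by (simp add: scaleR_scaleC[of "-1", simplified, symmetric])
  then have rep: "l2_fun (Abs_l2 L) = L"
    by (simp add: Abs_l2_inverse)
  have "X \<longlonglongrightarrow> Abs_l2 L"
  proof (rule LIMSEQ_I)
    fix r :: real assume "r > 0"
    then obtain M where M: "\<forall>i\<ge>M. \<forall>j\<ge>M. norm (X i - X j) < r / 2"
      using CauchyD[OF X, of "r / 2"] by auto
    have "norm (X i - Abs_l2 L) < r" if "i \<ge> M" for i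
    proof -
      have "(norm (X i - Abs_l2 L))\<^sup>2 \<le> (r / 2)\<^sup>2"
        using le[OF M that] by (simp add: norm_l2_eq rep)
      then have "norm (X i - Abs_l2 L) \<le> r / 2"
        using \<open>r > 0\<close> by (simp add: power2_le_iff_abs_le)
      then show ?thesis using \<open>r > 0\<close> by simp
    qed
    then show "\<exists>no. \<forall>n\<ge>no. norm (X n - Abs_l2 L) < r" by blast
  qed
  then show "convergent X" by (rule convergentI)
qed


section \<open>Operators\<close>

definition bounded_clinear :: "('a::complex_inner \<Rightarrow> 'b::complex_inner) \<Rightarrow> bool"
  where "bounded_clinear T \<longleftrightarrow> bounded_linear T \<and> (\<forall>c x. T (c *\<^sub>C x) = c *\<^sub>C T x)"

definition cadjoint :: "('a::complex_inner \<Rightarrow> 'b::complex_inner) \<Rightarrow> 'b \<Rightarrow> 'a"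
  where "cadjoint T = (THE S. \<forall>x y. cinner (S y) x = cinner y (T x))"

definition selfadjoint :: "('a::complex_inner \<Rightarrow> 'a) \<Rightarrow> bool"
  where "selfadjoint T \<longleftrightarrow> bounded_clinear T \<and> (\<forall>x y. cinner (T x) y = cinner x (T y))"

definition positive_op :: "('a::complex_inner \<Rightarrow> 'a) \<Rightarrow> bool"
  where "positive_op T \<longleftrightarrow> bounded_clinear T \<and> (\<forall>x. cinner x (T x) \<in> \<real>\<^sub>\<ge>\<^sub>0)"

definition op_sqrt :: "('a::complex_inner \<Rightarrow> 'a) \<Rightarrow> 'a \<Rightarrow> 'a"
  where "op_sqrt T = (THE R. positive_op R \<and> R \<circ> R = T)"

definition re_part :: "('a::complex_inner \<Rightarrow> 'a) \<Rightarrow> 'a \<Rightarrow> 'a"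
  where "re_part T = (\<lambda>u. (1/2) *\<^sub>C (T u + cadjoint T u))"

definition im_part :: "('a::complex_inner \<Rightarrow> 'a) \<Rightarrow> 'a \<Rightarrow> 'a"
  where "im_part T = (\<lambda>u. (1/(2*\<i>)) *\<^sub>C (T u - cadjoint T u))"

definition eigenspace :: "('a::complex_inner \<Rightarrow> 'a) \<Rightarrow> real \<Rightarrow> 'a set"
  where "eigenspace T r = {x. T x = r *\<^sub>R x}"

definition ortho_proj :: "'a::complex_inner set \<Rightarrow> 'a \<Rightarrow> 'a"
  where "ortho_proj W x = (THE y. y \<in> W \<and> (\<forall>w\<in>W. cinner w (x - y) = 0))"

definition is_onb :: "'a::complex_inner set \<Rightarrow> bool"
  where "is_onb E \<longleftrightarrow> (\<forall>x\<in>E. \<forall>y\<in>E. cinner x y = (if x = y then 1 else 0)) \<and>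
    closure (module.span (*\<^sub>C) E) = UNIV"

text \<open>The choice of the basis is immaterial for \<open>hilbert_schmidt\<close> and \<open>hs_norm\<close>, and for \<open>trace_op\<close> on the
  trace class.\<close>

definition some_onb :: "'a::complex_inner set"
  where "some_onb = (SOME E. is_onb E)"

definition hilbert_schmidt :: "('a::complex_inner \<Rightarrow> 'b::complex_inner) \<Rightarrow> bool"
  where "hilbert_schmidt T \<longleftrightarrow> bounded_clinear T \<and> (\<lambda>e. (norm (T e))\<^sup>2) summable_on some_onb"

definition hs_norm :: "('a::complex_inner \<Rightarrow> 'b::complex_inner) \<Rightarrow> real"
  where "hs_norm T = sqrt (\<Sum>\<^sub>\<infinity>e\<in>some_onb. (norm (T e))\<^sup>2)"

definition trace_op :: "('a::complex_inner \<Rightarrow> 'a) \<Rightarrow> complex"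
  where "trace_op T = (\<Sum>\<^sub>\<infinity>e\<in>some_onb. cinner e (T e))"

text \<open>Convergence in the Hilbert-Schmidt class. The first two conjuncts keep \<open>hs_norm\<close> away from
  operators for which its defining series diverges.\<close>

definition hs_tendsto :: "('i \<Rightarrow> 'a::complex_inner \<Rightarrow> 'b::complex_inner) \<Rightarrow> ('a \<Rightarrow> 'b) \<Rightarrow> 'i filter \<Rightarrow> bool"
  where "hs_tendsto T L F \<longleftrightarrow> hilbert_schmidt L \<and> (\<forall>\<^sub>F i in F. hilbert_schmidt (T i)) \<and>
    ((\<lambda>i. hs_norm (\<lambda>u. T i u - L u)) \<longlongrightarrow> 0) F"

text \<open>Borel functional calculus \<open>f(S)\<close> for a compact self-adjoint operator \<open>S\<close> and \<open>f\<close> bounded on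
  its spectrum. The eigenvectors of such an \<open>S\<close> (the kernel included) span a dense subspace, so a
  bounded operator is determined by its values on them.\<close>

definition fun_calc :: "(real \<Rightarrow> real) \<Rightarrow> ('a::complex_inner \<Rightarrow> 'a) \<Rightarrow> 'a \<Rightarrow> 'a"
  where "fun_calc f S = (THE R. bounded_clinear R \<and> (\<forall>r. \<forall>x\<in>eigenspace S r. R x = f r *\<^sub>R x))"

text \<open>The complex dimension of the range; it is \<open>0\<close> by convention for operators of infinite rank.\<close>

definition op_rank :: "('a::complex_inner \<Rightarrow> 'b::complex_inner) \<Rightarrow> nat"
  where "op_rank T = vector_space.dim (*\<^sub>C) (range T)"

text \<open>\<open>\<N>\<^sub>\<plusminus>(r, S)\<close> for compact self-adjoint \<open>S\<close> and \<open>r > 0\<close>; the sign is \<open>\<sigma> = \<plusminus>1\<close>.\<close>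

definition eig_count :: "real \<Rightarrow> real \<Rightarrow> ('a::complex_inner \<Rightarrow> 'a) \<Rightarrow> nat"
  where "eig_count \<sigma> r S = op_rank (fun_calc (indicator {r<..}) (\<lambda>u. \<sigma> *\<^sub>R S u))"


section \<open>Tensor products\<close>

text \<open>Elementary tensors under the identifications of \<open>\<ell>\<^sup>2(\<int>\<^sub>h) \<otimes> \<G>\<close> with \<open>\<ell>\<^sup>2(\<int>\<^sub>h, \<G>)\<close> and of
  \<open>\<complex>\<^sup>2 \<otimes> \<G>\<close> with \<open>\<G> \<times> \<G>\<close>.\<close>

lift_definition tensor_l2 :: "complex l2 \<Rightarrow> 'g::complex_inner \<Rightarrow> 'g l2"
  is "\<lambda>\<phi> x n. \<phi> n *\<^sub>C x"
  by (simp add: norm_scaleC power_mult_distrib summable_on_cmult_left)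

definition tensor_C2 :: "complex \<times> complex \<Rightarrow> 'g::complex_inner \<Rightarrow> 'g \<times> 'g"
  where "tensor_C2 c x = (fst c *\<^sub>C x, snd c *\<^sub>C x)"

text \<open>The bounded operator \<open>A \<otimes> B\<close>, given by its action on the elementary tensors \<open>t\<close> of the domain
  and \<open>t'\<close> of the codomain. Elementary tensors are total, hence uniqueness.\<close>

definition tensor_op ::
    "('a::complex_inner \<Rightarrow> 'g::complex_inner \<Rightarrow> 'ag::complex_inner) \<Rightarrow>
     ('b::complex_inner \<Rightarrow> 'k::complex_inner \<Rightarrow> 'bk::complex_inner) \<Rightarrow>
     ('a \<Rightarrow> 'b) \<Rightarrow> ('g \<Rightarrow> 'k) \<Rightarrow> 'ag \<Rightarrow> 'bk"
  where "tensor_op t t' A B =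
    (THE U. bounded_clinear U \<and> (\<forall>\<phi> x. U (t \<phi> x) = t' (A \<phi>) (B x)))"

abbreviation l2_tensor_op ::
    "(complex l2 \<Rightarrow> complex l2) \<Rightarrow> ('g::complex_inner \<Rightarrow> 'g) \<Rightarrow> 'g l2 \<Rightarrow> 'g l2" (infixr "\<otimes>\<^sub>o" 70)
  where "A \<otimes>\<^sub>o B \<equiv> tensor_op tensor_l2 tensor_l2 A B"


section \<open>The Hamiltonian and the spectral shift function\<close>

definition neg_laplace :: "real \<Rightarrow> complex l2 \<Rightarrow> complex l2"
  where "neg_laplace h \<phi> =
    Abs_l2 (\<lambda>n. (2 * l2_fun \<phi> n - l2_fun \<phi> (n + 1) - l2_fun \<phi> (n - 1)) / (of_real h)\<^sup>2)"

definition bracket :: "int \<Rightarrow> real"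
  where "bracket n = sqrt (1 + (of_int n)\<^sup>2)"

definition mult_psi :: "real \<Rightarrow> complex l2 \<Rightarrow> complex l2"
  where "mult_psi \<nu>\<^sub>0 \<phi> = Abs_l2 (\<lambda>n. of_real (bracket n powr (-\<nu>\<^sub>0/2)) * l2_fun \<phi> n)"

text \<open>\<open>I\<^sub>Q\<close>, and the structure of \<open>Q\<close>: either \<open>Q = 0\<close> with \<open>\<mu>\<^sub>0 = 0\<close>, or \<open>\<mu>\<^sub>1, \<dots>, \<mu>\<^sub>d\<close> are the distinct
  eigenvalues of \<open>Q\<close> and \<open>\<G>\<close> is the sum of the eigenspaces (which are mutually orthogonal because
  \<open>Q\<close> is self-adjoint). Such a \<open>Q\<close> is bounded.\<close>

definition index_set :: "('g::complex_inner \<Rightarrow> 'g) \<Rightarrow> nat \<Rightarrow> nat set"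
  where "index_set Q d = (if Q = (\<lambda>_. 0) then {0} else {1..d})"

definition finite_eigen_decomp :: "('g::complex_inner \<Rightarrow> 'g) \<Rightarrow> nat \<Rightarrow> (nat \<Rightarrow> real) \<Rightarrow> bool"
  where "finite_eigen_decomp Q d \<mu> \<longleftrightarrow> selfadjoint Q \<and>
    (if Q = (\<lambda>_. 0) then \<mu> 0 = 0
     else inj_on \<mu> {1..d} \<and> (\<forall>s\<in>{1..d}. eigenspace Q (\<mu> s) \<noteq> {0}) \<and>
       (\<forall>x. \<exists>y. (\<forall>s\<in>{1..d}. y s \<in> eigenspace Q (\<mu> s)) \<and> x = (\<Sum>s=1..d. y s)))"

text \<open>For \<open>Q = 0\<close> both conditions hold vacuously.\<close>

definition nondegenerate_lower ::
    "real \<Rightarrow> ('g::complex_inner \<Rightarrow> 'g) \<Rightarrow> nat \<Rightarrow> (nat \<Rightarrow> real) \<Rightarrow> nat \<Rightarrow> bool"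
  where "nondegenerate_lower h Q d \<mu> s \<longleftrightarrow>
    (\<forall>s'\<in>index_set Q d. s' \<noteq> s \<longrightarrow> \<mu> s \<noteq> 4/h\<^sup>2 + \<mu> s')"

definition nondegenerate_upper ::
    "real \<Rightarrow> ('g::complex_inner \<Rightarrow> 'g) \<Rightarrow> nat \<Rightarrow> (nat \<Rightarrow> real) \<Rightarrow> nat \<Rightarrow> bool"
  where "nondegenerate_upper h Q d \<mu> s \<longleftrightarrow>
    (\<forall>s'\<in>index_set Q d. s' \<noteq> s \<longrightarrow> 4/h\<^sup>2 + \<mu> s \<noteq> \<mu> s')"

definition H_Q :: "real \<Rightarrow> ('g::complex_inner \<Rightarrow> 'g) \<Rightarrow> 'g l2 \<Rightarrow> 'g l2"
  where "H_Q h Q u = (neg_laplace h \<otimes>\<^sub>o id) u + (id \<otimes>\<^sub>o Q) u"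

text \<open>The factor \<open>\<M>\<close> of the perturbation: \<open>V = (M\<^sub>\<psi> \<otimes> K\<^sup>*) \<V> (M\<^sub>\<psi> \<otimes> K) = \<M>\<^sup>* \<M>\<close>. The operators \<open>H\<^sup>\<plusminus> = H\<^sub>Q \<plusminus> V\<close>
  enter the formula for the spectral shift function only through \<open>\<M>\<close> and the sign.\<close>

definition factor_M ::
    "real \<Rightarrow> ('g::complex_inner \<Rightarrow> 'g) \<Rightarrow> ('g l2 \<Rightarrow> 'g l2) \<Rightarrow> 'g l2 \<Rightarrow> 'g l2"
  where "factor_M \<nu>\<^sub>0 K \<V> = op_sqrt \<V> \<circ> (mult_psi \<nu>\<^sub>0 \<otimes>\<^sub>o K)"

definition sandwiched_resolvent ::
    "real \<Rightarrow> ('g::complex_inner \<Rightarrow> 'g) \<Rightarrow> real \<Rightarrow> ('g \<Rightarrow> 'g) \<Rightarrow> ('g l2 \<Rightarrow> 'g l2) \<Rightarrow> complex \<Rightarrow> 'g l2 \<Rightarrow> 'g l2"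
  where "sandwiched_resolvent h Q \<nu>\<^sub>0 K \<V> z =
    factor_M \<nu>\<^sub>0 K \<V> \<circ> inv (\<lambda>u. H_Q h Q u - z *\<^sub>C u) \<circ> cadjoint (factor_M \<nu>\<^sub>0 K \<V>)"

definition boundary_value ::
    "real \<Rightarrow> ('g::complex_inner \<Rightarrow> 'g) \<Rightarrow> real \<Rightarrow> ('g \<Rightarrow> 'g) \<Rightarrow> ('g l2 \<Rightarrow> 'g l2) \<Rightarrow> real \<Rightarrow> 'g l2 \<Rightarrow> 'g l2"
  where "boundary_value h Q \<nu>\<^sub>0 K \<V> E =
    (THE L. hs_tendsto (\<lambda>\<epsilon>. sandwiched_resolvent h Q \<nu>\<^sub>0 K \<V> (Complex E \<epsilon>)) L (at_right 0))"

text \<open>\<open>\<xi>(E; H\<^sup>\<plusminus>, H\<^sub>Q)\<close> with \<open>\<sigma> = \<plusminus>1\<close>, in Pushnitski's representation, for \<open>E\<close> outside the threshold set.\<close>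

definition ssf ::
    "real \<Rightarrow> real \<Rightarrow> ('g::complex_inner \<Rightarrow> 'g) \<Rightarrow> real \<Rightarrow> ('g \<Rightarrow> 'g) \<Rightarrow> ('g l2 \<Rightarrow> 'g l2) \<Rightarrow> real \<Rightarrow> real"
  where "ssf \<sigma> h Q \<nu>\<^sub>0 K \<V> E =
    (let T = boundary_value h Q \<nu>\<^sub>0 K \<V> E in
      \<sigma> * (1/pi) * (LINT t|lborel.
        real (eig_count (-\<sigma>) 1 (\<lambda>u. re_part T u + t *\<^sub>R im_part T u)) / (1 + t\<^sup>2)))"


section \<open>The effective operator\<close>

definition V_eff :: "('g::complex_inner \<Rightarrow> 'g) \<Rightarrow> ('g l2 \<Rightarrow> 'g l2) \<Rightarrow> 'g l2 \<Rightarrow> 'g l2"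
  where "V_eff K \<V> = (id \<otimes>\<^sub>o cadjoint K) \<circ> \<V> \<circ> (id \<otimes>\<^sub>o K)"

definition g_fun :: "real \<Rightarrow> real \<Rightarrow> real \<Rightarrow> real"
  where "g_fun h \<mu>s E = arcsin (h/2 * sqrt (E - \<mu>s))"

definition Y_op :: "real \<Rightarrow> real \<Rightarrow> real \<Rightarrow> real \<Rightarrow> complex l2 \<Rightarrow> complex \<times> complex"
  where "Y_op h \<mu>s \<nu>\<^sub>0 E \<phi> =
    ((\<Sum>\<^sub>\<infinity>n. of_real (bracket n powr (-\<nu>\<^sub>0/2) * cos (2 * of_int n * g_fun h \<mu>s E)) * l2_fun \<phi> n),
     (\<Sum>\<^sub>\<infinity>n. of_real (bracket n powr (-\<nu>\<^sub>0/2) * sin (2 * of_int n * g_fun h \<mu>s E)) * l2_fun \<phi> n))"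

text \<open>Here \<open>\<mu>s\<close> is the value of the threshold \<open>\<mu>\<^sub>s\<close>. For \<open>Q = 0\<close> and \<open>\<mu>s = 0\<close> the eigenspace is all
  of \<open>\<G>\<close> and the projection is the identity.\<close>

definition Omega ::
    "real \<Rightarrow> ('g::complex_inner \<Rightarrow> 'g) \<Rightarrow> real \<Rightarrow> real \<Rightarrow> ('g \<Rightarrow> 'g) \<Rightarrow> ('g l2 \<Rightarrow> 'g l2) \<Rightarrow> real \<Rightarrow> 'g \<times> 'g \<Rightarrow> 'g \<times> 'g"
  where "Omega h Q \<mu>s \<nu>\<^sub>0 K \<V> E =
    (let Y = Y_op h \<mu>s \<nu>\<^sub>0 E; \<pi>s = ortho_proj (eigenspace Q \<mu>s) in
      (\<lambda>w. (1 / (sqrt (E - \<mu>s) * sqrt (4/h\<^sup>2 + \<mu>s - E))) *\<^sub>R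
        (tensor_op tensor_l2 tensor_C2 Y \<pi>s \<circ> V_eff K \<V> \<circ> tensor_op tensor_C2 tensor_l2 (cadjoint Y) \<pi>s) w))"


section \<open>The asymptotic relation\<close>

definition asymp_sim ::
    "(('a \<Rightarrow> 'b::real_vector) \<Rightarrow> real \<Rightarrow> real) \<Rightarrow> (('a \<Rightarrow> 'b) \<Rightarrow> real \<Rightarrow> real) \<Rightarrow> ('a \<Rightarrow> 'b) \<Rightarrow> real filter \<Rightarrow> bool"
  where "asymp_sim F\<^sub>1 F\<^sub>2 \<V> F \<longleftrightarrow>
    (\<forall>\<epsilon>\<in>{0<..<1}. \<exists>r\<^sub>1 \<in> O[F](\<lambda>_. 1). \<exists>r\<^sub>2 \<in> O[F](\<lambda>_. 1). \<forall>\<^sub>F E in F.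
      F\<^sub>2 (\<lambda>u. (1 / (1 - \<epsilon>)) *\<^sub>R \<V> u) E + r\<^sub>1 E \<le> F\<^sub>1 \<V> E \<and>
      F\<^sub>1 \<V> E \<le> F\<^sub>2 (\<lambda>u. (1 / (1 + \<epsilon>)) *\<^sub>R \<V> u) E + r\<^sub>2 E)"

end

theory Submission
  imports Defs
begin

text \<open>
  Decomposing \<open>\<G>\<close> into the eigenspaces of \<open>Q\<close> writes \<open>T(z)\<close> as a finite sum of channels, each of the form
  \<open>R C R\<close> with \<open>R\<close> the square root of \<open>\<V>\<close> and \<open>C\<close> the weighted convolution with Green's function
  \<open>\<gamma> \<rho>\<^bsup>|n - m|\<^esup>\<close>, where \<open>\<rho> + 1/\<rho> = 2 - h\<^sup>2 (z - \<mu>\<^sub>s)\<close> and \<open>|\<rho>| < 1\<close>. At a boundary value inside the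
  band, \<open>\<rho> = e\<^sup>i\<^sup>\<theta>\<close>. The real part of the kernel involves \<open>sin (j\<theta>) / sin \<theta>\<close>, which is at most \<open>|j|\<close> in absolute
  value; as \<open>\<nu>\<^sub>0 > 3\<close>, the real part of \<open>T(E + i0)\<close> stays bounded in Hilbert--Schmidt norm up to the
  threshold, and so do the channels for which \<open>E\<close> is not near a threshold. The imaginary part of the
  singular channel is \<open>c W W\<^sup>*\<close>, while \<open>\<Omega>\<^sub>s = c W\<^sup>* W\<close> has the same nonzero eigenvalues.

  By Weyl's inequalities, perturbations bounded in Hilbert--Schmidt or trace norm change the averaged
  counting function only by a bounded amount once the coupling is rescaled by \<open>1 \<plusminus> \<epsilon>\<close>. What remains
  is the integral of the number of eigenvalues of \<open>t B\<close> above \<open>1\<close> against \<open>dt / (1 + t\<^sup>2)\<close>, which an eigenvalue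
  \<open>b\<close> of \<open>B\<close> enters through \<open>\<pi>/2 - arctan (1/b) = arctan b\<close>.
\<close>

section \<open>Complex inner product spaces\<close>

text \<open>The two kinds of error are measured differently because of where they stand. The real
  part \<open>A\<close> is not multiplied by \<open>t\<close>: a Hilbert--Schmidt bound limits its
  eigenvalue count at a fixed level, and that constant is integrable against
  \<open>dt / (1 + t\<^sup>2)\<close>. The regular channels of the imaginary part are multiplied by
  \<open>t\<close>, so their count grows with \<open>t\<close>; it integrates to the trace of an
  arctangent, and this takes a trace bound. The trace of the singular channel may blow up at the
  threshold and must appear in no error term.

  Most operators in the statement are definite descriptions (adjoint, square root, tensor product,
  functional calculus, boundary value) or rest on a chosen basis. Each has to be shown to exist and
  to be unique before it can be evaluated; uniqueness mostly comes from a total set of vectors.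
  Hilbert--Schmidt and trace bounds are tested on all finite orthonormal families, which frees them
  from the chosen basis and yields explicit constants whose uniformity in the energy can be read
  off.\<close>

instance chilbert_space \<subseteq> banach ..

global_interpretation cspace: vector_space "(*\<^sub>C) :: complex \<Rightarrow> 'a::complex_inner \<Rightarrow> 'a"
  by (rule vector_space_scaleC)

global_interpretation cspace_pair:
  vector_space_pair "(*\<^sub>C) :: complex \<Rightarrow> 'a::complex_inner \<Rightarrow> 'a" "(*\<^sub>C) :: complex \<Rightarrow> 'b::complex_inner \<Rightarrow> 'b" ..

lemma cinner_zero_right [simp]: "cinner x 0 = 0"
  using cinner_scaleC_right[of x 0 0] by simp

lemma cinner_zero_left [simp]: "cinner 0 x = 0"
  using cinner_scaleC_left[of 0 0 x] by simp

lemma cinner_minus_right: "cinner x (- y) = - cinner x y"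
  using cinner_add_right[of x y "-y"] by (simp add: eq_neg_iff_add_eq_0 add.commute)

lemma cinner_minus_left: "cinner (- x) y = - cinner x y"
  using cinner_add_left[of x "-x" y] by (simp add: eq_neg_iff_add_eq_0 add.commute)

lemma cinner_diff_right: "cinner x (y - z) = cinner x y - cinner x z"
  using cinner_add_right[of x y "-z"] by (simp add: cinner_minus_right)

lemma cinner_diff_left: "cinner (x - y) z = cinner x z - cinner y z"
  using cinner_add_left[of x "-y" z] by (simp add: cinner_minus_left)

lemma cinner_scaleR_right: "cinner x (r *\<^sub>R y) = of_real r * cinner x y"
  by (simp add: scaleR_scaleC cinner_scaleC_right)

lemma cinner_scaleR_left: "cinner (r *\<^sub>R x) y = of_real r * cinner x y"
  by (simp add: scaleR_scaleC cinner_scaleC_left)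

lemma cinner_sum_right: "cinner x (sum f A) = (\<Sum>i\<in>A. cinner x (f i))"
  by (induction A rule: infinite_finite_induct) (auto simp: cinner_add_right)

lemma cinner_sum_left: "cinner (sum f A) x = (\<Sum>i\<in>A. cinner (f i) x)"
  by (induction A rule: infinite_finite_induct) (auto simp: cinner_add_left)

lemmas cinner_simps = cinner_add_left cinner_add_right cinner_diff_left cinner_diff_right
  cinner_minus_left cinner_minus_right cinner_scaleC_left cinner_scaleC_right
  cinner_scaleR_left cinner_scaleR_right cinner_sum_left cinner_sum_right

lemma cinner_swap_eq_0: "cinner x y = 0 \<longleftrightarrow> cinner y x = 0"
  by (metis cinner_commute complex_cnj_zero)

lemma norm_cinner_commute: "norm (cinner x y) = norm (cinner y x)"
  by (metis cinner_commute complex_mod_cnj)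

lemma Re_cinner_self: "Re (cinner x x) = (norm x)\<^sup>2"
  by (simp add: cinner_self)

lemma Re_cinner_commute: "Re (cinner x y) = Re (cinner y x)"
  by (metis cinner_commute cnj.sel(1))

lemma cinner_eq_zero_iff: "(\<forall>y. cinner y x = 0) \<longleftrightarrow> x = 0"
  by (metis cinner_self cinner_zero_right norm_eq_zero of_real_eq_0_iff power2_eq_square mult_eq_0_iff)

lemma cinner_extensionality: "(\<And>y. cinner y x = cinner y z) \<Longrightarrow> x = z"
  using cinner_eq_zero_iff[of "x - z"] by (simp add: cinner_diff_right)

lemma norm_add_squared: "(norm (x + y :: 'a::complex_inner))\<^sup>2 = (norm x)\<^sup>2 + (norm y)\<^sup>2 + 2 * Re (cinner x y)"
  using Re_cinner_commute[of y x] by (simp add: Re_cinner_self[symmetric] cinner_simps)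

lemma norm_diff_squared: "(norm (x - y :: 'a::complex_inner))\<^sup>2 = (norm x)\<^sup>2 + (norm y)\<^sup>2 - 2 * Re (cinner x y)"
  using Re_cinner_commute[of y x] by (simp add: Re_cinner_self[symmetric] cinner_simps)

lemma pythagoras: "cinner x y = 0 \<Longrightarrow> (norm (x + y))\<^sup>2 = (norm x)\<^sup>2 + (norm y)\<^sup>2"
  by (simp add: norm_add_squared)

lemma norm_sum_le_two: "(norm (x + y :: 'a::real_normed_vector))\<^sup>2 \<le> 2 * (norm x)\<^sup>2 + 2 * (norm y)\<^sup>2"
proof -
  have "(norm (x + y))\<^sup>2 \<le> (norm x + norm y)\<^sup>2"
    by (intro power_mono norm_triangle_ineq) auto
  also have "\<dots> \<le> 2 * (norm x)\<^sup>2 + 2 * (norm y)\<^sup>2"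
    using zero_le_power2[of "norm x - norm y"] by (simp add: power2_eq_square algebra_simps)
  finally show ?thesis .
qed

section \<open>Bounded complex linear operators\<close>

lemma bclI:
  assumes "\<And>x y. T (x + y) = T x + T y" "\<And>c x. T (c *\<^sub>C x) = c *\<^sub>C T x"
    and "\<And>x. norm (T x) \<le> C * norm x"
  shows "bounded_clinear T"
proof -
  have "T (r *\<^sub>R x) = r *\<^sub>R T x" for r x
    by (simp add: scaleR_scaleC assms(2))
  then have "bounded_linear T"
    using assms by (intro bounded_linear_intro[where K = C]) (auto simp: mult.commute)
  then show ?thesis using assms(2) by (simp add: bounded_clinear_def)
qed

lemma bcl_bounded_linear: "bounded_clinear T \<Longrightarrow> bounded_linear T"
  by (simp add: bounded_clinear_def)

lemma bcl_add: "bounded_clinear T \<Longrightarrow> T (x + y) = T x + T y"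
  by (simp add: bounded_clinear_def linear_simps)

lemma bcl_diff: "bounded_clinear T \<Longrightarrow> T (x - y) = T x - T y"
  by (simp add: bounded_clinear_def linear_simps)

lemma bcl_minus: "bounded_clinear T \<Longrightarrow> T (- x) = - T x"
  by (simp add: bounded_clinear_def linear_simps)

lemma bcl_zero: "bounded_clinear T \<Longrightarrow> T 0 = 0"
  by (simp add: bounded_clinear_def linear_simps)

lemma bcl_scaleC: "bounded_clinear T \<Longrightarrow> T (c *\<^sub>C x) = c *\<^sub>C T x"
  by (simp add: bounded_clinear_def)

lemma bcl_scaleR: "bounded_clinear T \<Longrightarrow> T (c *\<^sub>R x) = c *\<^sub>R T x"
  by (simp add: bounded_clinear_def scaleR_scaleC)

lemma bcl_sum: "bounded_clinear T \<Longrightarrow> T (sum f A) = (\<Sum>i\<in>A. T (f i))"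
  using linear_sum bounded_linear.linear bounded_clinear_def by blast

lemmas bcl_simps = bcl_add bcl_diff bcl_minus bcl_zero bcl_scaleC bcl_scaleR bcl_sum

lemma bcl_linear: "bounded_clinear T \<Longrightarrow> Vector_Spaces.linear (*\<^sub>C) (*\<^sub>C) T"
  by (unfold_locales) (auto simp: bcl_simps)

lemma bcl_onorm: "bounded_clinear T \<Longrightarrow> norm (T x) \<le> onorm T * norm x"
  by (simp add: bounded_clinear_def onorm)

lemma bcl_onorm_nonneg: "bounded_clinear T \<Longrightarrow> 0 \<le> onorm T"
  by (simp add: bounded_clinear_def onorm_pos_le)

lemma bcl_tendsto: "bounded_clinear T \<Longrightarrow> (f \<longlongrightarrow> l) F \<Longrightarrow> ((\<lambda>x. T (f x)) \<longlongrightarrow> T l) F"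
  using bcl_bounded_linear bounded_linear.tendsto by blast

lemma bcl_continuous_on: "bounded_clinear T \<Longrightarrow> continuous_on S T"
  using bcl_bounded_linear linear_continuous_on by blast

lemma bcl_id: "bounded_clinear (\<lambda>x. x)"
  by (rule bclI[where C = 1]) auto

lemma bcl_zero_op: "bounded_clinear (\<lambda>x. 0)"
  by (rule bclI[where C = 1]) auto

lemma bcl_compose: "bounded_clinear S \<Longrightarrow> bounded_clinear T \<Longrightarrow> bounded_clinear (\<lambda>x. S (T x))"
  unfolding bounded_clinear_def using bounded_linear_compose by auto

lemma bcl_plus: "bounded_clinear S \<Longrightarrow> bounded_clinear T \<Longrightarrow> bounded_clinear (\<lambda>x. S x + T x)"
  unfolding bounded_clinear_def using bounded_linear_add by (auto simp: scaleC_add_right)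

lemma bcl_const_scaleC:
  assumes "bounded_clinear T" shows "bounded_clinear (\<lambda>x. c *\<^sub>C T x)"
proof (rule bclI[where C = "norm c * onorm T"])
  show "norm (c *\<^sub>C T x) \<le> norm c * onorm T * norm x" for x
    using bcl_onorm[OF assms, of x] by (simp add: norm_scaleC mult.assoc mult_left_mono)
qed (use assms in \<open>auto simp: bcl_simps scaleC_add_right mult.commute\<close>)

lemma bcl_const_scaleR: "bounded_clinear T \<Longrightarrow> bounded_clinear (\<lambda>x. c *\<^sub>R T x)"
  unfolding scaleR_scaleC by (rule bcl_const_scaleC)

lemma bcl_uminus: "bounded_clinear T \<Longrightarrow> bounded_clinear (\<lambda>x. - T x)"
  using bcl_const_scaleR[of T "-1"] by simp

lemma bcl_minus_op: "bounded_clinear S \<Longrightarrow> bounded_clinear T \<Longrightarrow> bounded_clinear (\<lambda>x. S x - T x)"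
  using bcl_plus[OF _ bcl_uminus] by fastforce

lemma bcl_sum_op: "(\<And>i. i \<in> A \<Longrightarrow> bounded_clinear (T i)) \<Longrightarrow> bounded_clinear (\<lambda>x. \<Sum>i\<in>A. T i x)"
  by (induction A rule: infinite_finite_induct) (auto intro: bcl_plus bcl_zero_op)

lemma Re_cinner_le: "Re (cinner x y) \<le> norm x * norm y"
  using norm_cinner_le[of x y] complex_Re_le_cmod[of "cinner x y"] by linarith

lemma bcl_cinner: "bounded_clinear (cinner x)"
proof (rule bclI[where C = "norm x"])
qed (auto simp: cinner_simps norm_cinner_le scaleC_complex_def)

lemma bcl_scaleC_left: "bounded_clinear (\<lambda>c. c *\<^sub>C x)"
proof (rule bclI[where C = "norm x"])
qed (auto simp: scaleC_add_left norm_scaleC scaleC_complex_def mult.commute)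

lemmas bcl_intros = bcl_id bcl_zero_op bcl_plus bcl_const_scaleC bcl_const_scaleR
  bcl_uminus bcl_minus_op bcl_sum_op bcl_cinner bcl_scaleC_left

text \<open>Uniqueness for the objects given by definite descriptions: two bounded operators agree
  on a closed subspace, so agreement on a total set is agreement everywhere.\<close>

lemma bcl_eq_on_span:
  assumes T: "bounded_clinear T" "bounded_clinear T'" and eq: "\<And>e. e \<in> E \<Longrightarrow> T e = T' e"
    and x: "x \<in> closure (cspace.span E)"
  shows "T x = T' x"
proof -
  have "cspace.span E \<subseteq> {x. T x - T' x = 0}"
    by (rule cspace.span_minimal) (auto simp: eq intro!: cspace.subspaceI simp: T bcl_simps)
  moreover have "closed {x. T x - T' x = 0}"
    by (intro closed_Collect_eq continuous_intros bcl_continuous_on T)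
  ultimately have "closure (cspace.span E) \<subseteq> {x. T x - T' x = 0}"
    by (rule closure_minimal)
  then show ?thesis using x by auto
qed

lemma subspace_orthogonal: "cspace.subspace {x. cinner x y = 0}"
  by (auto intro!: cspace.subspaceI simp: cinner_simps)

lemma orthogonal_span: "x \<in> cspace.span S \<Longrightarrow> (\<And>s. s \<in> S \<Longrightarrow> cinner s y = 0) \<Longrightarrow> cinner x y = 0"
  using cspace.span_minimal[OF _ subspace_orthogonal, of S y] by auto

section \<open>Orthogonal projection, Riesz representation and adjoints\<close>

text \<open>A sequence minimizing the distance from \<open>x\<close> is Cauchy by the parallelogram
  identity, because midpoints stay in \<open>M\<close>. Its limit is a minimizer, and a first
  variation gives orthogonality.\<close>

lemma projection_exists:
  fixes M :: "'a::chilbert_space set"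
  assumes M: "cspace.subspace M" "closed M"
  shows "\<exists>y\<in>M. \<forall>w\<in>M. cinner w (x - y) = 0"
proof -
  define D where "D = (\<lambda>y. (norm (x - y))\<^sup>2) ` M"
  define d where "d = Inf D"
  have M0: "0 \<in> M" using M(1) cspace.subspace_0 by blast
  have bdd: "bdd_below D" by (auto simp: D_def intro!: bdd_belowI[of _ 0])
  have dle: "d \<le> (norm (x - y))\<^sup>2" if "y \<in> M" for y
    unfolding d_def using bdd that by (intro cInf_lower) (auto simp: D_def)
  have "\<exists>y\<in>M. (norm (x - y))\<^sup>2 < d + 1 / real (Suc n)" for n
    using cInf_lessD[of D "d + 1 / real (Suc n)"] M0 by (auto simp: D_def d_def)
  then obtain y where y: "\<And>n. y n \<in> M" "\<And>n. (norm (x - y n))\<^sup>2 < d + 1 / real (Suc n)"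
    by metis
  have dist: "(norm (y n - y m))\<^sup>2 \<le> 2 / real (Suc n) + 2 / real (Suc m)" for n m
  proof -
    have "(1/2) *\<^sub>C (y n + y m) \<in> M"
      using y(1) M(1) by (intro cspace.subspace_scale cspace.subspace_add)
    from dle[OF this] have *: "d \<le> (norm (x - (1/2) *\<^sub>C (y n + y m)))\<^sup>2" .
    have "x - (1/2) *\<^sub>C (y n + y m) = (1/2) *\<^sub>C ((x - y n) + (x - y m))"
      using scaleC_add_left[of "1/2" "1/2" x] by (simp add: cspace.scale_right_diff_distrib scaleC_add_right)
    then have "d \<le> (norm ((x - y n) + (x - y m)))\<^sup>2 / 4"
      using * by (simp add: norm_scaleC norm_divide power_divide)
    moreover have "(norm ((x - y n) - (x - y m)))\<^sup>2 + (norm ((x - y n) + (x - y m)))\<^sup>2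
        = 2 * (norm (x - y n))\<^sup>2 + 2 * (norm (x - y m))\<^sup>2"
      by (simp only: norm_diff_squared[of "x - y n" "x - y m"] norm_add_squared[of "x - y n" "x - y m"])
    moreover have "norm ((x - y n) - (x - y m)) = norm (y n - y m)"
      by (simp add: norm_minus_commute)
    ultimately show ?thesis using y(2)[of n] y(2)[of m] by simp
  qed
  have "Cauchy y"
  proof (rule metric_CauchyI)
    fix e :: real assume e: "e > 0"
    obtain N where N: "4 / real (Suc N) < e\<^sup>2"
      using reals_Archimedean[of "e\<^sup>2 / 4"] e by (auto simp: field_simps)
    have "dist (y n) (y m) < e" if "n \<ge> N" "m \<ge> N" for n m
    proof -
      have "2 / real (Suc n) \<le> 2 / real (Suc N)" "2 / real (Suc m) \<le> 2 / real (Suc N)"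
        using that by (auto intro!: divide_left_mono)
      then have "(norm (y n - y m))\<^sup>2 < e\<^sup>2" using dist[of n m] N by simp
      then show ?thesis using e by (simp add: dist_norm power2_less_imp_less)
    qed
    then show "\<exists>N. \<forall>m\<ge>N. \<forall>n\<ge>N. dist (y m) (y n) < e" by blast
  qed
  then obtain z where z: "y \<longlonglongrightarrow> z" using Cauchy_convergent_iff convergent_def by blast
  have zM: "z \<in> M" using M(2) y(1) z closed_sequentially by blast
  have "(\<lambda>n. (norm (x - y n))\<^sup>2) \<longlonglongrightarrow> (norm (x - z))\<^sup>2" by (intro tendsto_intros z)
  moreover have "(\<lambda>n. d + 1 / real (Suc n)) \<longlonglongrightarrow> d + 0"
    by (intro tendsto_intros LIMSEQ_Suc lim_1_over_n)
  ultimately have zd: "(norm (x - z))\<^sup>2 \<le> d"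
    using y(2) by (intro LIMSEQ_le[of _ _ _ "d"]) (auto intro: less_imp_le)
  have "cinner w (x - z) = 0" if w: "w \<in> M" for w
  proof (cases "w = 0")
    case False
    \<comment> \<open>Removing from \<open>x - z\<close> its component along \<open>w\<close> would
      lower the squared distance by
      \<open>(norm (cinner w (x - z)))\<^sup>2 / (norm w)\<^sup>2\<close>, which is impossible at a
      minimizer.\<close>
    define c where "c = cinner w (x - z) / of_real ((norm w)\<^sup>2)"
    have cw: "c * cnj (cinner w (x - z)) = of_real ((norm (cinner w (x - z)))\<^sup>2 / (norm w)\<^sup>2)"
      by (simp add: c_def complex_norm_square[symmetric] del: of_real_power)
    have "z + c *\<^sub>C w \<in> M"
      using zM w M(1) by (intro cspace.subspace_add cspace.subspace_scale)
    from dle[OF this] have "d \<le> (norm ((x - z) - c *\<^sub>C w))\<^sup>2" by (simp add: algebra_simps)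
    also have "\<dots> = (norm (x - z))\<^sup>2 + (norm c)\<^sup>2 * (norm w)\<^sup>2 - 2 * Re (c * cinner (x - z) w)"
      by (simp add: norm_diff_squared[of "x - z" "c *\<^sub>C w"] norm_scaleC power_mult_distrib cinner_simps)
    also have "c * cinner (x - z) w = of_real ((norm (cinner w (x - z)))\<^sup>2 / (norm w)\<^sup>2)"
      using cw cinner_commute[of "x - z" w] by simp
    also have "(norm c)\<^sup>2 * (norm w)\<^sup>2 = (norm (cinner w (x - z)))\<^sup>2 / (norm w)\<^sup>2"
      using False by (simp add: c_def norm_divide norm_power power_divide) (simp add: power2_eq_square power4_eq_xxxx)
    finally have "(norm (cinner w (x - z)))\<^sup>2 / (norm w)\<^sup>2 \<le> 0" using zd by simp
    then show ?thesis using False by (simp add: divide_le_0_iff)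
  qed simp
  then show ?thesis using zM by blast
qed

text \<open>The kernel of a nonzero functional has a nonzero orthogonal vector \<open>e\<close>, and
  every vector lies in the kernel up to a multiple of \<open>e\<close>.\<close>

lemma riesz_representation:
  fixes f :: "'a::chilbert_space \<Rightarrow> complex"
  assumes f: "bounded_clinear f"
  shows "\<exists>y. \<forall>x. f x = cinner y x"
proof (cases "\<forall>x. f x = 0")
  case False
  then obtain a where a: "f a \<noteq> 0" by blast
  define M where "M = {x. f x = 0}"
  have "cspace.subspace M"
    unfolding M_def by (auto intro!: cspace.subspaceI simp: f bcl_simps)
  moreover have "closed M"
    unfolding M_def by (intro closed_Collect_eq bcl_continuous_on[OF f] continuous_on_const)
  ultimately obtain b where b: "b \<in> M" "\<And>w. w \<in> M \<Longrightarrow> cinner w (a - b) = 0"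
    using projection_exists by meson
  define e where "e = a - b"
  have fe: "f e = f a" using b(1) by (simp add: e_def M_def bcl_simps f)
  then have "e \<noteq> 0" using a bcl_zero[OF f] by auto
  have "f x = cinner (cnj (f e / of_real ((norm e)\<^sup>2)) *\<^sub>C e) x" for x
  proof -
    have "x - (f x / f e) *\<^sub>C e \<in> M" using a fe by (simp add: M_def bcl_simps f scaleC_complex_def)
    then have "cinner (x - (f x / f e) *\<^sub>C e) e = 0" using b(2) by (simp add: e_def)
    then have "cinner e x = f x / f e * of_real ((norm e)\<^sup>2)"
      using cinner_swap_eq_0[of "x - (f x / f e) *\<^sub>C e" e]
      by (simp add: cinner_diff_right cinner_scaleC_right cinner_self)
    then show ?thesis using a fe \<open>e \<noteq> 0\<close> by (simp add: cinner_scaleC_left)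
  qed
  then show ?thesis by blast
next
  case True
  then show ?thesis by (intro exI[of _ 0]) simp
qed

section \<open>Adjoints of bounded operators\<close>

lemma cadjoint_eqI:
  assumes "\<And>x y. cinner (S y) x = cinner y (T x)"
  shows "cadjoint T = S"
  unfolding cadjoint_def
proof (rule the_equality)
  fix R assume "\<forall>x y. cinner (R y) x = cinner y (T x)"
  then have "cinner x (R y) = cinner x (S y)" for x y
    using assms by (metis cinner_commute)
  then show "R = S" using cinner_extensionality by blast
qed (use assms in blast)

lemma cadjoint_exists:
  fixes T :: "'a::chilbert_space \<Rightarrow> 'b::complex_inner"
  assumes "bounded_clinear T"
  shows "\<exists>S. \<forall>x y. cinner (S y) x = cinner y (T x)"
proof -
  have "\<exists>s. \<forall>x. cinner y (T x) = cinner s x" for y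
    by (rule riesz_representation) (intro bcl_compose[OF bcl_cinner] assms)
  then obtain S where "\<And>y x. cinner y (T x) = cinner (S y) x" by metis
  then show ?thesis by (intro exI[of _ S]) simp
qed

lemma cadjoint_left:
  fixes T :: "'a::chilbert_space \<Rightarrow> 'b::complex_inner"
  assumes "bounded_clinear T"
  shows "cinner (cadjoint T y) x = cinner y (T x)"
  using cadjoint_exists[OF assms] cadjoint_eqI by metis

lemma cadjoint_right:
  fixes T :: "'a::chilbert_space \<Rightarrow> 'b::complex_inner"
  assumes "bounded_clinear T"
  shows "cinner x (cadjoint T y) = cinner (T x) y"
  by (metis assms cadjoint_left cinner_commute)

lemma bcl_cadjoint:
  fixes T :: "'a::chilbert_space \<Rightarrow> 'b::complex_inner"
  assumes T: "bounded_clinear T"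
  shows "bounded_clinear (cadjoint T)"
proof (rule bclI[where C = "onorm T"])
  show "cadjoint T (x + y) = cadjoint T x + cadjoint T y" for x y
    by (rule cinner_extensionality) (simp add: cadjoint_right T cinner_simps)
  show "cadjoint T (c *\<^sub>C x) = c *\<^sub>C cadjoint T x" for c x
    by (rule cinner_extensionality) (simp add: cadjoint_right T cinner_simps)
  fix y
  have "(norm (cadjoint T y))\<^sup>2 = Re (cinner (T (cadjoint T y)) y)"
    using cadjoint_right[OF T, of "cadjoint T y" y] by (metis Re_cinner_self)
  also have "\<dots> \<le> norm (T (cadjoint T y)) * norm y"
    by (rule Re_cinner_le)
  also have "\<dots> \<le> onorm T * norm (cadjoint T y) * norm y"
    by (intro mult_right_mono bcl_onorm T) auto
  finally have "norm (cadjoint T y) * norm (cadjoint T y) \<le> norm (cadjoint T y) * (onorm T * norm y)"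
    by (simp add: power2_eq_square algebra_simps)
  then show "norm (cadjoint T y) \<le> onorm T * norm y"
    by (metis mult_left_le_imp_le mult_nonneg_nonneg norm_ge_zero order_le_less bcl_onorm_nonneg T)
qed

lemma cadjoint_compose:
  fixes S :: "'b::chilbert_space \<Rightarrow> 'c::complex_inner" and T :: "'a::chilbert_space \<Rightarrow> 'b"
  assumes "bounded_clinear S" "bounded_clinear T"
  shows "cadjoint (\<lambda>x. S (T x)) = (\<lambda>y. cadjoint T (cadjoint S y))"
  by (rule cadjoint_eqI) (simp add: cadjoint_left assms)

section \<open>Orthonormal sets\<close>

definition orthonormal :: "'a::complex_inner set \<Rightarrow> bool"
  where "orthonormal E \<longleftrightarrow> (\<forall>x\<in>E. \<forall>y\<in>E. cinner x y = (if x = y then 1 else 0))"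

lemma orthonormal_subset: "orthonormal E \<Longrightarrow> F \<subseteq> E \<Longrightarrow> orthonormal F"
  unfolding orthonormal_def by blast

lemma orthonormal_norm:
  assumes "orthonormal E" "e \<in> E" shows "norm e = 1"
proof -
  have "of_real ((norm e)\<^sup>2) = (of_real 1 :: complex)"
    using assms cinner_self[of e] by (auto simp: orthonormal_def)
  then have "(norm e)\<^sup>2 = 1" using of_real_eq_iff by blast
  then show ?thesis by (simp add: power2_eq_1_iff) (metis norm_ge_zero not_one_le_zero neg_0_le_iff_le)
qed

lemma orthonormal_insert:
  assumes "orthonormal E" "norm x = 1" "\<And>e. e \<in> E \<Longrightarrow> cinner e x = 0"
  shows "orthonormal (insert x E)"
  using assms cinner_swap_eq_0[of x] cinner_self[of x] by (auto simp: orthonormal_def)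

lemma orthonormal_cinner_sum:
  assumes "orthonormal E" "finite F" "F \<subseteq> E" "e \<in> E"
  shows "cinner e (\<Sum>f\<in>F. c f *\<^sub>C f) = (if e \<in> F then c e else 0)"
proof -
  have "cinner e (\<Sum>f\<in>F. c f *\<^sub>C f) = (\<Sum>f\<in>F. if f = e then c f else 0)"
    unfolding cinner_sum_right cinner_scaleC_right
    using assms by (intro sum.cong) (auto simp: orthonormal_def)
  then show ?thesis using assms(2) by simp
qed

lemma orthonormal_sum_norm:
  assumes "orthonormal F" "finite F"
  shows "(norm (\<Sum>f\<in>F. c f *\<^sub>C f))\<^sup>2 = (\<Sum>f\<in>F. (norm (c f))\<^sup>2)"
proof -
  have "cinner (\<Sum>f\<in>F. c f *\<^sub>C f) (\<Sum>f\<in>F. c f *\<^sub>C f) = (\<Sum>e\<in>F. cnj (c e) * c e)"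
    unfolding cinner_sum_left[of _ F] cinner_scaleC_left
    using assms orthonormal_cinner_sum[of F F] by (intro sum.cong) auto
  also have "\<dots> = of_real (\<Sum>f\<in>F. (norm (c f))\<^sup>2)"
    by (simp only: complex_norm_square of_real_sum) (simp add: mult.commute)
  finally show ?thesis unfolding cinner_self using of_real_eq_iff by blast
qed

text \<open>For finite orthonormal \<open>F\<close> this is the orthogonal projection onto the span.
  For any finite \<open>F\<close> it is still a linear map into the span that vanishes exactly on
  the orthogonal complement of \<open>F\<close>.\<close>

definition proj_on :: "'a::complex_inner set \<Rightarrow> 'a \<Rightarrow> 'a"
  where "proj_on F x = (\<Sum>f\<in>F. cinner f x *\<^sub>C f)"

lemma proj_on_orthogonal:
  assumes "orthonormal F" "finite F" "e \<in> F"
  shows "cinner e (x - proj_on F x) = 0"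
  using orthonormal_cinner_sum[of F F e] assms by (simp add: cinner_diff_right proj_on_def)

lemma proj_on_span: "proj_on F x \<in> cspace.span F"
  unfolding proj_on_def by (intro cspace.span_sum cspace.span_scale cspace.span_base)

lemma proj_on_norm: "orthonormal F \<Longrightarrow> finite F \<Longrightarrow> (norm (proj_on F x))\<^sup>2 = (\<Sum>f\<in>F. (norm (cinner f x))\<^sup>2)"
  by (simp add: orthonormal_sum_norm proj_on_def)

text \<open>Best approximation from the span. The choice \<open>y = 0\<close> gives Bessel's
  inequality, \<open>y = x\<close> the identity on the span.\<close>

lemma proj_on_pythagoras:
  assumes "orthonormal F" "finite F" "y \<in> cspace.span F"
  shows "(norm (x - y))\<^sup>2 = (norm (x - proj_on F x))\<^sup>2 + (norm (proj_on F x - y))\<^sup>2"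
proof -
  have "cinner (proj_on F x - y) (x - proj_on F x) = 0"
    by (rule orthogonal_span[of _ F]) (auto intro!: cspace.span_diff proj_on_span assms proj_on_orthogonal)
  then have "cinner (x - proj_on F x) (proj_on F x - y) = 0" using cinner_swap_eq_0 by blast
  from pythagoras[OF this] show ?thesis by simp
qed

lemma proj_on_span_eq: "orthonormal F \<Longrightarrow> finite F \<Longrightarrow> x \<in> cspace.span F \<Longrightarrow> proj_on F x = x"
  using proj_on_pythagoras[of F x x] by simp

lemma bessel:
  assumes "orthonormal F" "finite F"
  shows "(\<Sum>f\<in>F. (norm (cinner f x))\<^sup>2) \<le> (norm x)\<^sup>2"
  using proj_on_pythagoras[OF assms cspace.span_zero, of x] proj_on_norm[OF assms, of x] by simp

lemma orthonormal_independent: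
  assumes "orthonormal E" shows "cspace.independent E"
  unfolding cspace.independent_explicit_module
proof (intro allI impI)
  fix t u v assume t: "finite t" "t \<subseteq> E" "(\<Sum>v\<in>t. u v *\<^sub>C v) = 0" "v \<in> t"
  then show "u v = 0"
    using orthonormal_cinner_sum[OF assms t(1,2), of v u] by auto
qed

text \<open>Gram--Schmidt: a new vector contributes its normalized residual, or nothing if it
  already lies in the span.\<close>

lemma finite_orthonormal_basis:
  assumes "finite S"
  shows "\<exists>F. finite F \<and> orthonormal F \<and> S \<subseteq> cspace.span F \<and> F \<subseteq> cspace.span S"
  using assms
proof (induction S rule: finite_induct)
  case (insert x S)
  then obtain F where F: "finite F" "orthonormal F" "S \<subseteq> cspace.span F" "F \<subseteq> cspace.span S" by blast
  define y where "y = x - proj_on F x"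
  have FS: "cspace.span F \<subseteq> cspace.span (insert x S)"
    using F(4) by (metis cspace.span_mono cspace.span_span subset_insertI order_trans)
  have ys: "y \<in> cspace.span (insert x S)"
    unfolding y_def by (rule cspace.span_diff[OF cspace.span_base]) (use proj_on_span[of F x] FS in auto)
  show ?case
  proof (cases "y = 0")
    case True
    then have "x \<in> cspace.span F" using proj_on_span[of F x] by (simp add: y_def)
    moreover have "F \<subseteq> cspace.span (insert x S)" using FS cspace.span_superset by blast
    ultimately show ?thesis using F(1-3) by (intro exI[of _ F]) simp
  next
    case False
    define u where "u = (1 / of_real (norm y)) *\<^sub>C y"
    have "norm u = 1" using False by (simp add: u_def norm_scaleC norm_divide)
    moreover have "cinner e u = 0" if "e \<in> F" for e
      using proj_on_orthogonal[OF F(2,1) that, of x] by (simp add: u_def cinner_scaleC_right y_def)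
    ultimately have on: "orthonormal (insert u F)" by (rule orthonormal_insert[OF F(2)])
    have "x = of_real (norm y) *\<^sub>C u + proj_on F x" using False by (simp add: u_def y_def)
    then have "x \<in> cspace.span (insert u F)"
      using proj_on_span[of F x] cspace.span_mono[of F "insert u F"]
      by (metis cspace.span_add cspace.span_base cspace.span_scale insertI1 subsetD subset_insertI)
    moreover have "S \<subseteq> cspace.span (insert u F)"
      using F(3) cspace.span_mono[of F "insert u F"] by blast
    moreover have "u \<in> cspace.span (insert x S)" unfolding u_def by (rule cspace.span_scale[OF ys])
    ultimately show ?thesis using F on FS cspace.span_superset[of F]
      by (intro exI[of _ "insert u F"]) auto
  qed
qed (auto intro!: exI[of _ "{}"] simp: orthonormal_def)

text \<open>Zorn's lemma. The ambient set \<open>S\<close> is a parameter: with all vectors it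
  yields an orthonormal basis, with the eigenvectors of an operator the spectral theorem.\<close>

lemma maximal_orthonormal:
  "\<exists>E\<subseteq>S. orthonormal E \<and> (\<forall>F. orthonormal F \<longrightarrow> E \<subseteq> F \<longrightarrow> F \<subseteq> S \<longrightarrow> F = E)"
proof -
  have "\<exists>M\<in>{E. E \<subseteq> S \<and> orthonormal E}. \<forall>X\<in>{E. E \<subseteq> S \<and> orthonormal E}. M \<subseteq> X \<longrightarrow> X = M"
  proof (rule subset_Zorn')
    fix C assume C: "subset.chain {E. E \<subseteq> S \<and> orthonormal E} C"
    have "cinner x y = (if x = y then 1 else 0)" if "X \<in> C" "Y \<in> C" "x \<in> X" "y \<in> Y" for x y X Y
    proof -
      have "X \<subseteq> Y \<or> Y \<subseteq> X" "orthonormal X" "orthonormal Y"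
        using C that(1,2) unfolding subset_chain_def by auto
      then show ?thesis using that(3,4) unfolding orthonormal_def by blast
    qed
    then have "orthonormal (\<Union>C)" unfolding orthonormal_def by blast
    then show "\<Union>C \<in> {E. E \<subseteq> S \<and> orthonormal E}" using C unfolding subset_chain_def by auto
  qed
  then obtain M where M: "M \<subseteq> S" "orthonormal M" "\<And>X. X \<subseteq> S \<and> orthonormal X \<Longrightarrow> M \<subseteq> X \<Longrightarrow> X = M" by auto
  show ?thesis by (intro exI[of _ M] conjI allI impI M) auto
qed

section \<open>Orthonormal bases and Parseval's identity\<close>

lemma is_onb_iff: "is_onb E \<longleftrightarrow> orthonormal E \<and> closure (cspace.span E) = UNIV"
  by (simp add: is_onb_def orthonormal_def)

lemma subspace_closure:
  assumes "cspace.subspace M" shows "cspace.subspace (closure M)"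
proof (rule cspace.subspaceI)
  show "0 \<in> closure M" using assms cspace.subspace_0 closure_subset by blast
  fix x y assume "x \<in> closure M" "y \<in> closure M"
  then obtain f g where fg: "\<And>n::nat. f n \<in> M" "f \<longlonglongrightarrow> x" "\<And>n::nat. g n \<in> M" "g \<longlonglongrightarrow> y"
    unfolding closure_sequential by blast
  then have "(\<lambda>n. f n + g n) \<longlonglongrightarrow> x + y" "\<And>n. f n + g n \<in> M"
    using assms by (auto intro: tendsto_add cspace.subspace_add)
  then show "x + y \<in> closure M" unfolding closure_sequential by (intro exI[of _ "\<lambda>n. f n + g n"]) auto
next
  fix c x assume "x \<in> closure M"
  then obtain f where fg: "\<And>n::nat. f n \<in> M" "f \<longlonglongrightarrow> x"
    unfolding closure_sequential by blast
  then have "(\<lambda>n. c *\<^sub>C f n) \<longlonglongrightarrow> c *\<^sub>C x" "\<And>n. c *\<^sub>C f n \<in> M"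
    using assms bcl_tendsto[OF bcl_const_scaleC[OF bcl_id, of c]] by (auto intro: cspace.subspace_scale)
  then show "c *\<^sub>C x \<in> closure M" unfolding closure_sequential by (intro exI[of _ "\<lambda>n. c *\<^sub>C f n"]) auto
qed

text \<open>The projection onto the closed span leaves a remainder orthogonal to \<open>E\<close>,
  which totality makes zero.\<close>

lemma is_onbI:
  fixes E :: "'a::chilbert_space set"
  assumes "orthonormal E" and total: "\<And>x. (\<And>e. e \<in> E \<Longrightarrow> cinner e x = 0) \<Longrightarrow> x = 0"
  shows "is_onb E"
proof -
  have "x \<in> closure (cspace.span E)" for x
  proof -
    obtain y where y: "y \<in> closure (cspace.span E)" "\<And>w. w \<in> closure (cspace.span E) \<Longrightarrow> cinner w (x - y) = 0"
      using projection_exists[of "closure (cspace.span E)" x] subspace_closure by auto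
    then have "x - y = 0"
      by (intro total) (meson closure_subset cspace.span_base subsetD)
    then show ?thesis using y(1) by simp
  qed
  then show ?thesis using assms(1) by (auto simp: is_onb_iff)
qed

text \<open>Since \<open>some_onb\<close> is a choice, existence has to be shown: a unit vector
  orthogonal to a maximal orthonormal set would enlarge it.\<close>

lemma is_onb_some_onb: "is_onb (some_onb :: 'a::chilbert_space set)"
proof -
  obtain E :: "'a set" where E: "orthonormal E" "\<And>F. orthonormal F \<Longrightarrow> E \<subseteq> F \<Longrightarrow> F = E"
    using maximal_orthonormal[of "UNIV :: 'a set"] by auto
  have "is_onb E"
  proof (rule is_onbI[OF E(1)], rule ccontr)
    fix x assume x: "\<And>e. e \<in> E \<Longrightarrow> cinner e x = 0" "x \<noteq> 0"
    define u where "u = (1 / of_real (norm x)) *\<^sub>C x"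
    have u: "norm u = 1" "\<And>e. e \<in> E \<Longrightarrow> cinner e u = 0"
      using x by (auto simp: u_def norm_scaleC norm_divide cinner_scaleC_right)
    then have "u \<in> E" using E(2)[OF orthonormal_insert[OF E(1)]] by blast
    then show False using u cinner_self[of u] by auto
  qed
  then show ?thesis unfolding some_onb_def by (rule someI)
qed

text \<open>Bessel gives one inequality. For the other, a vector of the span close to
  \<open>x\<close> involves finitely many basis vectors, and the projection onto these approximates
  \<open>x\<close> at least as well.\<close>

lemma parseval:
  assumes "is_onb E"
  shows "((\<lambda>e. (norm (cinner e x))\<^sup>2) has_sum (norm x)\<^sup>2) E"
proof -
  have on: "orthonormal E" and cl: "x \<in> closure (cspace.span E)" using assms by (auto simp: is_onb_iff)
  have le: "(\<Sum>e\<in>F. (norm (cinner e x))\<^sup>2) \<le> (norm x)\<^sup>2" if "finite F" "F \<subseteq> E" for F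
    using bessel[OF orthonormal_subset[OF on that(2)] that(1)] .
  have sum: "(\<lambda>e. (norm (cinner e x))\<^sup>2) summable_on E"
    using le by (intro nonneg_bdd_above_summable_on bdd_aboveI[of _ "(norm x)\<^sup>2"]) auto
  have "(norm x)\<^sup>2 - d \<le> (\<Sum>\<^sub>\<infinity>e\<in>E. (norm (cinner e x))\<^sup>2)" if "d > 0" for d
  proof -
    have "sqrt d > 0" using that by simp
    then obtain y where y: "y \<in> cspace.span E" "dist y x < sqrt d"
      using cl unfolding closure_approachable by blast
    then obtain t where t: "finite t" "t \<subseteq> E" "y \<in> cspace.span t"
      unfolding cspace.span_explicit by (auto intro!: cspace.span_sum cspace.span_scale intro: cspace.span_base)
    have ont: "orthonormal t" using on t orthonormal_subset by blast
    have "(norm (x - y))\<^sup>2 \<le> d"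
      using y(2) that by (metis dist_commute dist_norm less_imp_le norm_ge_zero power_mono real_sqrt_pow2)
    moreover have "(norm (x - y))\<^sup>2 \<ge> (norm (x - proj_on t x))\<^sup>2"
      using proj_on_pythagoras[OF ont t(1,3), of x] by simp
    moreover have "(norm x)\<^sup>2 = (norm (x - proj_on t x))\<^sup>2 + (\<Sum>e\<in>t. (norm (cinner e x))\<^sup>2)"
      using proj_on_pythagoras[OF ont t(1) cspace.span_zero, of x] by (simp add: proj_on_norm[OF ont t(1)])
    moreover have "(\<Sum>e\<in>t. (norm (cinner e x))\<^sup>2) \<le> (\<Sum>\<^sub>\<infinity>e\<in>E. (norm (cinner e x))\<^sup>2)"
      by (rule finite_sum_le_infsum[OF sum t(1,2)]) simp
    ultimately show ?thesis by linarith
  qed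
  then have "(norm x)\<^sup>2 \<le> (\<Sum>\<^sub>\<infinity>e\<in>E. (norm (cinner e x))\<^sup>2)"
    by (metis diff_le_eq field_le_epsilon)
  moreover have "(\<Sum>\<^sub>\<infinity>e\<in>E. (norm (cinner e x))\<^sup>2) \<le> (norm x)\<^sup>2"
    by (rule infsum_le_finite_sums[OF sum le])
  ultimately show ?thesis using sum by (simp add: has_sum_iff)
qed

section \<open>Positive operators and square roots\<close>

lemma positive_op_bcl: "positive_op T \<Longrightarrow> bounded_clinear T"
  by (simp add: positive_op_def)

lemma positive_op_nonneg: "positive_op T \<Longrightarrow> 0 \<le> Re (cinner x (T x))"
  by (auto simp: positive_op_def complex_nonneg_Reals_iff)

lemma selfadjoint_bcl: "selfadjoint T \<Longrightarrow> bounded_clinear T"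
  by (simp add: selfadjoint_def)

lemma selfadjoint_cinner: "selfadjoint T \<Longrightarrow> cinner (T x) y = cinner x (T y)"
  by (simp add: selfadjoint_def)

lemma selfadjoint_cadjoint: "selfadjoint T \<Longrightarrow> cadjoint T = T"
  by (intro cadjoint_eqI) (simp add: selfadjoint_def)

lemma selfadjoint_Im: "selfadjoint T \<Longrightarrow> Im (cinner x (T x)) = 0"
  using cinner_commute[of x "T x"] selfadjoint_cinner[of T x x] by (metis cnj.sel(2) equal_neg_zero)

lemma positive_opI:
  assumes "selfadjoint T" "\<And>x. 0 \<le> Re (cinner x (T x))"
  shows "positive_op T"
  using assms selfadjoint_Im[OF assms(1)] by (simp add: positive_op_def selfadjoint_def complex_nonneg_Reals_iff)

text \<open>Polarization: a real quadratic form determines a Hermitian sesquilinear form.\<close>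

lemma positive_op_selfadjoint:
  assumes "positive_op T" shows "selfadjoint T"
proof -
  have T: "bounded_clinear T" by (rule positive_op_bcl[OF assms])
  have r: "Im (cinner x (T x)) = 0" for x
    using assms by (auto simp: positive_op_def complex_nonneg_Reals_iff)
  have "cinner (T x) y = cinner x (T y)" for x y
  proof -
    define a b where "a = cinner x (T y)" and "b = cinner y (T x)"
    have "Im a + Im b = 0"
      using r[of "x + y"] r[of x] r[of y] by (simp add: cinner_simps bcl_simps[OF T] a_def b_def)
    moreover have "Re a - Re b = 0"
      using r[of "x + \<i> *\<^sub>C y"] r[of x] r[of y] by (simp add: cinner_simps bcl_simps[OF T] a_def b_def)
    ultimately have "a = cnj b" by (simp add: complex_eq_iff)
    then show ?thesis unfolding a_def b_def using cinner_commute[of "T x" y] by simp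
  qed
  then show ?thesis using T by (simp add: selfadjoint_def)
qed

text \<open>The form is only semidefinite, so the classical argument is repeated for it: a quadratic
  polynomial in \<open>t\<close> is nonnegative, and the coefficient \<open>cnj c\<close> of
  \<open>y\<close> makes the mixed term real.\<close>

lemma positive_op_cauchy_schwarz:
  assumes "positive_op T"
  shows "(norm (cinner x (T y)))\<^sup>2 \<le> Re (cinner x (T x)) * Re (cinner y (T y))"
proof -
  note T = positive_op_bcl[OF assms] and sa = positive_op_selfadjoint[OF assms]
  define a b where "a = Re (cinner x (T x))" and "b = Re (cinner y (T y))"
  define c where "c = cinner x (T y)"
  have c': "cinner y (T x) = cnj c"
    unfolding c_def using selfadjoint_cinner[OF sa, of x y] cinner_commute[of y "T x"] by simp
  have q: "0 \<le> a * t\<^sup>2 + (norm c)\<^sup>2 * b - 2 * t * (norm c)\<^sup>2" for t :: real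
  proof -
    have "0 \<le> Re (cinner (of_real t *\<^sub>C x - cnj c *\<^sub>C y) (T (of_real t *\<^sub>C x - cnj c *\<^sub>C y)))"
      by (rule positive_op_nonneg[OF assms])
    also have "\<dots> = a * t\<^sup>2 + (norm c)\<^sup>2 * b - 2 * t * (norm c)\<^sup>2"
      using selfadjoint_Im[OF sa, of x] selfadjoint_Im[OF sa, of y]
      by (simp add: bcl_simps[OF T] cinner_simps c' c_def[symmetric] a_def b_def cmod_power2)
        (simp add: power2_eq_square algebra_simps)
    finally show ?thesis .
  qed
  have ab: "0 \<le> a" "0 \<le> b" unfolding a_def b_def using positive_op_nonneg[OF assms] by auto
  have "(norm c)\<^sup>2 \<le> a * b"
  proof (cases "a = 0")
    case True
    \<comment> \<open>With \<open>a = 0\<close> the expression is linear in \<open>t\<close> and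
      becomes negative beyond \<open>b / 2\<close> unless \<open>c = 0\<close>; the value
      \<open>b + 1\<close> is large enough.\<close>
    then have "0 \<le> (norm c)\<^sup>2 * (b - 2 * (b + 1))" using q[of "b + 1"] by (simp add: algebra_simps)
    then have "(norm c)\<^sup>2 \<le> 0" using ab by (simp add: zero_le_mult_iff)
    then show ?thesis using True by simp
  next
    case False
    \<comment> \<open>The quadratic has its minimum at
      \<open>t = (norm c)\<^sup>2 / a\<close>.\<close>
    then have "0 \<le> (norm c)\<^sup>2 * b - (norm c)\<^sup>2 * ((norm c)\<^sup>2 / a)"
    proof -
      have "a * ((norm c)\<^sup>2 / a)\<^sup>2 = (norm c)\<^sup>2 * ((norm c)\<^sup>2 / a)"
        using False by (simp add: power2_eq_square)
      then show ?thesis using q[of "(norm c)\<^sup>2 / a"] by (simp add: mult.commute mult.left_commute)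
    qed
    then have "0 \<le> (norm c)\<^sup>2 * (b - (norm c)\<^sup>2 / a)" by (simp add: algebra_simps)
    then have "(norm c)\<^sup>2 = 0 \<or> (norm c)\<^sup>2 / a \<le> b" by (auto simp: zero_le_mult_iff)
    then show ?thesis using ab False by (auto simp: field_simps)
  qed
  then show ?thesis by (simp add: a_def b_def c_def)
qed

lemma positive_op_eq_zero:
  assumes "positive_op T" "Re (cinner x (T x)) = 0"
  shows "T x = 0"
proof -
  have "(norm (cinner y (T x)))\<^sup>2 \<le> 0" for y
    using positive_op_cauchy_schwarz[OF assms(1), of y x] assms(2) by simp
  then have "\<forall>y. cinner y (T x) = 0" by simp
  then show ?thesis using cinner_eq_zero_iff by blast
qed

text \<open>A bound on the quadratic form becomes a bound on the operator through the
  Cauchy--Schwarz inequality for the pair \<open>T x\<close>, \<open>x\<close>.\<close>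

lemma positive_op_norm_le:
  assumes "positive_op T" "\<And>x. Re (cinner x (T x)) \<le> C * (norm x)\<^sup>2" "0 \<le> C"
  shows "norm (T x) \<le> C * norm x"
proof (cases "T x = 0")
  case False
  have "(norm (cinner (T x) (T x)))\<^sup>2 \<le> (C * (norm (T x))\<^sup>2) * (C * (norm x)\<^sup>2)"
    by (rule order_trans[OF positive_op_cauchy_schwarz[OF assms(1)]])
      (intro mult_mono assms positive_op_nonneg mult_nonneg_nonneg, auto simp: assms)
  then have "(norm (T x))\<^sup>2 * (norm (T x))\<^sup>2 \<le> (norm (T x))\<^sup>2 * (C * norm x)\<^sup>2"
    by (simp add: cinner_self norm_power power_mult_distrib algebra_simps del: of_real_power)
      (simp add: power2_eq_square algebra_simps)
  then have "(norm (T x))\<^sup>2 \<le> (C * norm x)\<^sup>2"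
    by (rule mult_left_le_imp_le) (use False in simp)
  then show ?thesis using assms(3) by (simp add: power2_le_iff_abs_le)
qed (use assms(3) in simp)

text \<open>Iterating \<open>p \<mapsto> (b + p\<^sup>2) / 2\<close> from \<open>0\<close> approximates \<open>1 - sqrt (1 - b)\<close>. All iterates are polynomials
  in \<open>b\<close> with nonnegative coefficients, so the norms of the differences for an operator \<open>b\<close> of norm
  at most \<open>1\<close> are bounded by the differences for the number \<open>1\<close>.\<close>

primrec sqrt_iter :: "('a::real_normed_vector \<Rightarrow>\<^sub>L 'a) \<Rightarrow> nat \<Rightarrow> 'a \<Rightarrow>\<^sub>L 'a"
  where "sqrt_iter b 0 = 0"
  | "sqrt_iter b (Suc n) = (1/2) *\<^sub>R (b + (sqrt_iter b n o\<^sub>L sqrt_iter b n))"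

primrec sqrt_iter1 :: "nat \<Rightarrow> real"
  where "sqrt_iter1 0 = 0"
  | "sqrt_iter1 (Suc n) = (1 + (sqrt_iter1 n)\<^sup>2) / 2"

lemma sqrt_iter1_bounds: "0 \<le> sqrt_iter1 n \<and> sqrt_iter1 n \<le> 1"
  by (induction n) (auto simp: power_le_one)

lemma sqrt_iter1_mono: "sqrt_iter1 n \<le> sqrt_iter1 (Suc n)"
  using zero_le_power2[of "1 - sqrt_iter1 n"] by (simp add: power2_diff)

lemma blinfun_compose_commute_sq:
  assumes "a o\<^sub>L b = b o\<^sub>L a"
  shows "(a o\<^sub>L a) - (b o\<^sub>L b) = (a - b) o\<^sub>L (a + b)"
  using assms
  by (simp add: bounded_bilinear.add_right[OF bounded_bilinear_blinfun_compose]
      bounded_bilinear.diff_left[OF bounded_bilinear_blinfun_compose])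

lemma sqrt_iter_commute:
  assumes "b o\<^sub>L c = c o\<^sub>L b"
  shows "sqrt_iter b n o\<^sub>L c = c o\<^sub>L sqrt_iter b n"
proof (induction n)
  case (Suc n)
  have "(sqrt_iter b n o\<^sub>L sqrt_iter b n) o\<^sub>L c = c o\<^sub>L (sqrt_iter b n o\<^sub>L sqrt_iter b n)"
    using Suc by (intro blinfun_eqI) (simp add: blinfun_eqI, metis blinfun_apply_blinfun_compose)
  then show ?case using assms
    by (simp add: bounded_bilinear.add_right[OF bounded_bilinear_blinfun_compose]
      bounded_bilinear.add_left[OF bounded_bilinear_blinfun_compose]
      bounded_bilinear.scaleR_left[OF bounded_bilinear_blinfun_compose]
      bounded_bilinear.scaleR_right[OF bounded_bilinear_blinfun_compose])
qed (simp add: bounded_bilinear.zero_left[OF bounded_bilinear_blinfun_compose]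
    bounded_bilinear.zero_right[OF bounded_bilinear_blinfun_compose])

text \<open>Iterates commute, so a difference of squares factors into difference times sum. Both
  factors are bounded by their scalar counterparts, and the scalar recursion reproduces the same
  product.\<close>

lemma sqrt_iter_norm:
  assumes b: "norm b \<le> 1"
  shows "norm (sqrt_iter b n) \<le> sqrt_iter1 n"
    and "norm (sqrt_iter b (Suc n) - sqrt_iter b n) \<le> sqrt_iter1 (Suc n) - sqrt_iter1 n"
proof -
  show le: "norm (sqrt_iter b n) \<le> sqrt_iter1 n" for n
  proof (induction n)
    case (Suc n)
    have "norm (sqrt_iter b n o\<^sub>L sqrt_iter b n) \<le> sqrt_iter1 n * sqrt_iter1 n"
      by (rule order_trans[OF norm_blinfun_compose]) (intro mult_mono Suc, auto simp: sqrt_iter1_bounds)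
    then have "norm (b + (sqrt_iter b n o\<^sub>L sqrt_iter b n)) \<le> 1 + sqrt_iter1 n * sqrt_iter1 n"
      by (intro norm_triangle_le add_mono b)
    then show ?case by (simp add: power2_eq_square)
  qed simp
  show "norm (sqrt_iter b (Suc n) - sqrt_iter b n) \<le> sqrt_iter1 (Suc n) - sqrt_iter1 n"
  proof (induction n)
    case (Suc n)
    let ?s = "sqrt_iter b"
    have comm: "?s (Suc n) o\<^sub>L ?s n = ?s n o\<^sub>L ?s (Suc n)"
      by (intro sqrt_iter_commute sqrt_iter_commute[symmetric]) simp
    have "?s (Suc (Suc n)) - ?s (Suc n) = (1/2) *\<^sub>R ((?s (Suc n) o\<^sub>L ?s (Suc n)) - (?s n o\<^sub>L ?s n))"
      by (simp only: sqrt_iter.simps(2)[of b "Suc n"] sqrt_iter.simps(2)[of b n] scaleR_diff_right[symmetric])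
        (simp add: algebra_simps)
    also have "\<dots> = (1/2) *\<^sub>R ((?s (Suc n) - ?s n) o\<^sub>L (?s (Suc n) + ?s n))"
      by (simp only: blinfun_compose_commute_sq[OF comm])
    finally have eq: "?s (Suc (Suc n)) - ?s (Suc n) = (1/2) *\<^sub>R ((?s (Suc n) - ?s n) o\<^sub>L (?s (Suc n) + ?s n))" .
    have "norm (?s (Suc n) + ?s n) \<le> sqrt_iter1 (Suc n) + sqrt_iter1 n"
      by (intro norm_triangle_le add_mono le)
    then have "norm ((?s (Suc n) - ?s n) o\<^sub>L (?s (Suc n) + ?s n))
        \<le> (sqrt_iter1 (Suc n) - sqrt_iter1 n) * (sqrt_iter1 (Suc n) + sqrt_iter1 n)"
      using Suc sqrt_iter1_mono[of n] by (intro order_trans[OF norm_blinfun_compose] mult_mono) (auto)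
    then have "norm (?s (Suc (Suc n)) - ?s (Suc n)) \<le> ((sqrt_iter1 (Suc n))\<^sup>2 - (sqrt_iter1 n)\<^sup>2) / 2"
      unfolding eq by (simp add: power2_eq_square algebra_simps del: sqrt_iter1.simps)
    also have "\<dots> = sqrt_iter1 (Suc (Suc n)) - sqrt_iter1 (Suc n)"
      by (simp only: sqrt_iter1.simps(2)[of "Suc n"] sqrt_iter1.simps(2)[of n]) (simp add: field_simps)
    finally show ?case .
  qed (use b in simp)
qed

lemma sqrt_iter_diff:
  assumes "norm b \<le> 1" "m \<le> n"
  shows "norm (sqrt_iter b n - sqrt_iter b m) \<le> sqrt_iter1 n - sqrt_iter1 m"
  using assms(2)
proof (induction n rule: dec_induct)
  case (step n)
  have "sqrt_iter b (Suc n) - sqrt_iter b m = (sqrt_iter b (Suc n) - sqrt_iter b n) + (sqrt_iter b n - sqrt_iter b m)"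
    by (simp del: sqrt_iter.simps)
  then have "norm (sqrt_iter b (Suc n) - sqrt_iter b m)
      \<le> norm (sqrt_iter b (Suc n) - sqrt_iter b n) + norm (sqrt_iter b n - sqrt_iter b m)"
    by (metis norm_triangle_ineq)
  then show ?case using step(3) sqrt_iter_norm(2)[OF assms(1), of n] by (simp del: sqrt_iter.simps sqrt_iter1.simps)
qed simp

text \<open>The scalar iteration increases and is bounded by 1, hence is Cauchy, and it dominates
  the increments of the operator iteration.\<close>

lemma sqrt_iter_convergent:
  fixes b :: "'a::chilbert_space \<Rightarrow>\<^sub>L 'a"
  assumes "norm b \<le> 1"
  shows "convergent (sqrt_iter b)"
proof -
  have "incseq sqrt_iter1" by (rule incseq_SucI) (rule sqrt_iter1_mono)
  then have "convergent sqrt_iter1"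
    using sqrt_iter1_bounds by (metis incseq_convergent convergentI)
  then have C: "Cauchy sqrt_iter1" by (rule convergent_Cauchy)
  have "Cauchy (sqrt_iter b)"
  proof (rule CauchyI)
    fix e :: real assume "0 < e"
    then obtain M where M: "\<forall>m\<ge>M. \<forall>n\<ge>M. norm (sqrt_iter1 m - sqrt_iter1 n) < e"
      using CauchyD[OF C] by blast
    have "norm (sqrt_iter b m - sqrt_iter b n) < e" if "m \<ge> M" "n \<ge> M" for m n
    proof (cases "n \<le> m")
      case True
      then show ?thesis using sqrt_iter_diff[OF assms True] M that
        by (smt (verit) real_norm_def)
    next
      case False
      then show ?thesis using sqrt_iter_diff[OF assms, of m n] M that
        by (smt (verit) real_norm_def norm_minus_commute nat_le_linear)
    qed
    then show "\<exists>M. \<forall>m\<ge>M. \<forall>n\<ge>M. norm (sqrt_iter b m - sqrt_iter b n) < e" by blast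
  qed
  then show ?thesis by (simp add: Cauchy_convergent_iff)
qed

text \<open>The square root commutes with everything that commutes with \<open>T\<close>, which is what makes it unique.\<close>

lemma positive_sqrt_exists_aux:
  fixes T :: "'a::chilbert_space \<Rightarrow> 'a"
  assumes T: "positive_op T" and le: "\<And>x. Re (cinner x (T x)) \<le> (norm x)\<^sup>2"
  shows "\<exists>R. positive_op R \<and> R \<circ> R = T \<and>
    (\<forall>S. bounded_clinear S \<longrightarrow> (\<forall>x. S (T x) = T (S x)) \<longrightarrow> (\<forall>x. S (R x) = R (S x)))"
proof -
  have bT: "bounded_clinear T" and saT: "selfadjoint T"
    using T positive_op_bcl positive_op_selfadjoint by auto
  \<comment> \<open>\<open>B = I - T\<close> is a positive contraction, and
    \<open>l = (B + l\<^sup>2) / 2\<close> means \<open>(I - l)\<^sup>2 = I - B = T\<close>. The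
    root is therefore \<open>I\<close> minus the limit of the iteration.\<close>
  define B where "B = (\<lambda>x. x - T x)"
  have B: "bounded_clinear B" unfolding B_def by (intro bcl_intros bT)
  have saB: "selfadjoint B" using B saT by (simp add: selfadjoint_def B_def cinner_simps)
  have posB: "positive_op B"
    by (rule positive_opI[OF saB]) (use le in \<open>simp add: B_def cinner_simps Re_cinner_self\<close>)
  have "norm (B x) \<le> 1 * norm x" for x
    by (rule positive_op_norm_le[OF posB])
      (use positive_op_nonneg[OF T] in \<open>auto simp: B_def cinner_simps Re_cinner_self\<close>)
  define b where "b = Blinfun B"
  have bB: "blinfun_apply b = B" unfolding b_def by (rule bounded_linear_Blinfun_apply[OF bcl_bounded_linear[OF B]])
  have nb: "norm b \<le> 1"
    using \<open>\<And>x. norm (B x) \<le> 1 * norm x\<close> by (intro norm_blinfun_bound) (auto simp: bB)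
  obtain l where l: "sqrt_iter b \<longlonglongrightarrow> l" using sqrt_iter_convergent[OF nb] convergent_def by blast
  have lx: "(\<lambda>n. sqrt_iter b n x) \<longlonglongrightarrow> l x" for x by (intro tendsto_intros l)
  have it: "bounded_clinear (sqrt_iter b n) \<and> (\<forall>x y. cinner (sqrt_iter b n x) y = cinner x (sqrt_iter b n y))" for n
  proof (induction n)
    case 0 then show ?case by (simp add: bcl_zero_op)
  next
    case (Suc n)
    have e: "blinfun_apply (sqrt_iter b (Suc n)) = (\<lambda>x. (1/2) *\<^sub>R (B x + sqrt_iter b n (sqrt_iter b n x)))"
      by (simp add: fun_eq_iff blinfun.add_left blinfun.scaleR_left bB)
    have "bounded_clinear (sqrt_iter b (Suc n))" unfolding e
      by (rule bcl_const_scaleR[OF bcl_plus[OF B bcl_compose]]) (use Suc in simp_all)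
    then show ?case unfolding e using Suc selfadjoint_cinner[OF saB] by (simp add: cinner_simps)
  qed
  have bl: "bounded_clinear l"
  proof (rule bclI[where C = "norm l"])
    fix c x
    have "(\<lambda>n. c *\<^sub>C sqrt_iter b n x) \<longlonglongrightarrow> c *\<^sub>C l x"
      by (rule bcl_tendsto[OF bcl_const_scaleC[OF bcl_id] lx])
    moreover have "(\<lambda>n. c *\<^sub>C sqrt_iter b n x) = (\<lambda>n. sqrt_iter b n (c *\<^sub>C x))"
      using it by (auto simp: bcl_scaleC)
    ultimately show "l (c *\<^sub>C x) = c *\<^sub>C l x" using lx[of "c *\<^sub>C x"] LIMSEQ_unique by simp
  qed (auto simp: blinfun.add_right norm_blinfun)
  have sal: "cinner (l x) y = cinner x (l y)" for x y
  proof -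
    have "(\<lambda>n. cinner y (sqrt_iter b n x)) \<longlonglongrightarrow> cinner y (l x)" "(\<lambda>n. cinner x (sqrt_iter b n y)) \<longlonglongrightarrow> cinner x (l y)"
      using bcl_tendsto[OF bcl_cinner] lx by blast+
    then have "(\<lambda>n. cnj (cinner y (sqrt_iter b n x))) \<longlonglongrightarrow> cnj (cinner y (l x))"
        "(\<lambda>n. cinner x (sqrt_iter b n y)) \<longlonglongrightarrow> cinner x (l y)" by (auto intro: tendsto_cnj)
    moreover have "cnj (cinner y (sqrt_iter b n x)) = cinner x (sqrt_iter b n y)" for n
      using it[of n] cinner_commute[of "sqrt_iter b n x" y] by simp
    ultimately have "cnj (cinner y (l x)) = cinner x (l y)" using LIMSEQ_unique by simp
    then show ?thesis using cinner_commute[of "l x" y] by simp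
  qed
  have nl: "norm l \<le> 1"
  proof (rule tendsto_upperbound[OF tendsto_norm[OF l]])
    have "norm (sqrt_iter b n) \<le> 1" for n
      using sqrt_iter_norm(1)[OF nb, of n] sqrt_iter1_bounds[of n] by linarith
    then show "\<forall>\<^sub>F n in sequentially. norm (sqrt_iter b n) \<le> 1" by simp
  qed simp
  have "(\<lambda>n. sqrt_iter b (Suc n)) \<longlonglongrightarrow> (1/2) *\<^sub>R (b + (l o\<^sub>L l))"
    unfolding sqrt_iter.simps
    by (intro tendsto_scaleR tendsto_add tendsto_const bounded_bilinear.tendsto[OF bounded_bilinear_blinfun_compose] l)
  then have fixl: "l = (1/2) *\<^sub>R (b + (l o\<^sub>L l))"
    using LIMSEQ_Suc[OF l] LIMSEQ_unique by blast
  have fx: "2 *\<^sub>R l x = B x + l (l x)" for x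
    using arg_cong[OF fixl, of "\<lambda>q. 2 *\<^sub>R blinfun_apply q x"]
    by (simp add: blinfun.add_left blinfun.scaleR_left bB)
  define R where "R = (\<lambda>x. x - l x)"
  have R: "bounded_clinear R" unfolding R_def by (intro bcl_intros bl)
  have saR: "selfadjoint R" using R sal by (simp add: selfadjoint_def R_def cinner_simps)
  have "0 \<le> Re (cinner x (R x))" for x
  proof -
    have "Re (cinner x (l x)) \<le> norm x * norm (l x)"
      by (rule Re_cinner_le)
    also have "\<dots> \<le> norm x * (1 * norm x)"
      using nl by (intro mult_left_mono order_trans[OF norm_blinfun] mult_right_mono) auto
    finally show ?thesis by (simp add: R_def cinner_simps Re_cinner_self power2_eq_square)
  qed
  then have "positive_op R" by (rule positive_opI[OF saR])
  moreover have "R (R x) = T x" for x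
    using fx[of x] by (simp add: R_def bcl_simps[OF bl] B_def scaleR_2 algebra_simps)
  moreover have "S (R x) = R (S x)" if S: "bounded_clinear S" "\<And>x. S (T x) = T (S x)" for S x
  proof -
    have "S (sqrt_iter b n x) = sqrt_iter b n (S x)" for n x
      by (induction n arbitrary: x)
        (simp_all add: bcl_simps[OF S(1)] S(2) blinfun.add_left blinfun.scaleR_left bB B_def)
    then have "(\<lambda>n. sqrt_iter b n (S x)) \<longlonglongrightarrow> S (l x)" using bcl_tendsto[OF S(1) lx[of x]] by simp
    then have "S (l x) = l (S x)" using lx LIMSEQ_unique by blast
    then show ?thesis by (simp add: R_def bcl_simps[OF S(1)])
  qed
  ultimately show ?thesis by (intro exI[of _ R]) auto
qed

lemma positive_sqrt_exists:
  fixes T :: "'a::chilbert_space \<Rightarrow> 'a"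
  assumes T: "positive_op T"
  shows "\<exists>R. positive_op R \<and> R \<circ> R = T \<and>
    (\<forall>S. bounded_clinear S \<longrightarrow> (\<forall>x. S (T x) = T (S x)) \<longrightarrow> (\<forall>x. S (R x) = R (S x)))"
proof -
  note bT = positive_op_bcl[OF T]
  \<comment> \<open>Dividing by \<open>C\<close> brings the form below 1, and the root is scaled
    back by \<open>sqrt C\<close>. The summand 1 keeps \<open>C\<close> positive when
    \<open>T = 0\<close>.\<close>
  define C where "C = onorm T + 1"
  have C: "C > 0" unfolding C_def using bcl_onorm_nonneg[OF bT] by simp
  define T' where "T' = (\<lambda>x. (1/C) *\<^sub>R T x)"
  have T': "bounded_clinear T'" unfolding T'_def by (intro bcl_intros bT)
  have "selfadjoint T'"
    using T' positive_op_selfadjoint[OF T] by (simp add: selfadjoint_def T'_def cinner_simps)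
  then have pT': "positive_op T'"
    by (rule positive_opI) (use positive_op_nonneg[OF T] C in \<open>simp add: T'_def cinner_simps\<close>)
  have "Re (cinner x (T' x)) \<le> (norm x)\<^sup>2" for x
  proof -
    have "Re (cinner x (T x)) \<le> norm x * norm (T x)"
      by (rule Re_cinner_le)
    also have "\<dots> \<le> norm x * (C * norm x)"
    proof (intro mult_left_mono)
      show "norm (T x) \<le> C * norm x"
        using bcl_onorm[OF bT, of x] norm_ge_zero[of x] unfolding C_def distrib_right by linarith
    qed simp
    finally show ?thesis using C by (simp add: T'_def cinner_simps power2_eq_square field_simps)
  qed
  from positive_sqrt_exists_aux[OF pT' this] obtain R where R: "positive_op R" "R \<circ> R = T'"
    "\<And>S x. bounded_clinear S \<Longrightarrow> (\<And>x. S (T' x) = T' (S x)) \<Longrightarrow> S (R x) = R (S x)" by blast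
  note bR = positive_op_bcl[OF R(1)]
  define R' where "R' = (\<lambda>x. sqrt C *\<^sub>R R x)"
  have "bounded_clinear R'" unfolding R'_def by (intro bcl_intros bR)
  then have "selfadjoint R'"
    using positive_op_selfadjoint[OF R(1)] by (simp add: selfadjoint_def R'_def cinner_simps)
  then have "positive_op R'"
    by (rule positive_opI) (use positive_op_nonneg[OF R(1)] C in \<open>simp add: R'_def cinner_simps\<close>)
  moreover have "R' (R' x) = T x" for x
  proof -
    have "R' (R' x) = C *\<^sub>R R (R x)" using C by (simp add: R'_def bcl_simps[OF bR])
    also have "R (R x) = T' x" using R(2) by (metis comp_apply)
    finally show ?thesis using C by (simp add: T'_def)
  qed
  moreover have "S (R' x) = R' (S x)" if S: "bounded_clinear S" "\<And>x. S (T x) = T (S x)" for S x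
    using R(3)[of S x] S(2) by (simp add: T'_def R'_def bcl_simps[OF S(1)] S(1))
  ultimately show ?thesis by (intro exI[of _ R']) auto
qed

text \<open>Commuting roots satisfy \<open>(R + S) (R - S) = 0\<close>. On
  \<open>y = (R - S) x\<close> the two nonnegative forms add up to zero, so
  \<open>R y = S y = 0\<close>, and then the squared norm of \<open>y\<close> is the inner product
  of \<open>x\<close> with \<open>(R - S) y = 0\<close>.\<close>

lemma positive_sqrt_unique:
  fixes T :: "'a::chilbert_space \<Rightarrow> 'a"
  assumes R: "positive_op R" "R \<circ> R = T" and S: "positive_op S" "S \<circ> S = T"
    and comm: "\<And>x. S (R x) = R (S x)"
  shows "R = S"
proof
  fix x
  note bR = positive_op_bcl[OF R(1)] and bS = positive_op_bcl[OF S(1)]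
  define y where "y = R x - S x"
  have RR: "R (R x) = T x" "S (S x) = T x" for x using R(2) S(2) by (auto simp: fun_eq_iff)
  have "R y + S y = 0" by (simp add: y_def bcl_simps[OF bR] bcl_simps[OF bS] RR comm)
  then have "Re (cinner y (R y)) + Re (cinner y (S y)) = 0"
    by (simp flip: plus_complex.sel(1) cinner_add_right)
  then have "Re (cinner y (R y)) = 0" "Re (cinner y (S y)) = 0"
    using positive_op_nonneg[OF R(1), of y] positive_op_nonneg[OF S(1), of y] by linarith+
  then have "R y = 0" "S y = 0" using positive_op_eq_zero R(1) S(1) by blast+
  moreover have "selfadjoint (\<lambda>x. R x - S x)"
    using positive_op_selfadjoint[OF R(1)] positive_op_selfadjoint[OF S(1)] bcl_minus_op[OF bR bS]
    by (simp add: selfadjoint_def cinner_simps)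
  from selfadjoint_cinner[OF this, of x y] have "cinner y y = cinner x (R y - S y)" by (simp add: y_def)
  ultimately have "cinner y y = 0" by simp
  then show "R x = S x" by (simp add: cinner_self y_def)
qed

lemma
  fixes T :: "'a::chilbert_space \<Rightarrow> 'a"
  assumes T: "positive_op T"
  shows positive_op_sqrt: "positive_op (op_sqrt T)" and op_sqrt_square: "op_sqrt T (op_sqrt T x) = T x"
proof -
  obtain R where R: "positive_op R" "R \<circ> R = T"
    "\<And>S x. bounded_clinear S \<Longrightarrow> (\<And>x. S (T x) = T (S x)) \<Longrightarrow> S (R x) = R (S x)"
    using positive_sqrt_exists[OF T] by blast
  \<comment> \<open>Any root \<open>S\<close> commutes with \<open>T = S \<circ> S\<close> and hence
    with the constructed \<open>R\<close>, which reduces uniqueness to the commuting case.\<close>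
  have uniq: "S = R" if "positive_op S \<and> S \<circ> S = T" for S
  proof -
    have "T = (\<lambda>x. S (S x))" using that by (auto simp: fun_eq_iff)
    then have "S (T x) = T (S x)" for x by simp
    then have "S (R x) = R (S x)" for x using R(3) that positive_op_bcl by blast
    then show ?thesis using positive_sqrt_unique[OF R(1,2)] that by blast
  qed
  have "op_sqrt T = R" unfolding op_sqrt_def by (rule the_equality[OF _ uniq]) (rule conjI[OF R(1,2)])
  then show "positive_op (op_sqrt T)" "op_sqrt T (op_sqrt T x) = T x"
    using R(1) fun_cong[OF R(2), of x] by simp_all
qed

section \<open>Hilbert--Schmidt operators\<close>

text \<open>\<open>C\<close> bounds the squared Hilbert--Schmidt norm. Testing on every finite
  orthonormal family makes the notion independent of \<open>some_onb\<close> and keeps infinite sums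
  out of the estimates.\<close>

definition hs_bdd :: "('a::complex_inner \<Rightarrow> 'b::complex_inner) \<Rightarrow> real \<Rightarrow> bool"
  where "hs_bdd T C \<longleftrightarrow> bounded_clinear T \<and>
    (\<forall>F. finite F \<longrightarrow> orthonormal F \<longrightarrow> (\<Sum>f\<in>F. (norm (T f))\<^sup>2) \<le> C)"

lemma hs_bdd_bcl: "hs_bdd T C \<Longrightarrow> bounded_clinear T"
  by (simp add: hs_bdd_def)

lemma hs_bddD: "hs_bdd T C \<Longrightarrow> finite F \<Longrightarrow> orthonormal F \<Longrightarrow> (\<Sum>f\<in>F. (norm (T f))\<^sup>2) \<le> C"
  by (simp add: hs_bdd_def)

lemma hs_bdd_nonneg: "hs_bdd T C \<Longrightarrow> 0 \<le> C"
  using hs_bddD[of T C "{}"] by (simp add: orthonormal_def)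

lemma hs_bdd_hilbert_schmidt:
  fixes T :: "'a::chilbert_space \<Rightarrow> 'b::complex_inner"
  assumes "hs_bdd T C"
  shows "hilbert_schmidt T" "hs_norm T \<le> sqrt C"
proof -
  have on: "orthonormal (some_onb :: 'a set)" using is_onb_some_onb is_onb_iff by blast
  have le: "(\<Sum>f\<in>F. (norm (T f))\<^sup>2) \<le> C" if "finite F" "F \<subseteq> some_onb" for F
    using hs_bddD[OF assms that(1) orthonormal_subset[OF on that(2)]] .
  have s: "(\<lambda>e. (norm (T e))\<^sup>2) summable_on some_onb"
    using le by (intro nonneg_bdd_above_summable_on bdd_aboveI[of _ C]) auto
  show "hilbert_schmidt T" using s hs_bdd_bcl[OF assms] by (simp add: hilbert_schmidt_def)
  show "hs_norm T \<le> sqrt C" unfolding hs_norm_def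
    by (intro real_sqrt_le_mono infsum_le_finite_sums s le)
qed

lemma cadjoint_norm:
  fixes T :: "'a::chilbert_space \<Rightarrow> 'b::complex_inner"
  assumes T: "bounded_clinear T" and "0 \<le> c" "\<And>x. norm (T x) \<le> c * norm x"
  shows "norm (cadjoint T y) \<le> c * norm y"
proof -
  have "(norm (cadjoint T y))\<^sup>2 = Re (cinner (T (cadjoint T y)) y)"
    using cadjoint_right[OF T, of "cadjoint T y" y] by (metis Re_cinner_self)
  also have "\<dots> \<le> norm (T (cadjoint T y)) * norm y"
    by (rule Re_cinner_le)
  also have "\<dots> \<le> c * norm (cadjoint T y) * norm y"
    by (intro mult_right_mono assms) auto
  finally have "norm (cadjoint T y) * norm (cadjoint T y) \<le> norm (cadjoint T y) * (c * norm y)"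
    by (simp add: power2_eq_square algebra_simps)
  then show ?thesis
    by (metis mult_left_le_imp_le mult_nonneg_nonneg norm_ge_zero order_le_less assms(2))
qed

lemma cadjoint_cadjoint:
  fixes T :: "'a::chilbert_space \<Rightarrow> 'b::complex_inner"
  assumes "bounded_clinear T"
  shows "cadjoint (cadjoint T) = T"
  by (rule cadjoint_eqI) (simp add: cadjoint_right assms)

text \<open>Double counting of the squared matrix elements between \<open>F\<close> and an
  orthonormal basis \<open>G\<close> of a space containing the images of \<open>F\<close>: summed
  over \<open>G\<close> they give the norms of the adjoint exactly, summed over \<open>F\<close>
  they are controlled by Bessel.\<close>

lemma hs_bdd_cadjoint:
  fixes T :: "'a::chilbert_space \<Rightarrow> 'b::complex_inner"
  assumes "hs_bdd T C"
  shows "hs_bdd (cadjoint T) C"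
proof -
  note T = hs_bdd_bcl[OF assms]
  have "(\<Sum>f\<in>F. (norm (cadjoint T f))\<^sup>2) \<le> C" if F: "finite F" "orthonormal F" for F
  proof -
    obtain G where G: "finite G" "orthonormal G" "cadjoint T ` F \<subseteq> cspace.span G"
      using finite_orthonormal_basis[of "cadjoint T ` F"] F(1) by auto
    have "(norm (cadjoint T f))\<^sup>2 = (\<Sum>g\<in>G. (norm (cinner f (T g)))\<^sup>2)" if "f \<in> F" for f
    proof -
      have "proj_on G (cadjoint T f) = cadjoint T f"
        using G that by (intro proj_on_span_eq) auto
      then have "(norm (cadjoint T f))\<^sup>2 = (\<Sum>g\<in>G. (norm (cinner g (cadjoint T f)))\<^sup>2)"
        using proj_on_norm[OF G(2,1)] by metis
      then show ?thesis by (simp add: cadjoint_right[OF T] norm_cinner_commute)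
    qed
    then have "(\<Sum>f\<in>F. (norm (cadjoint T f))\<^sup>2) = (\<Sum>g\<in>G. \<Sum>f\<in>F. (norm (cinner f (T g)))\<^sup>2)"
      by (simp add: sum.swap[of _ F G])
    also have "\<dots> \<le> (\<Sum>g\<in>G. (norm (T g))\<^sup>2)" by (intro sum_mono bessel F)
    also have "\<dots> \<le> C" by (rule hs_bddD[OF assms G(1,2)])
    finally show ?thesis .
  qed
  then show ?thesis using bcl_cadjoint[OF T] by (simp add: hs_bdd_def)
qed

text \<open>From one basis to all orthonormal families. The passage goes through the adjoint, whose
  norms Parseval evaluates in the chosen basis, and returns by taking the adjoint again.\<close>

lemma hilbert_schmidt_hs_bdd:
  fixes T :: "'a::chilbert_space \<Rightarrow> 'b::chilbert_space"
  assumes "hilbert_schmidt T"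
  shows "\<exists>C. hs_bdd T C"
proof -
  have T: "bounded_clinear T" and s: "(\<lambda>e. (norm (T e))\<^sup>2) summable_on some_onb"
    using assms by (auto simp: hilbert_schmidt_def)
  define C where "C = (\<Sum>\<^sub>\<infinity>e\<in>some_onb. (norm (T e))\<^sup>2)"
  have "(\<Sum>f\<in>F. (norm (cadjoint T f))\<^sup>2) \<le> C" if F: "finite F" "orthonormal F" for F
  proof -
    have h: "((\<lambda>e. (norm (cinner e (cadjoint T f)))\<^sup>2) has_sum (norm (cadjoint T f))\<^sup>2) some_onb" for f
      by (rule parseval[OF is_onb_some_onb])
    have "((\<lambda>e. \<Sum>f\<in>F. (norm (cinner e (cadjoint T f)))\<^sup>2) has_sum (\<Sum>f\<in>F. (norm (cadjoint T f))\<^sup>2)) some_onb"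
      using F(1) by (induction F rule: finite_induct) (auto intro: has_sum_add h)
    moreover have "(\<Sum>f\<in>F. (norm (cinner e (cadjoint T f)))\<^sup>2) \<le> (norm (T e))\<^sup>2" for e
      using bessel[OF F(2,1), of "T e"] by (simp add: cadjoint_right[OF T] norm_cinner_commute)
    ultimately show ?thesis unfolding C_def
      by (rule has_sum_mono[OF _ has_sum_infsum[OF s]])
  qed
  then have "hs_bdd (cadjoint T) C" using bcl_cadjoint[OF T] by (simp add: hs_bdd_def)
  from hs_bdd_cadjoint[OF this] show ?thesis using cadjoint_cadjoint[OF T] by auto
qed

lemma hs_bdd_left:
  fixes T :: "'a::complex_inner \<Rightarrow> 'b::complex_inner"
  assumes "hs_bdd T C" "bounded_clinear A" "\<And>x. norm (A x) \<le> c * norm x"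
  shows "hs_bdd (\<lambda>x. A (T x)) (c\<^sup>2 * C)"
  unfolding hs_bdd_def
proof (intro conjI allI impI)
  show "bounded_clinear (\<lambda>x. A (T x))" by (rule bcl_compose[OF assms(2) hs_bdd_bcl[OF assms(1)]])
  fix F :: "'a set" assume F: "finite F" "orthonormal F"
  have "(\<Sum>f\<in>F. (norm (A (T f)))\<^sup>2) \<le> (\<Sum>f\<in>F. c\<^sup>2 * (norm (T f))\<^sup>2)"
    using assms(3) by (intro sum_mono) (metis norm_ge_zero power_mono power_mult_distrib)
  also have "\<dots> \<le> c\<^sup>2 * C"
    using hs_bddD[OF assms(1) F] by (simp add: sum_distrib_left[symmetric] mult_left_mono)
  finally show "(\<Sum>f\<in>F. (norm (A (T f)))\<^sup>2) \<le> c\<^sup>2 * C" .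
qed

text \<open>A right factor becomes a left factor after taking adjoints.\<close>

lemma hs_bdd_right:
  fixes T :: "'b::chilbert_space \<Rightarrow> 'c::chilbert_space" and B :: "'a::chilbert_space \<Rightarrow> 'b"
  assumes T: "hs_bdd T C" and B: "bounded_clinear B" and c: "0 \<le> c" "\<And>x. norm (B x) \<le> c * norm x"
  shows "hs_bdd (\<lambda>x. T (B x)) (c\<^sup>2 * C)"
proof -
  note bT = hs_bdd_bcl[OF T]
  have "hs_bdd (\<lambda>y. cadjoint B (cadjoint T y)) (c\<^sup>2 * C)"
    by (intro hs_bdd_left hs_bdd_cadjoint T bcl_cadjoint B cadjoint_norm c)
  from hs_bdd_cadjoint[OF this] show ?thesis
    using cadjoint_compose[OF bT B] cadjoint_cadjoint[OF bcl_compose[OF bT B]] by simp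
qed

text \<open>The constants are squared norms, so the Cauchy--Schwarz inequality for sums brings in
  the factor \<open>card I\<close>.\<close>

lemma hs_bdd_sum:
  fixes T :: "'i \<Rightarrow> 'a::complex_inner \<Rightarrow> 'b::complex_inner"
  assumes "finite I" "\<And>i. i \<in> I \<Longrightarrow> hs_bdd (T i) (C i)"
  shows "hs_bdd (\<lambda>x. \<Sum>i\<in>I. T i x) (real (card I) * (\<Sum>i\<in>I. C i))"
  unfolding hs_bdd_def
proof (intro conjI allI impI)
  show "bounded_clinear (\<lambda>x. \<Sum>i\<in>I. T i x)" using assms(2) hs_bdd_bcl by (intro bcl_sum_op) blast
  fix F :: "'a set" assume F: "finite F" "orthonormal F"
  have "(norm (\<Sum>i\<in>I. T i f))\<^sup>2 \<le> real (card I) * (\<Sum>i\<in>I. (norm (T i f))\<^sup>2)" for f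
  proof -
    have "(norm (\<Sum>i\<in>I. T i f))\<^sup>2 \<le> (\<Sum>i\<in>I. norm (T i f))\<^sup>2" by (intro power_mono norm_sum) auto
    also have "\<dots> \<le> (\<Sum>i\<in>I. (norm (T i f))\<^sup>2) * real (card I)" by (rule sum_squared_le_sum_of_squares)
    finally show ?thesis by (simp add: mult.commute)
  qed
  then have "(\<Sum>f\<in>F. (norm (\<Sum>i\<in>I. T i f))\<^sup>2) \<le> (\<Sum>f\<in>F. real (card I) * (\<Sum>i\<in>I. (norm (T i f))\<^sup>2))"
    by (intro sum_mono)
  also have "\<dots> = real (card I) * (\<Sum>i\<in>I. \<Sum>f\<in>F. (norm (T i f))\<^sup>2)"
    by (simp add: sum_distrib_left[symmetric] sum.swap[of _ F I])
  also have "\<dots> \<le> real (card I) * (\<Sum>i\<in>I. C i)"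
    by (intro mult_left_mono sum_mono hs_bddD assms F) auto
  finally show "(\<Sum>f\<in>F. (norm (\<Sum>i\<in>I. T i f))\<^sup>2) \<le> real (card I) * (\<Sum>i\<in>I. C i)" .
qed

lemma hs_bdd_add:
  assumes "hs_bdd S C" "hs_bdd T D"
  shows "hs_bdd (\<lambda>x. S x + T x) (2 * C + 2 * D)"
proof -
  have "hs_bdd (\<lambda>x. \<Sum>i\<in>{False, True}. (if i then T else S) x) (real (card {False, True}) * (\<Sum>i\<in>{False, True}. if i then D else C))"
    by (rule hs_bdd_sum) (use assms in auto)
  then show ?thesis by simp
qed

lemma hs_bdd_scaleC: "hs_bdd T C \<Longrightarrow> hs_bdd (\<lambda>x. c *\<^sub>C T x) ((norm c)\<^sup>2 * C)"
  by (rule hs_bdd_left[OF _ bcl_const_scaleC[OF bcl_id]]) (auto simp: norm_scaleC)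

lemma hs_bdd_scaleR: "hs_bdd T C \<Longrightarrow> hs_bdd (\<lambda>x. c *\<^sub>R T x) (c\<^sup>2 * C)"
  using hs_bdd_scaleC[of T C "of_real c"] by (simp add: scaleR_scaleC)

section \<open>The spectral theorem for self-adjoint Hilbert--Schmidt operators\<close>

text \<open>If \<open>E\<close> comes within \<open>\<delta>\<^sup>2\<close> of the supremum of the
  finite sums, a further orthogonal unit vector can add at most
  \<open>\<delta>\<^sup>2\<close>.\<close>

lemma hs_small_off_finite:
  fixes T :: "'a::complex_inner \<Rightarrow> 'b::complex_inner"
  assumes T: "hs_bdd T C" and d: "\<delta> > 0"
  shows "\<exists>E. finite E \<and> orthonormal E \<and> (\<forall>y. (\<forall>e\<in>E. cinner e y = 0) \<longrightarrow> norm (T y) \<le> \<delta> * norm y)"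
proof -
  note bT = hs_bdd_bcl[OF T]
  define A where "A = (\<lambda>F. \<Sum>f\<in>F. (norm (T f))\<^sup>2) ` {F. finite F \<and> orthonormal F}"
  have bdd: "bdd_above A" using hs_bddD[OF T] by (auto simp: A_def intro!: bdd_aboveI[of _ C])
  have "{} \<in> {F :: 'a set. finite F \<and> orthonormal F}" by (simp add: orthonormal_def)
  then have "A \<noteq> {}" unfolding A_def by blast
  then obtain E where E: "finite E" "orthonormal E" "(\<Sum>f\<in>E. (norm (T f))\<^sup>2) > Sup A - \<delta>\<^sup>2"
    using less_cSupD[of A "Sup A - \<delta>\<^sup>2"] d by (auto simp: A_def)
  have "norm (T y) \<le> \<delta> * norm y" if y: "\<forall>e\<in>E. cinner e y = 0" for y
  proof (cases "y = 0")
    case False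
    define u where "u = (1 / of_real (norm y)) *\<^sub>C y"
    have u: "norm u = 1" "\<And>e. e \<in> E \<Longrightarrow> cinner e u = 0"
      using y False by (auto simp: u_def norm_scaleC norm_divide cinner_scaleC_right)
    have "u \<notin> E" using u cinner_self[of u] by auto
    have "(\<Sum>f\<in>insert u E. (norm (T f))\<^sup>2) \<in> A"
      unfolding A_def using E orthonormal_insert[OF E(2) u] by blast
    then have "(norm (T u))\<^sup>2 + (\<Sum>f\<in>E. (norm (T f))\<^sup>2) \<le> Sup A"
      using cSup_upper[OF _ bdd] \<open>u \<notin> E\<close> E(1) by fastforce
    then have "(norm (T u))\<^sup>2 \<le> \<delta>\<^sup>2" using E(3) by linarith
    then have "norm (T u) \<le> \<delta>" using d by (simp add: power2_le_iff_abs_le)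
    then show ?thesis using False
      by (simp add: u_def bcl_simps[OF bT] norm_scaleC norm_divide field_simps)
  qed (simp add: bcl_simps[OF bT])
  then show ?thesis using E by blast
qed

lemma compact_complex_combinations:
  assumes "finite E"
  shows "compact {\<Sum>e\<in>E. c e *\<^sub>C v e |c. \<forall>e\<in>E. norm (c e) \<le> 1}"
  using assms
proof (induction E rule: finite_induct)
  case (insert x E)
  have "{\<Sum>e\<in>insert x E. c e *\<^sub>C v e |c. \<forall>e\<in>insert x E. norm (c e) \<le> 1}
      = {a + b |a b. a \<in> (\<lambda>c. c *\<^sub>C v x) ` cball 0 1 \<and> b \<in> {\<Sum>e\<in>E. c e *\<^sub>C v e |c. \<forall>e\<in>E. norm (c e) \<le> 1}}"
    (is "?A = ?B")
  proof
    show "?A \<subseteq> ?B"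
    proof
      fix z assume "z \<in> ?A"
      then obtain c where c: "\<forall>e\<in>insert x E. norm (c e) \<le> 1" "z = (\<Sum>e\<in>insert x E. c e *\<^sub>C v e)" by blast
      then have "z = c x *\<^sub>C v x + (\<Sum>e\<in>E. c e *\<^sub>C v e)" using insert(1,2) by simp
      moreover have "c x *\<^sub>C v x \<in> (\<lambda>c. c *\<^sub>C v x) ` cball 0 1" using c(1) by auto
      moreover have "(\<Sum>e\<in>E. c e *\<^sub>C v e) \<in> {\<Sum>e\<in>E. c e *\<^sub>C v e |c. \<forall>e\<in>E. norm (c e) \<le> 1}" using c(1) by blast
      ultimately show "z \<in> ?B" by blast
    qed
    show "?B \<subseteq> ?A"
    proof
      fix z assume "z \<in> ?B"
      then obtain c0 c where c: "norm c0 \<le> 1" "\<forall>e\<in>E. norm (c e) \<le> 1" "z = c0 *\<^sub>C v x + (\<Sum>e\<in>E. c e *\<^sub>C v e)"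
        by auto
      have "(\<Sum>e\<in>E. (c(x := c0)) e *\<^sub>C v e) = (\<Sum>e\<in>E. c e *\<^sub>C v e)"
        using insert(2) by (intro sum.cong) auto
      then have "z = (\<Sum>e\<in>insert x E. (c(x := c0)) e *\<^sub>C v e)" using insert(1,2) c by simp
      moreover have "\<forall>e\<in>insert x E. norm ((c(x := c0)) e) \<le> 1" using c by simp
      ultimately show "z \<in> ?A" by blast
    qed
  qed
  moreover have "compact ((\<lambda>c. c *\<^sub>C v x) ` cball 0 1)"
    by (intro compact_continuous_image bcl_continuous_on bcl_scaleC_left) simp
  ultimately show ?case using compact_sums[OF _ insert(3)] by simp
qed simp

text \<open>Total boundedness: on the unit ball, up to an error \<open>\<epsilon> / 3\<close>, the
  operator takes the values of a finite-rank part with bounded coefficients, and those fill a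
  compact set.\<close>

lemma hs_compact:
  fixes T :: "'a::complex_inner \<Rightarrow> 'b::chilbert_space"
  assumes T: "hs_bdd T C"
  shows "compact (closure (T ` cball 0 1))"
  unfolding compact_eq_totally_bounded
proof (intro conjI allI impI)
  note bT = hs_bdd_bcl[OF T]
  show "complete (closure (T ` cball 0 1))" by (simp add: complete_eq_closed)
  fix \<epsilon> :: real assume "0 < \<epsilon>"
  then have d: "0 < \<epsilon> / 3" by simp
  obtain E where E: "finite E" "orthonormal E" "\<And>y. (\<forall>e\<in>E. cinner e y = 0) \<Longrightarrow> norm (T y) \<le> (\<epsilon>/3) * norm y"
    using hs_small_off_finite[OF T d] by blast
  define K where "K = {\<Sum>e\<in>E. c e *\<^sub>C T e |c. \<forall>e\<in>E. norm (c e) \<le> 1}"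
  have "compact K" unfolding K_def by (rule compact_complex_combinations[OF E(1)])
  then obtain N where N: "finite N" "K \<subseteq> (\<Union>x\<in>N. ball x (\<epsilon>/3))"
    using d unfolding compact_eq_totally_bounded by blast
  have "T x \<in> (\<Union>y\<in>N. cball y (2 * \<epsilon> / 3))" if x: "norm x \<le> 1" for x
  proof -
    have "norm (cinner e x) \<le> 1" if "e \<in> E" for e
      using norm_cinner_le[of e x] x orthonormal_norm[OF E(2) that] by simp
    then have "T (proj_on E x) \<in> K"
      unfolding K_def proj_on_def by (auto simp: bcl_simps[OF bT])
    then obtain y where y: "y \<in> N" "dist y (T (proj_on E x)) < \<epsilon>/3" using N(2) by auto
    have "(norm (x - proj_on E x))\<^sup>2 \<le> (norm x)\<^sup>2"
      using proj_on_pythagoras[OF E(2,1) cspace.span_zero, of x] by simp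
    then have "norm (x - proj_on E x) \<le> 1" using x by (simp add: power2_le_iff_abs_le)
    then have "norm (T (x - proj_on E x)) \<le> \<epsilon>/3"
      using E(3)[of "x - proj_on E x"] proj_on_orthogonal[OF E(2,1)] d
      by (smt (verit, ccfv_SIG) mult_left_le)
    then have "dist (T (proj_on E x)) (T x) \<le> \<epsilon>/3" by (simp add: bcl_simps[OF bT] dist_norm norm_minus_commute)
    then have "dist y (T x) \<le> 2 * \<epsilon> / 3" using y(2) dist_triangle[of y "T x" "T (proj_on E x)"] by simp
    then show ?thesis using y(1) by auto
  qed
  \<comment> \<open>Closed balls of radius \<open>2 * \<epsilon> / 3\<close> survive the passage to
    the closure and still fit into open balls of radius \<open>\<epsilon>\<close>.\<close>
  then have "T ` cball 0 1 \<subseteq> (\<Union>y\<in>N. cball y (2 * \<epsilon> / 3))" by auto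
  moreover have "closed (\<Union>y\<in>N. cball y (2 * \<epsilon> / 3))" by (intro closed_UN N) auto
  ultimately have "closure (T ` cball 0 1) \<subseteq> (\<Union>y\<in>N. cball y (2 * \<epsilon> / 3))" by (rule closure_minimal)
  also have "\<dots> \<subseteq> (\<Union>y\<in>N. ball y \<epsilon>)" using d by fastforce
  finally show "\<exists>k. finite k \<and> closure (T ` cball 0 1) \<subseteq> (\<Union>x\<in>k. ball x \<epsilon>)" using N(1) by blast
qed

text \<open>Maximizing \<open>norm (S x)\<close> over unit vectors of \<open>N\<close> leads to
  \<open>S (S y) = m\<^sup>2 *\<^sub>R y\<close>; then either \<open>y\<close> belongs to the
  eigenvalue \<open>- m\<close>, or \<open>S y + m *\<^sub>R y\<close> is an eigenvector for
  \<open>m\<close>. The invariant subspace \<open>N\<close> is there for the complement of the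
  eigenvectors already found.\<close>

lemma eigenvector_exists:
  fixes S :: "'a::chilbert_space \<Rightarrow> 'a"
  assumes S: "selfadjoint S" "hs_bdd S C"
    and N: "cspace.subspace N" "closed N" "\<And>x. x \<in> N \<Longrightarrow> S x \<in> N" "N \<noteq> {0}"
  shows "\<exists>x\<in>N. \<exists>r::real. norm x = 1 \<and> S x = r *\<^sub>R x"
proof -
  note bS = hs_bdd_bcl[OF S(2)]
  have normalize: "\<exists>u\<in>N. norm u = 1 \<and> u = (1 / norm x) *\<^sub>R x" if "x \<in> N" "x \<noteq> 0" for x
    using that N(1) cspace.subspace_scale[of N x "of_real (1 / norm x)"]
    by (intro bexI[of _ "(1 / norm x) *\<^sub>R x"]) (auto simp: scaleR_scaleC norm_scaleC norm_divide)
  obtain x0 where x0: "x0 \<in> N" "x0 \<noteq> 0" using N(1,4) cspace.subspace_0 by auto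
  then obtain u0 where u0: "u0 \<in> N" "norm u0 = 1" using normalize by blast
  define A where "A = (\<lambda>x. norm (S x)) ` {x\<in>N. norm x = 1}"
  define m where "m = Sup A"
  have bdd: "bdd_above A"
    using bcl_onorm[OF bS] by (auto simp: A_def intro!: bdd_aboveI[of _ "onorm S"]) (metis mult.right_neutral)
  have le1: "norm (S x) \<le> m" if "x \<in> N" "norm x = 1" for x
    unfolding m_def using that bdd by (intro cSup_upper) (auto simp: A_def)
  have m0: "0 \<le> m" using le1[OF u0] norm_ge_zero order_trans by blast
  have le: "norm (S x) \<le> m * norm x" if xN: "x \<in> N" for x
  proof (cases "x = 0")
    case False
    then obtain u where u: "u \<in> N" "norm u = 1" "u = (1 / norm x) *\<^sub>R x" using normalize[OF xN False] by blast
    then show ?thesis using le1[OF u(1,2)] False by (simp add: u(3) bcl_simps[OF bS] field_simps)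
  qed (simp add: bcl_simps[OF bS])
  show ?thesis
  proof (cases "m = 0")
    case True
    then have "S u0 = 0 *\<^sub>R u0" using le[OF u0(1)] by simp
    then show ?thesis using u0 by blast
  next
    case False
    then have m: "m > 0" using m0 by simp
    have "\<exists>x\<in>N. norm x = 1 \<and> norm (S x) > m - 1 / real (Suc n)" for n
      using less_cSupD[of A "m - 1 / real (Suc n)"] u0 by (auto simp: A_def m_def)
    then obtain x where x: "\<And>n. x n \<in> N" "\<And>n. norm (x n) = 1" "\<And>n. norm (S (x n)) > m - 1 / real (Suc n)"
      by metis
    have Sxn: "(\<lambda>n. norm (S (x n))) \<longlonglongrightarrow> m"
    proof (rule tendsto_sandwich)
      have "(\<lambda>n. m - 1 / real (Suc n)) \<longlonglongrightarrow> m - 0" by (intro tendsto_intros LIMSEQ_Suc lim_1_over_n)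
      then show "(\<lambda>n. m - 1 / real (Suc n)) \<longlonglongrightarrow> m" by simp
      show "\<forall>\<^sub>F n in sequentially. m - 1 / real (Suc n) \<le> norm (S (x n))"
        by (intro always_eventually allI less_imp_le x)
      show "\<forall>\<^sub>F n in sequentially. norm (S (x n)) \<le> m"
        by (intro always_eventually allI le1 x)
    qed simp
    \<comment> \<open>Expand the square, with
      \<open>norm (S (S (x n))) \<le> m * norm (S (x n))\<close> for the first term; the mixed term
      is evaluated by self-adjointness.\<close>
    have "(norm (S (S (x n)) - m\<^sup>2 *\<^sub>R x n))\<^sup>2 \<le> m\<^sup>2 * (m\<^sup>2 - (norm (S (x n)))\<^sup>2)" for n
    proof -
      have "Re (cinner (S (S (x n))) (m\<^sup>2 *\<^sub>R x n)) = m\<^sup>2 * (norm (S (x n)))\<^sup>2"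
        using selfadjoint_cinner[OF S(1), of "S (x n)" "x n"]
        by (simp add: cinner_simps cinner_self del: of_real_power)
      moreover have "(norm (S (S (x n))))\<^sup>2 \<le> (m * norm (S (x n)))\<^sup>2"
        by (intro power_mono le N x) auto
      moreover have "(norm (S (S (x n)) - m\<^sup>2 *\<^sub>R x n))\<^sup>2 =
          (norm (S (S (x n))))\<^sup>2 + m\<^sup>2 * m\<^sup>2 - 2 * Re (cinner (S (S (x n))) (m\<^sup>2 *\<^sub>R x n))"
        by (simp add: norm_diff_squared[of "S (S (x n))"] x(2) power2_eq_square[of "m\<^sup>2"])
      ultimately show ?thesis unfolding power_mult_distrib right_diff_distrib by linarith
    qed
    then have bd: "\<forall>\<^sub>F n in sequentially. (norm (S (S (x n)) - m\<^sup>2 *\<^sub>R x n))\<^sup>2 \<le> m\<^sup>2 * (m\<^sup>2 - (norm (S (x n)))\<^sup>2)"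
      by simp
    have "(\<lambda>n. m\<^sup>2 * (m\<^sup>2 - (norm (S (x n)))\<^sup>2)) \<longlonglongrightarrow> m\<^sup>2 * (m\<^sup>2 - m\<^sup>2)"
      by (intro tendsto_intros Sxn)
    then have "(\<lambda>n. m\<^sup>2 * (m\<^sup>2 - (norm (S (x n)))\<^sup>2)) \<longlonglongrightarrow> 0" by simp
    from tendsto_sandwich[OF _ bd tendsto_const this]
    have "(\<lambda>n. (norm (S (S (x n)) - m\<^sup>2 *\<^sub>R x n))\<^sup>2) \<longlonglongrightarrow> 0" by simp
    then have z: "(\<lambda>n. S (S (x n)) - m\<^sup>2 *\<^sub>R x n) \<longlonglongrightarrow> 0"
      by (simp add: tendsto_norm_zero_iff)
    \<comment> \<open>Compactness makes only \<open>S (x n)\<close> converge along a subsequence.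
      Since \<open>m > 0\<close>, the vectors \<open>x n\<close> themselves are recovered from
      \<open>S (S (x n))\<close>.\<close>
    have "S (x n) \<in> closure (S ` cball 0 1)" for n
      using x(2)[of n] closure_subset[of "S ` cball 0 1"] by force
    then obtain l r where lr: "strict_mono (r :: nat \<Rightarrow> nat)" "((\<lambda>n. S (x n)) \<circ> r) \<longlonglongrightarrow> l"
      using hs_compact[OF S(2)] unfolding compact_def by metis
    then have lr2: "(\<lambda>n. S (x (r n))) \<longlonglongrightarrow> l" by (simp add: o_def)
    have zr: "(\<lambda>n. S (S (x (r n))) - m\<^sup>2 *\<^sub>R x (r n)) \<longlonglongrightarrow> 0"
      using LIMSEQ_subseq_LIMSEQ[OF z lr(1)] by (simp add: o_def)
    have "(\<lambda>n. (1 / m\<^sup>2) *\<^sub>R (S (S (x (r n))) - (S (S (x (r n))) - m\<^sup>2 *\<^sub>R x (r n)))) \<longlonglongrightarrow> (1 / m\<^sup>2) *\<^sub>R (S l - 0)"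
      by (intro tendsto_intros bcl_tendsto[OF bS] lr2 zr)
    then have y: "(\<lambda>n. x (r n)) \<longlonglongrightarrow> (1 / m\<^sup>2) *\<^sub>R S l" using m by simp
    define y where "y = (1 / m\<^sup>2) *\<^sub>R S l"
    have yl: "(\<lambda>n. x (r n)) \<longlonglongrightarrow> y" using y by (simp add: y_def)
    have yN: "y \<in> N" using closed_sequentially[OF N(2) _ yl] x(1) by simp
    have y1: "norm y = 1"
      using tendsto_norm[OF yl] x(2) by (simp add: tendsto_const_iff)
    have SSy: "S (S y) = m\<^sup>2 *\<^sub>R y"
    proof -
      have "(\<lambda>n. S (S (x (r n))) - m\<^sup>2 *\<^sub>R x (r n)) \<longlonglongrightarrow> S (S y) - m\<^sup>2 *\<^sub>R y"
        by (intro tendsto_intros bcl_tendsto[OF bS] yl)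
      then show ?thesis using zr LIMSEQ_unique by fastforce
    qed
    show ?thesis
    proof (cases "S y + m *\<^sub>R y = 0")
      case True
      then have "S y = (- m) *\<^sub>R y" by (simp add: eq_neg_iff_add_eq_0)
      then show ?thesis using yN y1 by blast
    next
      case False
      have zN: "S y + m *\<^sub>R y \<in> N"
        using N(1,3) yN by (auto simp: scaleR_scaleC intro!: cspace.subspace_add cspace.subspace_scale)
      obtain u where u: "u \<in> N" "norm u = 1" "u = (1 / norm (S y + m *\<^sub>R y)) *\<^sub>R (S y + m *\<^sub>R y)"
        using normalize[OF zN False] by blast
      have "S (S y + m *\<^sub>R y) = m *\<^sub>R (S y + m *\<^sub>R y)"
        by (simp add: bcl_simps[OF bS] SSy scaleR_add_right power2_eq_square)
      then have "S u = m *\<^sub>R u" unfolding u(3) bcl_scaleR[OF bS] by (simp only: scaleR_left_commute)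
      then show ?thesis using u by blast
    qed
  qed
qed

text \<open>Eigenvalues are indexed by the basis vectors, so multiplicities are counted
  automatically; the values of \<open>l\<close> off \<open>E\<close> mean nothing.\<close>

definition eigen_basis :: "('a::complex_inner \<Rightarrow> 'a) \<Rightarrow> 'a set \<Rightarrow> ('a \<Rightarrow> real) \<Rightarrow> bool"
  where "eigen_basis S E l \<longleftrightarrow> is_onb E \<and> (\<forall>e\<in>E. S e = l e *\<^sub>R e)"

text \<open>The complement of a maximal orthonormal set of eigenvectors is closed and invariant; if
  it were nontrivial it would contain one more eigenvector.\<close>

lemma eigen_basis_exists:
  fixes S :: "'a::chilbert_space \<Rightarrow> 'a"
  assumes S: "selfadjoint S" "hs_bdd S C"
  shows "\<exists>E l. eigen_basis S E l"
proof -
  obtain E where E: "E \<subseteq> {x. \<exists>r::real. S x = r *\<^sub>R x}" "orthonormal E"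
    "\<And>F. orthonormal F \<Longrightarrow> E \<subseteq> F \<Longrightarrow> F \<subseteq> {x. \<exists>r::real. S x = r *\<^sub>R x} \<Longrightarrow> F = E"
    using maximal_orthonormal[of "{x. \<exists>r::real. S x = r *\<^sub>R x}"] by auto
  define N where "N = {x. \<forall>e\<in>E. cinner e x = 0}"
  have "N = (\<Inter>e\<in>E. {x. cinner e x = 0})" by (auto simp: N_def)
  then have clN: "closed N"
    by (auto intro!: closed_INT closed_Collect_eq bcl_continuous_on[OF bcl_cinner] continuous_on_const)
  have subN: "cspace.subspace N" by (auto simp: N_def cinner_simps intro!: cspace.subspaceI)
  have invN: "S x \<in> N" if "x \<in> N" for x
  proof -
    have "cinner e (S x) = 0" if e: "e \<in> E" for e
    proof -
      obtain r :: real where "S e = r *\<^sub>R e" using E(1) e by blast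
      then show ?thesis using selfadjoint_cinner[OF S(1), of e x] \<open>x \<in> N\<close> e by (simp add: cinner_simps N_def)
    qed
    then show ?thesis by (simp add: N_def)
  qed
  have "N = {0}"
  proof (rule ccontr)
    assume "N \<noteq> {0}"
    then obtain x r where x: "x \<in> N" "norm x = 1" "S x = (r::real) *\<^sub>R x"
      using eigenvector_exists[OF S subN clN invN] by blast
    then have "orthonormal (insert x E)" by (intro orthonormal_insert E) (auto simp: N_def)
    then have "insert x E = E" using E(1,3) x by blast
    then have "cinner x x = 0" using x(1) by (auto simp: N_def)
    then show False using x(2) by (simp add: cinner_self)
  qed
  then have onb: "is_onb E" using E(2) by (intro is_onbI) (auto simp: N_def)
  have "\<forall>e\<in>E. \<exists>r::real. S e = r *\<^sub>R e" using E(1) by blast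
  from bchoice[OF this] obtain l where "\<forall>e\<in>E. S e = (l e::real) *\<^sub>R e" by blast
  then show ?thesis using onb unfolding eigen_basis_def by blast
qed

section \<open>Functional calculus and eigenvalue counting\<close>

text \<open>The squared distance of a partial sum from \<open>x\<close> is the defect in Parseval's
  identity.\<close>

lemma onb_expansion:
  assumes "is_onb E"
  shows "((\<lambda>e. cinner e x *\<^sub>C e) has_sum x) E"
proof -
  have on: "orthonormal E" using assms by (simp add: is_onb_iff)
  have fin: "\<forall>\<^sub>F F in finite_subsets_at_top E. finite F \<and> F \<subseteq> E"
    by (rule eventually_finite_subsets_at_top_weakI) simp
  have "((\<lambda>F. \<Sum>e\<in>F. (norm (cinner e x))\<^sup>2) \<longlongrightarrow> (norm x)\<^sup>2) (finite_subsets_at_top E)"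
    using parseval[OF assms, of x] by (simp add: has_sum_def)
  then have lim: "((\<lambda>F. (norm x)\<^sup>2 - (\<Sum>e\<in>F. (norm (cinner e x))\<^sup>2)) \<longlongrightarrow> (norm x)\<^sup>2 - (norm x)\<^sup>2) (finite_subsets_at_top E)"
    by (intro tendsto_diff tendsto_const)
  have "\<forall>\<^sub>F F in finite_subsets_at_top E. (norm x)\<^sup>2 - (\<Sum>e\<in>F. (norm (cinner e x))\<^sup>2) = (norm ((\<Sum>e\<in>F. cinner e x *\<^sub>C e) - x))\<^sup>2"
    using fin
  proof eventually_elim
    case (elim F)
    then have F: "orthonormal F" "finite F" using on orthonormal_subset by auto
    show ?case using proj_on_pythagoras[OF F cspace.span_zero, of x] proj_on_norm[OF F, of x]
      by (simp add: proj_on_def norm_minus_commute)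
  qed
  from Lim_transform_eventually[OF lim this]
  have "((\<lambda>F. (norm ((\<Sum>e\<in>F. cinner e x *\<^sub>C e) - x))\<^sup>2) \<longlongrightarrow> 0) (finite_subsets_at_top E)" by simp
  then have "((\<lambda>F. (\<Sum>e\<in>F. cinner e x *\<^sub>C e) - x) \<longlongrightarrow> 0) (finite_subsets_at_top E)"
    by (simp add: tendsto_norm_zero_iff)
  then have "((\<lambda>F. \<Sum>e\<in>F. cinner e x *\<^sub>C e) \<longlongrightarrow> x) (finite_subsets_at_top E)"
    using Lim_null by blast
  then show ?thesis by (simp add: has_sum_def)
qed

lemma eigen_basis_orthogonal:
  assumes S: "selfadjoint S" and eb: "eigen_basis S E l" and e: "e \<in> E" "S x = r *\<^sub>R x" "l e \<noteq> r"
  shows "cinner e x = 0"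
proof -
  have "S e = l e *\<^sub>R e" using eb e(1) by (simp add: eigen_basis_def)
  then have "of_real (l e) * cinner e x = of_real r * cinner e x"
    using selfadjoint_cinner[OF S, of e x] e(2) by (simp add: cinner_simps)
  then show ?thesis using e(3) by simp
qed

text \<open>Absolute summability of \<open>f (l e)\<close> makes the series converge absolutely and
  defines a bounded operator. It holds for the two functions used: an indicator that is nonzero at
  finitely many eigenvalues, and the arctangent of a trace class operator.\<close>

lemma
  fixes S :: "'a::chilbert_space \<Rightarrow> 'a"
  assumes S: "selfadjoint S" and eb: "eigen_basis S E l" and summ: "(\<lambda>e. \<bar>f (l e)\<bar>) summable_on E"
  shows fun_calc_eq: "fun_calc f S = (\<lambda>x. \<Sum>\<^sub>\<infinity>e\<in>E. f (l e) *\<^sub>R (cinner e x *\<^sub>C e))"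
    and fun_calc_summable: "(\<lambda>e. f (l e) *\<^sub>R (cinner e x *\<^sub>C e)) summable_on E"
proof -
  define g where "g e x = f (l e) *\<^sub>R (cinner e x *\<^sub>C e)" for e x
  define R where "R x = (\<Sum>\<^sub>\<infinity>e\<in>E. g e x)" for x
  have onb: "is_onb E" and on: "orthonormal E" and Se: "\<And>e. e \<in> E \<Longrightarrow> S e = l e *\<^sub>R e"
    using eb by (auto simp: eigen_basis_def is_onb_iff)
  have ng: "norm (g e x) \<le> \<bar>f (l e)\<bar> * norm x" if "e \<in> E" for e x
    using norm_cinner_le[of e x] orthonormal_norm[OF on that]
    by (simp add: g_def norm_scaleC mult_left_mono)
  have nsum: "(\<lambda>e. norm (g e x)) summable_on E" for x
    by (rule summable_on_comparison_test[OF summable_on_cmult_left[OF summ, of "norm x"]]) (use ng in auto)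
  have sumg: "(\<lambda>e. g e x) summable_on E" for x by (rule abs_summable_summable[OF nsum])
  have R: "bounded_clinear R"
  proof (rule bclI[where C = "\<Sum>\<^sub>\<infinity>e\<in>E. \<bar>f (l e)\<bar>"])
    fix x y c
    have "g e (x + y) = g e x + g e y" for e by (simp add: g_def cinner_simps scaleC_add_left scaleR_add_right)
    then show "R (x + y) = R x + R y" by (simp add: R_def infsum_add sumg)
    have gc: "g e (c *\<^sub>C x) = c *\<^sub>C g e x" for e
      by (simp add: g_def cinner_simps scaleR_scaleC scaleC_scaleC mult.left_commute mult.assoc)
    have "((\<lambda>e. c *\<^sub>C g e x) has_sum c *\<^sub>C R x) E"
      unfolding R_def by (intro has_sum_bounded_linear[OF bcl_bounded_linear[OF bcl_const_scaleC[OF bcl_id]]] has_sum_infsum sumg)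
    then show "R (c *\<^sub>C x) = c *\<^sub>C R x" unfolding R_def gc by (rule infsumI)
    have "norm (R x) \<le> (\<Sum>\<^sub>\<infinity>e\<in>E. norm (g e x))" unfolding R_def by (rule norm_infsum_bound[OF nsum])
    also have "\<dots> \<le> (\<Sum>\<^sub>\<infinity>e\<in>E. \<bar>f (l e)\<bar> * norm x)"
      by (intro infsum_mono nsum summable_on_cmult_left summ ng)
    also have "\<dots> = (\<Sum>\<^sub>\<infinity>e\<in>E. \<bar>f (l e)\<bar>) * norm x" by (rule infsum_cmult_left) (use summ in simp)
    finally show "norm (R x) \<le> (\<Sum>\<^sub>\<infinity>e\<in>E. \<bar>f (l e)\<bar>) * norm x" .
  qed
  \<comment> \<open>On an eigenvector for \<open>r\<close>, basis vectors with another eigenvalue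
    have coefficient zero, so \<open>f r\<close> factors out of the whole expansion.\<close>
  have Reig: "R x = f r *\<^sub>R x" if x: "x \<in> eigenspace S r" for r x
  proof -
    have Sx: "S x = r *\<^sub>R x" using x by (simp add: eigenspace_def)
    have z: "cinner e x = 0" if "e \<in> E" "l e \<noteq> r" for e by (rule eigen_basis_orthogonal[OF S eb that(1) Sx that(2)])
    have "g e x = f r *\<^sub>R (cinner e x *\<^sub>C e)" if "e \<in> E" for e
      using z[OF that] by (cases "l e = r") (auto simp: g_def)
    then have "R x = (\<Sum>\<^sub>\<infinity>e\<in>E. f r *\<^sub>R (cinner e x *\<^sub>C e))" unfolding R_def by (intro infsum_cong)
    also have "\<dots> = f r *\<^sub>R x"
      by (intro infsumI has_sum_bounded_linear[OF bounded_linear_scaleR_right] onb_expansion onb)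
    finally show ?thesis .
  qed
  have "fun_calc f S = R"
    unfolding fun_calc_def
  proof (rule the_equality)
    show "bounded_clinear R \<and> (\<forall>r. \<forall>x\<in>eigenspace S r. R x = f r *\<^sub>R x)" using R Reig by blast
    fix R' assume R': "bounded_clinear R' \<and> (\<forall>r. \<forall>x\<in>eigenspace S r. R' x = f r *\<^sub>R x)"
    have "R' e = R e" if "e \<in> E" for e
    proof -
      have "e \<in> eigenspace S (l e)" using Se[OF that] by (simp add: eigenspace_def)
      then show ?thesis using R' Reig by simp
    qed
    then show "R' = R"
      using bcl_eq_on_span[of R' R E] R R' onb unfolding is_onb_iff by blast
  qed
  then show "fun_calc f S = (\<lambda>x. \<Sum>\<^sub>\<infinity>e\<in>E. f (l e) *\<^sub>R (cinner e x *\<^sub>C e))"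
    by (simp add: R_def[abs_def] g_def[abs_def])
  show "(\<lambda>e. f (l e) *\<^sub>R (cinner e x *\<^sub>C e)) summable_on E" using sumg[of x] by (simp add: g_def)
qed

section \<open>Eigenvalue counting functions\<close>

definition hs_selfadjoint :: "('a::complex_inner \<Rightarrow> 'a) \<Rightarrow> bool"
  where "hs_selfadjoint S \<longleftrightarrow> selfadjoint S \<and> (\<exists>C. hs_bdd S C)"

lemma hs_selfadjoint_add: "hs_selfadjoint S \<Longrightarrow> hs_selfadjoint T \<Longrightarrow> hs_selfadjoint (\<lambda>x. S x + T x)"
  unfolding hs_selfadjoint_def selfadjoint_def
  by (intro conjI bcl_plus) (use hs_bdd_add[of S _ T] in \<open>auto simp: cinner_simps\<close>)

lemma hs_selfadjoint_scaleR: "hs_selfadjoint S \<Longrightarrow> hs_selfadjoint (\<lambda>x. c *\<^sub>R S x)"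
  unfolding hs_selfadjoint_def selfadjoint_def
  by (intro conjI bcl_const_scaleR) (use hs_bdd_scaleR[of S] in \<open>auto simp: cinner_simps\<close>)

text \<open>Each eigenvalue above \<open>r\<close> uses up at least \<open>r\<^sup>2\<close> of the
  Hilbert--Schmidt bound, so there are finitely many. The spectral projection is then
  \<open>proj_on G\<close>, and the convention for infinite rank never enters.\<close>

lemma eigen_basis_count:
  fixes S :: "'a::chilbert_space \<Rightarrow> 'a"
  assumes S: "hs_selfadjoint S" and eb: "eigen_basis S E l" and r: "r > 0"
  shows "finite {e\<in>E. l e > r}" and "eig_count 1 r S = card {e\<in>E. l e > r}"
proof -
  define G where "G = {e\<in>E. l e > r}"
  obtain C where C: "hs_bdd S C" using S by (auto simp: hs_selfadjoint_def)
  have sa: "selfadjoint S" using S by (simp add: hs_selfadjoint_def)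
  have onb: "is_onb E" and on: "orthonormal E" and Se: "\<And>e. e \<in> E \<Longrightarrow> S e = l e *\<^sub>R e"
    using eb by (auto simp: eigen_basis_def is_onb_iff)
  have bound: "card F \<le> nat \<lceil>C / r\<^sup>2\<rceil>" if F: "F \<subseteq> G" "finite F" for F
  proof -
    have "real (card F) * r\<^sup>2 = (\<Sum>e\<in>F. r\<^sup>2)" by simp
    also have "\<dots> \<le> (\<Sum>e\<in>F. (norm (S e))\<^sup>2)"
    proof (rule sum_mono)
      fix e assume "e \<in> F"
      then have e: "e \<in> E" "r < l e" using F by (auto simp: G_def)
      then have "r\<^sup>2 \<le> (l e)\<^sup>2" using r by (intro power_mono) auto
      then show "r\<^sup>2 \<le> (norm (S e))\<^sup>2" using Se e orthonormal_norm[OF on] by simp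
    qed
    also have "\<dots> \<le> C" using F on by (intro hs_bddD[OF C]) (auto simp: G_def intro: orthonormal_subset)
    finally have "real (card F) \<le> C / r\<^sup>2" using r by (simp add: field_simps)
    then show ?thesis by linarith
  qed
  then have fG: "finite G" using finite_if_finite_subsets_card_bdd[of G "nat \<lceil>C / r\<^sup>2\<rceil>"] by blast
  then show "finite {e\<in>E. l e > r}" by (simp add: G_def)
  have onG: "orthonormal G" by (rule orthonormal_subset[OF on]) (simp add: G_def)
  have "(\<lambda>e. \<bar>indicator {r<..} (l e) :: real\<bar>) summable_on G" using fG by simp
  then have "(\<lambda>e. \<bar>indicator {r<..} (l e) :: real\<bar>) summable_on E"
    by (rule summable_on_cong_neutral[THEN iffD1, rotated 3]) (auto simp: G_def indicator_def)
  then have "fun_calc (indicator {r<..}) S x = proj_on G x" for x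
  proof -
    assume s: "(\<lambda>e. \<bar>indicator {r<..} (l e) :: real\<bar>) summable_on E"
    have "fun_calc (indicator {r<..}) S x = (\<Sum>\<^sub>\<infinity>e\<in>E. indicator {r<..} (l e) *\<^sub>R (cinner e x *\<^sub>C e))"
      using fun_calc_eq[where f = "indicator {r<..}", OF sa eb s] by simp
    also have "\<dots> = (\<Sum>\<^sub>\<infinity>e\<in>G. cinner e x *\<^sub>C e)"
      by (rule infsum_cong_neutral) (auto simp: G_def indicator_def)
    also have "\<dots> = proj_on G x" using fG by (simp add: proj_on_def)
    finally show ?thesis .
  qed
  then have eq: "fun_calc (indicator {r<..}) S = proj_on G" by (rule ext)
  have "range (proj_on G) = cspace.span G"
    using proj_on_span proj_on_span_eq[OF onG fG] by (metis rangeI subsetI subset_antisym image_subset_iff)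
  then have "op_rank (proj_on G) = card G"
    unfolding op_rank_def by (simp only: cspace.dim_span_eq_card_independent[OF orthonormal_independent[OF onG]])
  then show "eig_count 1 r S = card {e\<in>E. l e > r}"
    by (simp add: eig_count_def eq G_def)
qed

lemma hs_selfadjoint_eigen_basis:
  fixes S :: "'a::chilbert_space \<Rightarrow> 'a"
  shows "hs_selfadjoint S \<Longrightarrow> \<exists>E l. eigen_basis S E l"
  using eigen_basis_exists by (auto simp: hs_selfadjoint_def)

section \<open>Variational characterization of the counting function\<close>

lemma form_sum:
  assumes G: "finite G" "orthonormal G" "\<And>e. e \<in> G \<Longrightarrow> S e = l e *\<^sub>R e" and S: "bounded_clinear S"
  shows "Re (cinner (\<Sum>e\<in>G. c e *\<^sub>C e) (S (\<Sum>e\<in>G. c e *\<^sub>C e))) = (\<Sum>e\<in>G. l e * (norm (c e))\<^sup>2)"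
proof -
  have "S (\<Sum>e\<in>G. c e *\<^sub>C e) = (\<Sum>e\<in>G. (of_real (l e) * c e) *\<^sub>C e)"
    unfolding bcl_sum[OF S] using G(3)
    by (intro sum.cong) (simp_all add: bcl_scaleC[OF S] scaleR_scaleC scaleC_scaleC mult.commute)
  then have "cinner (\<Sum>e\<in>G. c e *\<^sub>C e) (S (\<Sum>e\<in>G. c e *\<^sub>C e))
      = (\<Sum>e\<in>G. cnj (c e) * cinner e (\<Sum>e\<in>G. (of_real (l e) * c e) *\<^sub>C e))"
    by (simp only: cinner_sum_left[of _ G] cinner_scaleC_left)
  also have "\<dots> = (\<Sum>e\<in>G. of_real (l e) * (c e * cnj (c e)))"
    using orthonormal_cinner_sum[OF G(2,1)] by (intro sum.cong) auto
  also have "\<dots> = of_real (\<Sum>e\<in>G. l e * (norm (c e))\<^sup>2)"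
    by (simp only: complex_norm_square[symmetric] of_real_sum of_real_mult)
  finally show ?thesis by simp
qed

text \<open>All that later comparisons need from the spectral theorem: \<open>G\<close> consists of
  the basis eigenvectors above \<open>r\<close>. On its complement the partial sums of the expansion
  see only eigenvalues up to \<open>r\<close>, and the inequality passes to the limit.\<close>

lemma eig_count_witness:
  fixes S :: "'a::chilbert_space \<Rightarrow> 'a"
  assumes S: "hs_selfadjoint S" and r: "r > 0"
  shows "\<exists>G. finite G \<and> orthonormal G \<and> card G = eig_count 1 r S \<and> (\<forall>e\<in>G. \<exists>q>r. S e = q *\<^sub>R e) \<and>
    (\<forall>x. (\<forall>e\<in>G. cinner e x = 0) \<longrightarrow> Re (cinner x (S x)) \<le> r * (norm x)\<^sup>2)"
proof -
  obtain E l where eb: "eigen_basis S E l" using hs_selfadjoint_eigen_basis[OF S] by blast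
  define G where "G = {e\<in>E. l e > r}"
  have onb: "is_onb E" and on: "orthonormal E" and Se: "\<And>e. e \<in> E \<Longrightarrow> S e = l e *\<^sub>R e"
    using eb by (auto simp: eigen_basis_def is_onb_iff)
  have bS: "bounded_clinear S" using S selfadjoint_bcl by (auto simp: hs_selfadjoint_def)
  have G: "finite G" "card G = eig_count 1 r S" using eigen_basis_count[OF S eb r] by (auto simp: G_def)
  have "Re (cinner x (S x)) \<le> r * (norm x)\<^sup>2" if x: "\<forall>e\<in>G. cinner e x = 0" for x
  proof (rule tendsto_le[OF finite_subsets_at_top_neq_bot])
    have lim: "((\<lambda>F. \<Sum>e\<in>F. cinner e x *\<^sub>C e) \<longlongrightarrow> x) (finite_subsets_at_top E)"
      using onb_expansion[OF onb, of x] by (simp add: has_sum_def)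
    show "((\<lambda>F. Re (cinner (\<Sum>e\<in>F. cinner e x *\<^sub>C e) (S (\<Sum>e\<in>F. cinner e x *\<^sub>C e)))) \<longlongrightarrow> Re (cinner x (S x))) (finite_subsets_at_top E)"
      unfolding inner_cinner[symmetric] by (intro tendsto_inner lim bcl_tendsto[OF bS])
    show "((\<lambda>F. r * (norm (\<Sum>e\<in>F. cinner e x *\<^sub>C e))\<^sup>2) \<longlongrightarrow> r * (norm x)\<^sup>2) (finite_subsets_at_top E)"
      by (intro tendsto_intros lim)
    show "\<forall>\<^sub>F F in finite_subsets_at_top E. Re (cinner (\<Sum>e\<in>F. cinner e x *\<^sub>C e) (S (\<Sum>e\<in>F. cinner e x *\<^sub>C e)))
        \<le> r * (norm (\<Sum>e\<in>F. cinner e x *\<^sub>C e))\<^sup>2"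
    proof (rule eventually_finite_subsets_at_top_weakI)
      fix F assume F: "finite F" "F \<subseteq> E"
      have onF: "orthonormal F" using on F orthonormal_subset by blast
      have SF: "\<And>e. e \<in> F \<Longrightarrow> S e = l e *\<^sub>R e" using F Se by blast
      have "l e * (norm (cinner e x))\<^sup>2 \<le> r * (norm (cinner e x))\<^sup>2" if "e \<in> F" for e
      proof (cases "l e > r")
        case True
        then have "cinner e x = 0" using x that F(2) by (auto simp: G_def)
        then show ?thesis by simp
      qed (auto intro!: mult_right_mono)
      then show "Re (cinner (\<Sum>e\<in>F. cinner e x *\<^sub>C e) (S (\<Sum>e\<in>F. cinner e x *\<^sub>C e))) \<le> r * (norm (\<Sum>e\<in>F. cinner e x *\<^sub>C e))\<^sup>2"
        using form_sum[OF F(1) onF SF bS, of "\<lambda>e. cinner e x"] orthonormal_sum_norm[OF onF F(1), of "\<lambda>e. cinner e x"]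
        by (simp add: sum_distrib_left sum_mono)
    qed
  qed
  moreover have "orthonormal G" by (rule orthonormal_subset[OF on]) (simp add: G_def)
  moreover have "\<forall>e\<in>G. \<exists>q>r. S e = q *\<^sub>R e" using Se by (auto simp: G_def)
  ultimately show ?thesis using G by blast
qed

text \<open>Dimension count. Otherwise \<open>proj_on E\<close> would be injective on the span of
  \<open>G\<close> and would map \<open>G\<close> to an independent set too large for the span of
  \<open>E\<close>.\<close>

lemma orthogonal_vector_exists:
  assumes "finite E" "finite G" "cspace.independent G" "card E < card G"
  shows "\<exists>x\<in>cspace.span G. x \<noteq> 0 \<and> (\<forall>e\<in>E. cinner e x = 0)"
proof (rule ccontr)
  assume no: "\<not> ?thesis"
  have b: "bounded_clinear (proj_on E)"
    unfolding proj_on_def[abs_def] 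
    by (rule bcl_sum_op) (rule bcl_compose[OF bcl_scaleC_left bcl_cinner])
  have "x = 0" if "x \<in> cspace.span G" "proj_on E x = 0" for x
  proof -
    have "cinner x (proj_on E x) = (\<Sum>e\<in>E. cinner e x * cnj (cinner e x))"
      unfolding proj_on_def cinner_sum_right cinner_scaleC_right
      by (intro sum.cong refl) (metis cinner_commute)
    then have "of_real (\<Sum>e\<in>E. (norm (cinner e x))\<^sup>2) = (of_real 0 :: complex)"
      using that(2) by (simp only: complex_norm_square of_real_sum) simp
    then have "(\<Sum>e\<in>E. (norm (cinner e x))\<^sup>2) = 0" using of_real_eq_iff by blast
    then have "\<forall>e\<in>E. cinner e x = 0" using assms(1) by (simp add: sum_nonneg_eq_0_iff)
    then show ?thesis using no that(1) by blast
  qed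
  then have inj: "inj_on (proj_on E) (cspace.span G)"
    using cspace_pair.linear_inj_on_iff_eq_0[OF bcl_linear[OF b] cspace.subspace_span] by blast
  then have "cspace.independent (proj_on E ` G)"
    by (rule cspace_pair.linear_independent_injective_image[OF bcl_linear[OF b] assms(3)])
  moreover have "proj_on E ` G \<subseteq> cspace.span E" using proj_on_span by blast
  ultimately have "card (proj_on E ` G) \<le> card E" using cspace.independent_span_bound[OF assms(1)] by blast
  moreover have "card (proj_on E ` G) = card G"
    by (rule card_image[OF inj_on_subset[OF inj cspace.span_superset]])
  ultimately show False using assms(4) by simp
qed

text \<open>Glazman's lemma. With fewer constraints than eigenvalues above \<open>r\<close>, some
  nonzero combination of the corresponding eigenvectors satisfies all constraints, while its form
  strictly exceeds \<open>r * (norm x)\<^sup>2\<close>.\<close>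

lemma eig_count_le_card:
  fixes S :: "'a::chilbert_space \<Rightarrow> 'a"
  assumes S: "hs_selfadjoint S" and r: "r > 0" and E: "finite E"
    and le: "\<And>x. (\<And>e. e \<in> E \<Longrightarrow> cinner e x = 0) \<Longrightarrow> Re (cinner x (S x)) \<le> r * (norm x)\<^sup>2"
  shows "eig_count 1 r S \<le> card E"
proof (rule ccontr)
  obtain G where G: "finite G" "orthonormal G" "card G = eig_count 1 r S" "\<forall>e\<in>G. \<exists>q>r. S e = q *\<^sub>R e"
    using eig_count_witness[OF S r] by blast
  from bchoice[OF G(4)] obtain l where l: "\<And>e. e \<in> G \<Longrightarrow> l e > r" "\<And>e. e \<in> G \<Longrightarrow> S e = l e *\<^sub>R e" by blast
  assume "\<not> ?thesis"
  then obtain x where x: "x \<in> cspace.span G" "x \<noteq> 0" "\<forall>e\<in>E. cinner e x = 0"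
    using orthogonal_vector_exists[OF E G(1) orthonormal_independent[OF G(2)]] G(3) by auto
  have xe: "x = (\<Sum>e\<in>G. cinner e x *\<^sub>C e)" using proj_on_span_eq[OF G(2,1) x(1)] by (simp add: proj_on_def)
  have bS: "bounded_clinear S" using S selfadjoint_bcl by (auto simp: hs_selfadjoint_def)
  have n: "(norm x)\<^sup>2 = (\<Sum>e\<in>G. (norm (cinner e x))\<^sup>2)"
    using orthonormal_sum_norm[OF G(2,1), of "\<lambda>e. cinner e x"] xe by simp
  then have "\<exists>e\<in>G. cinner e x \<noteq> 0" using x(2) by (intro ccontr[of "\<exists>e\<in>G. cinner e x \<noteq> 0"]) auto
  then obtain e0 where e0: "e0 \<in> G" "cinner e0 x \<noteq> 0" by blast
  have "r * (norm x)\<^sup>2 = (\<Sum>e\<in>G. r * (norm (cinner e x))\<^sup>2)" by (simp add: n sum_distrib_left)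
  also have "\<dots> < (\<Sum>e\<in>G. l e * (norm (cinner e x))\<^sup>2)"
  proof (rule sum_strict_mono_ex1[OF G(1)])
    show "\<forall>e\<in>G. r * (norm (cinner e x))\<^sup>2 \<le> l e * (norm (cinner e x))\<^sup>2"
      using l(1) by (auto intro!: mult_right_mono simp: less_imp_le)
    show "\<exists>e\<in>G. r * (norm (cinner e x))\<^sup>2 < l e * (norm (cinner e x))\<^sup>2"
      using l(1) e0 by (intro bexI[of _ e0]) auto
  qed
  also have "\<dots> = Re (cinner x (S x))"
    using form_sum[OF G(1,2) l(2) bS, of "\<lambda>e. cinner e x"] xe by simp
  finally show False using le[of x] x(3) by simp
qed

text \<open>The witness family of \<open>S'\<close> serves as the set of constraints for
  \<open>S\<close>. Only an implication between form bounds is required, so the two levels may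
  differ.\<close>

lemma eig_count_compare:
  fixes S S' :: "'a::chilbert_space \<Rightarrow> 'a"
  assumes S: "hs_selfadjoint S" "r > 0" and S': "hs_selfadjoint S'" "r' > 0"
    and le: "\<And>x. Re (cinner x (S' x)) \<le> r' * (norm x)\<^sup>2 \<Longrightarrow> Re (cinner x (S x)) \<le> r * (norm x)\<^sup>2"
  shows "eig_count 1 r S \<le> eig_count 1 r' S'"
proof -
  obtain G where G: "finite G" "card G = eig_count 1 r' S'"
    "\<And>x. (\<forall>e\<in>G. cinner e x = 0) \<longrightarrow> Re (cinner x (S' x)) \<le> r' * (norm x)\<^sup>2"
    using eig_count_witness[OF S'] by blast
  have "eig_count 1 r S \<le> card G" by (rule eig_count_le_card[OF S G(1) le]) (use G(3) in blast)
  then show ?thesis using G(2) by simp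
qed

lemma eig_count_mono:
  fixes S S' :: "'a::chilbert_space \<Rightarrow> 'a"
  assumes "hs_selfadjoint S" "hs_selfadjoint S'" "r > 0" "\<And>x. Re (cinner x (S x)) \<le> Re (cinner x (S' x))"
  shows "eig_count 1 r S \<le> eig_count 1 r S'"
  using assms(4) by (intro eig_count_compare assms) (meson order_trans)

lemma eig_count_scale:
  fixes S :: "'a::chilbert_space \<Rightarrow> 'a"
  assumes S: "hs_selfadjoint S" and "r > 0" "c > 0"
  shows "eig_count 1 (c * r) (\<lambda>x. c *\<^sub>R S x) = eig_count 1 r S"
proof (rule antisym)
  show "eig_count 1 (c * r) (\<lambda>x. c *\<^sub>R S x) \<le> eig_count 1 r S"
    by (rule eig_count_compare) (use assms hs_selfadjoint_scaleR[OF S] in \<open>auto simp: cinner_simps\<close>)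
  show "eig_count 1 r S \<le> eig_count 1 (c * r) (\<lambda>x. c *\<^sub>R S x)"
    by (rule eig_count_compare) (use assms hs_selfadjoint_scaleR[OF S] in \<open>auto simp: cinner_simps\<close>)
qed

text \<open>Orthogonality to both witness families bounds both forms, hence the form of the
  sum.\<close>

lemma weyl_inequality:
  fixes S T :: "'a::chilbert_space \<Rightarrow> 'a"
  assumes S: "hs_selfadjoint S" "r > 0" and T: "hs_selfadjoint T" "q > 0"
  shows "eig_count 1 (r + q) (\<lambda>x. S x + T x) \<le> eig_count 1 r S + eig_count 1 q T"
proof -
  obtain G where G: "finite G" "card G = eig_count 1 r S"
    "\<And>x. (\<forall>e\<in>G. cinner e x = 0) \<longrightarrow> Re (cinner x (S x)) \<le> r * (norm x)\<^sup>2"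
    using eig_count_witness[OF S] by blast
  obtain H where H: "finite H" "card H = eig_count 1 q T"
    "\<And>x. (\<forall>e\<in>H. cinner e x = 0) \<longrightarrow> Re (cinner x (T x)) \<le> q * (norm x)\<^sup>2"
    using eig_count_witness[OF T] by blast
  have "eig_count 1 (r + q) (\<lambda>x. S x + T x) \<le> card (G \<union> H)"
  proof (rule eig_count_le_card)
    fix x assume x: "\<And>e. e \<in> G \<union> H \<Longrightarrow> cinner e x = 0"
    then have "Re (cinner x (S x)) \<le> r * (norm x)\<^sup>2" "Re (cinner x (T x)) \<le> q * (norm x)\<^sup>2"
      using G(3) H(3) by blast+
    then show "Re (cinner x (S x + T x)) \<le> (r + q) * (norm x)\<^sup>2" by (simp add: cinner_simps distrib_right)
  qed (use S T G H hs_selfadjoint_add in auto)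
  also have "\<dots> \<le> card G + card H" by (rule card_Un_le)
  finally show ?thesis using G(2) H(2) by simp
qed

text \<open>Chebyshev's inequality for the squares of the eigenvalues.\<close>

lemma eig_count_hs_bound:
  fixes S :: "'a::chilbert_space \<Rightarrow> 'a"
  assumes "selfadjoint S" "hs_bdd S C" "r > 0"
  shows "real (eig_count 1 r S) \<le> C / r\<^sup>2"
proof -
  have "hs_selfadjoint S" using assms by (auto simp: hs_selfadjoint_def)
  then obtain G where G: "finite G" "orthonormal G" "card G = eig_count 1 r S" "\<forall>e\<in>G. \<exists>q>r. S e = q *\<^sub>R e"
    using eig_count_witness[of S r] assms(3) by blast
  have "real (card G) * r\<^sup>2 = (\<Sum>e\<in>G. r\<^sup>2)" by simp
  also have "\<dots> \<le> (\<Sum>e\<in>G. (norm (S e))\<^sup>2)"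
  proof (rule sum_mono)
    fix e assume e: "e \<in> G"
    then obtain q where q: "q > r" "S e = q *\<^sub>R e" using G(4) by blast
    have "r\<^sup>2 \<le> q\<^sup>2" using q assms(3) by (intro power_mono) auto
    then show "r\<^sup>2 \<le> (norm (S e))\<^sup>2" using q orthonormal_norm[OF G(2) e] by simp
  qed
  also have "\<dots> \<le> C" by (rule hs_bddD[OF assms(2) G(1,2)])
  finally show ?thesis using assms(3) G(3) by (simp add: field_simps)
qed

section \<open>The two products of an operator with its adjoint\<close>

lemma selfadjoint_star_product:
  fixes W :: "'a::chilbert_space \<Rightarrow> 'b::chilbert_space"
  assumes W: "bounded_clinear W"
  shows "selfadjoint (\<lambda>x. cadjoint W (W x))" "Re (cinner x (cadjoint W (W x))) = (norm (W x))\<^sup>2"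
  using bcl_compose[OF bcl_cadjoint[OF W] W]
  by (simp_all add: selfadjoint_def cadjoint_left[OF W] cadjoint_right[OF W] Re_cinner_self)

lemma hs_selfadjoint_star_product:
  fixes W :: "'a::chilbert_space \<Rightarrow> 'b::chilbert_space"
  assumes W: "hs_bdd W C"
  shows "hs_selfadjoint (\<lambda>x. cadjoint W (W x))"
proof -
  note b = hs_bdd_bcl[OF W]
  have "hs_bdd (\<lambda>x. cadjoint W (W x)) ((onorm (cadjoint W))\<^sup>2 * C)"
    by (intro hs_bdd_left[OF W] bcl_cadjoint b bcl_onorm)
  then show ?thesis using selfadjoint_star_product(1)[OF b] by (auto simp: hs_selfadjoint_def)
qed

lemma eig_count_star_le:
  fixes W :: "'a::chilbert_space \<Rightarrow> 'b::chilbert_space"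
  assumes W: "hs_bdd W C" and r: "r > 0"
  shows "eig_count 1 r (\<lambda>y. W (cadjoint W y)) \<le> eig_count 1 r (\<lambda>x. cadjoint W (W x))"
proof -
  note b = hs_bdd_bcl[OF W]
  have cc: "cadjoint (cadjoint W) = W" by (rule cadjoint_cadjoint[OF b])
  obtain G where G: "finite G" "card G = eig_count 1 r (\<lambda>x. cadjoint W (W x))"
    "\<And>x. (\<forall>e\<in>G. cinner e x = 0) \<longrightarrow> Re (cinner x (cadjoint W (W x))) \<le> r * (norm x)\<^sup>2"
    using eig_count_witness[OF hs_selfadjoint_star_product[OF W] r] by blast
  have "eig_count 1 r (\<lambda>y. W (cadjoint W y)) \<le> card (W ` G)"
  proof (rule eig_count_le_card[OF _ r])
    show "hs_selfadjoint (\<lambda>y. W (cadjoint W y))"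
      using hs_selfadjoint_star_product[OF hs_bdd_cadjoint[OF W]] by (simp add: cc)
    fix y assume y: "\<And>e. e \<in> W ` G \<Longrightarrow> cinner e y = 0"
    define v where "v = cadjoint W y"
    have "cinner e v = 0" if "e \<in> G" for e
      using y that by (simp add: v_def cadjoint_right[OF b])
    then have 1: "(norm (W v))\<^sup>2 \<le> r * (norm v)\<^sup>2"
      using G(3)[of v] by (simp add: selfadjoint_star_product(2)[OF b])
    have yv: "cinner y (W v) = of_real ((norm v)\<^sup>2)"
      unfolding cinner_self[symmetric] by (simp add: v_def cadjoint_left[OF b])
    then have "(norm v)\<^sup>2 \<le> norm y * norm (W v)"
      using norm_cinner_le[of y "W v"] by (simp add: norm_power)
    then have "((norm v)\<^sup>2)\<^sup>2 \<le> (norm y)\<^sup>2 * (norm (W v))\<^sup>2"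
      by (metis power_mono power_mult_distrib zero_le_power2)
    also have "\<dots> \<le> (norm y)\<^sup>2 * (r * (norm v)\<^sup>2)" by (intro mult_left_mono 1) auto
    finally have "(norm v)\<^sup>2 * (norm v)\<^sup>2 \<le> (norm v)\<^sup>2 * (r * (norm y)\<^sup>2)"
      by (simp add: power2_eq_square algebra_simps)
    then have "(norm v)\<^sup>2 \<le> r * (norm y)\<^sup>2"
    proof (cases "v = 0")
      case False
      then have "(norm v)\<^sup>2 > 0" by simp
      then show ?thesis by (rule mult_left_le_imp_le[rotated]) fact
    qed (use r in simp)
    then show "Re (cinner y (W (cadjoint W y))) \<le> r * (norm y)\<^sup>2"
      using yv by (simp add: v_def)
  qed (use G in auto)
  also have "\<dots> \<le> card G" by (rule card_image_le[OF G(1)])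
  finally show ?thesis using G(2) by simp
qed

lemma eig_count_star:
  fixes W :: "'a::chilbert_space \<Rightarrow> 'b::chilbert_space"
  assumes W: "hs_bdd W C" and r: "r > 0"
  shows "eig_count 1 r (\<lambda>y. W (cadjoint W y)) = eig_count 1 r (\<lambda>x. cadjoint W (W x))"
  using eig_count_star_le[OF W r] eig_count_star_le[OF hs_bdd_cadjoint[OF W] r]
  by (simp add: cadjoint_cadjoint[OF hs_bdd_bcl[OF W]])

section \<open>Trace class bounds and the arctangent of a positive operator\<close>

text \<open>Trace norm bound for positive operators, tested on finite orthonormal families for the
  same reason as \<open>hs_bdd\<close>.\<close>

definition trace_bdd :: "('a::complex_inner \<Rightarrow> 'a) \<Rightarrow> real \<Rightarrow> bool"
  where "trace_bdd B C \<longleftrightarrow> positive_op B \<and>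
    (\<forall>F. finite F \<longrightarrow> orthonormal F \<longrightarrow> (\<Sum>f\<in>F. Re (cinner f (B f))) \<le> C)"

lemma trace_bddD: "trace_bdd B C \<Longrightarrow> finite F \<Longrightarrow> orthonormal F \<Longrightarrow> (\<Sum>f\<in>F. Re (cinner f (B f))) \<le> C"
  by (simp add: trace_bdd_def)

lemma trace_bdd_positive: "trace_bdd B C \<Longrightarrow> positive_op B"
  by (simp add: trace_bdd_def)

lemma trace_bdd_mono: "trace_bdd B C \<Longrightarrow> C \<le> D \<Longrightarrow> trace_bdd B D"
  unfolding trace_bdd_def using order_trans by blast

text \<open>The operator inequality between the square of \<open>B\<close> and
  \<open>onorm B\<close> times \<open>B\<close>. It turns a trace bound into a Hilbert--Schmidt
  bound.\<close>

lemma positive_op_square_bound: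
  assumes "positive_op B"
  shows "(norm (B x))\<^sup>2 \<le> onorm B * Re (cinner x (B x))"
proof (cases "B x = 0")
  case False
  note b = positive_op_bcl[OF assms]
  have "(norm (cinner (B x) (B x)))\<^sup>2 \<le> Re (cinner (B x) (B (B x))) * Re (cinner x (B x))"
    by (rule positive_op_cauchy_schwarz[OF assms])
  also have "\<dots> \<le> (norm (B x) * (onorm B * norm (B x))) * Re (cinner x (B x))"
    by (intro mult_right_mono order_trans[OF Re_cinner_le] mult_left_mono bcl_onorm[OF b] positive_op_nonneg assms) auto
  finally have "(norm (B x))\<^sup>2 * (norm (B x))\<^sup>2 \<le> (norm (B x))\<^sup>2 * (onorm B * Re (cinner x (B x)))"
    by (simp add: cinner_self norm_power del: of_real_power) (simp add: power2_eq_square algebra_simps)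
  moreover have "0 < (norm (B x))\<^sup>2" using False by simp
  ultimately show ?thesis by (rule mult_left_le_imp_le)
next
  case True
  then show ?thesis by simp
qed

lemma trace_bdd_hs_selfadjoint:
  assumes "trace_bdd B C" shows "hs_selfadjoint B"
proof -
  note p = trace_bdd_positive[OF assms] and b = positive_op_bcl[OF trace_bdd_positive[OF assms]]
  have "(\<Sum>f\<in>F. (norm (B f))\<^sup>2) \<le> onorm B * C" if F: "finite F" "orthonormal F" for F
  proof -
    have "(\<Sum>f\<in>F. (norm (B f))\<^sup>2) \<le> (\<Sum>f\<in>F. onorm B * Re (cinner f (B f)))"
      by (intro sum_mono positive_op_square_bound p)
    also have "\<dots> \<le> onorm B * C"
      unfolding sum_distrib_left[symmetric] by (intro mult_left_mono trace_bddD[OF assms] F bcl_onorm_nonneg b)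
    finally show ?thesis .
  qed
  then have "hs_bdd B (onorm B * C)" using b by (simp add: hs_bdd_def)
  then show ?thesis using positive_op_selfadjoint[OF p] by (auto simp: hs_selfadjoint_def)
qed

lemma trace_bdd_scaleR:
  fixes B :: "'a::complex_inner \<Rightarrow> 'a"
  assumes "trace_bdd B C" "c \<ge> 0" shows "trace_bdd (\<lambda>x. c *\<^sub>R B x) (c * C)"
  unfolding trace_bdd_def
proof (intro conjI allI impI)
  note p = trace_bdd_positive[OF assms(1)]
  have "selfadjoint (\<lambda>x. c *\<^sub>R B x)"
    using positive_op_selfadjoint[OF p] by (simp add: selfadjoint_def cinner_simps bcl_const_scaleR)
  then show "positive_op (\<lambda>x. c *\<^sub>R B x)"
    by (rule positive_opI) (use positive_op_nonneg[OF p] assms(2) in \<open>simp add: cinner_simps\<close>)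
  fix F :: "'a set" assume "finite F" "orthonormal F"
  then show "(\<Sum>f\<in>F. Re (cinner f (c *\<^sub>R B f))) \<le> c * C"
    using mult_left_mono[OF trace_bddD[OF assms(1)] assms(2), of F] by (simp add: cinner_simps sum_distrib_left)
qed

lemma trace_bdd_sum:
  fixes B :: "'i \<Rightarrow> 'a::complex_inner \<Rightarrow> 'a"
  assumes "finite I" "\<And>i. i \<in> I \<Longrightarrow> trace_bdd (B i) (C i)"
  shows "trace_bdd (\<lambda>x. \<Sum>i\<in>I. B i x) (\<Sum>i\<in>I. C i)"
  unfolding trace_bdd_def
proof (intro conjI allI impI)
  have p: "positive_op (B i)" if "i \<in> I" for i using trace_bdd_positive assms(2) that by blast
  have sa: "selfadjoint (B i)" if "i \<in> I" for i using positive_op_selfadjoint p that by blast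
  have "bounded_clinear (\<lambda>x. \<Sum>i\<in>I. B i x)" by (rule bcl_sum_op) (use positive_op_bcl p in blast)
  moreover have "(\<Sum>i\<in>I. cinner (B i x) y) = (\<Sum>i\<in>I. cinner x (B i y))" for x y
    by (rule sum.cong) (use selfadjoint_cinner[OF sa] in auto)
  ultimately have "selfadjoint (\<lambda>x. \<Sum>i\<in>I. B i x)" by (simp add: selfadjoint_def cinner_simps)
  then show "positive_op (\<lambda>x. \<Sum>i\<in>I. B i x)"
    by (rule positive_opI) (use positive_op_nonneg[OF p] in \<open>simp add: cinner_simps sum_nonneg\<close>)
  fix F :: "'a set" assume F: "finite F" "orthonormal F"
  have "(\<Sum>f\<in>F. Re (cinner f (\<Sum>i\<in>I. B i f))) = (\<Sum>i\<in>I. \<Sum>f\<in>F. Re (cinner f (B i f)))"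
    by (simp add: cinner_simps sum.swap[of _ F I])
  also have "\<dots> \<le> (\<Sum>i\<in>I. C i)" by (intro sum_mono trace_bddD assms F)
  finally show "(\<Sum>f\<in>F. Re (cinner f (\<Sum>i\<in>I. B i f))) \<le> (\<Sum>i\<in>I. C i)" .
qed

text \<open>The constant is carried over unchanged: the trace of either product is the squared
  Hilbert--Schmidt norm of \<open>W\<close>.\<close>

lemma trace_bdd_star:
  fixes W :: "'a::chilbert_space \<Rightarrow> 'b::chilbert_space"
  assumes W: "hs_bdd W C"
  shows "trace_bdd (\<lambda>x. cadjoint W (W x)) C" "trace_bdd (\<lambda>y. W (cadjoint W y)) C"
proof -
  have *: "trace_bdd (\<lambda>x. cadjoint W (W x)) C" if "hs_bdd W C"
    for W :: "'c::chilbert_space \<Rightarrow> 'd::chilbert_space"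
    unfolding trace_bdd_def
  proof (intro conjI allI impI)
    note b = hs_bdd_bcl[OF that]
    show "positive_op (\<lambda>x. cadjoint W (W x))"
      by (rule positive_opI[OF selfadjoint_star_product(1)[OF b]]) (simp add: selfadjoint_star_product(2)[OF b])
    fix F :: "'c set" assume "finite F" "orthonormal F"
    then show "(\<Sum>f\<in>F. Re (cinner f (cadjoint W (W f)))) \<le> C"
      using hs_bddD[OF that] by (simp add: selfadjoint_star_product(2)[OF b])
  qed
  show "trace_bdd (\<lambda>x. cadjoint W (W x)) C" by (rule *[OF W])
  show "trace_bdd (\<lambda>y. W (cadjoint W y)) C"
    using *[OF hs_bdd_cadjoint[OF W]] by (simp add: cadjoint_cadjoint[OF hs_bdd_bcl[OF W]])
qed

lemma
  fixes B :: "'a::chilbert_space \<Rightarrow> 'a"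
  assumes B: "trace_bdd B C" and eb: "eigen_basis B E l"
  shows trace_bdd_eigen_nonneg: "e \<in> E \<Longrightarrow> 0 \<le> l e"
    and trace_bdd_eigen_summable: "l summable_on E"
    and trace_bdd_eigen_infsum: "infsum l E \<le> C"
proof -
  have on: "orthonormal E" and Se: "\<And>e. e \<in> E \<Longrightarrow> B e = l e *\<^sub>R e"
    using eb by (auto simp: eigen_basis_def is_onb_iff)
  have le: "Re (cinner e (B e)) = l e" if "e \<in> E" for e
    using Se[OF that] orthonormal_norm[OF on that] by (simp add: cinner_simps cinner_self)
  have fin: "sum l F \<le> C" if "finite F" "F \<subseteq> E" for F
  proof -
    have "sum l F = (\<Sum>f\<in>F. Re (cinner f (B f)))" using that le by (intro sum.cong) auto
    then show ?thesis using trace_bddD[OF B that(1) orthonormal_subset[OF on that(2)]] by simp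
  qed
  show nn: "0 \<le> l e" if "e \<in> E" for e
    using positive_op_nonneg[OF trace_bdd_positive[OF B], of e] le[OF that] by simp
  show s: "l summable_on E"
    using nn fin by (intro nonneg_bdd_above_summable_on bdd_aboveI[of _ C]) auto
  show "infsum l E \<le> C" by (rule infsum_le_finite_sums[OF s fin])
qed

lemma arctan_le_self: "0 \<le> x \<Longrightarrow> arctan x \<le> x"
proof -
  assume x: "0 \<le> x"
  have "0 - arctan 0 \<le> x - arctan x"
  proof (rule DERIV_nonneg_imp_nondecreasing[OF x])
    fix y :: real
    have "((\<lambda>x. x - arctan x) has_real_derivative 1 - inverse (1 + y\<^sup>2)) (at y)"
      by (auto intro!: derivative_eq_intros)
    moreover have "0 \<le> 1 - inverse (1 + y\<^sup>2)" by (simp add: inverse_eq_divide divide_le_eq add_pos_nonneg)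
    ultimately show "\<exists>d. ((\<lambda>x. x - arctan x) has_real_derivative d) (at y) \<and> 0 \<le> d" by blast
  qed
  then show ?thesis by simp
qed

text \<open>The trace is taken in \<open>some_onb\<close>, the eigenvalues live on \<open>E\<close>.
  The nonnegative double series with terms \<open>arctan (l e) * (norm (cinner e b))\<^sup>2\<close>
  connects them: Parseval sums it over \<open>b\<close>, the functional calculus over
  \<open>e\<close>.\<close>

lemma trace_fun_calc_arctan:
  fixes B :: "'a::chilbert_space \<Rightarrow> 'a"
  assumes B: "trace_bdd B C" and eb: "eigen_basis B E l"
  shows "Re (trace_op (fun_calc arctan B)) = (\<Sum>\<^sub>\<infinity>e\<in>E. arctan (l e))"
    and "(\<lambda>e. arctan (l e)) summable_on E"
proof -
  let ?E = "some_onb :: 'a set"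
  have onb: "is_onb ?E" by (rule is_onb_some_onb)
  have on: "orthonormal E" using eb by (auto simp: eigen_basis_def is_onb_iff)
  have sa: "selfadjoint B" using positive_op_selfadjoint trace_bdd_positive B by blast
  have nn: "\<And>e. e \<in> E \<Longrightarrow> 0 \<le> arctan (l e)" using trace_bdd_eigen_nonneg[OF B eb] by simp
  show s: "(\<lambda>e. arctan (l e)) summable_on E"
    by (rule summable_on_comparison_test[OF trace_bdd_eigen_summable[OF B eb]])
      (use trace_bdd_eigen_nonneg[OF B eb] arctan_le_self in auto)
  then have sabs: "(\<lambda>e. \<bar>arctan (l e)\<bar>) summable_on E" using nn by (simp cong: summable_on_cong)
  define a where "a e b = arctan (l e) * (norm (cinner e b))\<^sup>2" for e b
  have a_nn: "0 \<le> a e b" if "e \<in> E" for e b using nn[OF that] by (simp add: a_def)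
  have h: "((\<lambda>b. a e b) has_sum arctan (l e)) ?E" if "e \<in> E" for e
  proof -
    have "((\<lambda>b. (norm (cinner b e))\<^sup>2) has_sum (norm e)\<^sup>2) ?E" by (rule parseval[OF onb])
    then have "((\<lambda>b. (norm (cinner e b))\<^sup>2) has_sum 1) ?E"
      using orthonormal_norm[OF on that] by (simp add: norm_cinner_commute)
    from has_sum_cmult_right[OF this, of "arctan (l e)"] show ?thesis by (simp add: a_def)
  qed
  have "(\<lambda>p. norm (case p of (e, b) \<Rightarrow> a e b)) summable_on (E \<times> ?E)"
    unfolding Infinite_Sum.abs_summable_on_Sigma_iff
  proof (intro conjI ballI)
    fix e assume e: "e \<in> E"
    show "(\<lambda>b. norm (case (e, b) of (e, b) \<Rightarrow> a e b)) summable_on ?E"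
      using has_sum_imp_summable[OF h[OF e]] a_nn[OF e] by simp
  next
    have "(\<Sum>\<^sub>\<infinity>b\<in>?E. norm (case (e, b) of (e, b) \<Rightarrow> a e b)) = arctan (l e)" if "e \<in> E" for e
      using infsumI[OF h[OF that]] a_nn[OF that] by simp
    then show "(\<lambda>e. norm (\<Sum>\<^sub>\<infinity>b\<in>?E. norm (case (e, b) of (e, b) \<Rightarrow> a e b))) summable_on E"
      using sabs by (simp cong: summable_on_cong)
  qed
  then have "(\<lambda>(e, b). a e b) summable_on (E \<times> ?E)" by (rule abs_summable_summable)
  from infsum_swap_banach[OF this]
  have swap: "(\<Sum>\<^sub>\<infinity>b\<in>?E. \<Sum>\<^sub>\<infinity>e\<in>E. a e b) = (\<Sum>\<^sub>\<infinity>e\<in>E. arctan (l e))"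
    using infsumI[OF h] by (simp cong: infsum_cong)
  have fc: "cinner b (fun_calc arctan B b) = of_real (\<Sum>\<^sub>\<infinity>e\<in>E. a e b)" for b
  proof -
    have s1: "(\<lambda>e. arctan (l e) *\<^sub>R (cinner e b *\<^sub>C e)) summable_on E"
      by (rule fun_calc_summable[OF sa eb sabs])
    have "cinner b (fun_calc arctan B b) = (\<Sum>\<^sub>\<infinity>e\<in>E. cinner b (arctan (l e) *\<^sub>R (cinner e b *\<^sub>C e)))"
      unfolding fun_calc_eq[OF sa eb sabs]
      by (rule infsumI[symmetric]) (rule has_sum_bounded_linear[OF bcl_bounded_linear[OF bcl_cinner] has_sum_infsum[OF s1]])
    also have "\<dots> = (\<Sum>\<^sub>\<infinity>e\<in>E. complex_of_real (a e b))"
    proof (rule infsum_cong)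
      fix e
      have "cinner e b * cinner b e = of_real ((norm (cinner e b))\<^sup>2)"
        unfolding complex_norm_square using cinner_commute[of b e] by simp
      then show "cinner b (arctan (l e) *\<^sub>R (cinner e b *\<^sub>C e)) = complex_of_real (a e b)"
        by (simp add: cinner_scaleR_right cinner_scaleC_right a_def)
    qed
    also have "\<dots> = of_real (\<Sum>\<^sub>\<infinity>e\<in>E. a e b)"
    proof (rule infsumI, rule has_sum_of_real, rule has_sum_infsum)
      have "norm (cinner e b) \<le> norm b" if "e \<in> E" for e
        using norm_cinner_le[of e b] orthonormal_norm[OF on that] by simp
      then show "(\<lambda>e. a e b) summable_on E"
        using nn by (intro summable_on_comparison_test[OF summable_on_cmult_left[OF s, of "(norm b)\<^sup>2"]])
          (auto simp: a_def intro!: mult_left_mono power_mono)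
    qed
    finally show ?thesis .
  qed
  have sb: "(\<lambda>b. \<Sum>\<^sub>\<infinity>e\<in>E. a e b) summable_on ?E"
  proof -
    have "(\<lambda>(e, b). a e b) summable_on (E \<times> ?E)" by fact
    then have "(\<lambda>(b, e). a e b) summable_on (?E \<times> E)"
      by (subst summable_on_reindex_bij_betw[of prod.swap "E \<times> ?E" "?E \<times> E", symmetric])
        (auto simp: bij_betw_def inj_on_def case_prod_unfold image_def)
    from summable_on_Sigma_banach[OF this] show ?thesis by simp
  qed
  have "trace_op (fun_calc arctan B) = (\<Sum>\<^sub>\<infinity>b\<in>?E. complex_of_real (\<Sum>\<^sub>\<infinity>e\<in>E. a e b))"
    by (simp add: trace_op_def fc)
  also have "\<dots> = of_real (\<Sum>\<^sub>\<infinity>b\<in>?E. \<Sum>\<^sub>\<infinity>e\<in>E. a e b)"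
    by (rule infsumI, rule has_sum_of_real, rule has_sum_infsum[OF sb])
  finally show "Re (trace_op (fun_calc arctan B)) = (\<Sum>\<^sub>\<infinity>e\<in>E. arctan (l e))"
    unfolding swap by simp
qed

section \<open>Averaged eigenvalue counting functions\<close>

lemma nn_integral_cauchy_tail:
  assumes "c > 0"
  shows "(\<integral>\<^sup>+t. ennreal (if t * c > 1 then 1 / (1 + t\<^sup>2) else 0) \<partial>lborel) = ennreal (arctan c)"
proof -
  have "(\<integral>\<^sup>+t. ennreal (if t * c > 1 then 1 / (1 + t\<^sup>2) else 0) \<partial>lborel)
      = (\<integral>\<^sup>+t. ennreal (1 / (1 + t\<^sup>2)) * indicator {1 / c ..} t \<partial>lborel)"
  proof (rule nn_integral_cong_AE)
    \<comment> \<open>The strict inequality and the closed half line differ only at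
      \<open>t = 1 / c\<close>, a null set.\<close>
    show "AE t in lborel. ennreal (if t * c > 1 then 1 / (1 + t\<^sup>2) else 0) = ennreal (1 / (1 + t\<^sup>2)) * indicator {1 / c ..} t"
      using AE_lborel_singleton[of "1 / c"]
    proof eventually_elim
      case (elim t)
      then have "t * c > 1 \<longleftrightarrow> 1 / c \<le> t" using assms by (auto simp: field_simps less_le)
      then show ?case by (simp add: indicator_def)
    qed
  qed
  also have "\<dots> = ennreal (pi / 2 - arctan (1 / c))"
  proof (rule nn_integral_FTC_atLeast)
    show "(arctan has_real_derivative 1 / (1 + x\<^sup>2)) (at x)" for x
      using DERIV_arctan[of x] by (simp add: inverse_eq_divide)
    show "(arctan \<longlongrightarrow> pi / 2) at_top" by (rule tendsto_arctan_at_top)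
  qed auto
  also have "pi / 2 - arctan (1 / c) = arctan c"
    using arctan_inverse[of c] assms by (simp add: inverse_eq_divide)
  finally show ?thesis .
qed

lemma cauchy_integrable: "integrable lborel (\<lambda>t::real. 1 / (1 + t\<^sup>2))"
proof (rule integrableI_nonneg)
  have 1: "(\<integral>\<^sup>+t. ennreal (if t > (0::real) then 1 / (1 + t\<^sup>2) else 0) \<partial>lborel) \<le> ennreal (pi / 2)"
  proof -
    have "(\<integral>\<^sup>+t. ennreal (if t > (0::real) then 1 / (1 + t\<^sup>2) else 0) \<partial>lborel)
        \<le> (\<integral>\<^sup>+t. ennreal (1 / (1 + t\<^sup>2)) * indicator {0::real ..} t \<partial>lborel)"
      by (rule nn_integral_mono) (simp add: indicator_def)
    also have "\<dots> = ennreal (pi / 2 - arctan 0)"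
    proof (rule nn_integral_FTC_atLeast)
      show "(arctan has_real_derivative 1 / (1 + x\<^sup>2)) (at x)" for x
        using DERIV_arctan[of x] by (simp add: inverse_eq_divide)
      show "(arctan \<longlongrightarrow> pi / 2) at_top" by (rule tendsto_arctan_at_top)
    qed auto
    finally show ?thesis by simp
  qed
  have 2: "(\<integral>\<^sup>+t. ennreal (if t < (0::real) then 1 / (1 + t\<^sup>2) else 0) \<partial>lborel)
      = (\<integral>\<^sup>+t. ennreal (if t > (0::real) then 1 / (1 + t\<^sup>2) else 0) \<partial>lborel)"
    by (subst nn_integral_real_affine[of _ "-1" 0]) (auto intro!: nn_integral_cong)
  have "(\<integral>\<^sup>+t. ennreal (1 / (1 + t\<^sup>2)) \<partial>lborel)
      = (\<integral>\<^sup>+t. ennreal (if t > (0::real) then 1 / (1 + t\<^sup>2) else 0) + ennreal (if t < 0 then 1 / (1 + t\<^sup>2) else 0) \<partial>lborel)"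
    by (rule nn_integral_cong_AE, use AE_lborel_singleton[of "0::real"] in eventually_elim) auto
  also have "\<dots> = (\<integral>\<^sup>+t. ennreal (if t > (0::real) then 1 / (1 + t\<^sup>2) else 0) \<partial>lborel)
      + (\<integral>\<^sup>+t. ennreal (if t < (0::real) then 1 / (1 + t\<^sup>2) else 0) \<partial>lborel)"
    by (rule nn_integral_add) auto
  also have "\<dots> < \<infinity>" unfolding 2 using 1 by (simp add: order_le_less_trans[OF _ ennreal_less_top])
  finally show "(\<integral>\<^sup>+t. ennreal (1 / (1 + t\<^sup>2)) \<partial>lborel) < \<infinity>" .
qed auto

text \<open>This integral is the trace of \<open>arctan B\<close> for positive \<open>B\<close>.\<close>

definition arctan_count :: "('a::complex_inner \<Rightarrow> 'a) \<Rightarrow> real"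
  where "arctan_count B = (LINT t|lborel. real (eig_count 1 1 (\<lambda>x. t *\<^sub>R B x)) / (1 + t\<^sup>2))"

lemma eigen_basis_scaleR: "eigen_basis B E l \<Longrightarrow> eigen_basis (\<lambda>x. t *\<^sub>R B x) E (\<lambda>e. t * l e)"
  by (auto simp: eigen_basis_def)

text \<open>Tonelli: the integrand is a sum over eigenvalues of cut-off Cauchy densities, and each
  of them integrates to one arctangent.\<close>

lemma
  fixes B :: "'a::chilbert_space \<Rightarrow> 'a"
  assumes B: "trace_bdd B C" and eb: "eigen_basis B E l"
  shows arctan_count_integrable: "integrable lborel (\<lambda>t. real (eig_count 1 1 (\<lambda>x. t *\<^sub>R B x)) / (1 + t\<^sup>2))"
    and arctan_count_eq: "arctan_count B = (\<Sum>\<^sub>\<infinity>e\<in>E. arctan (l e))"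
proof -
  \<comment> \<open>A zero eigenvalue never satisfies \<open>t * l e > 1\<close>. Summability makes
    the set of the others countable, as the exchange of integral and sum requires.\<close>
  let ?E = "{e\<in>E. l e \<noteq> 0}"
  let ?f = "\<lambda>t. real (eig_count 1 1 (\<lambda>x. t *\<^sub>R B x)) / (1 + t\<^sup>2)"
  note nn = trace_bdd_eigen_nonneg[OF B eb] and hs = trace_bdd_hs_selfadjoint[OF B]
  have s: "(\<lambda>e. arctan (l e)) summable_on E" by (rule trace_fun_calc_arctan[OF B eb])
  have cnt: "countable ?E" by (rule summable_countable_real[OF trace_bdd_eigen_summable[OF B eb]])
  have pos: "0 < l e" if "e \<in> ?E" for e using nn[of e] that by auto
  have ev: "ennreal (?f t) = (\<integral>\<^sup>+e. ennreal (if t * l e > 1 then 1 / (1 + t\<^sup>2) else 0) \<partial>count_space ?E)" for t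
  proof -
    let ?A = "{e\<in>E. t * l e > 1}"
    have A: "finite ?A" "eig_count 1 1 (\<lambda>x. t *\<^sub>R B x) = card ?A"
      using eigen_basis_count[OF hs_selfadjoint_scaleR[OF hs] eigen_basis_scaleR[OF eb], of 1] by auto
    have "(\<integral>\<^sup>+e. ennreal (if t * l e > 1 then 1 / (1 + t\<^sup>2) else 0) \<partial>count_space ?E)
        = (\<Sum>e\<in>?A. ennreal (if t * l e > 1 then 1 / (1 + t\<^sup>2) else 0))"
      by (rule nn_integral_count_space'[OF A(1)]) auto
    also have "\<dots> = (\<Sum>e\<in>?A. ennreal (1 / (1 + t\<^sup>2)))" by (rule sum.cong) auto
    also have "\<dots> = ennreal (?f t)" by (simp add: A(2) ennreal_of_nat_eq_real_of_nat flip: ennreal_mult)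
    finally show ?thesis by simp
  qed
  have "(\<integral>\<^sup>+t. ennreal (?f t) \<partial>lborel)
      = (\<integral>\<^sup>+e. (\<integral>\<^sup>+t. ennreal (if t * l e > 1 then 1 / (1 + t\<^sup>2) else 0) \<partial>lborel) \<partial>count_space ?E)"
    unfolding ev by (rule nn_integral_count_space_nn_integral[OF cnt]) measurable
  also have "\<dots> = (\<integral>\<^sup>+e. ennreal (arctan (l e)) \<partial>count_space ?E)"
    by (rule nn_integral_cong) (use pos nn_integral_cauchy_tail in auto)
  also have "\<dots> = ennreal (infsum (\<lambda>e. arctan (l e)) ?E)"
  proof -
    have "(\<lambda>e. arctan (l e)) summable_on ?E" by (rule summable_on_subset[OF s]) auto
    moreover have "(\<lambda>e. norm (arctan (l e))) summable_on ?E \<longleftrightarrow> (\<lambda>e. arctan (l e)) summable_on ?E"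
    proof (rule summable_on_cong)
      fix e assume "e \<in> ?E"
      from pos[OF this] show "norm (arctan (l e)) = arctan (l e)" by simp
    qed
    ultimately have "(\<lambda>e. norm (arctan (l e))) summable_on ?E" by simp
    then have "Infinite_Set_Sum.abs_summable_on (\<lambda>e. arctan (l e)) ?E" by (simp only: abs_summable_equivalent)
    from nn_integral_conv_infsetsum[OF this] infsetsum_infsum[OF this] show ?thesis
      using pos by (simp add: less_imp_le)
  qed
  also have "infsum (\<lambda>e. arctan (l e)) ?E = infsum (\<lambda>e. arctan (l e)) E"
    by (rule infsum_cong_neutral) auto
  finally have int: "(\<integral>\<^sup>+t. ennreal (?f t) \<partial>lborel) = ennreal (\<Sum>\<^sub>\<infinity>e\<in>E. arctan (l e))" .
  \<comment> \<open>Measurability of the count in \<open>t\<close> comes from monotonicity, which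
    holds because \<open>B\<close> is positive.\<close>
  have "mono (\<lambda>t. real (eig_count 1 1 (\<lambda>x. t *\<^sub>R B x)))"
    using positive_op_nonneg[OF trace_bdd_positive[OF B]]
    by (auto simp: mono_def cinner_simps intro!: eig_count_mono hs_selfadjoint_scaleR hs mult_right_mono)
  then have [measurable]: "(\<lambda>t. real (eig_count 1 1 (\<lambda>x. t *\<^sub>R B x))) \<in> borel_measurable borel"
    by (rule borel_measurable_mono)
  show "integrable lborel ?f"
    by (rule integrableI_nonneg) (auto simp: int)
  have "0 \<le> (\<Sum>\<^sub>\<infinity>e\<in>E. arctan (l e))" using nn by (intro infsum_nonneg) auto
  then show "arctan_count B = (\<Sum>\<^sub>\<infinity>e\<in>E. arctan (l e))"
    unfolding arctan_count_def by (subst integral_eq_nn_integral) (auto simp: int)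
qed

text \<open>By \<open>arctan x \<le> x\<close>; this is how the trace bound of the regular channels
  becomes a bounded error.\<close>

lemma arctan_count_le:
  fixes B :: "'a::chilbert_space \<Rightarrow> 'a"
  assumes B: "trace_bdd B C" shows "arctan_count B \<le> C"
proof -
  obtain E l where eb: "eigen_basis B E l"
    using hs_selfadjoint_eigen_basis[OF trace_bdd_hs_selfadjoint[OF B]] by blast
  have "(\<Sum>\<^sub>\<infinity>e\<in>E. arctan (l e)) \<le> infsum l E"
    by (intro infsum_mono trace_fun_calc_arctan[OF B eb] trace_bdd_eigen_summable[OF B eb] arctan_le_self
        trace_bdd_eigen_nonneg[OF B eb])
  then show ?thesis using arctan_count_eq[OF B eb] trace_bdd_eigen_infsum[OF B eb] by simp
qed

lemma trace_arctan_eq_arctan_count: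
  fixes B :: "'a::chilbert_space \<Rightarrow> 'a"
  assumes B: "trace_bdd B C" shows "Re (trace_op (fun_calc arctan B)) = arctan_count B"
proof -
  obtain E l where eb: "eigen_basis B E l"
    using hs_selfadjoint_eigen_basis[OF trace_bdd_hs_selfadjoint[OF B]] by blast
  show ?thesis using trace_fun_calc_arctan(1)[OF B eb] arctan_count_eq[OF B eb] by simp
qed

lemma eig_count_nonpositive:
  fixes S :: "'a::chilbert_space \<Rightarrow> 'a"
  assumes "hs_selfadjoint S" "r > 0" "\<And>x. Re (cinner x (S x)) \<le> 0"
  shows "eig_count 1 r S = 0"
proof -
  have "eig_count 1 r S \<le> card ({} :: 'a set)"
    by (rule eig_count_le_card[OF assms(1,2)]) (use assms(2) in \<open>auto intro!: order_trans[OF assms(3)]\<close>)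
  then show ?thesis by simp
qed

lemma eig_count_one_scale:
  fixes S :: "'a::chilbert_space \<Rightarrow> 'a"
  assumes "hs_selfadjoint S" "q > 0"
  shows "eig_count 1 1 (\<lambda>x. q *\<^sub>R S x) = eig_count 1 (1 / q) S"
  using eig_count_scale[OF assms(1), of "1 / q" q] assms(2) by simp

text \<open>The integrands agree for every \<open>t\<close>: for \<open>t * c > 0\<close> by
  equality of the counts at level \<open>1 / (t * c)\<close>, otherwise because both operators are
  nonpositive and both counts vanish.\<close>

lemma arctan_count_star:
  fixes W :: "'a::chilbert_space \<Rightarrow> 'b::chilbert_space"
  assumes W: "hs_bdd W C" and c: "c \<ge> 0"
  shows "arctan_count (\<lambda>y. c *\<^sub>R W (cadjoint W y)) = arctan_count (\<lambda>x. c *\<^sub>R cadjoint W (W x))"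
proof -
  have "eig_count 1 1 (\<lambda>y. t *\<^sub>R (c *\<^sub>R W (cadjoint W y))) = eig_count 1 1 (\<lambda>x. t *\<^sub>R (c *\<^sub>R cadjoint W (W x)))" for t
  proof (cases "t * c > 0")
    case True
    have "hs_selfadjoint (\<lambda>y. W (cadjoint W y))" "hs_selfadjoint (\<lambda>x. cadjoint W (W x))"
      using trace_bdd_hs_selfadjoint trace_bdd_star[OF W] by blast+
    then show ?thesis
      using eig_count_star[OF W, of "1 / (t * c)"] True by (simp add: eig_count_one_scale)
  next
    case False
    then have tc: "t * c \<le> 0" by simp
    have p: "positive_op (\<lambda>y. W (cadjoint W y))" "positive_op (\<lambda>x. cadjoint W (W x))"
      and hs: "hs_selfadjoint (\<lambda>y. W (cadjoint W y))" "hs_selfadjoint (\<lambda>x. cadjoint W (W x))"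
      using trace_bdd_hs_selfadjoint trace_bdd_positive trace_bdd_star[OF W] by blast+
    have "eig_count 1 1 (\<lambda>y. t *\<^sub>R (c *\<^sub>R W (cadjoint W y))) = 0"
      using mult_nonpos_nonneg[OF tc positive_op_nonneg[OF p(1)]]
      by (intro eig_count_nonpositive hs_selfadjoint_scaleR hs) (simp_all add: cinner_simps mult.assoc)
    moreover have "eig_count 1 1 (\<lambda>x. t *\<^sub>R (c *\<^sub>R cadjoint W (W x))) = 0"
      using mult_nonpos_nonneg[OF tc positive_op_nonneg[OF p(2)]]
      by (intro eig_count_nonpositive hs_selfadjoint_scaleR hs) (simp_all add: cinner_simps mult.assoc)
    ultimately show ?thesis by simp
  qed
  then show ?thesis by (simp add: arctan_count_def)
qed

text \<open>The perturbation argument, isolated from the model. The error terms contain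
  \<open>C\<close> and \<open>D'\<close> but not the trace bound \<open>D\<close> of the main part
  \<open>B\<close>, so they stay bounded while \<open>B\<close> blows up.\<close>

lemma averaged_count_bounds:
  fixes A B B' :: "'a::chilbert_space \<Rightarrow> 'a"
  assumes A: "selfadjoint A" "hs_bdd A C" and B: "trace_bdd B D" and B': "trace_bdd B' D'" and e: "0 < \<epsilon>" "\<epsilon> < 1"
  defines "F \<equiv> \<lambda>t. real (eig_count 1 1 (\<lambda>x. A x + t *\<^sub>R (B x + B' x))) / (1 + t\<^sup>2)"
  shows "integrable lborel F"
    and "integral\<^sup>L lborel F \<le> arctan_count (\<lambda>x. (1 / (1 - \<epsilon>)) *\<^sub>R B x) + 4 * C / \<epsilon>\<^sup>2 * (LINT t|lborel. 1 / (1 + t\<^sup>2)) + 2 / \<epsilon> * D'"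
    and "arctan_count (\<lambda>x. (1 / (1 + \<epsilon>)) *\<^sub>R B x) - C / \<epsilon>\<^sup>2 * (LINT t|lborel. 1 / (1 + t\<^sup>2)) \<le> integral\<^sup>L lborel F"
proof -
  define N where "N = (\<lambda>t. eig_count 1 1 (\<lambda>x. A x + t *\<^sub>R (B x + B' x)))"
  have F: "F = (\<lambda>t. real (N t) / (1 + t\<^sup>2))" by (simp add: F_def N_def)
  define N1 where "N1 c t = eig_count 1 1 (\<lambda>x. t *\<^sub>R (c *\<^sub>R B x))" for c t :: real
  define N2 where "N2 t = eig_count 1 1 (\<lambda>x. t *\<^sub>R ((2 / \<epsilon>) *\<^sub>R B' x))" for t :: real
  have hsA: "hs_selfadjoint A" using A by (auto simp: hs_selfadjoint_def)
  have hsmA: "hs_selfadjoint (\<lambda>x. - A x)" using hs_selfadjoint_scaleR[OF hsA, of "-1"] by simp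
  note hsB = trace_bdd_hs_selfadjoint[OF B] and hsB' = trace_bdd_hs_selfadjoint[OF B']
  note Bnn = positive_op_nonneg[OF trace_bdd_positive[OF B]] and B'nn = positive_op_nonneg[OF trace_bdd_positive[OF B']]
  note hsI = hs_selfadjoint_add hs_selfadjoint_scaleR hsA hsmA hsB hsB'
  have C0: "0 \<le> C" by (rule hs_bdd_nonneg[OF A(2)])
  have NA: "real (eig_count 1 (\<epsilon>/2) A) \<le> 4 * C / \<epsilon>\<^sup>2"
    using eig_count_hs_bound[OF A, of "\<epsilon>/2"] e by (simp add: power2_eq_square mult.commute)
  have NmA: "real (eig_count 1 \<epsilon> (\<lambda>x. - A x)) \<le> C / \<epsilon>\<^sup>2"
  proof -
    have "hs_bdd (\<lambda>x. - A x) C" using hs_bdd_scaleR[OF A(2), of "-1"] by simp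
    moreover have "selfadjoint (\<lambda>x. - A x)" using hsmA by (simp add: hs_selfadjoint_def)
    ultimately show ?thesis using eig_count_hs_bound e by blast
  qed
  \<comment> \<open>For \<open>t > 0\<close> the level 1 is split as
    \<open>(1 - \<epsilon>) + \<epsilon>/2 + \<epsilon>/2\<close> among \<open>t B\<close>,
    \<open>A\<close> and \<open>t B'\<close>; the level \<open>\<epsilon>/2\<close> for
    \<open>A\<close> produces \<open>4 * C / \<epsilon>\<^sup>2\<close>. Levels other than 1 are
    turned into rescaled operators.\<close>
  have up: "real (N t) \<le> real (N1 (1 / (1 - \<epsilon>)) t) + 4 * C / \<epsilon>\<^sup>2 + real (N2 t)" for t
  proof (cases "t > 0")
    case True
    have eq: "(\<lambda>x. A x + t *\<^sub>R (B x + B' x)) = (\<lambda>x. t *\<^sub>R B x + (A x + t *\<^sub>R B' x))"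
      by (simp add: scaleR_add_right add.left_commute)
    have "eig_count 1 ((1 - \<epsilon>) + (\<epsilon>/2 + \<epsilon>/2)) (\<lambda>x. t *\<^sub>R B x + (A x + t *\<^sub>R B' x))
        \<le> eig_count 1 (1 - \<epsilon>) (\<lambda>x. t *\<^sub>R B x) + eig_count 1 (\<epsilon>/2 + \<epsilon>/2) (\<lambda>x. A x + t *\<^sub>R B' x)"
      using e by (intro weyl_inequality hsI) auto
    moreover have "eig_count 1 (\<epsilon>/2 + \<epsilon>/2) (\<lambda>x. A x + t *\<^sub>R B' x) \<le> eig_count 1 (\<epsilon>/2) A + eig_count 1 (\<epsilon>/2) (\<lambda>x. t *\<^sub>R B' x)"
      using e by (intro weyl_inequality hsI) auto
    moreover have "eig_count 1 (1 - \<epsilon>) (\<lambda>x. t *\<^sub>R B x) = N1 (1 / (1 - \<epsilon>)) t"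
      using eig_count_scale[OF hs_selfadjoint_scaleR[OF hsB], of "1 - \<epsilon>" "1 / (1 - \<epsilon>)" t] e by (simp add: N1_def mult.commute)
    moreover have "eig_count 1 (\<epsilon>/2) (\<lambda>x. t *\<^sub>R B' x) = N2 t"
      using eig_count_scale[OF hs_selfadjoint_scaleR[OF hsB'], of "\<epsilon>/2" "2/\<epsilon>" t] e by (simp add: N2_def mult.commute)
    ultimately show ?thesis using NA by (simp add: N_def eq)
  next
    case False
    \<comment> \<open>For \<open>t \<le> 0\<close> the term with \<open>B\<close> and
      \<open>B'\<close> is nonpositive, so \<open>A\<close> alone can produce eigenvalues.\<close>
    have "N t \<le> eig_count 1 (\<epsilon>/2) A" unfolding N_def
    proof (rule eig_count_compare)
      fix x assume a: "Re (cinner x (A x)) \<le> \<epsilon> / 2 * (norm x)\<^sup>2"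
      have "t * Re (cinner x (B x)) \<le> 0" "t * Re (cinner x (B' x)) \<le> 0"
        using False Bnn[of x] B'nn[of x] by (auto intro: mult_nonpos_nonneg)
      moreover have "\<epsilon> / 2 * (norm x)\<^sup>2 \<le> 1 * (norm x)\<^sup>2" using e by (intro mult_right_mono) auto
      ultimately show "Re (cinner x (A x + t *\<^sub>R (B x + B' x))) \<le> 1 * (norm x)\<^sup>2"
        using a by (simp add: cinner_simps distrib_left)
    qed (use e in \<open>auto intro!: hsI\<close>)
    then show ?thesis using NA by simp
  qed
  \<comment> \<open>For \<open>t > 0\<close>, write \<open>t B\<close> as \<open>A + t B\<close>
    plus \<open>- A\<close> at level \<open>1 + \<epsilon>\<close>; adding \<open>t B'\<close> only
    raises the count because \<open>B'\<close> is positive.\<close>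
  have low: "real (N1 (1 / (1 + \<epsilon>)) t) - C / \<epsilon>\<^sup>2 \<le> real (N t)" for t
  proof (cases "t > 0")
    case True
    have "eig_count 1 (1 + \<epsilon>) (\<lambda>x. (A x + t *\<^sub>R B x) + (- A x)) \<le> eig_count 1 1 (\<lambda>x. A x + t *\<^sub>R B x) + eig_count 1 \<epsilon> (\<lambda>x. - A x)"
      using e by (intro weyl_inequality hsI) auto
    moreover have "eig_count 1 1 (\<lambda>x. A x + t *\<^sub>R B x) \<le> N t" unfolding N_def
      using B'nn True by (intro eig_count_mono hsI) (auto simp: cinner_simps distrib_left)
    moreover have "eig_count 1 (1 + \<epsilon>) (\<lambda>x. t *\<^sub>R B x) = N1 (1 / (1 + \<epsilon>)) t"
      using eig_count_scale[OF hs_selfadjoint_scaleR[OF hsB], of "1 + \<epsilon>" "1 / (1 + \<epsilon>)" t] e by (simp add: N1_def mult.commute)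
    ultimately show ?thesis using NmA by simp
  next
    case False
    have "N1 (1 / (1 + \<epsilon>)) t = 0" unfolding N1_def
    proof (rule eig_count_nonpositive)
      fix x
      have "t * (1 / (1 + \<epsilon>) * Re (cinner x (B x))) \<le> 0"
        using False Bnn[of x] e by (intro mult_nonpos_nonneg) auto
      then show "Re (cinner x (t *\<^sub>R (1 / (1 + \<epsilon>)) *\<^sub>R B x)) \<le> 0" by (simp add: cinner_simps)
    qed (auto intro!: hsI)
    then show ?thesis using C0 e by (simp add: order_trans[of _ 0])
  qed
  have t1: "trace_bdd (\<lambda>x. c *\<^sub>R B x) (c * D)" if "c \<ge> 0" for c by (rule trace_bdd_scaleR[OF B that])
  have t2: "trace_bdd (\<lambda>x. (2 / \<epsilon>) *\<^sub>R B' x) (2 / \<epsilon> * D')" using e by (intro trace_bdd_scaleR[OF B']) auto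
  have i1: "integrable lborel (\<lambda>t. real (N1 c t) / (1 + t\<^sup>2))" if c: "c \<ge> 0" for c
    unfolding N1_def using hs_selfadjoint_eigen_basis[OF trace_bdd_hs_selfadjoint[OF t1[OF c]]] arctan_count_integrable[OF t1[OF c]] by blast
  have i2: "integrable lborel (\<lambda>t. real (N2 t) / (1 + t\<^sup>2))"
    unfolding N2_def using hs_selfadjoint_eigen_basis[OF trace_bdd_hs_selfadjoint[OF t2]] arctan_count_integrable[OF t2] by blast
  have ic: "integrable lborel (\<lambda>t::real. c * (1 / (1 + t\<^sup>2)))" for c by (intro integrable_mult_right cauchy_integrable)
  have c1: "0 \<le> 1 / (1 - \<epsilon>)" "0 \<le> 1 / (1 + \<epsilon>)" using e by auto
  let ?G = "\<lambda>t. real (N1 (1 / (1 - \<epsilon>)) t) / (1 + t\<^sup>2) + 4 * C / \<epsilon>\<^sup>2 * (1 / (1 + t\<^sup>2)) + real (N2 t) / (1 + t\<^sup>2)"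
  have iG: "integrable lborel ?G" by (intro Bochner_Integration.integrable_add i1 i2 ic c1)
  have FG: "F t \<le> ?G t" for t
    unfolding F using divide_right_mono[OF up[of t], of "1 + t\<^sup>2"] by (simp add: add_divide_distrib)
  have "mono (\<lambda>t. real (N t))"
    unfolding N_def using Bnn B'nn
    by (auto simp: mono_def cinner_simps intro!: eig_count_mono hsI mult_right_mono)
  then have [measurable]: "(\<lambda>t. real (N t)) \<in> borel_measurable borel" by (rule borel_measurable_mono)
  have mF: "F \<in> borel_measurable lborel" unfolding F by measurable
  show iF: "integrable lborel F"
  proof (rule Bochner_Integration.integrable_bound[OF iG mF])
    have "norm (F t) \<le> norm (?G t)" for t
      using FG[of t] unfolding F by (simp add: abs_of_nonneg order_trans[OF _ abs_ge_self])
    then show "AE t in lborel. norm (F t) \<le> norm (?G t)" by simp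
  qed
  have "integral\<^sup>L lborel F \<le> integral\<^sup>L lborel ?G" by (intro integral_mono iF iG FG)
  also have "\<dots> = arctan_count (\<lambda>x. (1 / (1 - \<epsilon>)) *\<^sub>R B x) + 4 * C / \<epsilon>\<^sup>2 * (LINT t|lborel. 1 / (1 + t\<^sup>2))
      + arctan_count (\<lambda>x. (2 / \<epsilon>) *\<^sub>R B' x)"
    unfolding Bochner_Integration.integral_add[OF Bochner_Integration.integrable_add[OF i1[OF c1(1)] ic] i2]
      Bochner_Integration.integral_add[OF i1[OF c1(1)] ic] integral_mult_right_zero
    by (simp only: arctan_count_def N1_def N2_def)
  finally show "integral\<^sup>L lborel F \<le> arctan_count (\<lambda>x. (1 / (1 - \<epsilon>)) *\<^sub>R B x) + 4 * C / \<epsilon>\<^sup>2 * (LINT t|lborel. 1 / (1 + t\<^sup>2)) + 2 / \<epsilon> * D'"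
    using arctan_count_le[OF t2] by linarith
  have iH: "integrable lborel (\<lambda>t. real (N1 (1 / (1 + \<epsilon>)) t) / (1 + t\<^sup>2) - C / \<epsilon>\<^sup>2 * (1 / (1 + t\<^sup>2)))"
    by (intro Bochner_Integration.integrable_diff i1 ic c1)
  have "arctan_count (\<lambda>x. (1 / (1 + \<epsilon>)) *\<^sub>R B x) - C / \<epsilon>\<^sup>2 * (LINT t|lborel. 1 / (1 + t\<^sup>2))
      = (LINT t|lborel. real (N1 (1 / (1 + \<epsilon>)) t) / (1 + t\<^sup>2) - C / \<epsilon>\<^sup>2 * (1 / (1 + t\<^sup>2)))"
    unfolding Bochner_Integration.integral_diff[OF i1[OF c1(2)] ic] integral_mult_right_zero
    by (simp only: arctan_count_def N1_def)
  also have "\<dots> \<le> integral\<^sup>L lborel F"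
  proof (rule integral_mono[OF iH iF])
    fix t show "real (N1 (1 / (1 + \<epsilon>)) t) / (1 + t\<^sup>2) - C / \<epsilon>\<^sup>2 * (1 / (1 + t\<^sup>2)) \<le> F t"
      unfolding F using divide_right_mono[OF low[of t], of "1 + t\<^sup>2"] by (simp add: diff_divide_distrib)
  qed
  finally show "arctan_count (\<lambda>x. (1 / (1 + \<epsilon>)) *\<^sub>R B x) - C / \<epsilon>\<^sup>2 * (LINT t|lborel. 1 / (1 + t\<^sup>2)) \<le> integral\<^sup>L lborel F" .
qed

section \<open>Operators between \<open>\<ell>\<^sup>2\<close> spaces\<close>

lemma l2_eqI: "(\<And>n. l2_fun u n = l2_fun v n) \<Longrightarrow> u = v"
  using l2_fun_inject[of u v] by (simp add: fun_eq_iff)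

lemma norm_l2_has_sum: "((\<lambda>n. (norm (l2_fun u n))\<^sup>2) has_sum (norm u)\<^sup>2) UNIV"
  using l2_fun_summable[of u] by (simp add: norm_l2_eq)

lemma cinner_l2_has_sum: "((\<lambda>n. cinner (l2_fun u n) (l2_fun v n)) has_sum cinner u v) UNIV"
  using cinner_l2_summable[of u v] by (simp add: cinner_l2_def)

lemma norm_l2_fun_le: "norm (l2_fun u n) \<le> norm u"
  using sum_le_norm_l2[of "{n}" u] by (simp add: power2_le_iff_abs_le)

lemma bcl_l2_fun: "bounded_clinear (\<lambda>u. l2_fun u n)"
  by (rule bclI[where C = 1]) (auto simp: norm_l2_fun_le)

lemma l2_fun_zero [simp]: "l2_fun 0 n = 0"
  by (simp add: zero_l2.rep_eq)

lemma l2_fun_sum: "l2_fun (sum f A) n = (\<Sum>i\<in>A. l2_fun (f i) n)"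
  by (rule bcl_sum[OF bcl_l2_fun])

text \<open>Assembles an operator into \<open>\<ell>\<close> 2 from its coordinates;
  \<open>Abs_l2\<close> is meaningful only under a bound on the sums of squares, as in the lemmas
  that follow.\<close>

definition l2_lift :: "(int \<Rightarrow> 'a \<Rightarrow> 'b::complex_inner) \<Rightarrow> 'a \<Rightarrow> 'b l2"
  where "l2_lift P x = Abs_l2 (\<lambda>n. P n x)"

lemma
  fixes P :: "int \<Rightarrow> 'a::complex_inner \<Rightarrow> 'b::complex_inner"
  assumes P: "\<And>n. bounded_clinear (P n)"
    and C: "\<And>F x. finite F \<Longrightarrow> (\<Sum>n\<in>F. (norm (P n x))\<^sup>2) \<le> C * (norm x)\<^sup>2"
  shows l2_fun_lift: "l2_fun (l2_lift P x) n = P n x"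
    and bcl_l2_lift: "bounded_clinear (l2_lift P)"
    and norm_l2_lift: "(norm (l2_lift P x))\<^sup>2 \<le> C * (norm x)\<^sup>2"
proof -
  have s: "(\<lambda>n. (norm (P n x))\<^sup>2) summable_on UNIV" for x
    using C by (intro nonneg_bdd_above_summable_on bdd_aboveI[of _ "C * (norm x)\<^sup>2"]) auto
  show f: "l2_fun (l2_lift P x) n = P n x" for x n
    using s[of x] by (simp add: l2_lift_def Abs_l2_inverse)
  show nb: "(norm (l2_lift P x))\<^sup>2 \<le> C * (norm x)\<^sup>2" for x
    unfolding norm_l2_eq f by (rule infsum_le_finite_sums[OF s C]) auto
  show "bounded_clinear (l2_lift P)"
  proof (rule bclI[where C = "sqrt \<bar>C\<bar>"])
    show "l2_lift P (x + y) = l2_lift P x + l2_lift P y" for x y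
      by (rule l2_eqI) (simp add: f bcl_add[OF P])
    show "l2_lift P (c *\<^sub>C x) = c *\<^sub>C l2_lift P x" for x c
      by (rule l2_eqI) (simp add: f bcl_scaleC[OF P])
    fix x
    have "(norm (l2_lift P x))\<^sup>2 \<le> \<bar>C\<bar> * (norm x)\<^sup>2"
      using nb[of x] mult_right_mono[OF abs_ge_self[of C], of "(norm x)\<^sup>2"] by simp
    then have "sqrt ((norm (l2_lift P x))\<^sup>2) \<le> sqrt (\<bar>C\<bar> * (norm x)\<^sup>2)" by (rule real_sqrt_le_mono)
    then show "norm (l2_lift P x) \<le> sqrt \<bar>C\<bar> * norm x" by (simp add: real_sqrt_mult)
  qed
qed

lemma hs_bdd_norm:
  assumes T: "hs_bdd T C" shows "(norm (T x))\<^sup>2 \<le> C * (norm x)\<^sup>2"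
proof (cases "x = 0")
  case False
  define u where "u = (1 / of_real (norm x)) *\<^sub>C x"
  have "norm u = 1" using False by (simp add: u_def norm_scaleC norm_divide)
  then have "orthonormal {u}" by (simp add: orthonormal_def cinner_self)
  then have "(norm (T u))\<^sup>2 \<le> C" using hs_bddD[OF T, of "{u}"] by simp
  moreover have "norm (T u) = norm (T x) / norm x"
    by (simp add: u_def bcl_scaleC[OF hs_bdd_bcl[OF T]] norm_scaleC norm_divide)
  ultimately show ?thesis using False by (simp add: power_divide field_simps)
qed (simp add: bcl_zero[OF hs_bdd_bcl[OF T]])

text \<open>Squared Hilbert--Schmidt norms of the coordinates add up.\<close>

lemma
  fixes P :: "int \<Rightarrow> 'a::complex_inner \<Rightarrow> 'b::complex_inner"
  assumes P: "\<And>n. hs_bdd (P n) (c n)" and c: "\<And>F. finite F \<Longrightarrow> sum c F \<le> C"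
  shows hs_l2_fun_lift: "l2_fun (l2_lift P x) n = P n x"
    and hs_bdd_l2_lift: "hs_bdd (l2_lift P) C"
proof -
  have bd: "(\<Sum>n\<in>F. (norm (P n x))\<^sup>2) \<le> C * (norm x)\<^sup>2" if "finite F" for F x
  proof -
    have "(\<Sum>n\<in>F. (norm (P n x))\<^sup>2) \<le> (\<Sum>n\<in>F. c n * (norm x)\<^sup>2)" by (intro sum_mono hs_bdd_norm P)
    also have "\<dots> \<le> C * (norm x)\<^sup>2"
      unfolding sum_distrib_right[symmetric] by (intro mult_right_mono c that) auto
    finally show ?thesis .
  qed
  note b = hs_bdd_bcl[OF P]
  show f: "l2_fun (l2_lift P x) n = P n x" for x n by (rule l2_fun_lift[OF b bd])
  have "(\<Sum>f\<in>F. (norm (l2_lift P f))\<^sup>2) \<le> C" if F: "finite F" "orthonormal F" for F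
  proof -
    have h0: "((\<lambda>n. (norm (P n x))\<^sup>2) has_sum (norm (l2_lift P x))\<^sup>2) UNIV" for x
      using norm_l2_has_sum[of "l2_lift P x"] by (simp add: f)
    have h: "((\<lambda>n. \<Sum>x\<in>F. (norm (P n x))\<^sup>2) has_sum (\<Sum>x\<in>F. (norm (l2_lift P x))\<^sup>2)) UNIV"
      using F(1) by (induction F rule: finite_induct) (simp_all add: has_sum_add h0)
    show ?thesis
    proof (rule has_sum_le_finite_sums[OF h])
      fix G :: "int set" assume G: "finite G" "G \<subseteq> UNIV"
      have "(\<Sum>n\<in>G. \<Sum>x\<in>F. (norm (P n x))\<^sup>2) \<le> sum c G" by (intro sum_mono hs_bddD[OF P] F)
      then show "(\<Sum>n\<in>G. \<Sum>x\<in>F. (norm (P n x))\<^sup>2) \<le> C" using c[OF G(1)] by simp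
    qed
  qed
  then show "hs_bdd (l2_lift P) C" using bcl_l2_lift[OF b bd] by (simp add: hs_bdd_def)
qed

subsection \<open>Tensor products\<close>

lemma l2_fun_tensor [simp]: "l2_fun (tensor_l2 a x) n = l2_fun a n *\<^sub>C x"
  by (simp add: tensor_l2.rep_eq)

lemma cinner_tensor_l2: "cinner (tensor_l2 a x) (tensor_l2 b y) = cinner a b * cinner x y"
proof -
  have "((\<lambda>n. cinner (l2_fun a n) (l2_fun b n) * cinner x y) has_sum cinner a b * cinner x y) UNIV"
    by (intro has_sum_cmult_left cinner_l2_has_sum)
  then have "((\<lambda>n. cinner (l2_fun (tensor_l2 a x) n) (l2_fun (tensor_l2 b y) n)) has_sum cinner a b * cinner x y) UNIV"
    by (simp add: cinner_simps cinner_complex_def mult.assoc mult.left_commute)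
  then show ?thesis using cinner_l2_has_sum has_sum_unique by blast
qed

lemma norm_tensor_l2: "norm (tensor_l2 a x) = norm a * norm x"
proof -
  have "complex_of_real ((norm (tensor_l2 a x))\<^sup>2) = of_real ((norm a * norm x)\<^sup>2)"
    unfolding cinner_self[symmetric] cinner_tensor_l2 by (simp add: cinner_self power_mult_distrib)
  then have "(norm (tensor_l2 a x))\<^sup>2 = (norm a * norm x)\<^sup>2" using of_real_eq_iff by blast
  then show ?thesis by (simp add: power2_eq_iff_nonneg)
qed

lemma bcl_tensor_l2: "bounded_clinear (tensor_l2 a)"
proof (rule bclI[where C = "norm a"])
  show "tensor_l2 a (x + y) = tensor_l2 a x + tensor_l2 a y" for x y
    by (rule l2_eqI) (simp add: scaleC_add_right)
  show "tensor_l2 a (c *\<^sub>C x) = c *\<^sub>C tensor_l2 a x" for c x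
    by (rule l2_eqI) (simp add: scaleC_scaleC mult.commute)
qed (simp add: norm_tensor_l2)

lemma square_summable_finite_support:
  assumes "finite {n. f n \<noteq> 0}"
  shows "(\<lambda>n. (norm (f n))\<^sup>2) summable_on UNIV"
  by (rule summable_on_cong_neutral[THEN iffD1, OF _ _ _ summable_on_finite[OF assms]]) auto

lift_definition l2_delta :: "int \<Rightarrow> complex l2" is "\<lambda>m n. if n = m then 1 else 0"
  by (rule square_summable_finite_support) simp

lemma cinner_delta_tensor: "cinner (tensor_l2 (l2_delta m) x) u = cinner x (l2_fun u m)"
proof -
  have "((\<lambda>n. cinner (l2_fun (tensor_l2 (l2_delta m) x) n) (l2_fun u n)) has_sum cinner x (l2_fun u m)) UNIV"
    by (rule has_sum_cong_neutral[THEN iffD1, OF _ _ _ has_sum_finiteI[of "{m}"]]) (auto simp: l2_delta.rep_eq)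
  then show ?thesis using cinner_l2_has_sum has_sum_unique by blast
qed

lemma closure_span_total:
  fixes S :: "'a::chilbert_space set"
  assumes total: "\<And>x. (\<And>e. e \<in> S \<Longrightarrow> cinner e x = 0) \<Longrightarrow> x = 0"
  shows "closure (cspace.span S) = UNIV"
proof -
  have "x \<in> closure (cspace.span S)" for x
  proof -
    obtain y where y: "y \<in> closure (cspace.span S)" "\<And>w. w \<in> closure (cspace.span S) \<Longrightarrow> cinner w (x - y) = 0"
      using projection_exists[of "closure (cspace.span S)" x] subspace_closure by auto
    then have "x - y = 0" by (intro total) (meson closure_subset cspace.span_base subsetD)
    then show ?thesis using y(1) by simp
  qed
  then show ?thesis by auto
qed

text \<open>A vector orthogonal to all these tensors has every coordinate zero, so they are total.
  Besides the uniqueness of tensor products this reduces adjoint identities to point masses.\<close>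

lemma bcl_eq_on_delta:
  fixes U U' :: "'g::chilbert_space l2 \<Rightarrow> 'b::complex_inner"
  assumes "bounded_clinear U" "bounded_clinear U'"
    and "\<And>n x. U (tensor_l2 (l2_delta n) x) = U' (tensor_l2 (l2_delta n) x)"
  shows "U = U'"
proof
  fix u
  define S where "S = range (\<lambda>(n, x :: 'g). tensor_l2 (l2_delta n) x)"
  have cl: "closure (cspace.span S) = UNIV"
  proof (rule closure_span_total)
    fix v :: "'g l2" assume v: "\<And>e. e \<in> S \<Longrightarrow> cinner e v = 0"
    have "cinner x (l2_fun v n) = 0" for x n
    proof -
      have "tensor_l2 (l2_delta n) x \<in> S"
        unfolding S_def by (rule range_eqI[of _ _ "(n, x)"]) simp
      from v[OF this] show ?thesis by (simp add: cinner_delta_tensor)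
    qed
    then have "l2_fun v n = 0" for n using cinner_eq_zero_iff by blast
    then show "v = 0" by (intro l2_eqI) simp
  qed
  have "U e = U' e" if "e \<in> S" for e
    using that assms(3) by (auto simp: S_def)
  moreover have "u \<in> closure (cspace.span S)" unfolding cl by (rule UNIV_I)
  ultimately show "U u = U' u" using bcl_eq_on_span[OF assms(1,2)] by blast
qed

lemma tensor_op_l2_eqI:
  fixes U :: "'g::chilbert_space l2 \<Rightarrow> 'b::complex_inner"
  assumes "bounded_clinear U" "\<And>\<phi> x. U (tensor_l2 \<phi> x) = t (A \<phi>) (B x)"
  shows "tensor_op tensor_l2 t A B = U"
  unfolding tensor_op_def
proof (rule the_equality)
  fix U' assume U': "bounded_clinear U' \<and> (\<forall>\<phi> x. U' (tensor_l2 \<phi> x) = t (A \<phi>) (B x))"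
  show "U' = U" by (rule bcl_eq_on_delta) (use U' assms in auto)
qed (use assms in auto)

lemma tensor_op_C2_eqI:
  fixes U :: "'g::complex_inner \<times> 'g \<Rightarrow> 'b::complex_inner"
  assumes U: "bounded_clinear U" and eq: "\<And>c x. U (tensor_C2 c x) = t (A c) (B x)"
  shows "tensor_op tensor_C2 t A B = U"
  unfolding tensor_op_def
proof (rule the_equality)
  fix U' assume U': "bounded_clinear U' \<and> (\<forall>c x. U' (tensor_C2 c x) = t (A c) (B x))"
  have "U' p = U p" for p
  proof -
    have "p = tensor_C2 (1, 0) (fst p) + tensor_C2 (0, 1) (snd p)"
      by (simp add: tensor_C2_def prod_eq_iff)
    then obtain p1 p2 where p: "p = p1 + p2" "U' p1 = U p1" "U' p2 = U p2" using U' eq by simp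
    have "bounded_clinear U'" using U' by blast
    then show ?thesis unfolding p(1) by (simp only: bcl_add[OF U] bcl_add p)
  qed
  then show "U' = U" by (rule ext)
qed (use assms in auto)

subsection \<open>Pairing with a scalar sequence\<close>

text \<open>The partial inner product with \<open>a\<close> in the first tensor factor, that is, the
  adjoint of \<open>tensor_l2 a\<close>.\<close>

definition l2_pair :: "complex l2 \<Rightarrow> 'g::complex_inner l2 \<Rightarrow> 'g"
  where "l2_pair a u = (\<Sum>\<^sub>\<infinity>m. cnj (l2_fun a m) *\<^sub>C l2_fun u m)"

lemma l2_pair_has_sum:
  fixes u :: "'g::chilbert_space l2"
  shows "((\<lambda>m. cnj (l2_fun a m) *\<^sub>C l2_fun u m) has_sum l2_pair a u) UNIV"
proof -
  have "(\<lambda>m. norm (cnj (l2_fun a m) *\<^sub>C l2_fun u m)) summable_on UNIV"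
  proof (rule summable_on_comparison_test)
    show "(\<lambda>m. (norm (l2_fun a m))\<^sup>2 + (norm (l2_fun u m))\<^sup>2) summable_on UNIV"
      by (intro summable_on_add l2_fun_summable)
    show "norm (cnj (l2_fun a m) *\<^sub>C l2_fun u m) \<le> (norm (l2_fun a m))\<^sup>2 + (norm (l2_fun u m))\<^sup>2" for m
    proof -
      have "norm (l2_fun a m) * norm (l2_fun u m) \<le> (norm (l2_fun a m))\<^sup>2 + (norm (l2_fun u m))\<^sup>2"
        using sum_squares_bound[of "norm (l2_fun a m)" "norm (l2_fun u m)"]
          mult_nonneg_nonneg[OF norm_ge_zero[of "l2_fun a m"] norm_ge_zero[of "l2_fun u m"]] by linarith
      then show ?thesis by (simp add: norm_scaleC)
    qed
  qed auto
  from abs_summable_summable[OF this] show ?thesis by (simp add: l2_pair_def)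
qed

lemma cinner_l2_pair:
  fixes u :: "'g::chilbert_space l2"
  shows "cinner z (l2_pair a u) = cinner (tensor_l2 a z) u"
proof -
  have "((\<lambda>m. cinner z (cnj (l2_fun a m) *\<^sub>C l2_fun u m)) has_sum cinner z (l2_pair a u)) UNIV"
    by (rule has_sum_bounded_linear[OF bcl_bounded_linear[OF bcl_cinner] l2_pair_has_sum])
  then have "((\<lambda>m. cinner (l2_fun (tensor_l2 a z) m) (l2_fun u m)) has_sum cinner z (l2_pair a u)) UNIV"
    by (simp add: cinner_simps)
  then show ?thesis using cinner_l2_has_sum has_sum_unique by blast
qed

lemma l2_pair_cadjoint: "cadjoint (tensor_l2 a) = (l2_pair a :: 'g::chilbert_space l2 \<Rightarrow> 'g)"
proof (rule cadjoint_eqI)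
  show "cinner (l2_pair a y) x = cinner y (tensor_l2 a x)" for x :: 'g and y
    using cinner_l2_pair[of x a y] cinner_commute[of "l2_pair a y" x] cinner_commute[of y "tensor_l2 a x"] by simp
qed

lemma bcl_l2_pair: "bounded_clinear (l2_pair a :: 'g::chilbert_space l2 \<Rightarrow> 'g)"
  unfolding l2_pair_cadjoint[symmetric] by (rule bcl_cadjoint[OF bcl_tensor_l2])

lemma norm_l2_pair: "norm (l2_pair a u :: 'g::chilbert_space) \<le> norm a * norm u"
  unfolding l2_pair_cadjoint[symmetric] by (rule cadjoint_norm[OF bcl_tensor_l2]) (auto simp: norm_tensor_l2)

lemma l2_pair_tensor: "l2_pair a (tensor_l2 \<phi> x :: 'g::chilbert_space l2) = cinner a \<phi> *\<^sub>C x"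
  by (rule cinner_extensionality) (simp add: cinner_l2_pair cinner_tensor_l2 cinner_simps)

subsection \<open>Diagonal operators\<close>

lemma
  fixes B :: "int \<Rightarrow> 'g::complex_inner \<Rightarrow> 'k::complex_inner"
  assumes B: "\<And>n. bounded_clinear (B n)" "\<And>n x. norm (B n x) \<le> C * norm x"
  shows l2_fun_diag: "l2_fun (l2_lift (\<lambda>n u. B n (l2_fun u n)) u) n = B n (l2_fun u n)"
    and bcl_l2_diag: "bounded_clinear (l2_lift (\<lambda>n u. B n (l2_fun u n)))"
proof -
  have b: "bounded_clinear (\<lambda>u. B n (l2_fun u n))" for n by (rule bcl_compose[OF B(1) bcl_l2_fun])
  have bd: "(\<Sum>n\<in>F. (norm (B n (l2_fun u n)))\<^sup>2) \<le> C\<^sup>2 * (norm u)\<^sup>2" if "finite F" for F u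
  proof -
    have "(\<Sum>n\<in>F. (norm (B n (l2_fun u n)))\<^sup>2) \<le> (\<Sum>n\<in>F. C\<^sup>2 * (norm (l2_fun u n))\<^sup>2)"
      using B(2) by (intro sum_mono) (metis norm_ge_zero power_mono power_mult_distrib)
    also have "\<dots> \<le> C\<^sup>2 * (norm u)\<^sup>2"
      unfolding sum_distrib_left[symmetric] by (intro mult_left_mono sum_le_norm_l2 that) auto
    finally show ?thesis .
  qed
  show "l2_fun (l2_lift (\<lambda>n u. B n (l2_fun u n)) u) n = B n (l2_fun u n)" by (rule l2_fun_lift[OF b bd])
  show "bounded_clinear (l2_lift (\<lambda>n u. B n (l2_fun u n)))" by (rule bcl_l2_lift[OF b bd])
qed

lemma
  fixes B :: "'g::chilbert_space \<Rightarrow> 'g"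
  assumes B: "bounded_clinear B"
  shows l2_fun_id_tensor: "l2_fun ((id \<otimes>\<^sub>o B) u) n = B (l2_fun u n)"
    and bcl_id_tensor: "bounded_clinear (id \<otimes>\<^sub>o B)"
proof -
  note d = l2_fun_diag[of "\<lambda>_. B", OF B bcl_onorm[OF B]] and b = bcl_l2_diag[of "\<lambda>_. B", OF B bcl_onorm[OF B]]
  have "(id \<otimes>\<^sub>o B) = l2_lift (\<lambda>n u. B (l2_fun u n))"
    by (rule tensor_op_l2_eqI[OF b]) (rule l2_eqI, simp add: d bcl_scaleC[OF B])
  then show "l2_fun ((id \<otimes>\<^sub>o B) u) n = B (l2_fun u n)" "bounded_clinear (id \<otimes>\<^sub>o B)"
    using d b by auto
qed

definition weight :: "real \<Rightarrow> int \<Rightarrow> real"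
  where "weight \<nu> n = bracket n powr (-\<nu>/2)"

lemma bracket_ge_1: "1 \<le> bracket n"
  by (simp add: bracket_def)

lemma weight_bounds: "0 < weight \<nu> n" "0 \<le> \<nu> \<Longrightarrow> weight \<nu> n \<le> 1"
proof -
  show "0 < weight \<nu> n" using bracket_ge_1[of n] by (simp add: weight_def)
  assume "0 \<le> \<nu>"
  then have "bracket n powr (-\<nu>/2) \<le> bracket n powr 0" using bracket_ge_1[of n] by (intro powr_mono) auto
  then show "weight \<nu> n \<le> 1" using bracket_ge_1[of n] by (simp add: weight_def)
qed

lemma
  fixes K :: "'g::chilbert_space \<Rightarrow> 'g"
  assumes K: "bounded_clinear K" and \<nu>: "0 \<le> \<nu>"
  shows l2_fun_psi_tensor: "l2_fun ((mult_psi \<nu> \<otimes>\<^sub>o K) u) n = weight \<nu> n *\<^sub>R K (l2_fun u n)"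
    and bcl_psi_tensor: "bounded_clinear (mult_psi \<nu> \<otimes>\<^sub>o K)"
proof -
  have wb: "norm (weight \<nu> n *\<^sub>R B x) \<le> C * norm x" if "norm (B x) \<le> C * norm x"
    for B :: "'c::complex_inner \<Rightarrow> 'c" and C x n
    using weight_bounds[of \<nu> n] \<nu> that mult_right_mono[of "weight \<nu> n" 1 "norm (B x)"] by simp
  have bK: "bounded_clinear (\<lambda>x. weight \<nu> n *\<^sub>R K x)" for n by (rule bcl_const_scaleR[OF K])
  have bI: "bounded_clinear (\<lambda>x. weight \<nu> n *\<^sub>R x :: complex)" for n by (rule bcl_const_scaleR[OF bcl_id])
  have nK: "norm (weight \<nu> n *\<^sub>R K x) \<le> onorm K * norm x" for n x by (rule wb[OF bcl_onorm[OF K]])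
  note d = l2_fun_diag[of "\<lambda>n x. weight \<nu> n *\<^sub>R K x", OF bK nK]
    and b = bcl_l2_diag[of "\<lambda>n x. weight \<nu> n *\<^sub>R K x", OF bK nK]
  have "mult_psi \<nu> = l2_lift (\<lambda>n \<phi>. weight \<nu> n *\<^sub>R l2_fun \<phi> n)"
    by (simp add: mult_psi_def[abs_def] l2_lift_def[abs_def] weight_def scaleR_conv_of_real)
  moreover have nI: "norm (weight \<nu> n *\<^sub>R x) \<le> 1 * norm x" for n and x :: complex
    by (rule wb[of "\<lambda>x. x"]) simp
  ultimately have m: "l2_fun (mult_psi \<nu> \<phi>) n = weight \<nu> n *\<^sub>R l2_fun \<phi> n" for \<phi> n
    using l2_fun_diag[of "\<lambda>n x. weight \<nu> n *\<^sub>R x :: complex", OF bI nI] by simp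
  have "(mult_psi \<nu> \<otimes>\<^sub>o K) = l2_lift (\<lambda>n u. weight \<nu> n *\<^sub>R K (l2_fun u n))"
    by (rule tensor_op_l2_eqI[OF b], rule l2_eqI)
      (simp only: l2_fun_tensor d m bcl_scaleC[OF K], simp add: scaleR_scaleC scaleC_scaleC scaleC_complex_def)
  then show "l2_fun ((mult_psi \<nu> \<otimes>\<^sub>o K) u) n = weight \<nu> n *\<^sub>R K (l2_fun u n)" "bounded_clinear (mult_psi \<nu> \<otimes>\<^sub>o K)"
    using d b by auto
qed

subsection \<open>The discrete Laplacian\<close>

text \<open>The constant is \<open>8 + 4 + 4\<close>, from applying \<open>norm_sum_le_two\<close>
  twice; shifts do not increase sums of squares beyond the norm.\<close>

lemma laplace_bound:
  fixes u :: "'g::complex_inner l2"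
  assumes "finite F"
  shows "(\<Sum>n\<in>F. (norm (c *\<^sub>R (2 *\<^sub>R l2_fun u n - l2_fun u (n + 1) - l2_fun u (n - 1))))\<^sup>2) \<le> (16 * c\<^sup>2) * (norm u)\<^sup>2"
proof -
  have sh: "(\<Sum>n\<in>F. (norm (l2_fun u (n + k)))\<^sup>2) \<le> (norm u)\<^sup>2" for k
    using sum_le_norm_l2[of "(\<lambda>n. n + k) ` F" u] assms by (simp add: sum.reindex inj_on_def)
  have "(norm (c *\<^sub>R (2 *\<^sub>R l2_fun u n - l2_fun u (n + 1) - l2_fun u (n - 1))))\<^sup>2
      \<le> c\<^sup>2 * (8 * (norm (l2_fun u n))\<^sup>2 + 4 * (norm (l2_fun u (n + 1)))\<^sup>2 + 4 * (norm (l2_fun u (n + - 1)))\<^sup>2)" for n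
  proof -
    have "(norm (2 *\<^sub>R l2_fun u n + - (l2_fun u (n + 1) + l2_fun u (n + - 1))))\<^sup>2
        \<le> 2 * (norm (2 *\<^sub>R l2_fun u n))\<^sup>2 + 2 * (norm (- (l2_fun u (n + 1) + l2_fun u (n + - 1))))\<^sup>2"
      by (rule norm_sum_le_two)
    moreover have "(norm (l2_fun u (n + 1) + l2_fun u (n + - 1)))\<^sup>2
        \<le> 2 * (norm (l2_fun u (n + 1)))\<^sup>2 + 2 * (norm (l2_fun u (n + - 1)))\<^sup>2"
      by (rule norm_sum_le_two)
    ultimately have "(norm (2 *\<^sub>R l2_fun u n - l2_fun u (n + 1) - l2_fun u (n - 1)))\<^sup>2
      \<le> 8 * (norm (l2_fun u n))\<^sup>2 + 4 * (norm (l2_fun u (n + 1)))\<^sup>2 + 4 * (norm (l2_fun u (n + - 1)))\<^sup>2"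
      unfolding norm_minus_cancel by (simp add: power_mult_distrib algebra_simps)
    then show ?thesis by (simp add: power_mult_distrib mult_left_mono)
  qed
  then have "(\<Sum>n\<in>F. (norm (c *\<^sub>R (2 *\<^sub>R l2_fun u n - l2_fun u (n + 1) - l2_fun u (n - 1))))\<^sup>2)
      \<le> (\<Sum>n\<in>F. c\<^sup>2 * (8 * (norm (l2_fun u n))\<^sup>2 + 4 * (norm (l2_fun u (n + 1)))\<^sup>2 + 4 * (norm (l2_fun u (n + - 1)))\<^sup>2))"
    by (rule sum_mono)
  also have "\<dots> = c\<^sup>2 * (8 * (\<Sum>n\<in>F. (norm (l2_fun u n))\<^sup>2) + 4 * (\<Sum>n\<in>F. (norm (l2_fun u (n + 1)))\<^sup>2)
      + 4 * (\<Sum>n\<in>F. (norm (l2_fun u (n + - 1)))\<^sup>2))"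
    by (simp add: sum_distrib_left[symmetric] sum.distrib)
  also have "\<dots> \<le> c\<^sup>2 * (8 * (norm u)\<^sup>2 + 4 * (norm u)\<^sup>2 + 4 * (norm u)\<^sup>2)"
    using sh[of 1] sh[of "-1"] sum_le_norm_l2[OF assms, of u] by (intro mult_left_mono) auto
  finally show ?thesis by simp
qed

lemma
  fixes u :: "'g::complex_inner l2" and h :: real
  defines "L \<equiv> l2_lift (\<lambda>n u. (1 / h\<^sup>2) *\<^sub>R (2 *\<^sub>R l2_fun u n - l2_fun u (n + 1) - l2_fun u (n - 1)))"
  shows l2_fun_laplace: "l2_fun (L u) n = (1 / h\<^sup>2) *\<^sub>R (2 *\<^sub>R l2_fun u n - l2_fun u (n + 1) - l2_fun u (n - 1))"
    and bcl_laplace: "bounded_clinear (L :: 'g l2 \<Rightarrow> 'g l2)"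
proof -
  have b: "bounded_clinear (\<lambda>u :: 'g l2. (1 / h\<^sup>2) *\<^sub>R (2 *\<^sub>R l2_fun u n - l2_fun u (n + 1) - l2_fun u (n - 1)))" for n
    by (intro bcl_const_scaleR bcl_minus_op bcl_l2_fun)
  show "l2_fun (L u) n = (1 / h\<^sup>2) *\<^sub>R (2 *\<^sub>R l2_fun u n - l2_fun u (n + 1) - l2_fun u (n - 1))"
    unfolding L_def by (rule l2_fun_lift[OF b laplace_bound])
  show "bounded_clinear (L :: 'g l2 \<Rightarrow> 'g l2)"
    unfolding L_def by (rule bcl_l2_lift[OF b laplace_bound])
qed

lemma
  fixes u :: "'g::chilbert_space l2"
  shows l2_fun_laplace_tensor: "l2_fun ((neg_laplace h \<otimes>\<^sub>o id) u) n =
      (1 / h\<^sup>2) *\<^sub>R (2 *\<^sub>R l2_fun u n - l2_fun u (n + 1) - l2_fun u (n - 1))"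
    and bcl_laplace_tensor: "bounded_clinear (neg_laplace h \<otimes>\<^sub>o (id :: 'g \<Rightarrow> 'g))"
proof -
  have nl: "neg_laplace h = l2_lift (\<lambda>n u. (1 / h\<^sup>2) *\<^sub>R (2 *\<^sub>R l2_fun u n - l2_fun u (n + 1) - l2_fun u (n - 1)))"
    by (simp add: neg_laplace_def[abs_def] l2_lift_def[abs_def] scaleR_conv_of_real)
  have "(neg_laplace h \<otimes>\<^sub>o (id :: 'g \<Rightarrow> 'g)) =
      l2_lift (\<lambda>n u. (1 / h\<^sup>2) *\<^sub>R (2 *\<^sub>R l2_fun u n - l2_fun u (n + 1) - l2_fun u (n - 1)))"
  proof (rule tensor_op_l2_eqI[OF bcl_laplace], rule l2_eqI)
    fix \<phi> and x :: 'g and n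
    show "l2_fun (l2_lift (\<lambda>n u. (1 / h\<^sup>2) *\<^sub>R (2 *\<^sub>R l2_fun u n - l2_fun u (n + 1) - l2_fun u (n - 1))) (tensor_l2 \<phi> x)) n
        = l2_fun (tensor_l2 (neg_laplace h \<phi>) (id x)) n"
      unfolding nl l2_fun_laplace l2_fun_tensor
      by (simp add: scaleR_scaleC scaleC_scaleC scaleC_complex_def cspace.scale_left_diff_distrib cspace.scale_right_diff_distrib
          right_diff_distrib diff_divide_distrib)
  qed
  then show "l2_fun ((neg_laplace h \<otimes>\<^sub>o id) u) n =
      (1 / h\<^sup>2) *\<^sub>R (2 *\<^sub>R l2_fun u n - l2_fun u (n + 1) - l2_fun u (n - 1))"
    "bounded_clinear (neg_laplace h \<otimes>\<^sub>o (id :: 'g \<Rightarrow> 'g))"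
    using l2_fun_laplace[of h u n] bcl_laplace[where 'g = 'g and h = h] by simp_all
qed

lemma l2_fun_H_Q:
  fixes Q :: "'g::chilbert_space \<Rightarrow> 'g"
  assumes "bounded_clinear Q"
  shows "l2_fun (H_Q h Q u) n = (1 / h\<^sup>2) *\<^sub>R (2 *\<^sub>R l2_fun u n - l2_fun u (n + 1) - l2_fun u (n - 1)) + Q (l2_fun u n)"
  by (simp add: H_Q_def l2_fun_laplace_tensor l2_fun_id_tensor[OF assms])

text \<open>The two hopping terms are \<open>a n\<close> and the conjugate of
  \<open>a (n - 1)\<close>. After a shift of the summation index their sums are complex conjugates
  of each other.\<close>

lemma Im_cinner_H_Q:
  fixes Q :: "'g::chilbert_space \<Rightarrow> 'g"
  assumes Q: "selfadjoint Q"
  shows "Im (cinner u (H_Q h Q u)) = 0"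
proof -
  have s1: "(\<lambda>n. (norm (l2_fun u (n + k)))\<^sup>2) summable_on UNIV" for k
    using l2_fun_summable[of u] by (subst summable_on_reindex_bij_witness[of UNIV "\<lambda>n. n - k" "\<lambda>n. n + k" UNIV]) auto
  define a where "a = (\<lambda>n. cinner (l2_fun u n) (l2_fun u (n + 1)))"
  have sa: "a summable_on UNIV"
    unfolding a_def by (rule l2_cinner[OF l2_fun_summable s1])
  have "((\<lambda>n. a (n - 1)) has_sum infsum a UNIV) UNIV"
  proof (rule has_sum_reindex_bij_betw[THEN iffD2, OF _ has_sum_infsum[OF sa]])
    show "bij_betw (\<lambda>n::int. n - 1) UNIV UNIV" by (rule bij_betwI[of _ _ _ "\<lambda>n. n + 1"]) auto
  qed
  then have "((\<lambda>n. cnj (a (n - 1))) has_sum cnj (infsum a UNIV)) UNIV" by simp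
  then have h: "((\<lambda>n. a n + cnj (a (n - 1))) has_sum infsum a UNIV + cnj (infsum a UNIV)) UNIV"
    by (intro has_sum_add has_sum_infsum sa)
  have q: "((\<lambda>n. cinner (l2_fun u n) (l2_fun ((id \<otimes>\<^sub>o Q) u) n)) has_sum cinner u ((id \<otimes>\<^sub>o Q) u)) UNIV"
    by (rule cinner_l2_has_sum)
  have sq: "((\<lambda>n. cinner (l2_fun u n) (l2_fun u n)) has_sum cinner u u) UNIV" by (rule cinner_l2_has_sum)
  have "((\<lambda>n. of_real (1 / h\<^sup>2) * (2 * cinner (l2_fun u n) (l2_fun u n) + (- 1) * (a n + cnj (a (n - 1))))
      + cinner (l2_fun u n) (l2_fun ((id \<otimes>\<^sub>o Q) u) n)) has_sum
      of_real (1 / h\<^sup>2) * (2 * cinner u u + (- 1) * (infsum a UNIV + cnj (infsum a UNIV))) + cinner u ((id \<otimes>\<^sub>o Q) u)) UNIV"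
    by (intro has_sum_add has_sum_cmult_right sq h q)
  moreover have "of_real (1 / h\<^sup>2) * (2 * cinner (l2_fun u n) (l2_fun u n) + (- 1) * (a n + cnj (a (n - 1))))
      + cinner (l2_fun u n) (l2_fun ((id \<otimes>\<^sub>o Q) u) n) = cinner (l2_fun u n) (l2_fun (H_Q h Q u) n)" for n
    using cinner_commute[of "l2_fun u n" "l2_fun u (n - 1)"]
    by (simp add: a_def l2_fun_H_Q[OF selfadjoint_bcl[OF Q]] l2_fun_id_tensor[OF selfadjoint_bcl[OF Q]] cinner_simps algebra_simps)
  ultimately have "cinner u (H_Q h Q u) = of_real (1 / h\<^sup>2) * (2 * cinner u u + (- 1) * (infsum a UNIV + cnj (infsum a UNIV))) + cinner u ((id \<otimes>\<^sub>o Q) u)"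
    using cinner_l2_has_sum[of u "H_Q h Q u"] has_sum_unique by simp
  moreover have "selfadjoint (id \<otimes>\<^sub>o Q)"
    unfolding selfadjoint_def
  proof (intro conjI allI bcl_id_tensor[OF selfadjoint_bcl[OF Q]])
    show "cinner ((id \<otimes>\<^sub>o Q) x) y = cinner x ((id \<otimes>\<^sub>o Q) y)" for x y
      unfolding cinner_l2_def by (simp add: l2_fun_id_tensor[OF selfadjoint_bcl[OF Q]] selfadjoint_cinner[OF Q])
  qed
  ultimately show ?thesis using selfadjoint_Im[of "id \<otimes>\<^sub>o Q" u] by (simp add: cinner_self)
qed

text \<open>At a point with a known preimage, \<open>inv\<close> is determined by injectivity alone.
  That holds off the real axis: a vector with \<open>H u = z u\<close> satisfies
  \<open>Im z * (norm u)\<^sup>2 = 0\<close>.\<close>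

lemma inv_H_Q_eqI:
  fixes Q :: "'g::chilbert_space \<Rightarrow> 'g"
  assumes Q: "selfadjoint Q" and z: "Im z \<noteq> 0" and x: "H_Q h Q x - z *\<^sub>C x = w"
  shows "inv (\<lambda>u. H_Q h Q u - z *\<^sub>C u) w = x"
proof (rule inv_f_eq[where f = "\<lambda>u. H_Q h Q u - z *\<^sub>C u", OF _ x], rule injI)
  fix u v assume eq: "H_Q h Q u - z *\<^sub>C u = H_Q h Q v - z *\<^sub>C v"
  have b: "bounded_clinear (H_Q h Q)"
    unfolding H_Q_def[abs_def] by (intro bcl_plus bcl_laplace_tensor bcl_id_tensor selfadjoint_bcl Q)
  have "H_Q h Q (u - v) = z *\<^sub>C (u - v)"
    using eq by (simp add: bcl_diff[OF b] cspace.scale_right_diff_distrib algebra_simps)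
  then have "Im (z * of_real ((norm (u - v))\<^sup>2)) = 0"
    using Im_cinner_H_Q[OF Q, of "u - v" h] by (simp add: cinner_scaleC_right cinner_self)
  then show "u = v" using z by simp
qed

section \<open>Kernel operators\<close>

definition kernel_bdd :: "(int \<Rightarrow> int \<Rightarrow> complex) \<Rightarrow> real \<Rightarrow> bool"
  where "kernel_bdd k D \<longleftrightarrow> (\<forall>F G. finite F \<longrightarrow> finite G \<longrightarrow> (\<Sum>n\<in>F. \<Sum>m\<in>G. (norm (k n m))\<^sup>2) \<le> D)"

text \<open>Conjugated because \<open>l2_pair\<close> conjugates its first argument.\<close>

definition kernel_row :: "(int \<Rightarrow> int \<Rightarrow> complex) \<Rightarrow> int \<Rightarrow> complex l2"
  where "kernel_row k n = Abs_l2 (\<lambda>m. cnj (k n m))"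

text \<open>The tensor product of the scalar kernel \<open>k\<close> with \<open>C\<close>, with
  \<open>C\<close> applied after the summation so that each coordinate is one partial inner
  product.\<close>

definition kernel_op :: "(int \<Rightarrow> int \<Rightarrow> complex) \<Rightarrow> ('g::complex_inner \<Rightarrow> 'g) \<Rightarrow> 'g l2 \<Rightarrow> 'g l2"
  where "kernel_op k C = l2_lift (\<lambda>n u. C (l2_pair (kernel_row k n) u))"

lemma
  assumes k: "kernel_bdd k D"
  shows l2_fun_kernel_row: "l2_fun (kernel_row k n) m = cnj (k n m)"
    and kernel_row_norm: "finite F \<Longrightarrow> (\<Sum>n\<in>F. (norm (kernel_row k n))\<^sup>2) \<le> D"
proof -
  have "(\<Sum>m\<in>G. (norm (cnj (k n m)))\<^sup>2) \<le> D" if "finite G" for G n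
    using k[unfolded kernel_bdd_def, rule_format, of "{n}" G] that by simp
  then have "(\<lambda>m. (norm (cnj (k n m)))\<^sup>2) summable_on UNIV" for n
    by (intro nonneg_bdd_above_summable_on bdd_aboveI[of _ D]) auto
  then show f: "l2_fun (kernel_row k n) m = cnj (k n m)" for n m
    by (simp add: kernel_row_def Abs_l2_inverse)
  assume F: "finite F"
  have h0: "((\<lambda>m. (norm (k n m))\<^sup>2) has_sum (norm (kernel_row k n))\<^sup>2) UNIV" for n
    using norm_l2_has_sum[of "kernel_row k n"] by (simp add: f)
  have h: "((\<lambda>m. \<Sum>n\<in>F. (norm (k n m))\<^sup>2) has_sum (\<Sum>n\<in>F. (norm (kernel_row k n))\<^sup>2)) UNIV"
    using F by (induction F rule: finite_induct) (simp_all add: has_sum_add h0)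
  show "(\<Sum>n\<in>F. (norm (kernel_row k n))\<^sup>2) \<le> D"
  proof (rule has_sum_le_finite_sums[OF h])
    fix G :: "int set" assume "finite G"
    then show "(\<Sum>m\<in>G. \<Sum>n\<in>F. (norm (k n m))\<^sup>2) \<le> D"
      using k F by (subst sum.swap) (simp add: kernel_bdd_def)
  qed
qed

lemma kernel_pair_has_sum:
  fixes u :: "'g::chilbert_space l2"
  assumes k: "kernel_bdd k D"
  shows "((\<lambda>m. k n m *\<^sub>C l2_fun u m) has_sum l2_pair (kernel_row k n) u) UNIV"
  using l2_pair_has_sum[of "kernel_row k n" u] by (simp add: l2_fun_kernel_row[OF k])

text \<open>Coordinate \<open>n\<close> contributes the squared norm of row \<open>n\<close> times
  \<open>c\<close>, and the squared row norms add up to at most \<open>D\<close>.\<close>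

lemma
  fixes C :: "'g::chilbert_space \<Rightarrow> 'g"
  assumes k: "kernel_bdd k D" and C: "hs_bdd C c"
  shows l2_fun_kernel_op: "l2_fun (kernel_op k C u) n = C (l2_pair (kernel_row k n) u)"
    and hs_bdd_kernel_op: "hs_bdd (kernel_op k C) (D * c)"
proof -
  have P: "hs_bdd (\<lambda>u. C (l2_pair (kernel_row k n) u)) ((norm (kernel_row k n))\<^sup>2 * c)" for n
    by (rule hs_bdd_right[OF C bcl_l2_pair norm_ge_zero norm_l2_pair])
  have s: "(\<Sum>n\<in>F. (norm (kernel_row k n))\<^sup>2 * c) \<le> D * c" if "finite F" for F
    unfolding sum_distrib_right[symmetric]
    by (intro mult_right_mono kernel_row_norm[OF k that] hs_bdd_nonneg[OF C])
  show "l2_fun (kernel_op k C u) n = C (l2_pair (kernel_row k n) u)"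
    unfolding kernel_op_def by (rule hs_l2_fun_lift[OF P s])
  show "hs_bdd (kernel_op k C) (D * c)"
    unfolding kernel_op_def by (rule hs_bdd_l2_lift[OF P s])
qed

lemma kernel_bdd_add:
  assumes "kernel_bdd k D" "kernel_bdd k' D'"
  shows "kernel_bdd (\<lambda>n m. k n m + k' n m) (2 * D + 2 * D')"
  unfolding kernel_bdd_def
proof (intro allI impI)
  fix F G :: "int set" assume fin: "finite F" "finite G"
  have "(\<Sum>n\<in>F. \<Sum>m\<in>G. (norm (k n m + k' n m))\<^sup>2) \<le> (\<Sum>n\<in>F. \<Sum>m\<in>G. 2 * (norm (k n m))\<^sup>2 + 2 * (norm (k' n m))\<^sup>2)"
    by (intro sum_mono norm_sum_le_two)
  also have "\<dots> = 2 * (\<Sum>n\<in>F. \<Sum>m\<in>G. (norm (k n m))\<^sup>2) + 2 * (\<Sum>n\<in>F. \<Sum>m\<in>G. (norm (k' n m))\<^sup>2)"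
    by (simp add: sum.distrib sum_distrib_left)
  also have "\<dots> \<le> 2 * D + 2 * D'" using assms fin unfolding kernel_bdd_def by (intro add_mono mult_left_mono) auto
  finally show "(\<Sum>n\<in>F. \<Sum>m\<in>G. (norm (k n m + k' n m))\<^sup>2) \<le> 2 * D + 2 * D'" .
qed

lemma kernel_bdd_scale:
  assumes "kernel_bdd k D" shows "kernel_bdd (\<lambda>n m. a * k n m) ((norm a)\<^sup>2 * D)"
  using assms unfolding kernel_bdd_def
  by (auto simp: norm_mult power_mult_distrib sum_distrib_left[symmetric] mult_left_mono)

lemma kernel_op_add:
  fixes C :: "'g::chilbert_space \<Rightarrow> 'g"
  assumes k: "kernel_bdd k D" "kernel_bdd k' D'" and C: "hs_bdd C c"
  shows "kernel_op (\<lambda>n m. k n m + k' n m) C u = kernel_op k C u + kernel_op k' C u"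
proof (rule l2_eqI)
  fix n
  have "((\<lambda>m. (k n m + k' n m) *\<^sub>C l2_fun u m) has_sum l2_pair (kernel_row k n) u + l2_pair (kernel_row k' n) u) UNIV"
    unfolding scaleC_add_left by (intro has_sum_add kernel_pair_has_sum[OF k(1)] kernel_pair_has_sum[OF k(2)])
  then have "l2_pair (kernel_row (\<lambda>n m. k n m + k' n m) n) u = l2_pair (kernel_row k n) u + l2_pair (kernel_row k' n) u"
    using kernel_pair_has_sum[OF kernel_bdd_add[OF k]] has_sum_unique by blast
  then show "l2_fun (kernel_op (\<lambda>n m. k n m + k' n m) C u) n = l2_fun (kernel_op k C u + kernel_op k' C u) n"
    by (simp add: l2_fun_kernel_op[OF kernel_bdd_add[OF k] C] l2_fun_kernel_op[OF k(1) C] l2_fun_kernel_op[OF k(2) C]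
        bcl_add[OF hs_bdd_bcl[OF C]])
qed

lemma kernel_op_scale:
  fixes C :: "'g::chilbert_space \<Rightarrow> 'g"
  assumes k: "kernel_bdd k D" and C: "hs_bdd C c"
  shows "kernel_op (\<lambda>n m. a * k n m) C u = a *\<^sub>C kernel_op k C u"
proof (rule l2_eqI)
  fix n
  have "((\<lambda>m. a *\<^sub>C k n m *\<^sub>C l2_fun u m) has_sum a *\<^sub>C l2_pair (kernel_row k n) u) UNIV"
    by (rule has_sum_bounded_linear[OF bcl_bounded_linear[OF bcl_const_scaleC[OF bcl_id]] kernel_pair_has_sum[OF k]])
  then have "l2_pair (kernel_row (\<lambda>n m. a * k n m) n) u = a *\<^sub>C l2_pair (kernel_row k n) u"
    using kernel_pair_has_sum[OF kernel_bdd_scale[OF k]] has_sum_unique unfolding scaleC_scaleC by blast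
  then show "l2_fun (kernel_op (\<lambda>n m. a * k n m) C u) n = l2_fun (a *\<^sub>C kernel_op k C u) n"
    by (simp add: l2_fun_kernel_op[OF kernel_bdd_scale[OF k] C] l2_fun_kernel_op[OF k C] bcl_scaleC[OF hs_bdd_bcl[OF C]])
qed

lemma kernel_bdd_cnj: "kernel_bdd k D \<Longrightarrow> kernel_bdd (\<lambda>n m. cnj (k n m)) D"
  by (simp add: kernel_bdd_def)

lemma cinner_l2_delta: "cinner (l2_delta m) a = l2_fun a m"
proof -
  have "tensor_l2 (l2_delta m) (1::complex) = l2_delta m" by (rule l2_eqI) (simp add: scaleC_complex_def)
  then show ?thesis using cinner_delta_tensor[of m "1::complex" a] by (simp add: cinner_complex_def)
qed

text \<open>Conjugated suitably, both sides are bounded linear functionals of \<open>u\<close>, so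
  point masses suffice. Symmetry of \<open>k\<close> identifies the column that a point mass selects
  with a row.\<close>

lemma kernel_op_cinner:
  fixes C :: "'g::chilbert_space \<Rightarrow> 'g"
  assumes k: "kernel_bdd k D" and C: "hs_bdd C c" "selfadjoint C" and sym: "\<And>n m. k n m = k m n"
  shows "cinner (kernel_op (\<lambda>n m. cnj (k n m)) C y) u = cinner y (kernel_op k C u)"
proof -
  note kc = kernel_bdd_cnj[OF k]
  have "(\<lambda>u. cnj (cinner u (kernel_op (\<lambda>n m. cnj (k n m)) C y))) = (\<lambda>u. cinner y (kernel_op k C u))"
  proof (rule bcl_eq_on_delta)
    have "(\<lambda>u. cnj (cinner u (kernel_op (\<lambda>n m. cnj (k n m)) C y))) = cinner (kernel_op (\<lambda>n m. cnj (k n m)) C y)"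
      by (rule ext) (rule cinner_commute[symmetric])
    then show "bounded_clinear (\<lambda>u. cnj (cinner u (kernel_op (\<lambda>n m. cnj (k n m)) C y)))"
      by (simp add: bcl_cinner)
    show "bounded_clinear (\<lambda>u. cinner y (kernel_op k C u))"
      by (rule bcl_compose[OF bcl_cinner hs_bdd_bcl[OF hs_bdd_kernel_op[OF k C(1)]]])
    fix m and x :: 'g
    have "((\<lambda>j. cinner (C x) (cnj (k m j) *\<^sub>C l2_fun y j)) has_sum cinner (C x) (l2_pair (kernel_row (\<lambda>n m. cnj (k n m)) m) y)) UNIV"
      by (rule has_sum_bounded_linear[OF bcl_bounded_linear[OF bcl_cinner] kernel_pair_has_sum[OF kc]])
    then have "((\<lambda>j. cnj (cinner (C x) (cnj (k m j) *\<^sub>C l2_fun y j))) has_sum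
        cnj (cinner (C x) (l2_pair (kernel_row (\<lambda>n m. cnj (k n m)) m) y))) UNIV" by simp
    moreover have "cnj (cinner (C x) (cnj (k m j) *\<^sub>C l2_fun y j)) = cinner (l2_fun y j) (l2_fun (kernel_op k C (tensor_l2 (l2_delta m) x)) j)" for j
    proof -
      have "cinner (kernel_row k j) (l2_delta m) = k m j"
        using cinner_l2_delta[of m "kernel_row k j"] cinner_commute[of "kernel_row k j" "l2_delta m"]
        by (simp add: l2_fun_kernel_row[OF k] sym[of j])
      then show ?thesis
        using cinner_commute[of "l2_fun y j" "C x"]
        by (simp add: l2_fun_kernel_op[OF k C(1)] l2_pair_tensor bcl_scaleC[OF hs_bdd_bcl[OF C(1)]] cinner_simps)
    qed
    ultimately have "((\<lambda>j. cinner (l2_fun y j) (l2_fun (kernel_op k C (tensor_l2 (l2_delta m) x)) j)) has_sum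
        cnj (cinner (C x) (l2_pair (kernel_row (\<lambda>n m. cnj (k n m)) m) y))) UNIV" by simp
    then have "cinner y (kernel_op k C (tensor_l2 (l2_delta m) x)) = cnj (cinner (C x) (l2_pair (kernel_row (\<lambda>n m. cnj (k n m)) m) y))"
      using cinner_l2_has_sum has_sum_unique by blast
    then show "cnj (cinner (tensor_l2 (l2_delta m) x) (kernel_op (\<lambda>n m. cnj (k n m)) C y)) = cinner y (kernel_op k C (tensor_l2 (l2_delta m) x))"
      by (simp add: cinner_delta_tensor l2_fun_kernel_op[OF kc C(1)] selfadjoint_cinner[OF C(2)])
  qed
  then show ?thesis using cinner_commute[of "kernel_op (\<lambda>n m. cnj (k n m)) C y" u] by (simp add: fun_eq_iff)
qed

subsection \<open>Weighted convolution kernels\<close>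

lemma summable_on_int_even:
  fixes f :: "int \<Rightarrow> real"
  assumes s: "summable (\<lambda>n. f (int n))" and nn: "\<And>n. 0 \<le> f n" and even: "\<And>n. f (- n) = f n"
  shows "f summable_on UNIV"
proof -
  have "(\<lambda>n. f (int n)) summable_on UNIV" using s nn by (intro summable_nonneg_imp_summable_on) auto
  moreover have "bij_betw int UNIV {0..}" by (rule bij_betwI[of _ _ _ nat]) auto
  ultimately have p: "f summable_on {0..}" using summable_on_reindex_bij_betw by blast
  have "bij_betw uminus {0..} {..0::int}" by (rule bij_betwI[of _ _ _ uminus]) auto
  then have "(\<lambda>n. f (- n)) summable_on {0..} \<longleftrightarrow> f summable_on {..0}"
    by (rule summable_on_reindex_bij_betw)
  then have m: "f summable_on {..0}" using p by (simp add: even)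
  have "f summable_on {0..} \<union> {..0}" by (rule summable_on_union[OF p m])
  moreover have "{0..} \<union> {..0} = (UNIV :: int set)" by auto
  ultimately show ?thesis by simp
qed

lemma bracket_powr_summable:
  assumes "a > 1"
  shows "(\<lambda>n. bracket n powr (- a)) summable_on UNIV"
proof (rule summable_on_int_even)
  show "summable (\<lambda>n. bracket (int n) powr (- a))"
  proof (rule summable_comparison_test'[where N = 1])
    show "summable (\<lambda>n. real n powr (- a))" using assms by (simp add: summable_real_powr_iff)
    fix n :: nat assume n: "1 \<le> n"
    have "real n \<le> bracket (int n)" unfolding bracket_def by (rule real_le_rsqrt) simp
    then have "bracket (int n) powr (- a) \<le> real n powr (- a)"
      using n assms by (intro powr_mono2') auto
    then show "norm (bracket (int n) powr (- a)) \<le> real n powr (- a)" by simp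
  qed
qed (auto simp: bracket_def)

definition weighted_kernel :: "real \<Rightarrow> (int \<Rightarrow> complex) \<Rightarrow> int \<Rightarrow> int \<Rightarrow> complex"
  where "weighted_kernel \<nu> r n m = of_real (weight \<nu> n * weight \<nu> m) * r (n - m)"

text \<open>The factor 2 comes from bounding \<open>1 + (n - m)\<^sup>2\<close> by twice the product
  of the squared brackets of \<open>n\<close> and \<open>m\<close>. Each bracket then lowers the
  decay of its weight from exponent \<open>\<nu>\<close> to \<open>\<nu> - 2\<close>.\<close>

definition weight_const :: "real \<Rightarrow> real"
  where "weight_const \<nu> = 2 * (\<Sum>\<^sub>\<infinity>n. bracket n powr (2 - \<nu>))\<^sup>2"

lemma weight_squared: "(weight \<nu> n)\<^sup>2 = bracket n powr (- \<nu>)"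
proof -
  have "(weight \<nu> n)\<^sup>2 = bracket n powr (-\<nu>/2) * bracket n powr (-\<nu>/2)"
    by (simp add: weight_def power2_eq_square)
  also have "\<dots> = bracket n powr (-\<nu>/2 + -\<nu>/2)" by (rule powr_add[symmetric])
  finally show ?thesis by simp
qed

text \<open>Here the hypothesis \<open>\<nu> > 3\<close> is decisive: a kernel of linear growth
  leaves the weights with exponent \<open>\<nu> - 2\<close>, which must exceed 1 for summability
  over the integers.\<close>

lemma kernel_bdd_weighted:
  assumes \<nu>: "\<nu> > 3" and r: "\<And>j. (norm (r j))\<^sup>2 \<le> \<kappa> * (1 + (of_int j)\<^sup>2)"
  shows "kernel_bdd (weighted_kernel \<nu> r) (weight_const \<nu> * \<kappa>)"
  unfolding kernel_bdd_def
proof (intro allI impI)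
  define b where "b n = bracket n powr (2 - \<nu>)" for n
  have b0: "0 \<le> b n" for n by (simp add: b_def)
  have bs: "b summable_on UNIV"
    using bracket_powr_summable[of "\<nu> - 2"] \<nu> by (simp add: b_def[abs_def])
  have \<kappa>: "0 \<le> \<kappa>" using r[of 0] order_trans[OF zero_le_power2 r[of 0]] by simp
  have le: "(norm (weighted_kernel \<nu> r n m))\<^sup>2 \<le> 2 * \<kappa> * (b n * b m)" for n m
  proof -
    have "1 + (of_int (n - m))\<^sup>2 \<le> 2 * ((bracket n)\<^sup>2 * (bracket m)\<^sup>2)"
    proof -
      have "(of_int (n - m) :: real)\<^sup>2 \<le> 2 * (of_int n)\<^sup>2 + 2 * (of_int m)\<^sup>2"
        using zero_le_power2[of "of_int n + of_int m :: real"] by (simp add: power2_eq_square algebra_simps)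
      moreover have "(bracket n)\<^sup>2 = 1 + (of_int n)\<^sup>2" "(bracket m)\<^sup>2 = 1 + (of_int m)\<^sup>2"
        by (simp_all add: bracket_def add_nonneg_nonneg)
      then have "2 * ((bracket n)\<^sup>2 * (bracket m)\<^sup>2)
          = 2 + 2 * (of_int n)\<^sup>2 + 2 * (of_int m)\<^sup>2 + 2 * ((of_int n)\<^sup>2 * (of_int m)\<^sup>2)"
        by (simp add: algebra_simps)
      moreover have "0 \<le> (of_int n)\<^sup>2 * (of_int m :: real)\<^sup>2" by simp
      ultimately show ?thesis by linarith
    qed
    then have "\<kappa> * (1 + (of_int (n - m))\<^sup>2) \<le> \<kappa> * (2 * ((bracket n)\<^sup>2 * (bracket m)\<^sup>2))"
      by (rule mult_left_mono[OF _ \<kappa>])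
    then have r': "(norm (r (n - m)))\<^sup>2 \<le> \<kappa> * (2 * ((bracket n)\<^sup>2 * (bracket m)\<^sup>2))"
      using r order_trans by blast
    have bb: "(weight \<nu> i)\<^sup>2 * (bracket i)\<^sup>2 = b i" for i
    proof -
      have "(bracket i)\<^sup>2 = bracket i powr 2" using bracket_ge_1[of i] by simp
      then show ?thesis by (simp add: weight_squared b_def powr_add[symmetric])
    qed
    have "(norm (weighted_kernel \<nu> r n m))\<^sup>2 = (weight \<nu> n)\<^sup>2 * (weight \<nu> m)\<^sup>2 * (norm (r (n - m)))\<^sup>2"
      by (simp add: weighted_kernel_def norm_mult power_mult_distrib)
    also have "\<dots> \<le> (weight \<nu> n)\<^sup>2 * (weight \<nu> m)\<^sup>2 * (\<kappa> * (2 * ((bracket n)\<^sup>2 * (bracket m)\<^sup>2)))"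
      by (intro mult_left_mono r') auto
    also have "\<dots> = 2 * \<kappa> * (((weight \<nu> n)\<^sup>2 * (bracket n)\<^sup>2) * ((weight \<nu> m)\<^sup>2 * (bracket m)\<^sup>2))"
      by (simp only: mult_ac)
    finally show ?thesis unfolding bb .
  qed
  fix F G :: "int set" assume fin: "finite F" "finite G"
  have "(\<Sum>n\<in>F. \<Sum>m\<in>G. (norm (weighted_kernel \<nu> r n m))\<^sup>2) \<le> (\<Sum>n\<in>F. \<Sum>m\<in>G. 2 * \<kappa> * (b n * b m))"
    by (intro sum_mono le)
  also have "\<dots> = 2 * \<kappa> * (sum b F * sum b G)" unfolding sum_product by (simp add: sum_distrib_left)
  also have "\<dots> \<le> 2 * \<kappa> * (infsum b UNIV * infsum b UNIV)"
    by (intro mult_left_mono mult_mono finite_sum_le_infsum bs fin sum_nonneg b0 infsum_nonneg) (auto simp: \<kappa> b0)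
  finally show "(\<Sum>n\<in>F. \<Sum>m\<in>G. (norm (weighted_kernel \<nu> r n m))\<^sup>2) \<le> weight_const \<nu> * \<kappa>"
    by (simp add: weight_const_def b_def[abs_def] power2_eq_square algebra_simps)
qed

section \<open>Green's function of the discrete Laplacian\<close>

text \<open>The prefactor is dictated by the point source at \<open>j = 0\<close>. For
  \<open>norm \<rho> < 1\<close> the sequence is square summable; on the unit circle the same
  formula gives the boundary value.\<close>

definition green :: "real \<Rightarrow> complex \<Rightarrow> int \<Rightarrow> complex"
  where "green h \<rho> j = of_real (h\<^sup>2) / (1 / \<rho> - \<rho>) * \<rho> ^ nat \<bar>j\<bar>"

text \<open>Away from 0 the relation for \<open>\<rho> + 1 / \<rho>\<close> is the characteristic
  equation of the recurrence; at 0 both neighbours carry \<open>\<rho>\<close>, which leaves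
  \<open>1 / \<rho> - \<rho>\<close> times the prefactor.\<close>

lemma green_equation:
  assumes h: "h \<noteq> 0" and \<rho>: "\<rho> \<noteq> 0" "\<rho>\<^sup>2 \<noteq> 1" "\<rho> + 1 / \<rho> = 2 - of_real (h\<^sup>2) * \<zeta>"
  shows "of_real (1 / h\<^sup>2) * (2 * green h \<rho> j - green h \<rho> (j + 1) - green h \<rho> (j - 1)) - \<zeta> * green h \<rho> j = (if j = 0 then 1 else 0)"
proof -
  define \<gamma> where "\<gamma> = of_real (h\<^sup>2) / (1 / \<rho> - \<rho>)"
  have g: "green h \<rho> j = \<gamma> * \<rho> ^ nat \<bar>j\<bar>" for j by (simp add: green_def \<gamma>_def)
  have h2: "complex_of_real (h\<^sup>2) \<noteq> 0" using h by simp
  have z: "of_real (h\<^sup>2) * \<zeta> = 2 - \<rho> - 1 / \<rho>" using \<rho>(3) by (simp add: algebra_simps)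
  have d: "1 / \<rho> - \<rho> \<noteq> 0" using \<rho>(1,2) by (auto simp: field_simps power2_eq_square)
  have main: "2 * green h \<rho> j - green h \<rho> (j + 1) - green h \<rho> (j - 1) - of_real (h\<^sup>2) * \<zeta> * green h \<rho> j
      = (if j = 0 then of_real (h\<^sup>2) else 0)"
  proof (cases "j = 0")
    case True
    have "2 * green h \<rho> j - green h \<rho> (j + 1) - green h \<rho> (j - 1) - of_real (h\<^sup>2) * \<zeta> * green h \<rho> j = \<gamma> * (1 / \<rho> - \<rho>)"
      unfolding z by (simp add: g True) (simp add: algebra_simps)
    then show ?thesis using d True by (simp add: \<gamma>_def)
  next
    case False
    define k where "k = nat \<bar>j\<bar> - 1"
    have jk: "nat \<bar>j\<bar> = Suc k" using False by (simp add: k_def)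
    have "(nat \<bar>j + 1\<bar> = Suc (Suc k) \<and> nat \<bar>j - 1\<bar> = k) \<or> (nat \<bar>j - 1\<bar> = Suc (Suc k) \<and> nat \<bar>j + 1\<bar> = k)"
      using jk by linarith
    then have "green h \<rho> (j + 1) + green h \<rho> (j - 1) = \<gamma> * (\<rho> ^ Suc (Suc k) + \<rho> ^ k)"
    proof (elim disjE conjE)
      assume a: "nat \<bar>j + 1\<bar> = Suc (Suc k)" "nat \<bar>j - 1\<bar> = k"
      show ?thesis unfolding g a by (simp only: distrib_left)
    next
      assume a: "nat \<bar>j - 1\<bar> = Suc (Suc k)" "nat \<bar>j + 1\<bar> = k"
      show ?thesis unfolding g a by (simp only: distrib_left add.commute)
    qed
    moreover have "\<rho> ^ Suc (Suc k) + \<rho> ^ k = \<rho> ^ Suc k * (\<rho> + 1 / \<rho>)" using \<rho>(1) by (simp add: algebra_simps)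
    ultimately have "green h \<rho> (j + 1) + green h \<rho> (j - 1) = green h \<rho> j * (\<rho> + 1 / \<rho>)"
      by (simp only: g jk mult.assoc)
    then show ?thesis unfolding z using False by (simp add: algebra_simps)
  qed
  have "of_real (1 / h\<^sup>2) * (2 * green h \<rho> j - green h \<rho> (j + 1) - green h \<rho> (j - 1)) - \<zeta> * green h \<rho> j
      = (2 * green h \<rho> j - green h \<rho> (j + 1) - green h \<rho> (j - 1) - of_real (h\<^sup>2) * \<zeta> * green h \<rho> j) / of_real (h\<^sup>2)"
    using h2 by (simp add: field_simps)
  also have "\<dots> = (if j = 0 then 1 else 0)" unfolding main using h2 by simp
  finally show ?thesis .
qed

text \<open>The two roots are inverse to each other. If both had modulus 1 they would be conjugate
  and their sum real, but it has nonzero imaginary part.\<close>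

lemma small_root_exists:
  assumes "h \<noteq> 0" "Im \<zeta> > 0"
  shows "\<exists>\<rho>. \<rho> \<noteq> 0 \<and> norm \<rho> < 1 \<and> \<rho> + 1 / \<rho> = 2 - of_real (h\<^sup>2) * \<zeta>"
proof -
  define b where "b = 2 - of_real (h\<^sup>2) * \<zeta>"
  define q where "q = (b + csqrt (b\<^sup>2 - 4)) / 2"
  define p where "p = (b - csqrt (b\<^sup>2 - 4)) / 2"
  have "p * q = (b\<^sup>2 - (csqrt (b\<^sup>2 - 4))\<^sup>2) / 4" by (simp add: p_def q_def power2_eq_square algebra_simps)
  then have pq: "p * q = 1" by simp
  have s: "p + q = b" by (simp add: p_def q_def add_divide_distrib[symmetric])
  have nz: "p \<noteq> 0" "q \<noteq> 0" using pq by auto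
  have inv: "1 / p = q" "1 / q = p" using pq nz by (auto simp: field_simps)
  have "Im b \<noteq> 0" using assms by (simp add: b_def)
  have "norm q \<noteq> 1"
  proof
    assume "norm q = 1"
    then have "cnj q = p" using pq nz complex_norm_square[of q] by (metis mult.commute mult_cancel_left of_real_1 power_one)
    then have "Im b = 0" using s by (metis add.commute complex_In_mult_cnj_zero complex_add_cnj Im_complex_of_real)
    then show False using \<open>Im b \<noteq> 0\<close> by simp
  qed
  moreover have "norm p * norm q = 1" using pq by (metis norm_mult norm_one)
  ultimately have "norm q < 1 \<or> norm p < 1" 
    using nz by (metis linorder_neqE_linordered_idom mult.left_neutral mult_less_cancel_right_pos zero_less_norm_iff)
  then show ?thesis
  proof
    assume "norm q < 1" then show ?thesis using nz inv s by (intro exI[of _ q]) (simp add: b_def add.commute)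
  next
    assume "norm p < 1" then show ?thesis using nz inv s by (intro exI[of _ p]) (simp add: b_def)
  qed
qed

text \<open>From \<open>(\<rho> - \<rho>\<^sub>0) * (\<rho> - 1 / \<rho>\<^sub>0) = \<rho> *
  ((\<rho> + 1 / \<rho>) - (\<rho>\<^sub>0 + 1 / \<rho>\<^sub>0))\<close>. A root kept away from
  \<open>1 / \<rho>\<^sub>0\<close> converges to \<open>\<rho>\<^sub>0\<close>, with no branch of
  the square root to follow.\<close>

lemma root_difference:
  assumes "\<rho> \<noteq> 0" "\<rho>\<^sub>0 \<noteq> 0" "norm \<rho> \<le> 1" "\<epsilon> > 0"
    and "\<rho> + 1 / \<rho> = 2 - of_real (h\<^sup>2) * Complex x \<epsilon>" "\<rho>\<^sub>0 + 1 / \<rho>\<^sub>0 = 2 - of_real (h\<^sup>2) * of_real x"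
  shows "norm (\<rho> - \<rho>\<^sub>0) * norm (\<rho> - 1 / \<rho>\<^sub>0) \<le> h\<^sup>2 * \<epsilon>"
proof -
  have C: "Complex x \<epsilon> = of_real x + \<i> * of_real \<epsilon>" by (simp add: complex_eq_iff)
  have "(\<rho> - \<rho>\<^sub>0) * (\<rho> - 1 / \<rho>\<^sub>0) = \<rho> * ((\<rho> + 1 / \<rho>) - (\<rho>\<^sub>0 + 1 / \<rho>\<^sub>0))"
    using assms(1,2) by (simp add: field_simps)
  also have "\<dots> = \<rho> * (- (of_real (h\<^sup>2) * (\<i> * of_real \<epsilon>)))"
    unfolding assms(5,6) C by (simp add: algebra_simps)
  finally have "norm ((\<rho> - \<rho>\<^sub>0) * (\<rho> - 1 / \<rho>\<^sub>0)) = norm \<rho> * (h\<^sup>2 * \<epsilon>)"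
    using assms(4) by (simp add: norm_mult del: of_real_power)
  also have "\<dots> \<le> 1 * (h\<^sup>2 * \<epsilon>)" using assms(3,4) by (intro mult_right_mono) auto
  finally show ?thesis by (simp add: norm_mult)
qed

text \<open>Selects the boundary root inside the band: in the disc \<open>1 / \<rho>\<close> has an
  imaginary part of opposite sign that dominates, so the sign of \<open>Im \<zeta>\<close> fixes
  that of \<open>Im \<rho>\<close>.\<close>

lemma Im_small_root:
  assumes "\<rho> \<noteq> 0" "norm \<rho> < 1" "Im \<zeta> > 0" "h \<noteq> 0" "\<rho> + 1 / \<rho> = 2 - of_real (h\<^sup>2) * \<zeta>"
  shows "Im \<rho> > 0"
proof -
  have "Im (1 / \<rho>) = - Im \<rho> / (norm \<rho>)\<^sup>2" by (simp add: Im_divide cmod_power2)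
  then have "Im \<rho> * (1 - 1 / (norm \<rho>)\<^sup>2) = - (h\<^sup>2 * Im \<zeta>)"
    using arg_cong[OF assms(5), of Im] by (simp add: algebra_simps del: of_real_power)
  moreover have "h\<^sup>2 * Im \<zeta> > 0" using assms by simp
  moreover have "1 - 1 / (norm \<rho>)\<^sup>2 < 0"
  proof -
    have "(norm \<rho>)\<^sup>2 < 1" "0 < (norm \<rho>)\<^sup>2" using assms(1,2) by (auto simp: power_less_one_iff abs_square_less_1)
    then show ?thesis by (simp add: less_divide_eq)
  qed
  ultimately show ?thesis by (smt (verit) mult_nonpos_nonpos)
qed

lemma norm_power_diff_le:
  fixes a b :: complex
  assumes "norm a \<le> 1" "norm b \<le> 1"
  shows "norm (a ^ n - b ^ n) \<le> real n * norm (a - b)"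
  using norm_power_diff[OF assms, of n] by simp

text \<open>The difference splits into one of prefactors and one of powers. The latter grows
  linearly in \<open>j\<close>, hence the factor \<open>1 + (of_int j)\<^sup>2\<close>.\<close>

lemma green_difference:
  assumes "norm \<rho> \<le> 1" "norm \<rho>\<^sub>0 \<le> 1"
  shows "(norm (green h \<rho> j - green h \<rho>\<^sub>0 j))\<^sup>2
    \<le> 2 * ((norm (of_real (h\<^sup>2) / (1 / \<rho> - \<rho>) - of_real (h\<^sup>2) / (1 / \<rho>\<^sub>0 - \<rho>\<^sub>0)))\<^sup>2
        + (norm (of_real (h\<^sup>2) / (1 / \<rho>\<^sub>0 - \<rho>\<^sub>0)))\<^sup>2 * (norm (\<rho> - \<rho>\<^sub>0))\<^sup>2) * (1 + (of_int j)\<^sup>2)"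
proof -
  define a b n where "a = of_real (h\<^sup>2) / (1 / \<rho> - \<rho>)" and "b = of_real (h\<^sup>2) / (1 / \<rho>\<^sub>0 - \<rho>\<^sub>0)" and "n = nat \<bar>j\<bar>"
  have "green h \<rho> j - green h \<rho>\<^sub>0 j = (a - b) * \<rho> ^ n + b * (\<rho> ^ n - \<rho>\<^sub>0 ^ n)"
    unfolding green_def a_def[symmetric] b_def[symmetric] n_def[symmetric] by (simp add: algebra_simps)
  then have "(norm (green h \<rho> j - green h \<rho>\<^sub>0 j))\<^sup>2 \<le> 2 * (norm ((a - b) * \<rho> ^ n))\<^sup>2 + 2 * (norm (b * (\<rho> ^ n - \<rho>\<^sub>0 ^ n)))\<^sup>2"
    by (metis norm_sum_le_two)
  moreover have "(norm ((a - b) * \<rho> ^ n))\<^sup>2 \<le> (norm (a - b))\<^sup>2"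
    using assms by (intro power_mono) (auto simp: norm_mult norm_power intro!: mult_left_le power_le_one)
  moreover have "(norm (b * (\<rho> ^ n - \<rho>\<^sub>0 ^ n)))\<^sup>2 \<le> (norm b * (real n * norm (\<rho> - \<rho>\<^sub>0)))\<^sup>2"
    using norm_power_diff_le[OF assms, of n] by (intro power_mono) (auto simp: norm_mult intro!: mult_left_mono)
  moreover have "(norm b * (real n * norm (\<rho> - \<rho>\<^sub>0)))\<^sup>2 = (norm b)\<^sup>2 * (norm (\<rho> - \<rho>\<^sub>0))\<^sup>2 * (of_int j)\<^sup>2"
    by (simp add: n_def power_mult_distrib)
  ultimately have "(norm (green h \<rho> j - green h \<rho>\<^sub>0 j))\<^sup>2
      \<le> 2 * (norm (a - b))\<^sup>2 + 2 * ((norm b)\<^sup>2 * (norm (\<rho> - \<rho>\<^sub>0))\<^sup>2 * (of_int j)\<^sup>2)"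
    by linarith
  also have "\<dots> \<le> 2 * ((norm (a - b))\<^sup>2 + (norm b)\<^sup>2 * (norm (\<rho> - \<rho>\<^sub>0))\<^sup>2) * (1 + (of_int j)\<^sup>2)"
    using mult_nonneg_nonneg[OF zero_le_power2[of "norm (a - b)"] zero_le_power2[of "of_int j"]]
      mult_nonneg_nonneg[OF zero_le_power2[of "norm b"] zero_le_power2[of "norm (\<rho> - \<rho>\<^sub>0)"]]
    unfolding distrib_left distrib_right by linarith
  finally show ?thesis unfolding a_def b_def .
qed

text \<open>The convolution is summed as a series of translates of Green's function in the Hilbert
  space. All translates have the same norm, so absolute summability of \<open>w\<close> suffices,
  and the coordinates converge along with the series.\<close>

lemma resolvent_solution:
  fixes w :: "'g::chilbert_space l2"
  assumes \<rho>: "norm \<rho> < 1" and w: "(\<lambda>m. norm (l2_fun w m)) summable_on UNIV"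
  shows "\<exists>x :: 'g l2. \<forall>n. ((\<lambda>m. green h \<rho> (n - m) *\<^sub>C l2_fun w m) has_sum l2_fun x n) UNIV"
proof -
  have s0: "(\<lambda>j. (norm (green h \<rho> j))\<^sup>2) summable_on UNIV"
  proof (rule summable_on_int_even)
    have "(norm (green h \<rho> (int n)))\<^sup>2 = (norm (of_real (h\<^sup>2) / (1 / \<rho> - \<rho>)))\<^sup>2 * ((norm \<rho>)\<^sup>2) ^ n" for n
      unfolding green_def norm_mult power_mult_distrib norm_power by (simp add: mult.commute flip: power_mult)
    moreover have "summable (\<lambda>n. (norm (of_real (h\<^sup>2) / (1 / \<rho> - \<rho>)))\<^sup>2 * ((norm \<rho>)\<^sup>2) ^ n)"
      using \<rho> by (intro summable_mult summable_geometric) (simp add: abs_square_less_1)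
    ultimately show "summable (\<lambda>n. (norm (green h \<rho> (int n)))\<^sup>2)" by simp
  qed (auto simp: green_def)
  have bij: "bij_betw (\<lambda>n::int. n - m) UNIV UNIV" for m by (rule bij_betwI[of _ _ _ "\<lambda>n. n + m"]) auto
  have sm: "(\<lambda>n. (norm (green h \<rho> (n - m)))\<^sup>2) summable_on UNIV" for m
    using s0 by (subst summable_on_reindex_bij_betw[OF bij[of m]])
  define a where "a m = Abs_l2 (\<lambda>n. green h \<rho> (n - m))" for m
  have a: "l2_fun (a m) n = green h \<rho> (n - m)" for m n
    using sm[of m] by (simp add: a_def Abs_l2_inverse)
  have na: "norm (a m) = norm (a 0)" for m
  proof -
    have "((\<lambda>n. (norm (green h \<rho> (n - m)))\<^sup>2) has_sum (norm (a 0))\<^sup>2) UNIV"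
      using norm_l2_has_sum[of "a 0"] unfolding a
      by (subst has_sum_reindex_bij_betw[OF bij[of m], of "\<lambda>n. (norm (green h \<rho> n))\<^sup>2"]) simp
    then have "(norm (a m))\<^sup>2 = (norm (a 0))\<^sup>2"
      using norm_l2_has_sum[of "a m"] has_sum_unique unfolding a by blast
    then show ?thesis by (simp add: power2_eq_iff_nonneg)
  qed
  have "norm (tensor_l2 (a m) (l2_fun w m)) = norm (a 0) * norm (l2_fun w m)" for m
    using na[of m] by (simp add: norm_tensor_l2)
  then have "(\<lambda>m. norm (tensor_l2 (a m) (l2_fun w m))) summable_on UNIV"
    by (simp add: summable_on_cmult_right[OF w])
  then have "(\<lambda>m. tensor_l2 (a m) (l2_fun w m)) summable_on UNIV" by (rule abs_summable_summable)
  then obtain x where "((\<lambda>m. tensor_l2 (a m) (l2_fun w m)) has_sum x) UNIV" by (auto simp: summable_on_def)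
  from has_sum_bounded_linear[OF bcl_bounded_linear[OF bcl_l2_fun] this]
  have "((\<lambda>m. green h \<rho> (n - m) *\<^sub>C l2_fun w m) has_sum l2_fun x n) UNIV" for n by (simp add: a)
  then show ?thesis by blast
qed

subsection \<open>Boundary values of Green's function\<close>

text \<open>The modulus of the prefactor \<open>h\<^sup>2 / (1 / \<rho> - \<rho>)\<close> at real
  energies, inside and outside the band; inside, it is also the scalar factor in
  \<open>Omega\<close>.\<close>

definition threshold_factor :: "real \<Rightarrow> real \<Rightarrow> real"
  where "threshold_factor h x = 1 / (sqrt \<bar>x\<bar> * sqrt \<bar>4 / h\<^sup>2 - x\<bar>)"

text \<open>The band is parametrized by \<open>x = (4 / h\<^sup>2) * (sin g)\<^sup>2\<close>, so
  that \<open>cos (2 * g) = 1 - h\<^sup>2 * x / 2\<close>. The last identity lets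
  \<open>sin (2 * g)\<close> cancel the singularity of the prefactor.\<close>

lemma boundary_root_inside:
  assumes h: "h > 0" and x: "0 < x" "x < 4 / h\<^sup>2"
  defines "g \<equiv> arcsin (h / 2 * sqrt x)"
  shows "cis (2 * g) + 1 / cis (2 * g) = 2 - of_real (h\<^sup>2) * of_real x"
    and "of_real (h\<^sup>2) / (1 / cis (2 * g) - cis (2 * g)) = \<i> * of_real (threshold_factor h x)"
    and "sin (2 * g) > 0" and "threshold_factor h x * sin (2 * g) = h\<^sup>2 / 2"
proof -
  define y where "y = h / 2 * sqrt x"
  have y2: "y\<^sup>2 = h\<^sup>2 * x / 4" using x by (simp add: y_def power_mult_distrib power_divide)
  have y0: "0 < y" using h x by (simp add: y_def)
  have "h\<^sup>2 * x < 4" using h x by (simp add: field_simps)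
  then have "y\<^sup>2 < 1" by (simp add: y2)
  then have y1: "y < 1" using y0 by (simp add: abs_square_less_1)
  have sg: "sin g = y" using y0 y1 unfolding g_def y_def[symmetric] by simp
  have cg: "cos g = sqrt (1 - y\<^sup>2)" using y0 y1 unfolding g_def y_def[symmetric] by (simp add: cos_arcsin)
  have "1 - y\<^sup>2 = (h / 2)\<^sup>2 * (4 / h\<^sup>2 - x)" using h by (simp add: y2 power_divide field_simps)
  then have cg': "cos g = h / 2 * sqrt (4 / h\<^sup>2 - x)" using h by (simp add: cg real_sqrt_mult)
  have s2: "sin (2 * g) = h\<^sup>2 / 2 * (sqrt x * sqrt (4 / h\<^sup>2 - x))"
    by (simp add: sin_double sg cg' y_def power2_eq_square)
  have pos: "sqrt x * sqrt (4 / h\<^sup>2 - x) > 0" using x by simp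
  show sp: "sin (2 * g) > 0" unfolding s2 by (rule mult_pos_pos[OF _ pos]) (use h in simp)
  have c2: "cos (2 * g) = 1 - h\<^sup>2 * x / 2" using cos_double_sin[of g] by (simp add: sg y2)
  have inv: "1 / cis (2 * g) = cis (- (2 * g))" by (simp add: cis_inverse[symmetric] inverse_eq_divide)
  show "cis (2 * g) + 1 / cis (2 * g) = 2 - of_real (h\<^sup>2) * of_real x"
    unfolding inv by (simp add: complex_eq_iff c2 del: of_real_power of_real_mult)
  show f: "threshold_factor h x * sin (2 * g) = h\<^sup>2 / 2"
    unfolding s2 threshold_factor_def using x pos by (simp add: field_simps)
  have tf: "threshold_factor h x = h\<^sup>2 / 2 / sin (2 * g)" using f sp by (simp add: field_simps)
  have d: "1 / cis (2 * g) - cis (2 * g) = - (2 * \<i> * of_real (sin (2 * g)))"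
    unfolding inv by (simp add: complex_eq_iff)
  show "of_real (h\<^sup>2) / (1 / cis (2 * g) - cis (2 * g)) = \<i> * of_real (threshold_factor h x)"
    unfolding d tf using sp by (simp add: complex_eq_iff Re_divide Im_divide power2_eq_square)
qed

text \<open>Outside the band \<open>2 - h\<^sup>2 * x\<close> has modulus above 2 and the roots are
  real. A value below -2 is reduced to one above 2 by changing the sign of the root.\<close>

lemma boundary_root_outside:
  assumes h: "h > 0" and x: "x < 0 \<or> 4 / h\<^sup>2 < x"
  shows "\<exists>r::real. r \<noteq> 0 \<and> \<bar>r\<bar> < 1 \<and> r + 1 / r = 2 - h\<^sup>2 * x \<and> h\<^sup>2 / \<bar>1 / r - r\<bar> = threshold_factor h x"
proof -
  have root: "\<exists>r. 0 < r \<and> r < 1 \<and> r + 1 / r = b" if "b > 2" for b :: real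
  proof -
    define s where "s = sqrt (b\<^sup>2 - 4)"
    have "b\<^sup>2 > 4" using that power_strict_mono[of 2 b 2] by simp
    then have s: "s > 0" "s\<^sup>2 = b\<^sup>2 - 4" by (auto simp: s_def)
    define r where "r = (b - s) / 2"
    have p: "r * ((b + s) / 2) = 1" using s(2) by (simp add: r_def power2_eq_square field_simps)
    have q: "(b + s) / 2 > 1" using that s(1) by simp
    have r0: "r > 0" using p q by (metis zero_less_mult_pos2 zero_less_one order_less_trans)
    have inv: "1 / r = (b + s) / 2" using p r0 by (simp add: field_simps)
    have "r * 1 < r * ((b + s) / 2)" using q r0 by (rule mult_strict_left_mono)
    then have "r < 1" unfolding p by simp
    moreover have "r + 1 / r = b" unfolding inv by (simp add: r_def field_simps)
    ultimately show ?thesis using r0 by blast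
  qed
  define b where "b = 2 - h\<^sup>2 * x"
  have "b > 2 \<or> - b > 2"
  proof (cases "x < 0")
    case True
    then have "h\<^sup>2 * x < 0" using h by (simp add: mult_pos_neg)
    then show ?thesis by (simp add: b_def)
  next
    case False
    then have "h\<^sup>2 * x > 4" using h x by (simp add: field_simps)
    then show ?thesis by (simp add: b_def)
  qed
  then obtain r where r: "r \<noteq> 0" "\<bar>r\<bar> < 1" "r + 1 / r = b"
  proof
    assume "b > 2"
    then obtain r where "0 < r" "r < 1" "r + 1 / r = b" using root[of b] by blast
    then show ?thesis using that[of r] by simp
  next
    assume "- b > 2"
    then obtain r where "0 < r" "r < 1" "r + 1 / r = - b" using root[of "- b"] by blast
    then show ?thesis using that[of "- r"] by simp
  qed
  have "(1 / r - r)\<^sup>2 = b\<^sup>2 - 4" using r(1) by (simp add: r(3)[symmetric] power2_eq_square field_simps)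
  also have "\<dots> = h\<^sup>2 * h\<^sup>2 * (x * (x - 4 / h\<^sup>2))" using h by (simp add: b_def power2_eq_square field_simps)
  finally have e: "(1 / r - r)\<^sup>2 = (h\<^sup>2)\<^sup>2 * (x * (x - 4 / h\<^sup>2))" by (simp add: power2_eq_square)
  have "\<bar>1 / r - r\<bar> = sqrt ((1 / r - r)\<^sup>2)" by simp
  also have "\<dots> = h\<^sup>2 * sqrt \<bar>x * (x - 4 / h\<^sup>2)\<bar>"
  proof -
    have "x * (x - 4 / h\<^sup>2) \<ge> 0"
    proof (cases "x < 0")
      case True
      then have "x - 4 / h\<^sup>2 \<le> 0" using h by (smt (verit) zero_le_divide_iff zero_le_power2)
      then show ?thesis using True by (simp add: mult_nonpos_nonpos)
    next
      case False
      then show ?thesis using x h by (simp add: mult_nonneg_nonneg)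
    qed
    then show ?thesis unfolding e real_sqrt_mult[of "(h\<^sup>2)\<^sup>2"] real_sqrt_abs by (simp only: abs_of_nonneg zero_le_power2)
  qed
  also have "\<dots> = h\<^sup>2 * (sqrt \<bar>x\<bar> * sqrt \<bar>4 / h\<^sup>2 - x\<bar>)"
    by (simp add: abs_mult real_sqrt_mult abs_minus_commute)
  finally have "h\<^sup>2 / \<bar>1 / r - r\<bar> = threshold_factor h x"
    using h by (simp add: threshold_factor_def)
  then show ?thesis using r by (auto simp: b_def)
qed

lemma abs_sin_multiple_le: "\<bar>sin (real n * t)\<bar> \<le> real n * \<bar>sin t\<bar>"
proof (induction n)
  case (Suc n)
  have "\<bar>sin (real (Suc n) * t)\<bar> = \<bar>sin (real n * t) * cos t + cos (real n * t) * sin t\<bar>"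
  proof -
    have "real (Suc n) * t = real n * t + t" by (simp add: distrib_right)
    then show ?thesis by (simp only: sin_add)
  qed
  also have "\<dots> \<le> \<bar>sin (real n * t)\<bar> * \<bar>cos t\<bar> + \<bar>cos (real n * t)\<bar> * \<bar>sin t\<bar>"
    by (metis abs_mult abs_triangle_ineq)
  also have "\<dots> \<le> \<bar>sin (real n * t)\<bar> * 1 + 1 * \<bar>sin t\<bar>"
    by (intro add_mono mult_left_mono mult_right_mono) auto
  finally show ?case using Suc by (simp add: algebra_simps)
qed simp

text \<open>The constant \<open>c\<close> keeps the roots away from the wrong limit
  \<open>1 / \<rho>\<close>; then \<open>root_difference\<close> forces convergence, and the
  prefactor is continuous because \<open>1 / \<rho> - \<rho>\<close> is nonzero.\<close>

lemma green_limit: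
  fixes R :: "real \<Rightarrow> complex"
  assumes R: "\<And>\<epsilon>. \<epsilon> > 0 \<Longrightarrow> R \<epsilon> \<noteq> 0 \<and> norm (R \<epsilon>) < 1 \<and> R \<epsilon> + 1 / R \<epsilon> = 2 - of_real (h\<^sup>2) * Complex x \<epsilon>"
    and \<rho>: "\<rho> \<noteq> 0" "norm \<rho> \<le> 1" "\<rho> + 1 / \<rho> = 2 - of_real (h\<^sup>2) * of_real x" "1 / \<rho> - \<rho> \<noteq> 0"
    and c: "c > 0" "\<And>\<epsilon>. \<epsilon> > 0 \<Longrightarrow> c \<le> norm (R \<epsilon> - 1 / \<rho>)"
  shows "\<exists>\<delta>. (\<delta> \<longlongrightarrow> 0) (at_right 0) \<and>
    (\<forall>\<epsilon>>0. \<forall>j. (norm (green h (R \<epsilon>) j - green h \<rho> j))\<^sup>2 \<le> \<delta> \<epsilon> * (1 + (of_int j)\<^sup>2))"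
proof -
  define \<delta> where "\<delta> \<epsilon> = 2 * ((norm (of_real (h\<^sup>2) / (1 / R \<epsilon> - R \<epsilon>) - of_real (h\<^sup>2) / (1 / \<rho> - \<rho>)))\<^sup>2
        + (norm (of_real (h\<^sup>2) / (1 / \<rho> - \<rho>)))\<^sup>2 * (norm (R \<epsilon> - \<rho>))\<^sup>2)" for \<epsilon>
  have pos: "\<forall>\<^sub>F \<epsilon> in at_right (0::real). \<epsilon> > 0" by (simp add: eventually_at_right_less)
  have "((\<lambda>\<epsilon>. R \<epsilon> - \<rho>) \<longlongrightarrow> 0) (at_right 0)"
  proof (rule Lim_null_comparison)
    show "\<forall>\<^sub>F \<epsilon> in at_right 0. norm (R \<epsilon> - \<rho>) \<le> h\<^sup>2 * \<epsilon> / c"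
      using pos
    proof eventually_elim
      case (elim \<epsilon>)
      have "norm (R \<epsilon> - \<rho>) * norm (R \<epsilon> - 1 / \<rho>) \<le> h\<^sup>2 * \<epsilon>"
        using R[OF elim] \<rho> elim by (intro root_difference) auto
      moreover have "norm (R \<epsilon> - \<rho>) * c \<le> norm (R \<epsilon> - \<rho>) * norm (R \<epsilon> - 1 / \<rho>)"
        by (intro mult_left_mono c elim) auto
      ultimately show ?case using c(1) by (simp add: field_simps)
    qed
    have "((\<lambda>\<epsilon>. h\<^sup>2 * \<epsilon> / c) \<longlongrightarrow> h\<^sup>2 * 0 / c) (at_right 0)" using c(1) by (intro tendsto_intros) auto
    then show "((\<lambda>\<epsilon>. h\<^sup>2 * \<epsilon> / c) \<longlongrightarrow> 0) (at_right 0)" by simp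
  qed
  then have lim: "(R \<longlongrightarrow> \<rho>) (at_right 0)" using Lim_null by blast
  have "(\<delta> \<longlongrightarrow> 2 * ((norm (of_real (h\<^sup>2) / (1 / \<rho> - \<rho>) - of_real (h\<^sup>2) / (1 / \<rho> - \<rho>)))\<^sup>2
        + (norm (of_real (h\<^sup>2) / (1 / \<rho> - \<rho>)))\<^sup>2 * (norm (\<rho> - \<rho>))\<^sup>2)) (at_right 0)"
    unfolding \<delta>_def[abs_def] by (intro tendsto_intros lim \<rho>)
  moreover have "(norm (green h (R \<epsilon>) j - green h \<rho> j))\<^sup>2 \<le> \<delta> \<epsilon> * (1 + (of_int j)\<^sup>2)" if "\<epsilon> > 0" for \<epsilon> j
    unfolding \<delta>_def using R[OF that] \<rho>(2) by (intro green_difference) auto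
  ultimately show ?thesis by (intro exI[of _ \<delta>]) simp
qed

text \<open>Energies inside and outside the band share one statement, since a regular channel may be
  of either type. Outside the band the root is real and the imaginary part vanishes.\<close>

lemma green_boundary:
  fixes R :: "real \<Rightarrow> complex"
  assumes h: "h > 0" and x: "x \<noteq> 0" "x \<noteq> 4 / h\<^sup>2"
    and R: "\<And>\<epsilon>. \<epsilon> > 0 \<Longrightarrow> R \<epsilon> \<noteq> 0 \<and> norm (R \<epsilon>) < 1 \<and> R \<epsilon> + 1 / R \<epsilon> = 2 - of_real (h\<^sup>2) * Complex x \<epsilon>"
  shows "\<exists>G \<delta>. (\<delta> \<longlongrightarrow> 0) (at_right 0) \<and>
    (\<forall>\<epsilon>>0. \<forall>j. (norm (green h (R \<epsilon>) j - G j))\<^sup>2 \<le> \<delta> \<epsilon> * (1 + (of_int j)\<^sup>2)) \<and>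
    (\<forall>j. G (- j) = G j \<and> norm (G j) \<le> threshold_factor h x) \<and>
    (if 0 < x \<and> x < 4 / h\<^sup>2
     then (\<forall>j. \<bar>Re (G j)\<bar> \<le> h\<^sup>2 / 2 * \<bar>of_int j\<bar> \<and>
       Im (G j) = threshold_factor h x * cos (2 * of_int j * arcsin (h / 2 * sqrt x)))
     else (\<forall>j. Im (G j) = 0))"
proof (cases "0 < x \<and> x < 4 / h\<^sup>2")
  case True
  define g where "g = arcsin (h / 2 * sqrt x)"
  note root = boundary_root_inside[OF h True[THEN conjunct1] True[THEN conjunct2], folded g_def]
  define \<rho> where "\<rho> = cis (2 * g)"
  have \<rho>0: "\<rho> \<noteq> 0" "norm \<rho> = 1" "Im \<rho> > 0" using root(3) by (auto simp: \<rho>_def)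
  have inv: "1 / \<rho> = cis (- (2 * g))" by (simp add: \<rho>_def cis_inverse[symmetric] inverse_eq_divide)
  have tf: "0 \<le> threshold_factor h x" by (simp add: threshold_factor_def)
  have d: "1 / \<rho> - \<rho> \<noteq> 0"
  proof
    assume "1 / \<rho> - \<rho> = 0"
    then have "Im (1 / \<rho> - \<rho>) = 0" by simp
    then show False using root(3) by (simp add: inv) (simp add: \<rho>_def)
  qed
  have "\<exists>\<delta>. (\<delta> \<longlongrightarrow> 0) (at_right 0) \<and>
    (\<forall>\<epsilon>>0. \<forall>j. (norm (green h (R \<epsilon>) j - green h \<rho> j))\<^sup>2 \<le> \<delta> \<epsilon> * (1 + (of_int j)\<^sup>2))"
  \<comment> \<open>The roots lie in the upper half plane and \<open>1 / \<rho>\<close> lies at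
    height \<open>- Im \<rho>\<close> in the lower one.\<close>
  proof (rule green_limit[where c = "Im \<rho>" and x = x])
    fix \<epsilon> :: real assume e: "\<epsilon> > 0"
    then have "Im (R \<epsilon>) > 0" using R[OF e] h by (intro Im_small_root[of "R \<epsilon>" "Complex x \<epsilon>" h]) auto
    then have "Im \<rho> \<le> Im (R \<epsilon> - 1 / \<rho>)" by (simp add: inv) (simp add: \<rho>_def)
    then show "Im \<rho> \<le> norm (R \<epsilon> - 1 / \<rho>)" using abs_Im_le_cmod[of "R \<epsilon> - 1 / \<rho>"] by linarith
  qed (use R \<rho>0 d root(1) in \<open>simp_all add: \<rho>_def\<close>)
  then obtain \<delta> where \<delta>: "(\<delta> \<longlongrightarrow> 0) (at_right 0)"
    "\<forall>\<epsilon>>0. \<forall>j. (norm (green h (R \<epsilon>) j - green h \<rho> j))\<^sup>2 \<le> \<delta> \<epsilon> * (1 + (of_int j)\<^sup>2)" by blast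
  have G: "green h \<rho> j = \<i> * of_real (threshold_factor h x) * cis (real (nat \<bar>j\<bar>) * (2 * g))" for j
    unfolding green_def \<rho>_def root(2) Complex.DeMoivre ..
  have "\<bar>Re (green h \<rho> j)\<bar> \<le> h\<^sup>2 / 2 * \<bar>of_int j\<bar>" for j
  proof -
    have "\<bar>Re (green h \<rho> j)\<bar> = threshold_factor h x * \<bar>sin (real (nat \<bar>j\<bar>) * (2 * g))\<bar>"
      using tf by (simp add: G abs_mult)
    also have "\<dots> \<le> threshold_factor h x * (real (nat \<bar>j\<bar>) * \<bar>sin (2 * g)\<bar>)"
      by (intro mult_left_mono abs_sin_multiple_le tf)
    also have "\<dots> = real (nat \<bar>j\<bar>) * (threshold_factor h x * sin (2 * g))" using root(3) by simp
    finally show ?thesis unfolding root(4) by (simp add: mult.commute)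
  qed
  moreover have "Im (green h \<rho> j) = threshold_factor h x * cos (2 * of_int j * g)" for j
  proof -
    have "cos (real (nat \<bar>j\<bar>) * (2 * g)) = cos (2 * of_int j * g)"
    proof (cases "j \<ge> 0")
      case True then show ?thesis by (simp add: mult_ac)
    next
      case False
      then have "real (nat \<bar>j\<bar>) * (2 * g) = - (2 * of_int j * g)" by simp
      then show ?thesis by (simp only: cos_minus)
    qed
    then show ?thesis by (simp add: G)
  qed
  moreover have "green h \<rho> (- j) = green h \<rho> j" for j by (simp add: green_def)
  moreover have "norm (green h \<rho> j) \<le> threshold_factor h x" for j using tf by (simp add: G norm_mult)
  ultimately show ?thesis using True \<delta> unfolding g_def by (intro exI[of _ "green h \<rho>"] exI[of _ \<delta>]) simp
next
  case False
  then have "x < 0 \<or> 4 / h\<^sup>2 < x" using x by linarith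
  then obtain r :: real where r: "r \<noteq> 0" "\<bar>r\<bar> < 1" "r + 1 / r = 2 - h\<^sup>2 * x" "h\<^sup>2 / \<bar>1 / r - r\<bar> = threshold_factor h x"
    using boundary_root_outside[OF h] by blast
  have tf: "threshold_factor h x > 0" using x by (simp add: threshold_factor_def)
  have d: "1 / r - r \<noteq> 0" using r(4) tf by auto
  have inv1: "1 / \<bar>r\<bar> > 1" using r by simp
  have "\<exists>\<delta>. (\<delta> \<longlongrightarrow> 0) (at_right 0) \<and>
    (\<forall>\<epsilon>>0. \<forall>j. (norm (green h (R \<epsilon>) j - green h (of_real r) j))\<^sup>2 \<le> \<delta> \<epsilon> * (1 + (of_int j)\<^sup>2))"
  \<comment> \<open>Here \<open>1 / r\<close> lies outside the unit disc that contains the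
    roots.\<close>
  proof (rule green_limit[where c = "1 / \<bar>r\<bar> - 1" and x = x])
    show "complex_of_real r + 1 / complex_of_real r = 2 - complex_of_real (h\<^sup>2) * complex_of_real x"
      using arg_cong[OF r(3), of complex_of_real] by simp
    show "1 / complex_of_real r - complex_of_real r \<noteq> 0" using d by (metis of_real_0 of_real_1 of_real_diff of_real_divide of_real_eq_iff)
    fix \<epsilon> :: real assume e: "\<epsilon> > 0"
    have "norm (1 / complex_of_real r) = 1 / \<bar>r\<bar>" by (simp add: norm_divide)
    then show "1 / \<bar>r\<bar> - 1 \<le> norm (R \<epsilon> - 1 / complex_of_real r)"
      using norm_triangle_ineq2[of "1 / complex_of_real r" "R \<epsilon>"] R[OF e] by (simp add: norm_minus_commute)
  qed (use R r inv1 in auto)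
  then obtain \<delta> where \<delta>: "(\<delta> \<longlongrightarrow> 0) (at_right 0)"
    "\<forall>\<epsilon>>0. \<forall>j. (norm (green h (R \<epsilon>) j - green h (of_real r) j))\<^sup>2 \<le> \<delta> \<epsilon> * (1 + (of_int j)\<^sup>2)" by blast
  have G: "green h (of_real r) j = of_real (h\<^sup>2 / (1 / r - r) * r ^ nat \<bar>j\<bar>)" for j by (simp add: green_def)
  have "norm (green h (of_real r) j) \<le> threshold_factor h x" for j
  proof -
    have "norm (green h (of_real r) j) = threshold_factor h x * \<bar>r\<bar> ^ nat \<bar>j\<bar>"
      unfolding G norm_of_real r(4)[symmetric] by (simp add: abs_mult power_abs)
    also have "\<dots> \<le> threshold_factor h x" using r(2) tf by (intro mult_left_le power_le_one) auto
    finally show ?thesis .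
  qed
  moreover have "Im (green h (of_real r) j) = 0" for j unfolding G by (rule Im_complex_of_real)
  moreover have "green h (of_real r) (- j) = green h (of_real r) j" for j by (simp add: green_def)
  ultimately show ?thesis using False \<delta> by (intro exI[of _ "green h (of_real r)"] exI[of _ \<delta>]) auto
qed

section \<open>Spectral projections of \<open>Q\<close>\<close>

lemma ortho_proj_eqI:
  assumes W: "cspace.subspace W" and y: "y \<in> W" "\<And>w. w \<in> W \<Longrightarrow> cinner w (x - y) = 0"
  shows "ortho_proj W x = y"
  unfolding ortho_proj_def
proof (rule the_equality)
  show "y \<in> W \<and> (\<forall>w\<in>W. cinner w (x - y) = 0)" using y by blast
  fix z assume z: "z \<in> W \<and> (\<forall>w\<in>W. cinner w (x - z) = 0)"
  have "z - y \<in> W" using W y z by (intro cspace.subspace_diff) auto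
  then have "cinner (z - y) (x - y) = 0" "cinner (z - y) (x - z) = 0" using y z by auto
  then have "cinner (z - y) (z - y) = 0" by (simp add: cinner_diff_right)
  then show "z = y" by (simp add: cinner_self)
qed

lemma
  fixes W :: "'a::chilbert_space set"
  assumes W: "cspace.subspace W" "closed W"
  shows ortho_proj_mem: "ortho_proj W x \<in> W"
    and ortho_proj_orthogonal: "w \<in> W \<Longrightarrow> cinner w (x - ortho_proj W x) = 0"
    and ortho_proj_idem: "x \<in> W \<Longrightarrow> ortho_proj W x = x"
    and selfadjoint_ortho_proj: "selfadjoint (ortho_proj W)"
    and norm_ortho_proj: "norm (ortho_proj W x) \<le> norm x"
proof -
  have ex: "ortho_proj W x \<in> W \<and> (\<forall>w\<in>W. cinner w (x - ortho_proj W x) = 0)" for x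
    using projection_exists[OF W, of x] ortho_proj_eqI[OF W(1)] by metis
  then show mem: "ortho_proj W x \<in> W" and orth: "w \<in> W \<Longrightarrow> cinner w (x - ortho_proj W x) = 0" for x w by auto
  show "x \<in> W \<Longrightarrow> ortho_proj W x = x" by (rule ortho_proj_eqI[OF W(1)]) auto
  show le: "norm (ortho_proj W x) \<le> norm x" for x
  proof -
    have "(norm (ortho_proj W x + (x - ortho_proj W x)))\<^sup>2 = (norm (ortho_proj W x))\<^sup>2 + (norm (x - ortho_proj W x))\<^sup>2"
      by (rule pythagoras[OF orth[OF mem]])
    then have "(norm (ortho_proj W x))\<^sup>2 \<le> (norm x)\<^sup>2" by simp
    then show ?thesis by (simp add: power2_le_iff_abs_le)
  qed
  have "bounded_clinear (ortho_proj W)"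
  proof (rule bclI[where C = 1])
    fix x y c
    have e: "x + y - (ortho_proj W x + ortho_proj W y) = (x - ortho_proj W x) + (y - ortho_proj W y)" by simp
    show "ortho_proj W (x + y) = ortho_proj W x + ortho_proj W y"
      by (rule ortho_proj_eqI[OF W(1)]) (simp_all only: e cinner_add_right orth cspace.subspace_add[OF W(1)] mem add_0)
    show "ortho_proj W (c *\<^sub>C x) = c *\<^sub>C ortho_proj W x"
      by (rule ortho_proj_eqI[OF W(1)])
        (simp_all add: cspace.subspace_scale[OF W(1)] mem orth cinner_scaleC_right flip: cspace.scale_right_diff_distrib)
  qed (simp add: le)
  moreover have "cinner (ortho_proj W x) y = cinner x (ortho_proj W y)" for x y
  proof -
    have "cinner (ortho_proj W x) y = cinner (ortho_proj W x) (ortho_proj W y)"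
      using orth[OF mem[of x], of y] by (simp add: cinner_diff_right)
    moreover have "cinner (x - ortho_proj W x) (ortho_proj W y) = 0"
      using orth[OF mem[of y], of x] cinner_swap_eq_0 by blast
    ultimately show ?thesis by (simp add: cinner_diff_left)
  qed
  ultimately show "selfadjoint (ortho_proj W)" by (simp add: selfadjoint_def)
qed

lemma
  fixes T :: "'a::complex_inner \<Rightarrow> 'a"
  assumes T: "bounded_clinear T"
  shows subspace_eigenspace: "cspace.subspace (eigenspace T r)"
    and closed_eigenspace: "closed (eigenspace T r)"
proof -
  show "cspace.subspace (eigenspace T r)"
    by (rule cspace.subspaceI)
      (auto simp: eigenspace_def bcl_simps[OF T] scaleC_add_right scaleR_scaleC scaleC_scaleC mult.commute)
  show "closed (eigenspace T r)"
    unfolding eigenspace_def by (intro closed_Collect_eq bcl_continuous_on[OF T] continuous_intros)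
qed

text \<open>Eigenspaces of distinct eigenvalues are orthogonal, so the components of any
  decomposition are the orthogonal projections. For \<open>Q = 0\<close> the single eigenspace is
  the whole space.\<close>

lemma eigen_decomposition:
  fixes Q :: "'g::chilbert_space \<Rightarrow> 'g"
  assumes dec: "finite_eigen_decomp Q d \<mu>"
  shows "selfadjoint Q" "finite (index_set Q d)" "inj_on \<mu> (index_set Q d)"
    and "(\<Sum>s\<in>index_set Q d. ortho_proj (eigenspace Q (\<mu> s)) x) = x"
proof -
  show sa: "selfadjoint Q" using dec by (simp add: finite_eigen_decomp_def)
  show fin: "finite (index_set Q d)" by (simp add: index_set_def)
  show inj: "inj_on \<mu> (index_set Q d)"
    using dec by (auto simp: index_set_def finite_eigen_decomp_def split: if_splits)
  note bQ = selfadjoint_bcl[OF sa]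
  have "\<exists>y. (\<forall>s\<in>index_set Q d. y s \<in> eigenspace Q (\<mu> s)) \<and> x = (\<Sum>s\<in>index_set Q d. y s)"
  proof (cases "Q = (\<lambda>_. 0)")
    case True
    then have "\<mu> 0 = 0" using dec by (simp add: finite_eigen_decomp_def)
    then show ?thesis using True by (intro exI[of _ "\<lambda>_. x"]) (simp add: index_set_def eigenspace_def)
  next
    case False
    then show ?thesis using dec by (simp add: index_set_def finite_eigen_decomp_def)
  qed
  then obtain y where y: "\<And>s. s \<in> index_set Q d \<Longrightarrow> y s \<in> eigenspace Q (\<mu> s)" "x = (\<Sum>s\<in>index_set Q d. y s)" by blast
  have "ortho_proj (eigenspace Q (\<mu> s)) x = y s" if s: "s \<in> index_set Q d" for s
  proof (rule ortho_proj_eqI[OF subspace_eigenspace[OF bQ] y(1)[OF s]])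
    fix w assume w: "w \<in> eigenspace Q (\<mu> s)"
    have "cinner w (y t) = 0" if t: "t \<in> index_set Q d - {s}" for t
    proof -
      have "\<mu> s \<noteq> \<mu> t" using inj s t by (auto dest: inj_onD)
      moreover have "Q w = \<mu> s *\<^sub>R w" "Q (y t) = \<mu> t *\<^sub>R y t" using w y(1)[of t] t by (auto simp: eigenspace_def)
      then have "of_real (\<mu> s) * cinner w (y t) = of_real (\<mu> t) * cinner w (y t)"
        using selfadjoint_cinner[OF sa, of w "y t"] by (simp add: cinner_simps)
      ultimately show ?thesis by simp
    qed
    moreover have "x - y s = (\<Sum>t\<in>index_set Q d - {s}. y t)" unfolding y(2) using fin s by (simp add: sum.remove)
    ultimately show "cinner w (x - y s) = 0" by (simp add: cinner_sum_right)
  qed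
  then show "(\<Sum>s\<in>index_set Q d. ortho_proj (eigenspace Q (\<mu> s)) x) = x" unfolding y(2) by simp
qed

section \<open>The sandwiched resolvent and its boundary values\<close>

lemma hs_norm_ge:
  assumes "hilbert_schmidt S" "e \<in> some_onb" shows "norm (S e) \<le> hs_norm S"
proof -
  have "(\<lambda>e. (norm (S e))\<^sup>2) summable_on some_onb" using assms(1) by (simp add: hilbert_schmidt_def)
  from finite_sum_le_infsum[OF this, of "{e}"] have "(norm (S e))\<^sup>2 \<le> (\<Sum>\<^sub>\<infinity>e\<in>some_onb. (norm (S e))\<^sup>2)"
    using assms(2) by simp
  then show ?thesis unfolding hs_norm_def by (rule real_le_rsqrt)
qed

lemma hilbert_schmidt_diff:
  assumes "hilbert_schmidt S" "hilbert_schmidt T"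
  shows "hilbert_schmidt (\<lambda>x. S x - T x)"
  unfolding hilbert_schmidt_def
proof
  show "bounded_clinear (\<lambda>x. S x - T x)" using assms by (intro bcl_minus_op) (auto simp: hilbert_schmidt_def)
  show "(\<lambda>e. (norm (S e - T e))\<^sup>2) summable_on some_onb"
  proof (rule summable_on_comparison_test)
    show "(\<lambda>e. 2 * (norm (S e))\<^sup>2 + 2 * (norm (T e))\<^sup>2) summable_on some_onb"
      using assms by (intro summable_on_add summable_on_cmult_right) (auto simp: hilbert_schmidt_def)
    show "(norm (S e - T e))\<^sup>2 \<le> 2 * (norm (S e))\<^sup>2 + 2 * (norm (T e))\<^sup>2" for e
      using norm_sum_le_two[of "S e" "- T e"] by simp
  qed auto
qed

text \<open>The Hilbert--Schmidt norm dominates the norm at each basis vector, so limits agree on a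
  basis.\<close>

lemma hs_tendsto_unique:
  fixes T :: "'i \<Rightarrow> 'a::chilbert_space \<Rightarrow> 'b::complex_inner"
  assumes L: "hs_tendsto T L F" "hs_tendsto T L' F" and F: "F \<noteq> bot"
  shows "L = L'"
proof
  fix x :: 'a
  have lim: "((\<lambda>i. T i e) \<longlongrightarrow> L e) F" if L: "hs_tendsto T L F" and e: "e \<in> some_onb" for L e
  proof -
    have "((\<lambda>i. T i e - L e) \<longlongrightarrow> 0) F"
    proof (rule Lim_null_comparison)
      have ev: "\<forall>\<^sub>F i in F. hilbert_schmidt (T i)" and hL: "hilbert_schmidt L" using L by (auto simp: hs_tendsto_def)
      show "\<forall>\<^sub>F i in F. norm (T i e - L e) \<le> hs_norm (\<lambda>u. T i u - L u)"
        using ev by eventually_elim (rule hs_norm_ge[OF hilbert_schmidt_diff[OF _ hL] e])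
      show "((\<lambda>i. hs_norm (\<lambda>u. T i u - L u)) \<longlongrightarrow> 0) F" using L by (simp add: hs_tendsto_def)
    qed
    then show ?thesis using Lim_null by blast
  qed
  have e: "L e = L' e" if "e \<in> some_onb" for e
    using tendsto_unique[OF F lim[OF L(1) that] lim[OF L(2) that]] .
  have b: "bounded_clinear L" "bounded_clinear L'" using L by (auto simp: hs_tendsto_def hilbert_schmidt_def)
  have cl: "x \<in> closure (cspace.span some_onb)" using is_onb_some_onb[where 'a = 'a] by (simp add: is_onb_iff)
  show "L x = L' x" by (rule bcl_eq_on_span[OF b _ cl]) (rule e)
qed

text \<open>Fixing a bound \<open>cK\<close> for the squared Hilbert--Schmidt norm of
  \<open>K\<close> lets all later constants be written out, which shows that they do not depend on
  the energy.\<close>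

locale lattice_model =
  fixes h \<nu> :: real and Q K :: "'g::chilbert_space \<Rightarrow> 'g" and d :: nat and \<mu> :: "nat \<Rightarrow> real"
    and V :: "'g l2 \<Rightarrow> 'g l2" and cK :: real
  assumes h: "h > 0" and dec: "finite_eigen_decomp Q d \<mu>" and \<nu>: "\<nu> > 3"
    and V: "positive_op V" and K: "hs_bdd K cK"
begin

section \<open>Channel operators and their bounds\<close>

definition "channels = index_set Q d"
definition "prj s = ortho_proj (eigenspace Q (\<mu> s))"
definition "rootV = op_sqrt V"
definition "weightC s x = K (prj s (cadjoint K x))"
definition "boundC = (onorm (cadjoint K))\<^sup>2 * cK"

text \<open>With \<open>r\<close> Green's function at \<open>z - \<mu>\<^sub>s\<close>, this is the part of \<open>T(z)\<close> that lives on \<open>Ker (Q - \<mu>\<^sub>s)\<close>.\<close>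

definition "channel_op r s u = rootV (kernel_op (weighted_kernel \<nu> r) (weightC s) (rootV u))"
definition "boundT = (onorm rootV)\<^sup>2 * ((onorm rootV)\<^sup>2 * (weight_const \<nu> * boundC))"
definition "decay r \<kappa> \<longleftrightarrow> (\<forall>j. (norm (r j :: complex))\<^sup>2 \<le> \<kappa> * (1 + (of_int j)\<^sup>2))"

lemma bcl_K: "bounded_clinear K" by (rule hs_bdd_bcl[OF K])
lemma bcl_Kstar: "bounded_clinear (cadjoint K)" by (rule bcl_cadjoint[OF bcl_K])
lemma sa_Q: "selfadjoint Q" by (rule eigen_decomposition(1)[OF dec])
lemma finite_channels: "finite channels" unfolding channels_def by (rule eigen_decomposition(2)[OF dec])
lemma prj_sum: "(\<Sum>s\<in>channels. prj s x) = x" unfolding channels_def prj_def by (rule eigen_decomposition(4)[OF dec])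
lemma positive_rootV: "positive_op rootV" unfolding rootV_def by (rule positive_op_sqrt[OF V])
lemma rootV_square: "rootV (rootV u) = V u" unfolding rootV_def by (rule op_sqrt_square[OF V])
lemma bcl_rootV: "bounded_clinear rootV" by (rule positive_op_bcl[OF positive_rootV])
lemma sa_rootV: "selfadjoint rootV" by (rule positive_op_selfadjoint[OF positive_rootV])

lemmas eigenspace_Q = subspace_eigenspace[OF selfadjoint_bcl[OF sa_Q]] closed_eigenspace[OF selfadjoint_bcl[OF sa_Q]]

lemma sa_prj: "selfadjoint (prj s)" unfolding prj_def by (rule selfadjoint_ortho_proj[OF eigenspace_Q])
lemma bcl_prj: "bounded_clinear (prj s)" by (rule selfadjoint_bcl[OF sa_prj])
lemma norm_prj: "norm (prj s x) \<le> norm x" unfolding prj_def by (rule norm_ortho_proj[OF eigenspace_Q])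
lemma prj_idem: "prj s (prj s x) = prj s x"
  unfolding prj_def by (rule ortho_proj_idem[OF eigenspace_Q ortho_proj_mem[OF eigenspace_Q]])
lemma Q_prj: "Q (prj s x) = \<mu> s *\<^sub>R prj s x"
  using ortho_proj_mem[OF eigenspace_Q, of "\<mu> s" x] by (simp add: eigenspace_def prj_def)

lemma hs_weightC: "hs_bdd (weightC s) boundC"
  unfolding boundC_def weightC_def[abs_def]
proof (rule hs_bdd_right[OF K bcl_compose[OF bcl_prj bcl_Kstar] bcl_onorm_nonneg[OF bcl_Kstar]])
  show "norm (prj s (cadjoint K x)) \<le> onorm (cadjoint K) * norm x" for x
    by (rule order_trans[OF norm_prj bcl_onorm[OF bcl_Kstar]])
qed

lemma sa_weightC: "selfadjoint (weightC s)"
  using hs_bdd_bcl[OF hs_weightC]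
  by (simp add: selfadjoint_def weightC_def cadjoint_right[OF bcl_K, symmetric]
      selfadjoint_cinner[OF sa_prj] cadjoint_left[OF bcl_K])

lemma kernel_bdd_decay: "decay r \<kappa> \<Longrightarrow> kernel_bdd (weighted_kernel \<nu> r) (weight_const \<nu> * \<kappa>)"
  by (rule kernel_bdd_weighted[OF \<nu>]) (simp add: decay_def)

lemma decay_bounded: "(\<And>j. norm (r j) \<le> c) \<Longrightarrow> decay r (c\<^sup>2)"
  unfolding decay_def
proof
  fix j assume "\<And>j. norm (r j) \<le> c"
  then have "(norm (r j))\<^sup>2 \<le> c\<^sup>2" by (intro power_mono) auto
  also have "\<dots> \<le> c\<^sup>2 * (1 + (of_int j)\<^sup>2)" by (simp add: mult_le_cancel_left1)
  finally show "(norm (r j))\<^sup>2 \<le> c\<^sup>2 * (1 + (of_int j)\<^sup>2)" .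
qed

text \<open>For the real part of the singular channel, whose available uniform bound
  \<open>threshold_factor\<close> diverges while the slope bound does not.\<close>

lemma decay_linear: "(\<And>j. norm (r j) \<le> c * \<bar>of_int j\<bar>) \<Longrightarrow> decay r (c\<^sup>2)"
  unfolding decay_def
proof
  fix j assume "\<And>j. norm (r j) \<le> c * \<bar>of_int j\<bar>"
  then have "(norm (r j))\<^sup>2 \<le> (c * \<bar>of_int j\<bar>)\<^sup>2" by (intro power_mono) auto
  also have "\<dots> = c\<^sup>2 * (of_int j)\<^sup>2" by (simp add: power_mult_distrib)
  also have "\<dots> \<le> c\<^sup>2 * (1 + (of_int j)\<^sup>2)" by (intro mult_left_mono) auto
  finally show "(norm (r j))\<^sup>2 \<le> c\<^sup>2 * (1 + (of_int j)\<^sup>2)" .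
qed

lemma hs_channel_op:
  assumes r: "decay r \<kappa>" shows "hs_bdd (channel_op r s) (boundT * \<kappa>)"
proof -
  have "hs_bdd (\<lambda>u. rootV (kernel_op (weighted_kernel \<nu> r) (weightC s) (rootV u)))
      ((onorm rootV)\<^sup>2 * ((onorm rootV)\<^sup>2 * (weight_const \<nu> * \<kappa> * boundC)))"
    by (rule hs_bdd_left[OF hs_bdd_right[OF hs_bdd_kernel_op[OF kernel_bdd_decay[OF r] hs_weightC] bcl_rootV
          bcl_onorm_nonneg[OF bcl_rootV] bcl_onorm[OF bcl_rootV]] bcl_rootV bcl_onorm[OF bcl_rootV]])
  moreover have "(onorm rootV)\<^sup>2 * ((onorm rootV)\<^sup>2 * (weight_const \<nu> * \<kappa> * boundC)) = boundT * \<kappa>"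
    by (simp add: boundT_def)
  ultimately show ?thesis by (simp only: channel_op_def[abs_def])
qed

lemma channel_op_add:
  assumes "decay r \<kappa>" "decay r' \<kappa>'"
  shows "channel_op (\<lambda>j. r j + r' j) s u = channel_op r s u + channel_op r' s u"
proof -
  have "weighted_kernel \<nu> (\<lambda>j. r j + r' j) = (\<lambda>n m. weighted_kernel \<nu> r n m + weighted_kernel \<nu> r' n m)"
    by (simp add: weighted_kernel_def fun_eq_iff distrib_left)
  then show ?thesis unfolding channel_op_def
    using kernel_op_add[OF kernel_bdd_decay[OF assms(1)] kernel_bdd_decay[OF assms(2)] hs_weightC]
    by (simp add: bcl_add[OF bcl_rootV])
qed

lemma channel_op_scale:
  assumes "decay r \<kappa>"
  shows "channel_op (\<lambda>j. a * r j) s u = a *\<^sub>C channel_op r s u"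
proof -
  have "weighted_kernel \<nu> (\<lambda>j. a * r j) = (\<lambda>n m. a * weighted_kernel \<nu> r n m)"
    by (simp add: weighted_kernel_def fun_eq_iff mult.left_commute)
  then show ?thesis unfolding channel_op_def
    using kernel_op_scale[OF kernel_bdd_decay[OF assms] hs_weightC] by (simp add: bcl_scaleC[OF bcl_rootV])
qed

lemma channel_op_cinner:
  assumes "decay r \<kappa>" "\<And>j. r (- j) = r j"
  shows "cinner (channel_op (\<lambda>j. cnj (r j)) s y) u = cinner y (channel_op r s u)"
proof -
  have "weighted_kernel \<nu> (\<lambda>j. cnj (r j)) = (\<lambda>n m. cnj (weighted_kernel \<nu> r n m))"
    by (simp add: weighted_kernel_def fun_eq_iff)
  moreover have "weighted_kernel \<nu> r n m = weighted_kernel \<nu> r m n" for n m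
    using assms(2)[of "m - n"] by (simp add: weighted_kernel_def mult.commute)
  ultimately show ?thesis unfolding channel_op_def
    using kernel_op_cinner[OF kernel_bdd_decay[OF assms(1)] hs_weightC sa_weightC]
    by (simp add: selfadjoint_cinner[OF sa_rootV])
qed

lemma decay_cnj: "decay r \<kappa> \<Longrightarrow> decay (\<lambda>j. cnj (r j)) \<kappa>"
  by (simp add: decay_def)

text \<open>The resolvent is only evaluated at the vector \<open>w\<close>: a solution of the
  resolvent equation is assembled from scalar convolutions in the channels, and
  \<open>inv_H_Q_eqI\<close> identifies it.\<close>

lemma sandwiched_resolvent_eq:
  assumes z: "Im z > 0"
    and R: "\<And>s. s \<in> channels \<Longrightarrow> R s \<noteq> 0 \<and> norm (R s) < 1 \<and> R s + 1 / R s = 2 - of_real (h\<^sup>2) * (z - of_real (\<mu> s))"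
  shows "sandwiched_resolvent h Q \<nu> K V z v = (\<Sum>s\<in>channels. channel_op (green h (R s)) s v)"
proof -
  have \<nu>0: "0 \<le> \<nu>" using \<nu> by simp
  define D where "D = (mult_psi \<nu> \<otimes>\<^sub>o K)"
  have bD: "bounded_clinear D" and D: "l2_fun (D u) n = weight \<nu> n *\<^sub>R K (l2_fun u n)" for u n
    unfolding D_def by (rule bcl_psi_tensor[OF bcl_K \<nu>0], rule l2_fun_psi_tensor[OF bcl_K \<nu>0])
  have Ds: "l2_fun (cadjoint D y) n = weight \<nu> n *\<^sub>R cadjoint K (l2_fun y n)" for y n
  proof (rule cinner_extensionality)
    fix a
    have "D (tensor_l2 (l2_delta n) a) = tensor_l2 (l2_delta n) (weight \<nu> n *\<^sub>R K a)"
      by (rule l2_eqI) (auto simp: D l2_delta.rep_eq bcl_zero[OF bcl_K])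
    then show "cinner a (l2_fun (cadjoint D y) n) = cinner a (weight \<nu> n *\<^sub>R cadjoint K (l2_fun y n))"
      by (simp add: cinner_delta_tensor[symmetric] cadjoint_right[OF bD])
        (simp add: cinner_delta_tensor cadjoint_right[OF bcl_K] cinner_simps)
  qed
  have M: "factor_M \<nu> K V = (\<lambda>u. rootV (D u))" by (simp add: factor_M_def D_def rootV_def comp_def)
  have Ms: "cadjoint (factor_M \<nu> K V) = (\<lambda>v. cadjoint D (rootV v))"
    unfolding M cadjoint_compose[OF bcl_rootV bD] selfadjoint_cadjoint[OF sa_rootV] ..
  define y where "y = rootV v"
  define w where "w = cadjoint D y"
  have w: "l2_fun w m = weight \<nu> m *\<^sub>R cadjoint K (l2_fun y m)" for m by (simp add: w_def Ds)
  \<comment> \<open>Since \<open>\<nu> / 2 > 1\<close> the weight itself is summable, so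
    \<open>w\<close> is absolutely summable, as \<open>resolvent_solution\<close> demands.\<close>
  have sw: "(\<lambda>m. norm (l2_fun w m)) summable_on UNIV"
  proof (rule summable_on_comparison_test)
    have "(\<lambda>m. bracket m powr (- (\<nu> / 2))) summable_on UNIV" using \<nu> by (intro bracket_powr_summable) simp
    then show "(\<lambda>m. weight \<nu> m * (onorm (cadjoint K) * norm y)) summable_on UNIV"
      by (intro summable_on_cmult_left) (simp add: weight_def[abs_def])
    fix m
    have "norm (cadjoint K (l2_fun y m)) \<le> onorm (cadjoint K) * norm y"
      by (rule order_trans[OF bcl_onorm[OF bcl_Kstar] mult_left_mono[OF norm_l2_fun_le bcl_onorm_nonneg[OF bcl_Kstar]]])
    then show "norm (l2_fun w m) \<le> weight \<nu> m * (onorm (cadjoint K) * norm y)"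
      unfolding w using weight_bounds(1)[of \<nu> m] by (simp add: mult_left_mono)
  qed auto
  have "\<forall>s\<in>channels. \<exists>x :: 'g l2. \<forall>n. ((\<lambda>m. green h (R s) (n - m) *\<^sub>C l2_fun w m) has_sum l2_fun x n) UNIV"
    using resolvent_solution[OF _ sw] R by blast
  from bchoice[OF this] obtain X :: "nat \<Rightarrow> 'g l2" where X:
    "\<And>s n. s \<in> channels \<Longrightarrow> ((\<lambda>m. green h (R s) (n - m) *\<^sub>C l2_fun w m) has_sum l2_fun (X s) n) UNIV" by blast
  \<comment> \<open>The difference operator in \<open>n\<close> acts only on Green's function under
    the sum, and \<open>green_equation\<close> leaves the single term \<open>m = n\<close>.\<close>
  have lap: "(1 / h\<^sup>2) *\<^sub>R (2 *\<^sub>R l2_fun (X s) n - l2_fun (X s) (n + 1) - l2_fun (X s) (n - 1)) - (z - of_real (\<mu> s)) *\<^sub>C l2_fun (X s) n = l2_fun w n"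
    if s: "s \<in> channels" for s n
  proof -
    let ?c = "complex_of_real (1 / h\<^sup>2)"
    note hs = has_sum_bounded_linear[OF bcl_bounded_linear[OF bcl_const_scaleC[OF bcl_id]] X[OF s]]
    have "((\<lambda>m. (?c * 2) *\<^sub>C green h (R s) (n - m) *\<^sub>C l2_fun w m + (- ?c) *\<^sub>C green h (R s) (n + 1 - m) *\<^sub>C l2_fun w m
        + (- ?c) *\<^sub>C green h (R s) (n - 1 - m) *\<^sub>C l2_fun w m + (- (z - of_real (\<mu> s))) *\<^sub>C green h (R s) (n - m) *\<^sub>C l2_fun w m)
      has_sum ((?c * 2) *\<^sub>C l2_fun (X s) n + (- ?c) *\<^sub>C l2_fun (X s) (n + 1) + (- ?c) *\<^sub>C l2_fun (X s) (n - 1)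
        + (- (z - of_real (\<mu> s))) *\<^sub>C l2_fun (X s) n)) UNIV"
      by (intro has_sum_add hs)
    moreover have "(?c * 2) *\<^sub>C green h (R s) (n - m) *\<^sub>C l2_fun w m + (- ?c) *\<^sub>C green h (R s) (n + 1 - m) *\<^sub>C l2_fun w m
        + (- ?c) *\<^sub>C green h (R s) (n - 1 - m) *\<^sub>C l2_fun w m + (- (z - of_real (\<mu> s))) *\<^sub>C green h (R s) (n - m) *\<^sub>C l2_fun w m
      = (if m = n then l2_fun w n else 0)" for m
    proof -
      have "(R s)\<^sup>2 \<noteq> 1"
      proof
        assume "(R s)\<^sup>2 = 1"
        then have "(norm (R s))\<^sup>2 = 1" by (simp flip: norm_power)
        moreover have "(norm (R s))\<^sup>2 < 1" using R[OF s] by (simp add: abs_square_less_1)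
        ultimately show False by simp
      qed
      then have "?c * (2 * green h (R s) (n - m) - green h (R s) (n - m + 1) - green h (R s) (n - m - 1))
          - (z - of_real (\<mu> s)) * green h (R s) (n - m) = (if n - m = 0 then 1 else 0)"
        using h R[OF s] by (intro green_equation) auto
      moreover have "n - m + 1 = n + 1 - m" "n - m - 1 = n - 1 - m" by auto
      ultimately have e: "?c * 2 * green h (R s) (n - m) + (- ?c) * green h (R s) (n + 1 - m)
          + (- ?c) * green h (R s) (n - 1 - m) + (- (z - of_real (\<mu> s))) * green h (R s) (n - m) = (if m = n then 1 else 0)"
        by (simp only: right_diff_distrib) (simp add: algebra_simps)
      show ?thesis unfolding scaleC_scaleC scaleC_add_left[symmetric] e by simp
    qed
    ultimately have "((\<lambda>m. if m = n then l2_fun w n else 0) has_sum ((?c * 2) *\<^sub>C l2_fun (X s) n + (- ?c) *\<^sub>C l2_fun (X s) (n + 1) + (- ?c) *\<^sub>C l2_fun (X s) (n - 1)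
        + (- (z - of_real (\<mu> s))) *\<^sub>C l2_fun (X s) n)) UNIV" by simp
    moreover have "((\<lambda>m. if m = n then l2_fun w n else 0) has_sum l2_fun w n) UNIV"
      by (rule has_sum_cong_neutral[THEN iffD1, OF _ _ _ has_sum_finiteI[of "{n}"]]) auto
    ultimately have "(?c * 2) *\<^sub>C l2_fun (X s) n + (- ?c) *\<^sub>C l2_fun (X s) (n + 1) + (- ?c) *\<^sub>C l2_fun (X s) (n - 1)
        + (- (z - of_real (\<mu> s))) *\<^sub>C l2_fun (X s) n = l2_fun w n" by (rule has_sum_unique)
    then show ?thesis
      by (simp add: scaleR_scaleC cspace.scale_right_diff_distrib scaleC_scaleC cspace.scale_minus_left)
        (simp add: algebra_simps)
  qed
  \<comment> \<open>The channel solutions solve scalar equations at \<open>z - \<mu> s\<close>. On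
    the range of \<open>prj s\<close> the number \<open>\<mu> s\<close> is the action of
    \<open>Q\<close>, and the projections of \<open>w\<close> add up to \<open>w\<close>.\<close>
  define x where "x = (\<Sum>s\<in>channels. (id \<otimes>\<^sub>o prj s) (X s))"
  have x: "l2_fun x n = (\<Sum>s\<in>channels. prj s (l2_fun (X s) n))" for n
    by (simp add: x_def l2_fun_sum l2_fun_id_tensor[OF bcl_prj])
  have "H_Q h Q x - z *\<^sub>C x = w"
  proof (rule l2_eqI)
    fix n
    have bQ: "bounded_clinear Q" by (rule selfadjoint_bcl[OF sa_Q])
    have "l2_fun (H_Q h Q x - z *\<^sub>C x) n = (\<Sum>s\<in>channels. (1 / h\<^sup>2) *\<^sub>R (2 *\<^sub>R prj s (l2_fun (X s) n) - prj s (l2_fun (X s) (n + 1)) - prj s (l2_fun (X s) (n - 1)))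
        + Q (prj s (l2_fun (X s) n)) - z *\<^sub>C prj s (l2_fun (X s) n))"
      by (simp add: l2_fun_H_Q[OF bQ] x bcl_sum[OF bQ] scaleR_sum_right scaleR_diff_right sum.distrib sum_subtractf cspace.scale_sum_right)
    also have "\<dots> = (\<Sum>s\<in>channels. prj s (l2_fun w n))"
    proof (rule sum.cong[OF refl])
      fix s assume s: "s \<in> channels"
      show "(1 / h\<^sup>2) *\<^sub>R (2 *\<^sub>R prj s (l2_fun (X s) n) - prj s (l2_fun (X s) (n + 1)) - prj s (l2_fun (X s) (n - 1)))
        + Q (prj s (l2_fun (X s) n)) - z *\<^sub>C prj s (l2_fun (X s) n) = prj s (l2_fun w n)"
        unfolding lap[OF s, symmetric] Q_prj
        by (simp only: bcl_simps[OF bcl_prj] cspace.scale_left_diff_distrib) (simp add: scaleR_scaleC)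
    qed
    finally show "l2_fun (H_Q h Q x - z *\<^sub>C x) n = l2_fun w n" by (simp add: prj_sum)
  qed
  then have inv: "inv (\<lambda>u. H_Q h Q u - z *\<^sub>C u) w = x" using z by (intro inv_H_Q_eqI[OF sa_Q]) auto
  \<comment> \<open>The two weights of the kernel come from the two outer factors:
    \<open>weight \<nu> n\<close> from \<open>D\<close> and \<open>weight \<nu> m\<close> from
    \<open>w\<close>. Likewise \<open>K\<close> and its adjoint enclose the projection in
    \<open>weightC\<close>.\<close>
  have "D x = (\<Sum>s\<in>channels. kernel_op (weighted_kernel \<nu> (green h (R s))) (weightC s) y)"
  proof (rule l2_eqI)
    fix n
    have "weight \<nu> n *\<^sub>R K (prj s (l2_fun (X s) n)) = l2_fun (kernel_op (weighted_kernel \<nu> (green h (R s))) (weightC s) y) n"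
      if s: "s \<in> channels" for s
    proof -
      have "decay (green h (R s)) ((norm (of_real (h\<^sup>2) / (1 / R s - R s)))\<^sup>2)"
      proof (rule decay_bounded)
        show "norm (green h (R s) j) \<le> norm (of_real (h\<^sup>2) / (1 / R s - R s))" for j
          unfolding green_def norm_mult norm_power using R[OF s] by (intro mult_left_le power_le_one) auto
      qed
      note kb = kernel_bdd_decay[OF this]
      let ?p = "l2_pair (kernel_row (weighted_kernel \<nu> (green h (R s))) n) y"
      have "((\<lambda>m. cadjoint K (weighted_kernel \<nu> (green h (R s)) n m *\<^sub>C l2_fun y m)) has_sum cadjoint K ?p) UNIV"
        by (rule has_sum_bounded_linear[OF bcl_bounded_linear[OF bcl_Kstar] kernel_pair_has_sum[OF kb]])
      moreover have "cadjoint K (weighted_kernel \<nu> (green h (R s)) n m *\<^sub>C l2_fun y m) = weight \<nu> n *\<^sub>R (green h (R s) (n - m) *\<^sub>C l2_fun w m)" for m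
        by (simp add: bcl_scaleC[OF bcl_Kstar] weighted_kernel_def w scaleR_scaleC scaleC_scaleC mult_ac)
      ultimately have "((\<lambda>m. weight \<nu> n *\<^sub>R (green h (R s) (n - m) *\<^sub>C l2_fun w m)) has_sum cadjoint K ?p) UNIV" by simp
      moreover have "((\<lambda>m. weight \<nu> n *\<^sub>R (green h (R s) (n - m) *\<^sub>C l2_fun w m)) has_sum weight \<nu> n *\<^sub>R l2_fun (X s) n) UNIV"
        by (rule has_sum_bounded_linear[OF bounded_linear_scaleR_right X[OF s]])
      ultimately have "cadjoint K ?p = weight \<nu> n *\<^sub>R l2_fun (X s) n" by (rule has_sum_unique)
      then show ?thesis
        by (simp add: l2_fun_kernel_op[OF kb hs_weightC] weightC_def bcl_scaleR[OF bcl_prj] bcl_scaleR[OF bcl_K])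
    qed
    then show "l2_fun (D x) n = l2_fun (\<Sum>s\<in>channels. kernel_op (weighted_kernel \<nu> (green h (R s))) (weightC s) y) n"
      by (simp add: D x bcl_sum[OF bcl_K] scaleR_sum_right l2_fun_sum)
  qed
  then show ?thesis
    by (simp add: sandwiched_resolvent_def Ms) (simp add: M inv flip: y_def w_def add: channel_op_def bcl_sum[OF bcl_rootV])
qed

text \<open>The facts kept about a boundary value of Green's function. The bound by
  \<open>threshold_factor\<close> serves channels away from their thresholds, the linear one the
  channel at its threshold.\<close>

definition "boundary_kernel x G \<longleftrightarrow> (\<forall>j. G (- j) = G j \<and> norm (G j :: complex) \<le> threshold_factor h x) \<and>
    (if 0 < x \<and> x < 4 / h\<^sup>2
     then (\<forall>j. \<bar>Re (G j)\<bar> \<le> h\<^sup>2 / 2 * \<bar>of_int j\<bar> \<and>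
       Im (G j) = threshold_factor h x * cos (2 * of_int j * arcsin (h / 2 * sqrt x)))
     else (\<forall>j. Im (G j) = 0))"

lemma boundary_kernel_decay: "boundary_kernel x G \<Longrightarrow> decay G ((threshold_factor h x)\<^sup>2)"
  by (rule decay_bounded) (simp add: boundary_kernel_def)

text \<open>The difference from the limit is again a sum of channel operators, with the difference
  kernels; its squared Hilbert--Schmidt bound is linear in the errors
  \<open>\<delta> s \<epsilon>\<close> and tends to 0 with them.\<close>

lemma boundary_value_eq:
  assumes E: "\<And>s. s \<in> channels \<Longrightarrow> E - \<mu> s \<noteq> 0 \<and> E - \<mu> s \<noteq> 4 / h\<^sup>2"
  shows "\<exists>G. (\<forall>s\<in>channels. boundary_kernel (E - \<mu> s) (G s)) \<and>
    boundary_value h Q \<nu> K V E = (\<lambda>v. \<Sum>s\<in>channels. channel_op (G s) s v)"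
proof -
  \<comment> \<open>The roots are chosen for each \<open>\<epsilon>\<close> separately, without any
    continuity; \<open>green_boundary\<close> gives convergence for every such choice.\<close>
  define R where "R s \<epsilon> = (SOME \<rho>. \<rho> \<noteq> 0 \<and> norm \<rho> < 1 \<and> \<rho> + 1 / \<rho> = 2 - of_real (h\<^sup>2) * Complex (E - \<mu> s) \<epsilon>)" for s \<epsilon>
  have R: "R s \<epsilon> \<noteq> 0 \<and> norm (R s \<epsilon>) < 1 \<and> R s \<epsilon> + 1 / R s \<epsilon> = 2 - of_real (h\<^sup>2) * Complex (E - \<mu> s) \<epsilon>"
    if "\<epsilon> > 0" for s \<epsilon>
    unfolding R_def by (rule someI_ex, rule small_root_exists) (use h that in auto)
  have "\<forall>s\<in>channels. \<exists>G\<delta>. ((snd G\<delta>) \<longlongrightarrow> 0) (at_right 0) \<and>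
      (\<forall>\<epsilon>>0. \<forall>j. (norm (green h (R s \<epsilon>) j - fst G\<delta> j))\<^sup>2 \<le> snd G\<delta> \<epsilon> * (1 + (of_int j)\<^sup>2)) \<and>
      boundary_kernel (E - \<mu> s) (fst G\<delta>)"
  proof
    fix s assume s: "s \<in> channels"
    from E[OF this] obtain G \<delta> where "(\<delta> \<longlongrightarrow> 0) (at_right 0)"
      "\<forall>\<epsilon>>0. \<forall>j. (norm (green h (R s \<epsilon>) j - G j))\<^sup>2 \<le> \<delta> \<epsilon> * (1 + (of_int j)\<^sup>2)" "boundary_kernel (E - \<mu> s) G"
      using green_boundary[OF h _ _ R, folded boundary_kernel_def] by blast
    then show "\<exists>G\<delta>. ((snd G\<delta>) \<longlongrightarrow> 0) (at_right 0) \<and>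
      (\<forall>\<epsilon>>0. \<forall>j. (norm (green h (R s \<epsilon>) j - fst G\<delta> j))\<^sup>2 \<le> snd G\<delta> \<epsilon> * (1 + (of_int j)\<^sup>2)) \<and>
      boundary_kernel (E - \<mu> s) (fst G\<delta>)"
      by (intro exI[of _ "(G, \<delta>)"]) simp
  qed
  from bchoice[OF this] obtain G\<delta> where G\<delta>: "\<And>s. s \<in> channels \<Longrightarrow> ((snd (G\<delta> s)) \<longlongrightarrow> 0) (at_right 0)"
    "\<And>s \<epsilon>. s \<in> channels \<Longrightarrow> \<epsilon> > 0 \<Longrightarrow> decay (\<lambda>j. green h (R s \<epsilon>) j - fst (G\<delta> s) j) (snd (G\<delta> s) \<epsilon>)"
    "\<And>s. s \<in> channels \<Longrightarrow> boundary_kernel (E - \<mu> s) (fst (G\<delta> s))"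
    unfolding decay_def by blast
  define G where "G s = fst (G\<delta> s)" for s
  define \<delta> where "\<delta> s = snd (G\<delta> s)" for s
  note G = G\<delta>[folded G_def \<delta>_def]
  define L where "L v = (\<Sum>s\<in>channels. channel_op (G s) s v)" for v
  define T where "T \<epsilon> = sandwiched_resolvent h Q \<nu> K V (Complex E \<epsilon>)" for \<epsilon>
  have hsL: "hs_bdd L (real (card channels) * (\<Sum>s\<in>channels. boundT * (threshold_factor h (E - \<mu> s))\<^sup>2))"
    unfolding L_def by (intro hs_bdd_sum finite_channels hs_channel_op boundary_kernel_decay G)
  have diff: "hs_bdd (\<lambda>v. T \<epsilon> v - L v) (real (card channels) * (\<Sum>s\<in>channels. boundT * \<delta> s \<epsilon>))" if e: "\<epsilon> > 0" for \<epsilon>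
  proof -
    have "T \<epsilon> v = (\<Sum>s\<in>channels. channel_op (green h (R s \<epsilon>)) s v)" for v
      unfolding T_def
    proof (rule sandwiched_resolvent_eq)
      show "0 < Im (Complex E \<epsilon>)" using e by simp
      have "Complex E \<epsilon> - complex_of_real (\<mu> s) = Complex (E - \<mu> s) \<epsilon>" for s by (simp add: complex_eq_iff)
      then show "R s \<epsilon> \<noteq> 0 \<and> norm (R s \<epsilon>) < 1 \<and> R s \<epsilon> + 1 / R s \<epsilon> = 2 - of_real (h\<^sup>2) * (Complex E \<epsilon> - of_real (\<mu> s))" for s
        using R[OF e, of s] by simp
    qed
    moreover have "channel_op (green h (R s \<epsilon>)) s v = channel_op (\<lambda>j. green h (R s \<epsilon>) j - G s j) s v + channel_op (G s) s v"
      if s: "s \<in> channels" for s v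
      using channel_op_add[OF G(2)[OF s e] boundary_kernel_decay[OF G(3)[OF s]], of s v] by simp
    ultimately have "(\<lambda>v. T \<epsilon> v - L v) = (\<lambda>v. \<Sum>s\<in>channels. channel_op (\<lambda>j. green h (R s \<epsilon>) j - G s j) s v)"
      by (simp add: L_def sum.distrib)
    then show ?thesis by (simp only:) (intro hs_bdd_sum finite_channels hs_channel_op G e)
  qed
  have pos: "\<forall>\<^sub>F \<epsilon> in at_right (0::real). \<epsilon> > 0" by (simp add: eventually_at_right_less)
  have lim: "hs_tendsto T L (at_right 0)"
    unfolding hs_tendsto_def
  proof (intro conjI)
    show "hilbert_schmidt L" by (rule hs_bdd_hilbert_schmidt[OF hsL])
    show "\<forall>\<^sub>F \<epsilon> in at_right 0. hilbert_schmidt (T \<epsilon>)"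
      using pos
    proof eventually_elim
      case (elim \<epsilon>)
      show ?case using hs_bdd_hilbert_schmidt(1)[OF hs_bdd_add[OF diff[OF elim] hsL]] by simp
    qed
    show "((\<lambda>\<epsilon>. hs_norm (\<lambda>u. T \<epsilon> u - L u)) \<longlongrightarrow> 0) (at_right 0)"
    proof (rule Lim_null_comparison)
      show "\<forall>\<^sub>F \<epsilon> in at_right 0. norm (hs_norm (\<lambda>u. T \<epsilon> u - L u)) \<le> sqrt (real (card channels) * (\<Sum>s\<in>channels. boundT * \<delta> s \<epsilon>))"
        using pos
      proof eventually_elim
        case (elim \<epsilon>)
        have "0 \<le> hs_norm (\<lambda>u. T \<epsilon> u - L u)" unfolding hs_norm_def by (simp add: infsum_nonneg)
        then show ?case using hs_bdd_hilbert_schmidt(2)[OF diff[OF elim]] by simp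
      qed
      have "((\<lambda>\<epsilon>. sqrt (real (card channels) * (\<Sum>s\<in>channels. boundT * \<delta> s \<epsilon>))) \<longlongrightarrow>
          sqrt (real (card channels) * (\<Sum>s\<in>channels. boundT * 0))) (at_right 0)"
        by (intro tendsto_intros G)
      then show "((\<lambda>\<epsilon>. sqrt (real (card channels) * (\<Sum>s\<in>channels. boundT * \<delta> s \<epsilon>))) \<longlongrightarrow> 0) (at_right 0)" by simp
    qed
  qed
  have "boundary_value h Q \<nu> K V E = L"
    unfolding boundary_value_def T_def[symmetric]
  proof (rule the_equality)
    show "hs_tendsto T L (at_right 0)" by (rule lim)
    show "L' = L" if "hs_tendsto T L' (at_right 0)" for L'
      by (rule hs_tendsto_unique[OF that lim trivial_limit_at_right_real])
  qed
  then show ?thesis using G(3) by (intro exI[of _ G]) (simp add: L_def[abs_def])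
qed

text \<open>Green's function is even, so the adjoint of a channel operator has the conjugate kernel,
  and real and imaginary parts can be taken in the kernel.\<close>

lemma
  assumes G: "\<And>s. s \<in> channels \<Longrightarrow> boundary_kernel (x s) (G s)"
  defines "L \<equiv> \<lambda>v. \<Sum>s\<in>channels. channel_op (G s) s v"
  shows re_part_channels: "re_part L = (\<lambda>v. \<Sum>s\<in>channels. channel_op (\<lambda>j. of_real (Re (G s j))) s v)"
    and im_part_channels: "im_part L = (\<lambda>v. \<Sum>s\<in>channels. channel_op (\<lambda>j. of_real (Im (G s j))) s v)"
proof -
  have dG: "decay (G s) ((threshold_factor h (x s))\<^sup>2)" if "s \<in> channels" for s
    by (rule boundary_kernel_decay[OF G[OF that]])
  have adj: "cadjoint L = (\<lambda>v. \<Sum>s\<in>channels. channel_op (\<lambda>j. cnj (G s j)) s v)"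
  proof (rule cadjoint_eqI)
    fix u v
    show "cinner (\<Sum>s\<in>channels. channel_op (\<lambda>j. cnj (G s j)) s v) u = cinner v (L u)"
      unfolding L_def cinner_sum_left cinner_sum_right
      by (intro sum.cong refl channel_op_cinner[OF dG]) (use G in \<open>auto simp: boundary_kernel_def\<close>)
  qed
  have lin: "a *\<^sub>C (channel_op (G s) s v + b *\<^sub>C channel_op (\<lambda>j. cnj (G s j)) s v) = channel_op (\<lambda>j. a * G s j + (a * b) * cnj (G s j)) s v"
    if s: "s \<in> channels" for a b s v
  proof -
    have sc: "decay (\<lambda>j. c * r j) ((norm c)\<^sup>2 * \<kappa>)" if "decay r \<kappa>" for c r \<kappa>
      using that by (simp add: decay_def norm_mult power_mult_distrib mult.assoc mult_left_mono)
    show ?thesis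
      by (simp add: channel_op_add[OF sc[OF dG[OF s]] sc[OF decay_cnj[OF dG[OF s]]]]
        channel_op_scale[OF dG[OF s]] channel_op_scale[OF decay_cnj[OF dG[OF s]]] scaleC_add_right scaleC_scaleC)
  qed
  have "(1/2) * w + (1/2 * 1) * cnj w = of_real (Re w)" "(1/(2*\<i>)) * w + (1/(2*\<i>) * (-1)) * cnj w = of_real (Im w)" for w
    by (simp_all add: complex_eq_iff)
  then have e: "(\<lambda>j. (1/2) * G s j + (1/2 * 1) * cnj (G s j)) = (\<lambda>j. of_real (Re (G s j)))"
    "(\<lambda>j. (1/(2*\<i>)) * G s j + (1/(2*\<i>) * (-1)) * cnj (G s j)) = (\<lambda>j. of_real (Im (G s j)))" for s
    by (simp_all only:)
  show "re_part L = (\<lambda>v. \<Sum>s\<in>channels. channel_op (\<lambda>j. of_real (Re (G s j))) s v)"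
  proof
    fix v
    have "re_part L v = (\<Sum>s\<in>channels. (1/2) *\<^sub>C (channel_op (G s) s v + 1 *\<^sub>C channel_op (\<lambda>j. cnj (G s j)) s v))"
      unfolding re_part_def adj unfolding L_def by (simp add: cspace.scale_sum_right sum.distrib scaleC_add_right)
    also have "\<dots> = (\<Sum>s\<in>channels. channel_op (\<lambda>j. of_real (Re (G s j))) s v)"
      by (intro sum.cong refl) (simp only: lin e)
    finally show "re_part L v = (\<Sum>s\<in>channels. channel_op (\<lambda>j. of_real (Re (G s j))) s v)" .
  qed
  show "im_part L = (\<lambda>v. \<Sum>s\<in>channels. channel_op (\<lambda>j. of_real (Im (G s j))) s v)"
  proof
    fix v
    have "im_part L v = (\<Sum>s\<in>channels. (1/(2*\<i>)) *\<^sub>C (channel_op (G s) s v + (-1) *\<^sub>C channel_op (\<lambda>j. cnj (G s j)) s v))"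
      unfolding im_part_def adj unfolding L_def
      by (simp only: cspace.scale_sum_right[symmetric] sum.distrib cspace.scale_minus_left scaleC_one sum_negf) simp
    also have "\<dots> = (\<Sum>s\<in>channels. channel_op (\<lambda>j. of_real (Im (G s j))) s v)"
      by (intro sum.cong refl) (simp only: lin e)
    finally show "im_part L v = (\<Sum>s\<in>channels. channel_op (\<lambda>j. of_real (Im (G s j))) s v)" .
  qed
qed

end

section \<open>The effective operator\<close>

lemma bcl_fst: "bounded_clinear (fst :: 'a::complex_inner \<times> 'b::complex_inner \<Rightarrow> 'a)"
  by (rule bclI[where C = 1]) (auto simp: scaleC_prod_def norm_fst_le)

lemma bcl_snd: "bounded_clinear (snd :: 'a::complex_inner \<times> 'b::complex_inner \<Rightarrow> 'b)"
  by (rule bclI[where C = 1]) (auto simp: scaleC_prod_def norm_snd_le)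

lemma bcl_Pair:
  assumes f: "bounded_clinear f" and g: "bounded_clinear g"
  shows "bounded_clinear (\<lambda>x. (f x, g x))"
proof (rule bclI[where C = "onorm f + onorm g"])
  show "norm (f x, g x) \<le> (onorm f + onorm g) * norm x" for x
    using norm_Pair_le[of "f x" "g x"] bcl_onorm[OF f, of x] bcl_onorm[OF g, of x] by (simp add: distrib_right)
qed (simp_all add: bcl_add[OF f] bcl_add[OF g] bcl_scaleC[OF f] bcl_scaleC[OF g] scaleC_prod_def)

lemma cinner_l2_pair_left:
  fixes u :: "'g::chilbert_space l2"
  shows "cinner u (tensor_l2 a z) = cinner (l2_pair a u) z"
  using cinner_l2_pair[of z a u] cinner_commute[of "l2_pair a u" z] cinner_commute[of u "tensor_l2 a z"] by simp

lemma cinner_id_tensor: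
  fixes B :: "'g::chilbert_space \<Rightarrow> 'g"
  assumes B: "bounded_clinear B"
  shows "cinner y ((id \<otimes>\<^sub>o B) u) = cinner ((id \<otimes>\<^sub>o cadjoint B) y) u"
  unfolding cinner_l2_def
  by (simp add: l2_fun_id_tensor[OF B] l2_fun_id_tensor[OF bcl_cadjoint[OF B]] cadjoint_left[OF B])

lemma l2_pair_id_tensor:
  fixes B :: "'g::chilbert_space \<Rightarrow> 'g"
  assumes B: "bounded_clinear B"
  shows "l2_pair a ((id \<otimes>\<^sub>o B) u) = B (l2_pair a u)"
proof -
  have "((\<lambda>m. B (cnj (l2_fun a m) *\<^sub>C l2_fun u m)) has_sum B (l2_pair a u)) UNIV"
    by (rule has_sum_bounded_linear[OF bcl_bounded_linear[OF B] l2_pair_has_sum])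
  then have "((\<lambda>m. cnj (l2_fun a m) *\<^sub>C l2_fun ((id \<otimes>\<^sub>o B) u) m) has_sum B (l2_pair a u)) UNIV"
    by (simp add: l2_fun_id_tensor[OF B] bcl_scaleC[OF B])
  then show ?thesis using l2_pair_has_sum has_sum_unique by blast
qed

context lattice_model
begin

section \<open>Factorization of the effective operator\<close>

definition "trig_vec f g = Abs_l2 (\<lambda>n. complex_of_real (weight \<nu> n * f (2 * of_int n * g)))"

lemma l2_fun_trig_vec:
  assumes "\<And>t. \<bar>f t\<bar> \<le> (1::real)"
  shows "l2_fun (trig_vec f g) n = of_real (weight \<nu> n * f (2 * of_int n * g))"
proof -
  have "(\<lambda>n. (norm (complex_of_real (weight \<nu> n * f (2 * of_int n * g))))\<^sup>2) summable_on UNIV"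
  proof (rule summable_on_comparison_test)
    show "(\<lambda>n. bracket n powr (- \<nu>)) summable_on UNIV" using \<nu> by (intro bracket_powr_summable) simp
    fix n
    have "(weight \<nu> n)\<^sup>2 * (f (2 * of_int n * g))\<^sup>2 \<le> (weight \<nu> n)\<^sup>2 * 1"
      using assms by (intro mult_left_mono) (auto simp: abs_square_le_1)
    then show "(norm (complex_of_real (weight \<nu> n * f (2 * of_int n * g))))\<^sup>2 \<le> bracket n powr (- \<nu>)"
      by (simp add: norm_mult power_mult_distrib weight_squared)
  qed auto
  then show ?thesis by (simp add: trig_vec_def Abs_l2_inverse)
qed

lemmas l2_fun_cos_vec = l2_fun_trig_vec[of cos, OF abs_cos_le_one]
  and l2_fun_sin_vec = l2_fun_trig_vec[of sin, OF abs_sin_le_one]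

lemma Y_op_eq: "Y_op h \<mu>s \<nu> E = (\<lambda>\<phi>. (cinner (trig_vec cos (g_fun h \<mu>s E)) \<phi>, cinner (trig_vec sin (g_fun h \<mu>s E)) \<phi>))"
  by (rule ext) (simp add: Y_op_def cinner_l2_def l2_fun_cos_vec l2_fun_sin_vec cinner_complex_def weight_def)

lemma cadjoint_Y_op: "cadjoint (Y_op h \<mu>s \<nu> E) =
    (\<lambda>c. fst c *\<^sub>C trig_vec cos (g_fun h \<mu>s E) + snd c *\<^sub>C trig_vec sin (g_fun h \<mu>s E))"
  by (rule cadjoint_eqI) (simp add: Y_op_eq cinner_prod_def cinner_complex_def cinner_simps)

text \<open>Together with \<open>synthesis\<close>, the explicit form of the two tensor factors
  around \<open>V_eff\<close> in \<open>Omega\<close>; the two are adjoint to each other.\<close>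

definition "analysis s g u = (prj s (l2_pair (trig_vec cos g) u), prj s (l2_pair (trig_vec sin g) u))"
definition "synthesis s g p = tensor_l2 (trig_vec cos g) (prj s (fst p)) + tensor_l2 (trig_vec sin g) (prj s (snd p))"

lemma bcl_analysis: "bounded_clinear (analysis s g)"
  unfolding analysis_def[abs_def] by (intro bcl_Pair) (rule bcl_compose[OF bcl_prj bcl_l2_pair])+

lemma bcl_synthesis: "bounded_clinear (synthesis s g)"
  unfolding synthesis_def[abs_def]
  by (rule bcl_plus; rule bcl_compose[OF bcl_tensor_l2], rule bcl_compose[OF bcl_prj]) (rule bcl_fst bcl_snd)+

lemma tensor_Y_op: "tensor_op tensor_l2 tensor_C2 (Y_op h \<mu>s \<nu> E) (prj s) = analysis s (g_fun h \<mu>s E)"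
  by (rule tensor_op_l2_eqI[OF bcl_analysis])
    (simp add: analysis_def Y_op_eq tensor_C2_def l2_pair_tensor bcl_scaleC[OF bcl_prj])

lemma tensor_Y_op_adjoint: "tensor_op tensor_C2 tensor_l2 (cadjoint (Y_op h \<mu>s \<nu> E)) (prj s) = synthesis s (g_fun h \<mu>s E)"
proof (rule tensor_op_C2_eqI[OF bcl_synthesis], rule l2_eqI)
  fix c x n
  show "l2_fun (synthesis s (g_fun h \<mu>s E) (tensor_C2 c x)) n = l2_fun (tensor_l2 (cadjoint (Y_op h \<mu>s \<nu> E) c) (prj s x)) n"
    by (simp add: synthesis_def cadjoint_Y_op tensor_C2_def bcl_scaleC[OF bcl_prj] scaleC_scaleC scaleC_add_left
        scaleC_complex_def mult.commute)
qed

text \<open>The operator \<open>W\<close> with \<open>\<Omega>\<^sub>s = c W\<^sup>* W\<close>, while \<open>c W W\<^sup>*\<close> is the part of \<open>B(E + i0)\<close> in channel \<open>s\<close>.\<close>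

definition "halfOmega s g p = rootV ((id \<otimes>\<^sub>o K) (synthesis s g p))"

lemma cadjoint_halfOmega: "cadjoint (halfOmega s g) = (\<lambda>v. analysis s g ((id \<otimes>\<^sub>o cadjoint K) (rootV v)))"
proof (rule cadjoint_eqI)
  fix p v
  show "cinner (analysis s g ((id \<otimes>\<^sub>o cadjoint K) (rootV v))) p = cinner v (halfOmega s g p)"
    by (simp add: halfOmega_def selfadjoint_cinner[OF sa_rootV, symmetric] cinner_id_tensor[OF bcl_K]
        synthesis_def analysis_def cinner_prod_def cinner_add_right cinner_l2_pair_left selfadjoint_cinner[OF sa_prj])
qed

text \<open>Free of \<open>g\<close> and \<open>s\<close>, hence uniform in the energy. Cosine and
  sine contribute one weight each to a coordinate, and the square of
  \<open>2 * weight \<nu> n\<close> gives the 4.\<close>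

definition "boundW = (onorm rootV)\<^sup>2 * (4 * (\<Sum>\<^sub>\<infinity>n. bracket n powr (- \<nu>)) * cK)"

lemma hs_halfOmega: "hs_bdd (halfOmega s g) boundW"
proof -
  define B where "B n p = of_real (weight \<nu> n * cos (2 * of_int n * g)) *\<^sub>C prj s (fst p)
      + complex_of_real (weight \<nu> n * sin (2 * of_int n * g)) *\<^sub>C prj s (snd p)" for n p
  have bB: "bounded_clinear (B n)" for n
    unfolding B_def[abs_def]
    by (intro bcl_plus bcl_const_scaleC; rule bcl_compose[OF bcl_prj]) (rule bcl_fst bcl_snd)+
  have nB: "norm (B n p) \<le> (2 * weight \<nu> n) * norm p" for n p
  proof -
    have t: "norm (complex_of_real (weight \<nu> n * f) *\<^sub>C prj s x) \<le> weight \<nu> n * norm p" if "\<bar>f\<bar> \<le> 1" "norm x \<le> norm p" for f x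
    proof -
      have "norm (complex_of_real (weight \<nu> n * f) *\<^sub>C prj s x) = weight \<nu> n * (\<bar>f\<bar> * norm (prj s x))"
        using weight_bounds(1)[of \<nu> n] by (simp add: norm_scaleC norm_mult abs_mult)
      also have "\<dots> \<le> weight \<nu> n * (1 * norm p)"
        using weight_bounds(1)[of \<nu> n] norm_prj[of s x] that by (intro mult_left_mono mult_mono) auto
      finally show ?thesis by simp
    qed
    show ?thesis unfolding B_def
      by (rule order_trans[OF norm_triangle_ineq], rule order_trans[OF add_mono[OF t t]])
        (cases p; simp add: norm_fst_le norm_snd_le)+
  qed
  have P: "hs_bdd (\<lambda>p. K (B n p)) ((2 * weight \<nu> n)\<^sup>2 * cK)" for n
    using weight_bounds(1)[of \<nu> n] by (intro hs_bdd_right[OF K bB _ nB]) simp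
  have bs: "(\<lambda>n. bracket n powr (- \<nu>)) summable_on UNIV" using \<nu> by (intro bracket_powr_summable) simp
  have sb: "(\<Sum>n\<in>F. (2 * weight \<nu> n)\<^sup>2 * cK) \<le> 4 * (\<Sum>\<^sub>\<infinity>n. bracket n powr (- \<nu>)) * cK" if "finite F" for F
  proof -
    have "(\<Sum>n\<in>F. (2 * weight \<nu> n)\<^sup>2 * cK) = 4 * (\<Sum>n\<in>F. bracket n powr (- \<nu>)) * cK"
      by (simp add: power_mult_distrib weight_squared sum_distrib_left sum_distrib_right)
    also have "\<dots> \<le> 4 * (\<Sum>\<^sub>\<infinity>n. bracket n powr (- \<nu>)) * cK"
      using finite_sum_le_infsum[OF bs that] hs_bdd_nonneg[OF K] by (intro mult_right_mono mult_left_mono) auto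
    finally show ?thesis .
  qed
  have "(id \<otimes>\<^sub>o K) (synthesis s g p) = l2_lift (\<lambda>n p. K (B n p)) p" for p
    by (rule l2_eqI) (simp only: l2_fun_id_tensor[OF bcl_K] hs_l2_fun_lift[OF P sb], simp add: synthesis_def B_def l2_fun_cos_vec l2_fun_sin_vec)
  then have "halfOmega s g = (\<lambda>p. rootV (l2_lift (\<lambda>n p. K (B n p)) p))" by (simp add: halfOmega_def fun_eq_iff)
  then show ?thesis unfolding boundW_def
    by (simp only:) (rule hs_bdd_left[OF hs_bdd_l2_lift[OF P sb] bcl_rootV bcl_onorm[OF bcl_rootV]])
qed

lemma boundW_nonneg: "0 \<le> boundW"
  by (rule hs_bdd_nonneg[OF hs_halfOmega])

text \<open>By the addition theorem for \<open>cos (x - y)\<close> the weighted kernel has rank at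
  most two, spanned by the cosine and sine vectors. Idempotence of \<open>prj s\<close> provides the
  second projection.\<close>

lemma channel_op_cos: "channel_op (\<lambda>j. of_real (cos (2 * of_int j * g))) s v = halfOmega s g (cadjoint (halfOmega s g) v)"
proof -
  define y where "y = rootV v"
  define a b where "a = trig_vec cos g" and "b = trig_vec sin g"
  define k where "k = weighted_kernel \<nu> (\<lambda>j. complex_of_real (cos (2 * of_int j * g)))"
  have a: "l2_fun a n = of_real (weight \<nu> n * cos (2 * of_int n * g))" for n by (simp only: a_def l2_fun_cos_vec)
  have b: "l2_fun b n = of_real (weight \<nu> n * sin (2 * of_int n * g))" for n by (simp only: b_def l2_fun_sin_vec)
  have "decay (\<lambda>j. complex_of_real (cos (2 * of_int j * g))) (1\<^sup>2)" by (rule decay_bounded) simp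
  note kb = kernel_bdd_decay[OF this, folded k_def]
  have k: "k n m = l2_fun a n * cnj (l2_fun a m) + l2_fun b n * cnj (l2_fun b m)" for n m
  proof -
    have "2 * real_of_int (n - m) * g = 2 * of_int n * g - 2 * of_int m * g" by (simp add: algebra_simps)
    then have "cos (2 * real_of_int (n - m) * g) = cos (2 * of_int n * g) * cos (2 * of_int m * g) + sin (2 * of_int n * g) * sin (2 * of_int m * g)"
      by (simp only: cos_diff)
    then show ?thesis unfolding k_def weighted_kernel_def a b by (simp add: algebra_simps)
  qed
  have pair: "l2_pair (kernel_row k n) y = l2_fun a n *\<^sub>C l2_pair a y + l2_fun b n *\<^sub>C l2_pair b y" for n
  proof -
    note hs = has_sum_bounded_linear[OF bcl_bounded_linear[OF bcl_const_scaleC[OF bcl_id]] l2_pair_has_sum]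
    have "((\<lambda>m. l2_fun a n *\<^sub>C (cnj (l2_fun a m) *\<^sub>C l2_fun y m) + l2_fun b n *\<^sub>C (cnj (l2_fun b m) *\<^sub>C l2_fun y m))
        has_sum (l2_fun a n *\<^sub>C l2_pair a y + l2_fun b n *\<^sub>C l2_pair b y)) UNIV"
      by (intro has_sum_add hs)
    then have "((\<lambda>m. k n m *\<^sub>C l2_fun y m) has_sum (l2_fun a n *\<^sub>C l2_pair a y + l2_fun b n *\<^sub>C l2_pair b y)) UNIV"
      by (simp add: k scaleC_scaleC scaleC_add_left)
    then show ?thesis using kernel_pair_has_sum[OF kb] has_sum_unique by blast
  qed
  have "kernel_op k (weightC s) y = (id \<otimes>\<^sub>o K) (synthesis s g (analysis s g ((id \<otimes>\<^sub>o cadjoint K) y)))"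
  proof (rule l2_eqI)
    fix n
    show "l2_fun (kernel_op k (weightC s) y) n = l2_fun ((id \<otimes>\<^sub>o K) (synthesis s g (analysis s g ((id \<otimes>\<^sub>o cadjoint K) y)))) n"
      by (simp add: l2_fun_kernel_op[OF kb hs_weightC] pair weightC_def l2_fun_id_tensor[OF bcl_K] synthesis_def analysis_def
          l2_pair_id_tensor[OF bcl_Kstar] prj_idem bcl_add[OF bcl_Kstar] bcl_scaleC[OF bcl_Kstar] bcl_add[OF bcl_prj] bcl_scaleC[OF bcl_prj]
          flip: a_def b_def)
  qed
  then show ?thesis by (simp add: channel_op_def halfOmega_def cadjoint_halfOmega flip: y_def k_def)
qed

text \<open>\<open>Omega\<close> is linear in \<open>V\<close>, so the coupling \<open>q\<close>
  stays outside and the rescaled operators are all built from the same \<open>halfOmega\<close>,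
  with the root of the original \<open>V\<close>.\<close>

lemma Omega_eq:
  assumes E: "0 < E - \<mu> s" "E - \<mu> s < 4 / h\<^sup>2"
  shows "Omega h Q (\<mu> s) \<nu> K (\<lambda>u. q *\<^sub>R V u) E =
    (\<lambda>p. q *\<^sub>R (threshold_factor h (E - \<mu> s) *\<^sub>R cadjoint (halfOmega s (g_fun h (\<mu> s) E)) (halfOmega s (g_fun h (\<mu> s) E) p)))"
proof
  fix p
  define g where "g = g_fun h (\<mu> s) E"
  have c: "1 / (sqrt (E - \<mu> s) * sqrt (4 / h\<^sup>2 + \<mu> s - E)) = threshold_factor h (E - \<mu> s)"
    using E by (simp add: threshold_factor_def algebra_simps)
  have "analysis s g (V_eff K (\<lambda>u. q *\<^sub>R V u) (synthesis s g p)) = q *\<^sub>R cadjoint (halfOmega s g) (halfOmega s g p)"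
    by (simp add: V_eff_def cadjoint_halfOmega halfOmega_def rootV_square bcl_scaleR[OF bcl_id_tensor[OF bcl_Kstar]]
        bcl_scaleR[OF bcl_analysis])
  then show "Omega h Q (\<mu> s) \<nu> K (\<lambda>u. q *\<^sub>R V u) E p =
      q *\<^sub>R (threshold_factor h (E - \<mu> s) *\<^sub>R cadjoint (halfOmega s (g_fun h (\<mu> s) E)) (halfOmega s (g_fun h (\<mu> s) E) p))"
    unfolding Omega_def Let_def prj_def[symmetric] tensor_Y_op tensor_Y_op_adjoint c
    by (simp add: g_def mult.commute)
qed

section \<open>Asymptotics of the spectral shift function\<close>

lemma threshold_factor_nonneg: "0 \<le> threshold_factor h x"
  by (simp add: threshold_factor_def)

text \<open>The estimate at one energy. Given the bounds \<open>c t\<close> on the factors of the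
  other channels, the error constants no longer depend on \<open>E\<close>, which makes them uniform
  near the threshold.\<close>

lemma ssf_bounds:
  assumes s: "s \<in> channels" and \<sigma>: "\<sigma> \<in> {1, -1}" and \<epsilon>: "0 < \<epsilon>" "\<epsilon> < 1"
    and inside: "0 < E - \<mu> s" "E - \<mu> s < 4 / h\<^sup>2"
    and c: "\<And>t. t \<in> channels - {s} \<Longrightarrow> E - \<mu> t \<noteq> 0 \<and> E - \<mu> t \<noteq> 4 / h\<^sup>2 \<and> threshold_factor h (E - \<mu> t) \<le> c t"
  defines "CA \<equiv> real (card channels) * (\<Sum>t\<in>channels. boundT * (if t = s then h\<^sup>2 / 2 else c t)\<^sup>2)"
    and "D \<equiv> (\<Sum>t\<in>channels - {s}. c t * boundW)" and "P \<equiv> LINT t|lborel. 1 / (1 + t\<^sup>2)"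
  defines "\<Phi> q \<equiv> - (1/pi) * Re (trace_op (fun_calc arctan (Omega h Q (\<mu> s) \<nu> K (\<lambda>u. q *\<^sub>R V u) E)))"
  shows "\<Phi> (1 / (1 - \<epsilon>)) - 1 / pi * (4 * CA / \<epsilon>\<^sup>2 * P + 2 / \<epsilon> * D) \<le> - \<sigma> * ssf \<sigma> h Q \<nu> K V E"
    and "- \<sigma> * ssf \<sigma> h Q \<nu> K V E \<le> \<Phi> (1 / (1 + \<epsilon>)) + 1 / pi * (CA / \<epsilon>\<^sup>2 * P)"
proof -
  define cs where "cs = threshold_factor h (E - \<mu> s)"
  define W where "W t = halfOmega t (g_fun h (\<mu> t) E)" for t
  have "E - \<mu> t \<noteq> 0 \<and> E - \<mu> t \<noteq> 4 / h\<^sup>2" if "t \<in> channels" for t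
    using c[of t] inside that by (cases "t = s") auto
  from boundary_value_eq[OF this] obtain G where G: "\<And>t. t \<in> channels \<Longrightarrow> boundary_kernel (E - \<mu> t) (G t)"
    and L: "boundary_value h Q \<nu> K V E = (\<lambda>v. \<Sum>t\<in>channels. channel_op (G t) t v)" by blast
  define A where "A = re_part (boundary_value h Q \<nu> K V E)"
  have A: "A = (\<lambda>v. \<Sum>t\<in>channels. channel_op (\<lambda>j. of_real (Re (G t j))) t v)"
    unfolding A_def L by (rule re_part_channels[OF G])
  \<comment> \<open>The singular channel uses the slope bound \<open>h\<^sup>2 / 2\<close>, all
    others the uniform bound \<open>c t\<close>.\<close>
  have dRe: "decay (\<lambda>j. of_real (Re (G t j))) ((if t = s then h\<^sup>2 / 2 else c t)\<^sup>2)" if t: "t \<in> channels" for t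
  proof (cases "t = s")
    case True
    have "norm (complex_of_real (Re (G s j))) \<le> h\<^sup>2 / 2 * \<bar>of_int j\<bar>" for j
      using G[OF s] inside by (simp add: boundary_kernel_def)
    from decay_linear[of "\<lambda>j. of_real (Re (G s j))", OF this] show ?thesis using True by simp
  next
    case False
    have "norm (complex_of_real (Re (G t j))) \<le> c t" for j
    proof -
      have "\<bar>Re (G t j)\<bar> \<le> threshold_factor h (E - \<mu> t)"
        using G[OF t] abs_Re_le_cmod[of "G t j"] order_trans unfolding boundary_kernel_def by blast
      then show ?thesis using c[of t] False t by simp
    qed
    from decay_bounded[of "\<lambda>j. of_real (Re (G t j))", OF this] show ?thesis using False by simp
  qed
  have hsA: "hs_bdd A CA" unfolding A CA_def by (intro hs_bdd_sum finite_channels hs_channel_op dRe)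
  have saA: "selfadjoint A"
    unfolding selfadjoint_def
  proof (intro conjI allI hs_bdd_bcl[OF hsA])
    fix x y
    show "cinner (A x) y = cinner x (A y)"
      unfolding A cinner_sum_left cinner_sum_right
    proof (intro sum.cong refl)
      fix t assume t: "t \<in> channels"
      have "G t (- j) = G t j" for j using G[OF t] by (simp add: boundary_kernel_def)
      then show "cinner (channel_op (\<lambda>j. of_real (Re (G t j))) t x) y = cinner x (channel_op (\<lambda>j. of_real (Re (G t j))) t y)"
        using channel_op_cinner[OF dRe[OF t], of t x y] by simp
    qed
  qed
  define B where "B x = cs *\<^sub>R W s (cadjoint (W s) x)" for x
  define B' where "B' x = (\<Sum>t\<in>channels - {s}. channel_op (\<lambda>j. of_real (Im (G t j))) t x)" for x
  have ImG: "channel_op (\<lambda>j. of_real (Im (G t j))) t = (\<lambda>x. threshold_factor h (E - \<mu> t) *\<^sub>R W t (cadjoint (W t) x))"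
    if t: "t \<in> channels" and i: "0 < E - \<mu> t \<and> E - \<mu> t < 4 / h\<^sup>2" for t
  proof
    fix x
    have "(\<lambda>j. complex_of_real (Im (G t j))) = (\<lambda>j. of_real (threshold_factor h (E - \<mu> t)) * of_real (cos (2 * of_int j * g_fun h (\<mu> t) E)))"
      using G[OF t] i by (simp add: boundary_kernel_def g_fun_def fun_eq_iff)
    moreover have "decay (\<lambda>j. complex_of_real (cos (2 * of_int j * g_fun h (\<mu> t) E))) (1\<^sup>2)" by (rule decay_bounded) simp
    ultimately show "channel_op (\<lambda>j. of_real (Im (G t j))) t x = threshold_factor h (E - \<mu> t) *\<^sub>R W t (cadjoint (W t) x)"
      by (simp add: channel_op_scale channel_op_cos W_def scaleR_scaleC)
  qed
  have "im_part (boundary_value h Q \<nu> K V E) = (\<lambda>v. \<Sum>t\<in>channels. channel_op (\<lambda>j. of_real (Im (G t j))) t v)"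
    unfolding L by (rule im_part_channels[OF G])
  then have im: "im_part (boundary_value h Q \<nu> K V E) x = B x + B' x" for x
    using finite_channels s inside by (simp add: sum.remove ImG B_def B'_def cs_def)
  have cs0: "0 \<le> cs" unfolding cs_def by (rule threshold_factor_nonneg)
  have trB: "trace_bdd B (cs * boundW)"
    unfolding B_def W_def by (rule trace_bdd_scaleR[OF trace_bdd_star(2)[OF hs_halfOmega] cs0])
  have trB': "trace_bdd B' D"
    unfolding B'_def D_def
  proof (rule trace_bdd_sum)
    fix t assume t: "t \<in> channels - {s}"
    have c0: "0 \<le> c t" using c[OF t] threshold_factor_nonneg order_trans by blast
    show "trace_bdd (channel_op (\<lambda>j. of_real (Im (G t j))) t) (c t * boundW)"
    proof (cases "0 < E - \<mu> t \<and> E - \<mu> t < 4 / h\<^sup>2")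
      case True
      have "trace_bdd (channel_op (\<lambda>j. of_real (Im (G t j))) t) (threshold_factor h (E - \<mu> t) * boundW)"
        using t True unfolding W_def
        by (simp add: ImG W_def trace_bdd_scaleR[OF trace_bdd_star(2)[OF hs_halfOmega] threshold_factor_nonneg])
      then show ?thesis
        by (rule trace_bdd_mono) (intro mult_right_mono boundW_nonneg, use c[OF t] in simp)
    next
      case False
      \<comment> \<open>Outside its band the channel has no imaginary part; writing the zero kernel
        as \<open>0 * 1\<close> makes the scaling lemma yield the zero operator.\<close>
      then have "(\<lambda>j. complex_of_real (Im (G t j))) = (\<lambda>j. 0 * 1)"
        using G[of t] t by (auto simp: boundary_kernel_def fun_eq_iff)
      moreover have "decay (\<lambda>j. 1) (1\<^sup>2)" by (rule decay_bounded) simp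
      ultimately have "channel_op (\<lambda>j. of_real (Im (G t j))) t = (\<lambda>x. 0 *\<^sub>R channel_op (\<lambda>j. 1) t x)"
        using channel_op_scale[of "\<lambda>j. 1" "1\<^sup>2" 0] by (simp add: fun_eq_iff)
      then have z: "channel_op (\<lambda>j. of_real (Im (G t j))) t = (\<lambda>x. 0)" by simp
      have "positive_op (\<lambda>x :: 'g l2. 0 :: 'g l2)" by (simp add: positive_op_def bcl_zero_op)
      then show ?thesis unfolding z trace_bdd_def using c0 boundW_nonneg by simp
    qed
  qed (use finite_channels in simp)
  \<comment> \<open>The sign of the counting function is absorbed into \<open>A\<close> and the
    variable \<open>t\<close>, leaving the positive operators \<open>B\<close> and \<open>B'\<close>
    untouched; thus one estimate covers both signs.\<close>
  define A' where "A' x = (- \<sigma>) *\<^sub>R A x" for x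
  have s2: "\<sigma> * \<sigma> = 1" "(- \<sigma>)\<^sup>2 = 1" using \<sigma> by auto
  have hsA': "hs_bdd A' CA" using hs_bdd_scaleR[OF hsA, of "- \<sigma>"] s2 by (simp add: A'_def[abs_def])
  have saA': "selfadjoint A'"
    using hs_bdd_bcl[OF hsA'] by (simp add: selfadjoint_def A'_def cinner_simps selfadjoint_cinner[OF saA])
  define F where "F t = real (eig_count 1 1 (\<lambda>x. A' x + t *\<^sub>R (B x + B' x))) / (1 + t\<^sup>2)" for t
  note bounds = averaged_count_bounds[OF saA' hsA' trB trB' \<epsilon>, folded F_def P_def]
  have "ssf \<sigma> h Q \<nu> K V E = \<sigma> * (1/pi) * (LINT t|lborel. F (- \<sigma> * t))"
  proof -
    have "eig_count (- \<sigma>) 1 (\<lambda>u. A u + t *\<^sub>R (B u + B' u)) = eig_count 1 1 (\<lambda>x. A' x + (- \<sigma> * t) *\<^sub>R (B x + B' x))" for t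
      by (simp add: eig_count_def A'_def scaleR_add_right)
    moreover have "(- \<sigma> * t)\<^sup>2 = t\<^sup>2" for t using s2 by (simp add: power_mult_distrib)
    ultimately show ?thesis unfolding ssf_def Let_def im A_def[symmetric] F_def by simp
  qed
  \<comment> \<open>For \<open>\<sigma> = 1\<close> this is the reflection invariance of Lebesgue
    measure, for \<open>\<sigma> = -1\<close> nothing changes.\<close>
  also have "(LINT t|lborel. F (- \<sigma> * t)) = integral\<^sup>L lborel F"
  proof (cases "\<sigma> = 1")
    case True
    then show ?thesis using lborel_integral_real_affine[of "-1" F 0] by simp
  next
    case False
    then show ?thesis using \<sigma> by simp
  qed
  finally have ssf: "- \<sigma> * ssf \<sigma> h Q \<nu> K V E = - (1/pi) * integral\<^sup>L lborel F"
    using s2(1) by (simp add: mult.assoc[symmetric])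
  \<comment> \<open>The trace concerns the product with the adjoint on the left, acting on pairs,
    while \<open>B\<close> has it on the right; \<open>arctan_count_star\<close> passes between
    them.\<close>
  have \<Phi>: "\<Phi> q = - (1/pi) * arctan_count (\<lambda>x. q *\<^sub>R B x)" if q: "q \<ge> 0" for q
  proof -
    have hsW: "hs_bdd (W s) boundW" unfolding W_def by (rule hs_halfOmega)
    have "trace_bdd (\<lambda>p. q *\<^sub>R (cs *\<^sub>R cadjoint (W s) (W s p))) (q * (cs * boundW))"
      by (intro trace_bdd_scaleR trace_bdd_star(1)[OF hsW] cs0 q)
    from trace_arctan_eq_arctan_count[OF this]
    have "\<Phi> q = - (1/pi) * arctan_count (\<lambda>p. q *\<^sub>R (cs *\<^sub>R cadjoint (W s) (W s p)))"
      unfolding \<Phi>_def Omega_eq[OF inside] W_def cs_def by simp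
    also have "arctan_count (\<lambda>p. q *\<^sub>R (cs *\<^sub>R cadjoint (W s) (W s p))) = arctan_count (\<lambda>x. q *\<^sub>R B x)"
      using arctan_count_star[OF hsW, of "q * cs"] q cs0 by (simp add: B_def)
    finally show ?thesis .
  qed
  have q: "0 \<le> 1 / (1 - \<epsilon>)" "0 \<le> 1 / (1 + \<epsilon>)" using \<epsilon> by auto
  have pi: "0 \<le> 1 / pi" by simp
  show "\<Phi> (1 / (1 - \<epsilon>)) - 1 / pi * (4 * CA / \<epsilon>\<^sup>2 * P + 2 / \<epsilon> * D) \<le> - \<sigma> * ssf \<sigma> h Q \<nu> K V E"
    unfolding ssf \<Phi>[OF q(1)] using mult_left_mono[OF bounds(2) pi] by (simp add: distrib_left)
  show "- \<sigma> * ssf \<sigma> h Q \<nu> K V E \<le> \<Phi> (1 / (1 + \<epsilon>)) + 1 / pi * (CA / \<epsilon>\<^sup>2 * P)"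
    unfolding ssf \<Phi>[OF q(2)] using mult_left_mono[OF bounds(3) pi] by (simp add: right_diff_distrib)
qed

text \<open>Both thresholds at once: they enter only through a filter at \<open>E\<^sub>0\<close>
  along which the energy lies in the band of channel \<open>s\<close>. Nondegeneracy becomes the
  condition that \<open>E\<^sub>0\<close> is a threshold of no other channel.\<close>

lemma ssf_asymptotics:
  assumes s: "s \<in> channels" and \<sigma>: "\<sigma> \<in> {1, -1}" and F: "F \<le> nhds E\<^sub>0"
    and inside: "\<forall>\<^sub>F E in F. 0 < E - \<mu> s \<and> E - \<mu> s < 4 / h\<^sup>2"
    and other: "\<And>t. t \<in> channels - {s} \<Longrightarrow> E\<^sub>0 - \<mu> t \<noteq> 0 \<and> E\<^sub>0 - \<mu> t \<noteq> 4 / h\<^sup>2"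
  shows "asymp_sim (\<lambda>V E. - \<sigma> * ssf \<sigma> h Q \<nu> K V E)
    (\<lambda>V E. - (1/pi) * Re (trace_op (fun_calc arctan (Omega h Q (\<mu> s) \<nu> K V E)))) V F"
proof -
  \<comment> \<open>By continuity the factors of the other channels stay below their values at
    \<open>E\<^sub>0\<close> plus a margin of 1.\<close>
  define c where "c t = threshold_factor h (E\<^sub>0 - \<mu> t) + 1" for t
  have id: "((\<lambda>E. E) \<longlongrightarrow> E\<^sub>0) F" using F by (simp add: filterlim_def)
  have "\<forall>\<^sub>F E in F. \<forall>t\<in>channels - {s}. E - \<mu> t \<noteq> 0 \<and> E - \<mu> t \<noteq> 4 / h\<^sup>2 \<and> threshold_factor h (E - \<mu> t) \<le> c t"
  proof (rule eventually_ball_finite)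
    show "\<forall>t\<in>channels - {s}. \<forall>\<^sub>F E in F. E - \<mu> t \<noteq> 0 \<and> E - \<mu> t \<noteq> 4 / h\<^sup>2 \<and> threshold_factor h (E - \<mu> t) \<le> c t"
    proof
      fix t assume t: "t \<in> channels - {s}"
      have l: "((\<lambda>E. E - \<mu> t) \<longlongrightarrow> E\<^sub>0 - \<mu> t) F" by (intro tendsto_intros id)
      have "((\<lambda>E. threshold_factor h (E - \<mu> t)) \<longlongrightarrow> threshold_factor h (E\<^sub>0 - \<mu> t)) F"
        unfolding threshold_factor_def using other[OF t] by (intro tendsto_intros l) auto
      then have "\<forall>\<^sub>F E in F. threshold_factor h (E - \<mu> t) < c t"
        by (rule order_tendstoD) (simp add: c_def)
      moreover have "\<forall>\<^sub>F E in F. E - \<mu> t \<noteq> 0" "\<forall>\<^sub>F E in F. E - \<mu> t \<noteq> 4 / h\<^sup>2"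
        by (rule tendsto_imp_eventually_ne[OF l], use other[OF t] in blast)+
      ultimately show "\<forall>\<^sub>F E in F. E - \<mu> t \<noteq> 0 \<and> E - \<mu> t \<noteq> 4 / h\<^sup>2 \<and> threshold_factor h (E - \<mu> t) \<le> c t"
        by eventually_elim simp
    qed
  qed (use finite_channels in simp)
  then have ev: "\<forall>\<^sub>F E in F. (0 < E - \<mu> s \<and> E - \<mu> s < 4 / h\<^sup>2) \<and>
      (\<forall>t\<in>channels - {s}. E - \<mu> t \<noteq> 0 \<and> E - \<mu> t \<noteq> 4 / h\<^sup>2 \<and> threshold_factor h (E - \<mu> t) \<le> c t)"
    using inside by eventually_elim simp
  show ?thesis
    unfolding asymp_sim_def
  proof
    fix \<epsilon> :: real assume e: "\<epsilon> \<in> {0<..<1}"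
    define CA where "CA = real (card channels) * (\<Sum>t\<in>channels. boundT * (if t = s then h\<^sup>2 / 2 else c t)\<^sup>2)"
    define r1 where "r1 = 1 / pi * (4 * CA / \<epsilon>\<^sup>2 * (LINT t|lborel. 1 / (1 + t\<^sup>2)) + 2 / \<epsilon> * (\<Sum>t\<in>channels - {s}. c t * boundW))"
    define r2 where "r2 = 1 / pi * (CA / \<epsilon>\<^sup>2 * (LINT t|lborel. 1 / (1 + t\<^sup>2)))"
    show "\<exists>r\<^sub>1\<in>O[F](\<lambda>_. 1). \<exists>r\<^sub>2\<in>O[F](\<lambda>_. 1). \<forall>\<^sub>F E in F.
        - (1/pi) * Re (trace_op (fun_calc arctan (Omega h Q (\<mu> s) \<nu> K (\<lambda>u. (1 / (1 - \<epsilon>)) *\<^sub>R V u) E))) + r\<^sub>1 E \<le> - \<sigma> * ssf \<sigma> h Q \<nu> K V E \<and>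
        - \<sigma> * ssf \<sigma> h Q \<nu> K V E \<le> - (1/pi) * Re (trace_op (fun_calc arctan (Omega h Q (\<mu> s) \<nu> K (\<lambda>u. (1 / (1 + \<epsilon>)) *\<^sub>R V u) E))) + r\<^sub>2 E"
    proof (rule bexI[of _ "\<lambda>E. - r1"], rule bexI[of _ "\<lambda>E. r2"])
      show "(\<lambda>E. - r1) \<in> O[F](\<lambda>_. 1)" "(\<lambda>E. r2) \<in> O[F](\<lambda>_. 1)" by simp_all
      show "\<forall>\<^sub>F E in F.
        - (1/pi) * Re (trace_op (fun_calc arctan (Omega h Q (\<mu> s) \<nu> K (\<lambda>u. (1 / (1 - \<epsilon>)) *\<^sub>R V u) E))) + - r1 \<le> - \<sigma> * ssf \<sigma> h Q \<nu> K V E \<and>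
        - \<sigma> * ssf \<sigma> h Q \<nu> K V E \<le> - (1/pi) * Re (trace_op (fun_calc arctan (Omega h Q (\<mu> s) \<nu> K (\<lambda>u. (1 / (1 + \<epsilon>)) *\<^sub>R V u) E))) + r2"
        using ev
      proof eventually_elim
        case (elim E)
        then have c: "\<And>t. t \<in> channels - {s} \<Longrightarrow> E - \<mu> t \<noteq> 0 \<and> E - \<mu> t \<noteq> 4 / h\<^sup>2 \<and> threshold_factor h (E - \<mu> t) \<le> c t"
          and i: "0 < E - \<mu> s" "E - \<mu> s < 4 / h\<^sup>2" by auto
        have e': "0 < \<epsilon>" "\<epsilon> < 1" using e by auto
        show ?case
          using ssf_bounds[OF s \<sigma> e' i c, folded CA_def] unfolding r1_def r2_def by simp
      qed
    qed
  qed
qed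

end

theorem theorem5p5:
  fixes h \<nu>\<^sub>0 \<sigma> :: real and Q K :: "'g::chilbert_space \<Rightarrow> 'g"
    and d s :: nat and \<mu> :: "nat \<Rightarrow> real" and \<V> :: "'g l2 \<Rightarrow> 'g l2"
  assumes "separable_space (euclidean :: 'g topology)"
    and "h > 0"
    and "finite_eigen_decomp Q d \<mu>"
    and "\<nu>\<^sub>0 > 3"
    and "positive_op \<V>"
    and "hilbert_schmidt K"
    and "s \<in> index_set Q d"
    and "\<sigma> \<in> {1, -1}"
  shows "(nondegenerate_lower h Q d \<mu> s \<longrightarrow>
      asymp_sim (\<lambda>\<V> E. - \<sigma> * ssf \<sigma> h Q \<nu>\<^sub>0 K \<V> E)
        (\<lambda>\<V> E. - (1/pi) * Re (trace_op (fun_calc arctan (Omega h Q (\<mu> s) \<nu>\<^sub>0 K \<V> E))))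
        \<V> (at_right (\<mu> s))) \<and>
    (nondegenerate_upper h Q d \<mu> s \<longrightarrow>
      asymp_sim (\<lambda>\<V> E. - \<sigma> * ssf \<sigma> h Q \<nu>\<^sub>0 K \<V> E)
        (\<lambda>\<V> E. - (1/pi) * Re (trace_op (fun_calc arctan (Omega h Q (\<mu> s) \<nu>\<^sub>0 K \<V> E))))
        \<V> (at_left (4/h\<^sup>2 + \<mu> s)))"
proof -
  obtain cK where cK: "hs_bdd K cK" using hilbert_schmidt_hs_bdd[OF assms(6)] by blast
  interpret lattice_model h \<nu>\<^sub>0 Q K d \<mu> \<V> cK
    by unfold_locales (use assms cK in auto)
  have s: "s \<in> channels" using assms(7) by (simp add: channels_def)
  have inj: "\<mu> s \<noteq> \<mu> t" if "t \<in> channels - {s}" for t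
    using eigen_decomposition(3)[OF assms(3)] that assms(7) by (auto simp: channels_def dest: inj_onD)
  have h2: "4 / h\<^sup>2 > 0" using assms(2) by simp
  show ?thesis
  proof (intro conjI impI)
    assume nd: "nondegenerate_lower h Q d \<mu> s"
    have "\<forall>\<^sub>F E in at_right (\<mu> s). E \<in> {\<mu> s<..<\<mu> s + 4 / h\<^sup>2}"
      by (rule eventually_at_right_real) (use h2 in simp)
    then have ins: "\<forall>\<^sub>F E in at_right (\<mu> s). 0 < E - \<mu> s \<and> E - \<mu> s < 4 / h\<^sup>2"
      by eventually_elim auto
    show "asymp_sim (\<lambda>\<V> E. - \<sigma> * ssf \<sigma> h Q \<nu>\<^sub>0 K \<V> E)
        (\<lambda>\<V> E. - (1/pi) * Re (trace_op (fun_calc arctan (Omega h Q (\<mu> s) \<nu>\<^sub>0 K \<V> E)))) \<V> (at_right (\<mu> s))"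
    proof (rule ssf_asymptotics[OF s assms(8) _ ins])
      show "at_right (\<mu> s) \<le> nhds (\<mu> s)" by (simp add: at_within_def)
      fix t assume t: "t \<in> channels - {s}"
      \<comment> \<open>Distinctness of the eigenvalues excludes a common lower threshold,
        nondegeneracy an upper threshold of another channel.\<close>
      have "\<mu> s \<noteq> 4 / h\<^sup>2 + \<mu> t" using nd t by (auto simp: nondegenerate_lower_def channels_def)
      then show "\<mu> s - \<mu> t \<noteq> 0 \<and> \<mu> s - \<mu> t \<noteq> 4 / h\<^sup>2" using inj[OF t] by auto
    qed
  next
    assume nd: "nondegenerate_upper h Q d \<mu> s"
    have "\<forall>\<^sub>F E in at_left (4 / h\<^sup>2 + \<mu> s). E \<in> {\<mu> s<..<4 / h\<^sup>2 + \<mu> s}"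
      by (rule eventually_at_left_real) (use h2 in simp)
    then have ins: "\<forall>\<^sub>F E in at_left (4 / h\<^sup>2 + \<mu> s). 0 < E - \<mu> s \<and> E - \<mu> s < 4 / h\<^sup>2"
      by eventually_elim auto
    show "asymp_sim (\<lambda>\<V> E. - \<sigma> * ssf \<sigma> h Q \<nu>\<^sub>0 K \<V> E)
        (\<lambda>\<V> E. - (1/pi) * Re (trace_op (fun_calc arctan (Omega h Q (\<mu> s) \<nu>\<^sub>0 K \<V> E)))) \<V> (at_left (4/h\<^sup>2 + \<mu> s))"
    proof (rule ssf_asymptotics[OF s assms(8) _ ins])
      show "at_left (4 / h\<^sup>2 + \<mu> s) \<le> nhds (4 / h\<^sup>2 + \<mu> s)" by (simp add: at_within_def)
      fix t assume t: "t \<in> channels - {s}"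
      \<comment> \<open>At the upper end the roles are exchanged: nondegeneracy excludes a lower
        threshold of another channel, distinctness a common upper one.\<close>
      have "4 / h\<^sup>2 + \<mu> s \<noteq> \<mu> t" using nd t by (auto simp: nondegenerate_upper_def channels_def)
      then show "4 / h\<^sup>2 + \<mu> s - \<mu> t \<noteq> 0 \<and> 4 / h\<^sup>2 + \<mu> s - \<mu> t \<noteq> 4 / h\<^sup>2" using inj[OF t] by auto
    qed
  qed
qed

end
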